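(* Let $d \geq 2$ be an integer, let $\alpha \in (1,2)$ and let $\nu_\alpha$ be a non-degenerate symmetric $\alpha$-stable L\'evy measure on $\mathbb{R}^d$, with associated fractional gradient operator $D^{\alpha-1}$. Then, for all $p \in (1,d/(\alpha-1))$, there exists a constant $C_{\alpha,p,d}>0$ such that, for all $f \in \mathcal{C}^{\infty}_c(\mathbb{R}^d)$, $$\|f\|_{L^{p_\alpha^*}(\mathbb{R}^d,dx)} \leq C_{\alpha,p,d}\, \|D^{\alpha-1}(f)\|_{L^p(\mathbb{R}^d,dx)}, \qquad p_\alpha^* = \frac{pd}{d-p(\alpha-1)}.$$
   Context: $\|\cdot\|$ and $\langle\cdot;\cdot\rangle$ are the Euclidean norm and inner product on $\mathbb{R}^d$, and $\mathbb{S}^{d-1}$ is the Euclidean unit sphere. A symmetric $\alpha$-stable L\'evy measure on $\mathbb{R}^d$ is a measure of the form $\nu_\alpha(B)=\int_{\mathbb{S}^{d-1}}\int_0^{+\infty} \mathbf{1}_B(ry)\,\frac{dr}{r^{\alpha+1}}\,\sigma(dy)$, where $\sigma$ (the spherical component) is a finite positive Borel measure on $\mathbb{S}^{d-1}$ with $\sigma(B)=\sigma(-B)$ for all Borel $B\subset\mathbb{S}^{d-1}$. Its spectral measure is $\lambda_1 = -\cos(\alpha\pi/2)\frac{\Gamma(2-\alpha)}{\alpha(\alpha-1)}\sigma$, and $\nu_\alpha$ is non-degenerate if $\inf_{y\in\mathbb{S}^{d-1}}\int_{\mathbb{S}^{d-1}}|\langle y;x\rangle|^\alpha\lambda_1(dx)>0$.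 The fractional gradient is the $\mathbb{R}^d$-valued operator $D^{\alpha-1}(f)(x)=\int_{\mathbb{R}^d}(f(x+u)-f(x))\,u\,\nu_\alpha(du)$, for $f\in\mathcal{C}_c^\infty(\mathbb{R}^d)$ and $x\in\mathbb{R}^d$. For $\mathbb{R}^d$-valued $F$, $\|F\|_{L^p(\mathbb{R}^d,dx)}=(\int_{\mathbb{R}^d}\|F(x)\|^pdx)^{1/p}$. *)

theory Defs
  imports "HOL-Analysis.Analysis"
begin

text \<open>The first condition also makes the unit sphere the whole space of \<open>\<sigma>\<close>.\<close>

definition spherical_component :: "(real ^ 'n) measure \<Rightarrow> bool" where
  "spherical_component \<sigma> \<longleftrightarrow>
     sets \<sigma> = sets (restrict_space borel (sphere 0 1)) \<and>
     finite_measure \<sigma> \<and>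
     (\<forall>B\<in>sets \<sigma>. emeasure \<sigma> (uminus ` B) = emeasure \<sigma> B)"

definition symmetric_stable_levy_measure ::
    "real \<Rightarrow> (real ^ 'n) measure \<Rightarrow> (real ^ 'n) measure \<Rightarrow> bool" where
  "symmetric_stable_levy_measure \<alpha> \<sigma> \<nu> \<longleftrightarrow>
     spherical_component \<sigma> \<and>
     sets \<nu> = sets borel \<and>
     (\<forall>B\<in>sets borel. emeasure \<nu> B =
        (\<integral>\<^sup>+y. (\<integral>\<^sup>+r\<in>{0<..}. indicator B (r *\<^sub>R y) * ennreal (1 / r powr (\<alpha> + 1)) \<partial>lborel) \<partial>\<sigma>))"

text \<open>For \<open>1 < \<alpha> < 2\<close> the factor is positive, so \<^const>\<open>ennreal\<close> does not truncate it.\<close>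

definition spectral_measure :: "real \<Rightarrow> (real ^ 'n) measure \<Rightarrow> (real ^ 'n) measure" where
  "spectral_measure \<alpha> \<sigma> =
     scale_measure (ennreal (- cos (\<alpha> * pi / 2) * Gamma (2 - \<alpha>) / (\<alpha> * (\<alpha> - 1)))) \<sigma>"

definition nondegenerate :: "real \<Rightarrow> (real ^ 'n) measure \<Rightarrow> bool" where
  "nondegenerate \<alpha> \<sigma> \<longleftrightarrow>
     (INF y\<in>sphere 0 1. \<integral>x. \<bar>y \<bullet> x\<bar> powr \<alpha> \<partial>(spectral_measure \<alpha> \<sigma>)) > 0"

definition fractional_gradient ::
    "(real ^ 'n) measure \<Rightarrow> (real ^ 'n \<Rightarrow> real) \<Rightarrow> real ^ 'n \<Rightarrow> real ^ 'n" where
  "fractional_gradient \<nu> f x = (\<integral>u. (f (x + u) - f x) *\<^sub>R u \<partial>\<nu>)"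

text \<open>Class \<open>C\<^sup>k\<close>, by recursion on the (total) derivatives evaluated in a fixed direction \<open>v\<close>.\<close>

primrec Ck :: "nat \<Rightarrow> (real ^ 'n \<Rightarrow> real) \<Rightarrow> bool" where
  "Ck 0 f \<longleftrightarrow> continuous_on UNIV f"
| "Ck (Suc k) f \<longleftrightarrow>
     (\<forall>x. f differentiable (at x)) \<and> (\<forall>v. Ck k (\<lambda>x. frechet_derivative f (at x) v))"

definition Cc_infinity :: "(real ^ 'n \<Rightarrow> real) set" where
  "Cc_infinity = {f. (\<forall>k. Ck k f) \<and> compact (closure (support_on UNIV f))}"

text \<open>The value is \<open>\<infinity>\<close> exactly when the \<open>p\<close>-th power of the norm is not integrable.\<close>

definition Lp_norm :: "real \<Rightarrow> (real ^ 'n \<Rightarrow> 'b::real_normed_vector) \<Rightarrow> ennreal" where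
  "Lp_norm p F =
     (let I = (\<integral>\<^sup>+x. ennreal (norm (F x) powr p) \<partial>lborel)
      in if I = \<infinity> then \<infinity> else ennreal (enn2real I powr (1 / p)))"

end

theory Submission
  imports Defs
begin

text \<open>Write \<open>w\<close> for the divergence of \<open>F = D\<^sup>\<alpha>\<^sup>-\<^sup>1 f\<close>, and let \<open>\<mu>\<close> be the normalised restriction of \<open>\<nu>\<close> to
  the jumps longer than a small \<open>\<epsilon>\<close>. Radial integration by parts shows that \<open>w\<close> is \<open>\<alpha>\<close> times the
  generator applied to \<open>f\<close>, so up to a vanishing error \<open>w = \<alpha> \<rho> (\<mu> * f - f)\<close> with \<open>\<rho>\<close> the total jump rate, and
  summing over the steps of the random walk with jump law \<open>\<mu>\<close> expresses \<open>f\<close> by the functions \<open>\<mu>\<^sup>k * w\<close>.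
  Non-degeneracy gives \<open>d\<close> linearly independent caps of directions that are charged by \<open>\<sigma>\<close>. In about
  \<open>2\<^sup>n\<close> steps the walk makes, outside an event of small probability \<open>r\<close>, a jump of length comparable to
  \<open>s = 2\<^sup>n\<^sup>/\<^sup>\<alpha> \<epsilon>\<close> in each cap. Integrating by parts in the lengths of these \<open>d\<close> jumps replaces \<open>w\<close>
  by \<open>\<parallel>F\<parallel> / s\<close>, averaged with a density of size \<open>s\<^sup>-\<^sup>d\<close>; the bad event is passed on to the next finer scale.
  Hence \<open>\<bar>f\<bar>\<close> is at most a sum over dyadic \<open>s\<close> of positive operators applied to \<open>\<parallel>F\<parallel>\<close>, bounded by
  \<open>s\<^sup>\<alpha>\<^sup>-\<^sup>1\<close> on \<open>L\<^sup>1\<close> and \<open>L\<^sup>\<infinity>\<close> and by \<open>s\<^sup>\<alpha>\<^sup>-\<^sup>1\<^sup>-\<^sup>d\<close> from \<open>L\<^sup>1\<close> to \<open>L\<^sup>\<infinity>\<close>. Cutting the sum at a scale that depends on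
  the level of \<open>\<bar>f\<bar>\<close> gives the strong type estimate, as in the Hardy--Littlewood--Sobolev inequality.\<close>

section \<open>Positive operators and convolution powers\<close>

text \<open>The obstacle is that the spherical measure may be singular, for instance carried by
  finitely many directions. A single jump then has no density, and no pointwise bound by a Riesz
  kernel is at hand, so all estimates are made for operators at one scale. A bounded density appears
  only after \<open>d\<close> jumps in independent directions; their lengths are also the variables
  in which a derivative can be moved off \<open>F\<close>. Cutting off the jumps shorter than
  \<open>\<epsilon>\<close> turns the semigroup into powers of one probability measure. One step
  counts for a time of order \<open>\<epsilon> powr \<alpha>\<close>, so \<open>2 ^ n\<close> steps
  count for \<open>s powr \<alpha>\<close>; the integration by parts divides by \<open>s\<close>.
  This is the origin of the exponent \<open>\<alpha> - 1\<close>. The number of steps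
  \<open>2 ^ n\<close> also enters each bound through the choice of the times of the
  \<open>d\<close> jumps, \<open>(2 ^ n) ^ d\<close> in all, and it cancels because each jump of
  size \<open>s\<close> has probability of order \<open>1 / 2 ^ n\<close>. The cutoff leaves errors
  for fixed \<open>\<epsilon>\<close>; they vanish only when \<open>\<epsilon>\<close> tends to zero
  at a rate tied to the number of scales.\<close>

definition nact :: "'a::euclidean_space measure \<Rightarrow> ('a \<Rightarrow> ennreal) \<Rightarrow> 'a \<Rightarrow> ennreal" where
  "nact M g x = (\<integral>\<^sup>+u. g (x + u) \<partial>M)"

definition act :: "'a::euclidean_space measure \<Rightarrow> ('a \<Rightarrow> real) \<Rightarrow> 'a \<Rightarrow> real" where
  "act M h x = (\<integral>u. h (x + u) \<partial>M)"

definition finite_borel :: "'a::euclidean_space measure \<Rightarrow> bool" where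
  "finite_borel M \<longleftrightarrow> finite_measure M \<and> sets M = sets borel"

definition bounded_borel :: "('a::euclidean_space \<Rightarrow> real) \<Rightarrow> bool" where
  "bounded_borel h \<longleftrightarrow> h \<in> borel_measurable borel \<and> (\<exists>B. \<forall>x. \<bar>h x\<bar> \<le> B)"

text \<open>One constant serves both endpoints because convolution with a measure of mass
  \<open>c\<close> has norm at most \<open>c\<close> on integrable and on bounded functions.
  Monotonicity ranges over all functions, so a pointwise bound can be inserted under an operator
  without a measurability check.\<close>

definition positive_op ::
    "ennreal \<Rightarrow> (('a::euclidean_space \<Rightarrow> ennreal) \<Rightarrow> 'a \<Rightarrow> ennreal) \<Rightarrow> bool" where
  "positive_op c V \<longleftrightarrow>
     (\<forall>g\<in>borel_measurable borel. V g \<in> borel_measurable borel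
        \<and> (\<integral>\<^sup>+x. V g x \<partial>lborel) \<le> c * (\<integral>\<^sup>+x. g x \<partial>lborel)
        \<and> (\<forall>k. (\<forall>x. g x \<le> k) \<longrightarrow> (\<forall>x. V g x \<le> c * k)))
   \<and> (\<forall>g g'. g \<in> borel_measurable borel \<longrightarrow> g' \<in> borel_measurable borel \<longrightarrow>
        V (\<lambda>x. g x + g' x) = (\<lambda>x. V g x + V g' x))
   \<and> (\<forall>g g' x. (\<forall>x. g x \<le> g' x) \<longrightarrow> V g x \<le> V g' x)"

text \<open>The bound from integrable to bounded functions. \<open>D\<close> bounds the density when
  the operator is convolution with an absolutely continuous measure.\<close>

definition smoothing_op ::
    "ennreal \<Rightarrow> (('a::euclidean_space \<Rightarrow> ennreal) \<Rightarrow> 'a \<Rightarrow> ennreal) \<Rightarrow> bool" where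
  "smoothing_op D V \<longleftrightarrow> (\<forall>g\<in>borel_measurable borel. \<forall>x. V g x \<le> D * (\<integral>\<^sup>+x. g x \<partial>lborel))"

lemma positive_opD:
  assumes "positive_op c V"
  shows "g \<in> borel_measurable borel \<Longrightarrow> V g \<in> borel_measurable borel"
    and "g \<in> borel_measurable borel \<Longrightarrow> (\<integral>\<^sup>+x. V g x \<partial>lborel) \<le> c * (\<integral>\<^sup>+x. g x \<partial>lborel)"
    and "g \<in> borel_measurable borel \<Longrightarrow> (\<And>x. g x \<le> k) \<Longrightarrow> V g x \<le> c * k"
    and "g \<in> borel_measurable borel \<Longrightarrow> g' \<in> borel_measurable borel \<Longrightarrow>
        V (\<lambda>x. g x + g' x) x = V g x + V g' x"
    and "(\<And>x. g x \<le> g' x) \<Longrightarrow> V g x \<le> V g' x"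
  using assms unfolding positive_op_def by auto

lemma positive_op_comp:
  assumes V: "positive_op c V" and W: "positive_op c' W"
  shows "positive_op (c * c') (\<lambda>g. V (W g))"
  unfolding positive_op_def
proof (intro conjI ballI allI impI)
  fix g :: "'a \<Rightarrow> ennreal" assume g: "g \<in> borel_measurable borel"
  show "V (W g) \<in> borel_measurable borel"
    by (intro positive_opD(1)[OF V] positive_opD(1)[OF W] g)
  have "(\<integral>\<^sup>+x. V (W g) x \<partial>lborel) \<le> c * (\<integral>\<^sup>+x. W g x \<partial>lborel)"
    by (intro positive_opD(2)[OF V] positive_opD(1)[OF W] g)
  also have "\<dots> \<le> c * (c' * (\<integral>\<^sup>+x. g x \<partial>lborel))"
    by (intro mult_left_mono positive_opD(2)[OF W] g zero_le)
  finally show "(\<integral>\<^sup>+x. V (W g) x \<partial>lborel) \<le> c * c' * (\<integral>\<^sup>+x. g x \<partial>lborel)"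
    by (simp add: mult.assoc)
  fix k x assume "\<forall>x. g x \<le> k"
  then show "V (W g) x \<le> c * c' * k"
    using positive_opD(3)[OF V positive_opD(1)[OF W g] positive_opD(3)[OF W g]]
    by (simp add: mult.assoc)
next
  fix g g' :: "'a \<Rightarrow> ennreal" assume g: "g \<in> borel_measurable borel" "g' \<in> borel_measurable borel"
  then have "W (\<lambda>x. g x + g' x) = (\<lambda>x. W g x + W g' x)"
    by (simp add: positive_opD(4)[OF W] fun_eq_iff)
  then show "V (W (\<lambda>x. g x + g' x)) = (\<lambda>x. V (W g) x + V (W g') x)"
    using g by (auto simp add: positive_opD(4)[OF V] positive_opD(1)[OF W])
next
  fix g g' :: "'a \<Rightarrow> ennreal" and x assume g: "\<forall>x. g x \<le> g' x"
  show "V (W g) x \<le> V (W g') x"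
    using g by (intro positive_opD(5)[OF V] positive_opD(5)[OF W]) auto
qed

lemma positive_op_add:
  assumes V: "positive_op c V" and W: "positive_op c' W"
  shows "positive_op (c + c') (\<lambda>g x. V g x + W g x)"
  unfolding positive_op_def
proof (intro conjI ballI allI impI)
  fix g :: "'a \<Rightarrow> ennreal" assume g: "g \<in> borel_measurable borel"
  note [measurable] = positive_opD(1)[OF V g] positive_opD(1)[OF W g]
  show "(\<lambda>x. V g x + W g x) \<in> borel_measurable borel"
    by measurable
  have "(\<integral>\<^sup>+x. V g x + W g x \<partial>lborel) = (\<integral>\<^sup>+x. V g x \<partial>lborel) + (\<integral>\<^sup>+x. W g x \<partial>lborel)"
    by (intro nn_integral_add) auto
  also have "\<dots> \<le> c * (\<integral>\<^sup>+x. g x \<partial>lborel) + c' * (\<integral>\<^sup>+x. g x \<partial>lborel)"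
    by (intro add_mono positive_opD(2)[OF V] positive_opD(2)[OF W] g)
  finally show "(\<integral>\<^sup>+x. V g x + W g x \<partial>lborel) \<le> (c + c') * (\<integral>\<^sup>+x. g x \<partial>lborel)"
    by (simp add: distrib_right)
  fix k x assume "\<forall>x. g x \<le> k"
  then show "V g x + W g x \<le> (c + c') * k"
    using g by (simp add: distrib_right positive_opD(3)[OF V] positive_opD(3)[OF W] add_mono)
next
  fix g g' :: "'a \<Rightarrow> ennreal" assume g: "g \<in> borel_measurable borel" "g' \<in> borel_measurable borel"
  then show "(\<lambda>x. V (\<lambda>x. g x + g' x) x + W (\<lambda>x. g x + g' x) x)
      = (\<lambda>x. V g x + W g x + (V g' x + W g' x))"
    by (simp add: positive_opD(4)[OF V] positive_opD(4)[OF W] fun_eq_iff algebra_simps)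
next
  fix g g' :: "'a \<Rightarrow> ennreal" and x assume g: "\<forall>x. g x \<le> g' x"
  show "V g x + W g x \<le> V g' x + W g' x"
    using g by (intro add_mono positive_opD(5)[OF V] positive_opD(5)[OF W]) auto
qed

lemma positive_op_mono:
  assumes V: "positive_op c V" and "c \<le> c'" shows "positive_op c' V"
proof -
  have le: "c * k \<le> c' * k" for k using assms(2) by (rule mult_right_mono) simp
  have "(\<integral>\<^sup>+x. V g x \<partial>lborel) \<le> c' * (\<integral>\<^sup>+x. g x \<partial>lborel)" if "g \<in> borel_measurable borel" for g
    using positive_opD(2)[OF V that] le by (rule order_trans)
  moreover have "V g x \<le> c' * k" if "g \<in> borel_measurable borel" "\<forall>x. g x \<le> k" for g k x
    using positive_opD(3)[OF V that(1)] that(2) le by (meson order_trans)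
  ultimately show ?thesis
    using V unfolding positive_op_def by simp
qed

lemma positive_op_zero: "positive_op 0 (\<lambda>g x. 0)"
  by (auto simp: positive_op_def)

lemma positive_op_id: "positive_op 1 (\<lambda>g. g)"
  by (auto simp: positive_op_def)

lemma positive_op_cmult:
  assumes V: "positive_op c V" shows "positive_op (a * c) (\<lambda>g x. a * V g x)"
  unfolding positive_op_def
proof (intro conjI ballI allI impI)
  fix g :: "'a \<Rightarrow> ennreal" assume g: "g \<in> borel_measurable borel"
  note [measurable] = positive_opD(1)[OF V g]
  show "(\<lambda>x. a * V g x) \<in> borel_measurable borel"
    by measurable
  show "(\<integral>\<^sup>+x. a * V g x \<partial>lborel) \<le> a * c * (\<integral>\<^sup>+x. g x \<partial>lborel)"
    using positive_opD(2)[OF V g] by (simp add: nn_integral_cmult mult.assoc mult_left_mono)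
  fix k x assume "\<forall>x. g x \<le> k"
  then show "a * V g x \<le> a * c * k"
    using g by (simp add: mult.assoc positive_opD(3)[OF V] mult_left_mono)
next
  fix g g' :: "'a \<Rightarrow> ennreal" assume g: "g \<in> borel_measurable borel" "g' \<in> borel_measurable borel"
  then show "(\<lambda>x. a * V (\<lambda>x. g x + g' x) x) = (\<lambda>x. a * V g x + a * V g' x)"
    by (simp add: positive_opD(4)[OF V] fun_eq_iff algebra_simps)
next
  fix g g' :: "'a \<Rightarrow> ennreal" and x assume g: "\<forall>x. g x \<le> g' x"
  show "a * V g x \<le> a * V g' x"
    using g by (intro mult_left_mono positive_opD(5)[OF V]) auto
qed

lemma positive_op_sum:
  assumes "finite I" "\<And>i. i \<in> I \<Longrightarrow> positive_op (c i) (V i)"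
  shows "positive_op (\<Sum>i\<in>I. c i) (\<lambda>g x. \<Sum>i\<in>I. V i g x)"
  using assms
proof (induction I rule: finite_induct)
  case empty
  then show ?case using positive_op_zero by simp
next
  case (insert i I)
  then show ?case using positive_op_add[of "c i" "V i"] by simp
qed

lemma smoothing_opD:
  "smoothing_op D V \<Longrightarrow> g \<in> borel_measurable borel \<Longrightarrow> V g x \<le> D * (\<integral>\<^sup>+x. g x \<partial>lborel)"
  by (auto simp: smoothing_op_def)

lemma smoothing_op_mono: "smoothing_op D V \<Longrightarrow> D \<le> D' \<Longrightarrow> smoothing_op D' V"
  unfolding smoothing_op_def by (meson mult_right_mono order_trans zero_le)

lemma smoothing_op_comp_left:
  assumes V: "positive_op c V" and W: "positive_op c' W" "smoothing_op D W"
  shows "smoothing_op (c * D) (\<lambda>g. V (W g))"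
  unfolding smoothing_op_def
proof (intro ballI allI)
  fix g :: "'a \<Rightarrow> ennreal" and x assume g: "g \<in> borel_measurable borel"
  show "V (W g) x \<le> c * D * (\<integral>\<^sup>+x. g x \<partial>lborel)"
    using positive_opD(3)[OF V positive_opD(1)[OF W(1) g], of "D * (\<integral>\<^sup>+x. g x \<partial>lborel)"]
      smoothing_opD[OF W(2) g] by (simp add: mult.assoc)
qed

lemma smoothing_op_add:
  "smoothing_op D V \<Longrightarrow> smoothing_op D' W \<Longrightarrow> smoothing_op (D + D') (\<lambda>g x. V g x + W g x)"
  by (auto simp: smoothing_op_def distrib_right intro!: add_mono)

lemma smoothing_op_zero: "smoothing_op 0 (\<lambda>g x. 0)"
  by (auto simp: smoothing_op_def)

lemma smoothing_op_cmult: "smoothing_op D V \<Longrightarrow> smoothing_op (a * D) (\<lambda>g x. a * V g x)"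
  by (auto simp: smoothing_op_def mult.assoc intro!: mult_left_mono)

lemma smoothing_op_sum:
  assumes "finite I" "\<And>i. i \<in> I \<Longrightarrow> smoothing_op (c i) (V i)"
  shows "smoothing_op (\<Sum>i\<in>I. c i) (\<lambda>g x. \<Sum>i\<in>I. V i g x)"
  using assms
proof (induction I rule: finite_induct)
  case empty
  then show ?case using smoothing_op_zero by simp
next
  case (insert i I)
  then show ?case using smoothing_op_add[of "c i" "V i"] by simp
qed

section \<open>Convolution with finite measures\<close>

lemma nn_integral_lborel_translate:
  fixes g :: "'a::euclidean_space \<Rightarrow> ennreal"
  assumes [measurable]: "g \<in> borel_measurable borel"
  shows "(\<integral>\<^sup>+x. g (x + u) \<partial>lborel) = (\<integral>\<^sup>+x. g x \<partial>lborel)"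
proof -
  have "(\<integral>\<^sup>+x. g x \<partial>lborel) = (\<integral>\<^sup>+x. g x \<partial>distr lborel borel ((+) u))"
    by (simp add: lborel_distr_plus)
  also have "\<dots> = (\<integral>\<^sup>+x. g (u + x) \<partial>lborel)"
    by (subst nn_integral_distr) auto
  finally show ?thesis by (simp add: add.commute)
qed

lemma nact_measurable [measurable]:
  assumes M: "finite_borel M" and [measurable]: "g \<in> borel_measurable borel"
  shows "nact M g \<in> borel_measurable borel"
proof -
  interpret finite_measure M using M by (simp add: finite_borel_def)
  have [measurable_cong]: "sets M = sets borel" using M by (simp add: finite_borel_def)
  show ?thesis unfolding nact_def by measurable
qed

text \<open>After Fubini the inner integral is over a translate of \<open>g\<close> and does not
  depend on \<open>u\<close>; this gives the integral bound. The supremum bound is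
  immediate.\<close>

lemma nact_positive_op:
  assumes M: "finite_borel M"
  shows "positive_op (emeasure M UNIV) (nact M)"
  unfolding positive_op_def
proof (intro conjI ballI allI impI)
  interpret finite_measure M using M by (simp add: finite_borel_def)
  have [measurable_cong]: "sets M = sets borel" using M by (simp add: finite_borel_def)
  then have sp: "space M = UNIV" using sets_eq_imp_space_eq by fastforce
  {
    fix g :: "'a \<Rightarrow> ennreal" assume [measurable]: "g \<in> borel_measurable borel"
    show "nact M g \<in> borel_measurable borel" using M by measurable
    interpret pair_sigma_finite M lborel ..
    have "(\<integral>\<^sup>+x. nact M g x \<partial>lborel) = (\<integral>\<^sup>+u. (\<integral>\<^sup>+x. g (x + u) \<partial>lborel) \<partial>M)"
      unfolding nact_def by (rule Fubini') measurable
    also have "\<dots> = (\<integral>\<^sup>+u. (\<integral>\<^sup>+x. g x \<partial>lborel) \<partial>M)"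
      by (simp add: nn_integral_lborel_translate)
    finally show "(\<integral>\<^sup>+x. nact M g x \<partial>lborel) \<le> emeasure M UNIV * (\<integral>\<^sup>+x. g x \<partial>lborel)"
      by (simp add: sp mult.commute)
    fix k x assume "\<forall>x. g x \<le> k"
    then have "nact M g x \<le> (\<integral>\<^sup>+u. k \<partial>M)"
      unfolding nact_def by (intro nn_integral_mono) auto
    then show "nact M g x \<le> emeasure M UNIV * k"
      by (simp add: sp mult.commute)
  next
    fix g g' :: "'a \<Rightarrow> ennreal"
    assume [measurable]: "g \<in> borel_measurable borel" "g' \<in> borel_measurable borel"
    show "nact M (\<lambda>x. g x + g' x) = (\<lambda>x. nact M g x + nact M g' x)"
      unfolding nact_def by (intro ext nn_integral_add) auto
  next
    fix g g' :: "'a \<Rightarrow> ennreal" and x assume g: "\<forall>x. g x \<le> g' x"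
    then show "nact M g x \<le> nact M g' x"
      unfolding nact_def by (intro nn_integral_mono) auto
  }
qed

lemma bounded_borel_integrable:
  assumes "finite_borel M" "bounded_borel h"
  shows "integrable M h"
proof -
  interpret finite_measure M using assms by (simp add: finite_borel_def)
  have [measurable_cong]: "sets M = sets borel" using assms by (simp add: finite_borel_def)
  obtain B where "\<And>x. \<bar>h x\<bar> \<le> B" and [measurable]: "h \<in> borel_measurable borel"
    using assms(2) by (auto simp: bounded_borel_def)
  then show ?thesis by (intro integrable_const_bound[of _ B]) auto
qed

lemma bounded_borel_translate: "bounded_borel h \<Longrightarrow> bounded_borel (\<lambda>u. h (x + u))"
  by (auto simp: bounded_borel_def)

lemma bounded_borel_measurable [measurable_dest]: "bounded_borel h \<Longrightarrow> h \<in> borel_measurable borel"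
  by (auto simp: bounded_borel_def)

lemma act_le_nact:
  assumes "finite_borel M" "bounded_borel h"
  shows "ennreal \<bar>act M h x\<bar> \<le> nact M (\<lambda>x. ennreal \<bar>h x\<bar>) x"
proof -
  have "ennreal (norm (\<integral>u. h (x + u) \<partial>M)) \<le> (\<integral>\<^sup>+u. ennreal (norm (h (x + u))) \<partial>M)"
    by (rule integral_norm_bound_ennreal
        [OF bounded_borel_integrable[OF assms(1) bounded_borel_translate[OF assms(2)]]])
  then show ?thesis by (simp add: act_def nact_def)
qed

lemma bounded_borel_act:
  assumes M: "finite_borel M" and h: "bounded_borel h"
  shows "bounded_borel (act M h)"
proof -
  interpret finite_measure M using assms by (simp add: finite_borel_def)
  have [measurable_cong]: "sets M = sets borel" using assms by (simp add: finite_borel_def)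
  obtain B where B: "\<And>x. \<bar>h x\<bar> \<le> B" and [measurable]: "h \<in> borel_measurable borel"
    using assms(2) by (auto simp: bounded_borel_def)
  have "\<bar>act M h x\<bar> \<le> (\<integral>u. B \<partial>M)" for x
  proof -
    have "\<bar>act M h x\<bar> \<le> (\<integral>u. \<bar>h (x + u)\<bar> \<partial>M)"
      unfolding act_def by (rule integral_abs_bound)
    also have "\<dots> \<le> (\<integral>u. B \<partial>M)"
      using B bounded_borel_integrable[OF M bounded_borel_translate[OF h]]
      by (intro integral_mono integrable_abs) auto
    finally show ?thesis .
  qed
  moreover have "act M h \<in> borel_measurable borel"
    unfolding act_def by measurable
  ultimately show ?thesis unfolding bounded_borel_def by blast
qed

text \<open>By Fubini the order of independent jumps is irrelevant. Hence a jump singled out at any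
  time of the walk can be moved past all the others.\<close>

lemma act_comm:
  assumes M: "finite_borel M" and N: "finite_borel N" and h: "bounded_borel h"
  shows "act M (act N h) = act N (act M h)"
proof
  fix x
  interpret M: finite_measure M using assms by (simp add: finite_borel_def)
  interpret N: finite_measure N using assms by (simp add: finite_borel_def)
  interpret P: pair_sigma_finite M N ..
  interpret Q: finite_measure "M \<Otimes>\<^sub>M N"
    by (rule finite_measure_pair_measure) unfold_locales
  have [measurable_cong]: "sets M = sets borel" "sets N = sets borel"
    using assms by (simp_all add: finite_borel_def)
  obtain B where B: "\<And>x. \<bar>h x\<bar> \<le> B" and [measurable]: "h \<in> borel_measurable borel"
    using assms(3) by (auto simp: bounded_borel_def)
  have "integrable (M \<Otimes>\<^sub>M N) (\<lambda>(u, v). h (x + u + v))"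
    using B by (intro Q.integrable_const_bound[of _ B]) auto
  then have "(\<integral>v. (\<integral>u. h (x + u + v) \<partial>M) \<partial>N) = (\<integral>u. (\<integral>v. h (x + u + v) \<partial>N) \<partial>M)"
    by (rule P.Fubini_integral)
  then show "act M (act N h) x = act N (act M h) x"
    unfolding act_def by (simp add: add_ac)
qed

lemma act_add:
  assumes "finite_borel M" "bounded_borel h" "bounded_borel k"
  shows "act M (\<lambda>x. h x + k x) = (\<lambda>x. act M h x + act M k x)"
  unfolding act_def
  by (intro ext Bochner_Integration.integral_add
      bounded_borel_integrable[OF assms(1) bounded_borel_translate] assms)

lemma bounded_borel_add: "bounded_borel h \<Longrightarrow> bounded_borel k \<Longrightarrow> bounded_borel (\<lambda>x. h x + k x)"
  unfolding bounded_borel_def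
proof (elim conjE exE, intro conjI)
  fix A B assume "\<forall>x. \<bar>h x\<bar> \<le> A" "\<forall>x. \<bar>k x\<bar> \<le> B"
  then have "\<forall>x. \<bar>h x + k x\<bar> \<le> A + B"
    by (meson abs_triangle_ineq add_mono order_trans)
  then show "\<exists>B. \<forall>x. \<bar>h x + k x\<bar> \<le> B" by blast
qed auto

section \<open>Splitting a jump law\<close>

text \<open>This is \<open>M = X + Y\<close> as measures, tested on nonnegative functions so that no
  integrability enters.\<close>

definition splits :: "'a::euclidean_space measure \<Rightarrow> 'a measure \<Rightarrow> 'a measure \<Rightarrow> bool" where
  "splits M X Y \<longleftrightarrow> finite_borel M \<and> finite_borel X \<and> finite_borel Y \<and>
     (\<forall>g\<in>borel_measurable borel. (\<integral>\<^sup>+u. g u \<partial>M) = (\<integral>\<^sup>+u. g u \<partial>X) + (\<integral>\<^sup>+u. g u \<partial>Y))"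

lemma splits_act:
  assumes s: "splits M X Y" and h: "bounded_borel h"
  shows "act M h = (\<lambda>x. act X h x + act Y h x)"
proof
  fix x
  have fb: "finite_borel M" "finite_borel X" "finite_borel Y"
    using s by (auto simp: splits_def)
  obtain B where B: "\<And>x. \<bar>h x\<bar> \<le> B" and [measurable]: "h \<in> borel_measurable borel"
    using h by (auto simp: bounded_borel_def)
  have *: "(\<integral>u. k u \<partial>M) = (\<integral>u. k u \<partial>X) + (\<integral>u. k u \<partial>Y)"
    if k: "bounded_borel k" "\<And>x. 0 \<le> k x" for k
  proof -
    have "ennreal (\<integral>u. k u \<partial>M) = ennreal (\<integral>u. k u \<partial>X) + ennreal (\<integral>u. k u \<partial>Y)"
      using s k bounded_borel_integrable[OF fb(1) k(1)] bounded_borel_integrable[OF fb(2) k(1)]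
        bounded_borel_integrable[OF fb(3) k(1)] bounded_borel_measurable[OF k(1)]
      by (simp add: splits_def nn_integral_eq_integral[symmetric])
    also have "\<dots> = ennreal ((\<integral>u. k u \<partial>X) + (\<integral>u. k u \<partial>Y))"
      using k by (simp add: ennreal_plus)
    finally show ?thesis
      using k by (subst (asm) ennreal_inj) (auto intro!: add_nonneg_nonneg)
  qed
  \<comment> \<open>A signed \<open>h\<close> is the difference of \<open>h + B\<close> and the
    constant \<open>B\<close>, both nonnegative, so the identity \<open>*\<close> applies to each of
    them.\<close>
  have bc: "bounded_borel (\<lambda>u::'a. B)" by (auto simp: bounded_borel_def)
  have bt: "bounded_borel (\<lambda>u. h (x + u))" by (rule bounded_borel_translate[OF h])
  have "0 \<le> B" using B[of 0] by linarith
  moreover have "0 \<le> h u + B" for u using B[of u] by linarith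
  ultimately show "act M h x = act X h x + act Y h x"
    using *[OF bc] *[OF bounded_borel_add[OF bt bc]]
      bounded_borel_integrable[OF fb(1) bt] bounded_borel_integrable[OF fb(1) bc]
      bounded_borel_integrable[OF fb(2) bt] bounded_borel_integrable[OF fb(2) bc]
      bounded_borel_integrable[OF fb(3) bt] bounded_borel_integrable[OF fb(3) bc]
    unfolding act_def by (simp add: Bochner_Integration.integral_add)
qed

lemma bounded_borel_act_pow:
  assumes "finite_borel M" "bounded_borel h" shows "bounded_borel ((act M ^^ m) h)"
  using assms by (induction m) (simp_all add: bounded_borel_act)

lemma act_pow_comm:
  assumes "finite_borel M" "finite_borel N" "bounded_borel h"
  shows "act N ((act M ^^ m) h) = (act M ^^ m) (act N h)"
proof (induction m)
  case (Suc m)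
  show ?case
    using act_comm[OF assms(2,1) bounded_borel_act_pow[OF assms(1,3)]] by (simp add: Suc)
qed simp

lemma act_pow_add:
  assumes "finite_borel M" "bounded_borel h" "bounded_borel k"
  shows "(act M ^^ m) (\<lambda>x. h x + k x) = (\<lambda>x. (act M ^^ m) h x + (act M ^^ m) k x)"
  by (induction m) (simp_all add: act_add bounded_borel_act_pow assms)

lemma positive_op_pow:
  assumes "positive_op c V" shows "positive_op (c ^ m) (V ^^ m)"
proof (induction m)
  case 0
  show ?case using positive_op_id by (simp add: id_def)
next
  case (Suc m)
  then show ?case using positive_op_comp[OF assms Suc] by (simp add: comp_def)
qed

lemma abs_measurable_ennreal:
  "bounded_borel h \<Longrightarrow> (\<lambda>x. ennreal \<bar>h x\<bar>) \<in> borel_measurable borel"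
  by (auto simp: bounded_borel_def)

lemma act_pow_le_nact_pow:
  assumes M: "finite_borel M" and h: "bounded_borel h"
  shows "ennreal \<bar>(act M ^^ m) h x\<bar> \<le> (nact M ^^ m) (\<lambda>x. ennreal \<bar>h x\<bar>) x"
proof (induction m arbitrary: x)
  case (Suc m)
  have "ennreal \<bar>(act M ^^ Suc m) h x\<bar> \<le> nact M (\<lambda>x. ennreal \<bar>(act M ^^ m) h x\<bar>) x"
    using act_le_nact[OF M bounded_borel_act_pow[OF M h]] by simp
  also have "\<dots> \<le> nact M ((nact M ^^ m) (\<lambda>x. ennreal \<bar>h x\<bar>)) x"
    using Suc by (rule positive_opD(5)[OF nact_positive_op[OF M]])
  finally show ?case by simp
qed simp

lemma nact_positive_op_mono:
  assumes "finite_borel M" "emeasure M UNIV \<le> c" shows "positive_op c (nact M)"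
  using nact_positive_op[OF assms(1)] assms(2) by (rule positive_op_mono)

text \<open>Expand the power of \<open>M = X + Y\<close> at the last factor taken from \<open>X\<close>.\<close>

lemma act_pow_splits:
  assumes s: "splits M X Y" and M1: "emeasure M UNIV \<le> 1" and Y1: "emeasure Y UNIV \<le> 1"
  shows "\<exists>V. positive_op (of_nat m) V \<and> (\<forall>h x. bounded_borel h \<longrightarrow>
     ennreal \<bar>(act M ^^ m) h x\<bar>
       \<le> V (\<lambda>x. ennreal \<bar>act X h x\<bar>) x + (nact Y ^^ m) (\<lambda>x. ennreal \<bar>h x\<bar>) x)"
proof (induction m)
  case 0
  show ?case using positive_op_zero by (intro exI[of _ "\<lambda>g x. 0"]) auto
next
  case (Suc m)
  then obtain V where V: "positive_op (of_nat m) V" and le: "\<And>h x. bounded_borel h \<Longrightarrow>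
     ennreal \<bar>(act M ^^ m) h x\<bar>
       \<le> V (\<lambda>x. ennreal \<bar>act X h x\<bar>) x + (nact Y ^^ m) (\<lambda>x. ennreal \<bar>h x\<bar>) x"
    by blast
  have fb: "finite_borel M" "finite_borel X" "finite_borel Y"
    using s by (auto simp: splits_def)
  have Mp: "positive_op 1 (nact M ^^ m)" and Yp: "positive_op 1 (nact Y)"
      and Yp': "positive_op 1 (nact Y ^^ m)"
    using positive_op_pow[OF nact_positive_op_mono[OF fb(1) M1], of m] nact_positive_op_mono[OF fb(3) Y1]
      positive_op_pow[OF nact_positive_op_mono[OF fb(3) Y1], of m] by auto
  \<comment> \<open>The first split writes \<open>M ^ (m + 1)\<close> as \<open>M ^ m\<close> after
    \<open>X\<close> plus \<open>M ^ m\<close> after \<open>Y\<close>. The first term costs one more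
    unit of mass. The second is handled by the induction hypothesis for \<open>act Y h\<close>, with
    \<open>Y\<close> commuted past \<open>X\<close>.\<close>
  define V' where "V' = (\<lambda>g x. V (nact Y g) x + (nact M ^^ m) g x)"
  have V': "positive_op (of_nat (Suc m)) V'"
    using positive_op_add[OF positive_op_comp[OF V Yp] Mp] unfolding V'_def
    by (simp add: add.commute)
  have "ennreal \<bar>(act M ^^ Suc m) h x\<bar>
       \<le> V' (\<lambda>x. ennreal \<bar>act X h x\<bar>) x + (nact Y ^^ Suc m) (\<lambda>x. ennreal \<bar>h x\<bar>) x"
    if h: "bounded_borel h" for h x
  proof -
    have X: "bounded_borel (act X h)" and Y: "bounded_borel (act Y h)"
      using h fb by (auto intro: bounded_borel_act)
    have "(act M ^^ Suc m) h x = (act M ^^ m) (act M h) x" by (simp add: funpow_swap1)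
    also have "\<dots> = (act M ^^ m) (act X h) x + (act M ^^ m) (act Y h) x"
      using splits_act[OF s h] act_pow_add[OF fb(1) X Y] by simp
    finally have "ennreal \<bar>(act M ^^ Suc m) h x\<bar>
        \<le> ennreal (\<bar>(act M ^^ m) (act X h) x\<bar> + \<bar>(act M ^^ m) (act Y h) x\<bar>)"
      by (metis abs_triangle_ineq ennreal_leI)
    also have "\<dots> = ennreal \<bar>(act M ^^ m) (act X h) x\<bar> + ennreal \<bar>(act M ^^ m) (act Y h) x\<bar>"
      by simp
    also have "\<dots> \<le> (nact M ^^ m) (\<lambda>x. ennreal \<bar>act X h x\<bar>) x
        + (V (nact Y (\<lambda>x. ennreal \<bar>act X h x\<bar>)) x + (nact Y ^^ m) (nact Y (\<lambda>x. ennreal \<bar>h x\<bar>)) x)"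
    proof (intro add_mono)
      show "ennreal \<bar>(act M ^^ m) (act X h) x\<bar> \<le> (nact M ^^ m) (\<lambda>x. ennreal \<bar>act X h x\<bar>) x"
        by (rule act_pow_le_nact_pow[OF fb(1) X])
      have "ennreal \<bar>act X (act Y h) x\<bar> \<le> nact Y (\<lambda>x. ennreal \<bar>act X h x\<bar>) x" for x
        using act_le_nact[OF fb(3) X] act_comm[OF fb(2,3) h] by simp
      then have 1: "V (\<lambda>x. ennreal \<bar>act X (act Y h) x\<bar>) x
          \<le> V (nact Y (\<lambda>x. ennreal \<bar>act X h x\<bar>)) x"
        by (rule positive_opD(5)[OF V])
      have 2: "(nact Y ^^ m) (\<lambda>x. ennreal \<bar>act Y h x\<bar>) x
          \<le> (nact Y ^^ m) (nact Y (\<lambda>x. ennreal \<bar>h x\<bar>)) x"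
        by (intro positive_opD(5)[OF Yp'] act_le_nact fb h)
      show "ennreal \<bar>(act M ^^ m) (act Y h) x\<bar>
          \<le> V (nact Y (\<lambda>x. ennreal \<bar>act X h x\<bar>)) x + (nact Y ^^ m) (nact Y (\<lambda>x. ennreal \<bar>h x\<bar>)) x"
        using le[OF Y, of x] add_mono[OF 1 2] by (rule order_trans)
    qed
    finally show ?thesis
      unfolding V'_def by (simp add: funpow_swap1 add_ac)
  qed
  then show ?case using V' by blast
qed

lemma bounded_borel_foldr_act:
  assumes "\<And>i. i \<in> set is \<Longrightarrow> finite_borel (X i)" "bounded_borel h"
  shows "bounded_borel (foldr (\<lambda>i. act (X i)) is h)"
  using assms by (induction "is") (simp_all add: bounded_borel_act)

lemma foldr_act_comm:
  assumes "\<And>i. i \<in> set is \<Longrightarrow> finite_borel (X i)" "finite_borel N" "bounded_borel h"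
  shows "act N (foldr (\<lambda>i. act (X i)) is h) = foldr (\<lambda>i. act (X i)) is (act N h)"
  using assms(1)
proof (induction "is")
  case (Cons i "is")
  have "act N (act (X i) (foldr (\<lambda>i. act (X i)) is h)) = act (X i) (act N (foldr (\<lambda>i. act (X i)) is h))"
    using Cons.prems
    by (intro act_comm assms(2) bounded_borel_foldr_act[OF _ assms(3)]) auto
  then show ?case using Cons by simp
qed simp

lemma foldr_act_comm_pow:
  assumes "\<And>i. i \<in> set is \<Longrightarrow> finite_borel (X i)" "finite_borel N" "bounded_borel h"
  shows "(act N ^^ m) (foldr (\<lambda>i. act (X i)) is h) = foldr (\<lambda>i. act (X i)) is ((act N ^^ m) h)"
proof (induction m)
  case (Suc m)
  show ?case
    using foldr_act_comm[OF assms(1,2) bounded_borel_act_pow[OF assms(2,3), of m], of "is"] by (simp add: Suc)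
qed simp

lemma foldr_act_le:
  assumes "\<And>i. i \<in> set is \<Longrightarrow> finite_borel (X i)" "bounded_borel h"
  shows "ennreal \<bar>foldr (\<lambda>i. act (X i)) is h x\<bar> \<le> foldr (\<lambda>i. nact (X i)) is (\<lambda>x. ennreal \<bar>h x\<bar>) x"
  using assms(1)
proof (induction "is" arbitrary: x)
  case (Cons i "is")
  have X: "finite_borel (X i)" using Cons by simp
  have "ennreal \<bar>foldr (\<lambda>i. act (X i)) (i # is) h x\<bar>
      \<le> nact (X i) (\<lambda>x. ennreal \<bar>foldr (\<lambda>i. act (X i)) is h x\<bar>) x"
    using act_le_nact[OF X bounded_borel_foldr_act[OF _ assms(2)], of "is"] Cons by simp
  also have "\<dots> \<le> nact (X i) (foldr (\<lambda>i. nact (X i)) is (\<lambda>x. ennreal \<bar>h x\<bar>)) x"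
    using Cons by (intro positive_opD(5)[OF nact_positive_op[OF X]]) auto
  finally show ?case by simp
qed simp

lemma positive_op_foldr:
  assumes "\<And>i. i \<in> set is \<Longrightarrow> positive_op \<kappa> (V i)"
  shows "positive_op (\<kappa> ^ length is) (foldr V is)"
  using assms
proof (induction "is")
  case Nil
  then show ?case using positive_op_id by (simp add: id_def)
next
  case (Cons i "is")
  then show ?case using positive_op_comp[of \<kappa> "V i" "\<kappa> ^ length is" "foldr V is"]
    by (simp add: comp_def)
qed

text \<open>One block of \<open>m\<close> steps is spent on each index \<open>i\<close>, and one
  factor \<open>X i\<close> is extracted from it; its \<open>m\<close> possible places give the
  powers of \<open>m\<close> in \<open>V\<close>. If a block uses only \<open>Y i\<close>, its mass
  is at most \<open>\<theta>\<close>, while each factor extracted from the other blocks costs at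
  most \<open>m * \<kappa>\<close>, that is, its number of places times its mass. The bound
  \<open>B\<close> on this product is taken at least 1 so that its powers increase along the
  list.\<close>

lemma act_pow_splits_list:
  fixes X Y :: "'i \<Rightarrow> 'a::euclidean_space measure"
  assumes s: "\<And>i. i \<in> set is \<Longrightarrow> splits M (X i) (Y i)"
    and M: "finite_borel M" "emeasure M UNIV \<le> 1"
    and X: "\<And>i. i \<in> set is \<Longrightarrow> emeasure (X i) UNIV \<le> \<kappa>"
    and Y: "\<And>i. i \<in> set is \<Longrightarrow> emeasure (Y i) UNIV \<le> 1" 
           "\<And>i. i \<in> set is \<Longrightarrow> emeasure (Y i) UNIV ^ m \<le> \<theta>"
    and B: "of_nat m * \<kappa> \<le> B" "1 \<le> B"
  shows "\<exists>V W. positive_op (of_nat m ^ length is) V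
     \<and> positive_op (of_nat (length is) * (B ^ length is * \<theta>)) W
     \<and> (\<forall>h x. bounded_borel h \<longrightarrow> ennreal \<bar>(act M ^^ (m * length is)) h x\<bar>
       \<le> V (\<lambda>x. ennreal \<bar>foldr (\<lambda>i. act (X i)) is h x\<bar>) x + W (\<lambda>x. ennreal \<bar>h x\<bar>) x)"
  using s X Y
proof (induction "is")
  case Nil
  show ?case using positive_op_id positive_op_zero
    by (intro exI[of _ "\<lambda>g. g"] exI[of _ "\<lambda>g x. 0"]) auto
next
  case (Cons i "is")
  obtain V W where V: "positive_op (of_nat m ^ length is) V"
    and W: "positive_op (of_nat (length is) * (B ^ length is * \<theta>)) W"
    and le: "\<And>h x. bounded_borel h \<Longrightarrow> ennreal \<bar>(act M ^^ (m * length is)) h x\<bar>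
       \<le> V (\<lambda>x. ennreal \<bar>foldr (\<lambda>i. act (X i)) is h x\<bar>) x + W (\<lambda>x. ennreal \<bar>h x\<bar>) x"
    using Cons.IH[OF Cons.prems] by auto
  have si: "splits M (X i) (Y i)" and Yi: "emeasure (Y i) UNIV \<le> 1" "emeasure (Y i) UNIV ^ m \<le> \<theta>"
    using Cons.prems by auto
  have fb: "finite_borel (X i)" "finite_borel (Y i)" using si by (auto simp: splits_def)
  have fbs: "finite_borel (X j)" if "j \<in> set is" for j
    using Cons.prems(1)[of j] that by (auto simp: splits_def)
  obtain V1 where V1: "positive_op (of_nat m) V1" and le1: "\<And>h x. bounded_borel h \<Longrightarrow>
     ennreal \<bar>(act M ^^ m) h x\<bar>
       \<le> V1 (\<lambda>x. ennreal \<bar>act (X i) h x\<bar>) x + (nact (Y i) ^^ m) (\<lambda>x. ennreal \<bar>h x\<bar>) x"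
    using act_pow_splits[OF si M(2) Yi(1), of m] by blast
  let ?K = "foldr (\<lambda>i. act (X i)) is" and ?nK = "foldr (\<lambda>i. nact (X i)) is"
  define V' where "V' = (\<lambda>g. V (V1 g))"
  define W' where "W' = (\<lambda>g x. V ((nact (Y i) ^^ m) (?nK g)) x + W ((nact M ^^ m) g) x)"
  have V': "positive_op (of_nat m ^ length (i # is)) V'"
    using positive_op_comp[OF V V1] by (simp add: V'_def mult.commute)
  have Ypm: "positive_op \<theta> (nact (Y i) ^^ m)"
    using positive_op_pow[OF nact_positive_op[OF fb(2)], of m] Yi(2) by (rule positive_op_mono)
  have nK: "positive_op (\<kappa> ^ length is) ?nK"
    using Cons.prems(2) fbs by (intro positive_op_foldr nact_positive_op_mono) auto
  have Mpm: "positive_op 1 (nact M ^^ m)"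
    using positive_op_pow[OF nact_positive_op_mono[OF M], of m] by simp
  have "of_nat m ^ length is * (\<theta> * \<kappa> ^ length is) = (of_nat m * \<kappa>) ^ length is * \<theta>"
    by (simp add: power_mult_distrib mult_ac)
  also have "\<dots> \<le> B ^ length is * \<theta>"
    using B(1) by (intro mult_right_mono power_mono) auto
  also have "\<dots> \<le> B ^ length (i # is) * \<theta>"
    using mult_right_mono[OF B(2), of "B ^ length is"] by (intro mult_right_mono) auto
  finally have c1: "of_nat m ^ length is * (\<theta> * \<kappa> ^ length is) \<le> B ^ length (i # is) * \<theta>" .
  have "B ^ length is * \<theta> \<le> B ^ length (i # is) * \<theta>"
    using mult_right_mono[OF B(2), of "B ^ length is"] by (intro mult_right_mono) auto
  then have c2: "of_nat (length is) * (B ^ length is * \<theta>) * 1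
      \<le> of_nat (length is) * (B ^ length (i # is) * \<theta>)"
    by (simp only: mult_1_right) (rule mult_left_mono, auto)
  have "positive_op (of_nat m ^ length is * (\<theta> * \<kappa> ^ length is)
      + of_nat (length is) * (B ^ length is * \<theta>) * 1) W'"
    unfolding W'_def
    by (rule positive_op_add[OF positive_op_comp[OF V positive_op_comp[OF Ypm nK]] positive_op_comp[OF W Mpm]])
  then have W': "positive_op (of_nat (length (i # is)) * (B ^ length (i # is) * \<theta>)) W'"
    by (rule positive_op_mono) (use add_mono[OF c1 c2] in \<open>simp add: distrib_right\<close>)
  have "ennreal \<bar>(act M ^^ (m * length (i # is))) h x\<bar>
       \<le> V' (\<lambda>x. ennreal \<bar>foldr (\<lambda>i. act (X i)) (i # is) h x\<bar>) x + W' (\<lambda>x. ennreal \<bar>h x\<bar>) x"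
    if h: "bounded_borel h" for h x
  proof -
    let ?h = "(act M ^^ m) h"
    have hm: "bounded_borel ?h" by (rule bounded_borel_act_pow[OF M(1) h])
    have Kh: "bounded_borel (?K h)" using fbs h by (rule bounded_borel_foldr_act)
    let ?G = "\<lambda>x. V1 (\<lambda>x. ennreal \<bar>act (X i) (?K h) x\<bar>) x" 
    let ?H = "\<lambda>x. (nact (Y i) ^^ m) (?nK (\<lambda>x. ennreal \<bar>h x\<bar>)) x"
    have "m * length (i # is) = m * length is + m" by simp
    then have "(act M ^^ (m * length (i # is))) h = (act M ^^ (m * length is)) ?h"
      by (simp only: funpow_add comp_def)
    then have "ennreal \<bar>(act M ^^ (m * length (i # is))) h x\<bar>
        \<le> V (\<lambda>x. ennreal \<bar>?K ?h x\<bar>) x + W (\<lambda>x. ennreal \<bar>?h x\<bar>) x"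
      using le[OF hm] by simp
    also have "\<dots> \<le> V (\<lambda>x. ?G x + ?H x) x + W ((nact M ^^ m) (\<lambda>x. ennreal \<bar>h x\<bar>)) x"
    proof (intro add_mono positive_opD(5)[OF V] positive_opD(5)[OF W] act_pow_le_nact_pow M h)
      fix x
      \<comment> \<open>The \<open>m\<close> steps reserved for \<open>i\<close> commute with the
        jumps already extracted, so the expansion for one index can be applied to
        \<open>?K h\<close>.\<close>
      have "ennreal \<bar>?K ?h x\<bar> = ennreal \<bar>(act M ^^ m) (?K h) x\<bar>"
        by (subst foldr_act_comm_pow[where X = X, OF fbs M(1) h]) auto
      also have "\<dots> \<le> ?G x + (nact (Y i) ^^ m) (\<lambda>x. ennreal \<bar>?K h x\<bar>) x"
        by (rule le1[OF Kh])
      also have "\<dots> \<le> ?G x + ?H x"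
        by (intro add_left_mono positive_opD(5)[OF Ypm] foldr_act_le fbs h)
      finally show "ennreal \<bar>?K ?h x\<bar> \<le> ?G x + ?H x" .
    qed
    also have "V (\<lambda>x. ?G x + ?H x) x = V ?G x + V ?H x"
      by (intro positive_opD(4)[OF V] positive_opD(1)[OF V1] positive_opD(1)[OF Ypm]
         positive_opD(1)[OF nK] abs_measurable_ennreal bounded_borel_act fb Kh h)
    finally show ?thesis
      unfolding V'_def W'_def by (simp add: add_ac)
  qed
  then show ?case using V' W' by blast
qed

section \<open>Recursion over dyadic scales\<close>

lemma act_diff:
  assumes "finite_borel M" "bounded_borel h" "bounded_borel k"
  shows "act M (\<lambda>x. h x - k x) = (\<lambda>x. act M h x - act M k x)"
  unfolding act_def
  by (intro ext Bochner_Integration.integral_diff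
      bounded_borel_integrable[OF assms(1) bounded_borel_translate] assms)

lemma act_cmult: "act M (\<lambda>x. c * h x) = (\<lambda>x. c * act M h x)"
  unfolding act_def by simp

lemma act_pow_cmult: "(act M ^^ m) (\<lambda>x. c * h x) = (\<lambda>x. c * (act M ^^ m) h x)"
  by (induction m) (simp_all add: act_cmult)

lemma bounded_borel_cmult: "bounded_borel h \<Longrightarrow> bounded_borel (\<lambda>x. c * h x)"
  unfolding bounded_borel_def
proof (elim conjE exE, intro conjI)
  fix B assume "\<forall>x. \<bar>h x\<bar> \<le> B"
  then have "\<forall>x. \<bar>c * h x\<bar> \<le> \<bar>c\<bar> * B" by (simp add: abs_mult mult_left_mono)
  then show "\<exists>B. \<forall>x. \<bar>c * h x\<bar> \<le> B" by blast
qed auto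

lemma bounded_borel_diff: "bounded_borel h \<Longrightarrow> bounded_borel k \<Longrightarrow> bounded_borel (\<lambda>x. h x - k x)"
  using bounded_borel_add[OF _ bounded_borel_cmult[of k "-1"], of h] by simp

lemma act_pow_bound:
  assumes M: "finite_borel M" "emeasure M UNIV \<le> 1" and h: "bounded_borel h"
    and B: "\<And>x. \<bar>h x\<bar> \<le> B"
  shows "\<bar>(act M ^^ m) h x\<bar> \<le> B"
proof -
  have "ennreal \<bar>(act M ^^ m) h x\<bar> \<le> (nact M ^^ m) (\<lambda>x. ennreal \<bar>h x\<bar>) x"
    by (rule act_pow_le_nact_pow[OF M(1) h])
  also have "\<dots> \<le> 1 ^ m * ennreal B"
    by (rule positive_opD(3)[OF positive_op_pow[OF nact_positive_op_mono[OF M]]])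
      (use B h in \<open>auto simp: abs_measurable_ennreal ennreal_leI\<close>)
  finally show ?thesis
    using B[of x] by (auto simp: ennreal_le_iff)
qed

text \<open>The partial sum is the Green operator of the walk up to time \<open>n\<close> applied to
  \<open>f - act M f\<close>; the last summand is what remains of \<open>f\<close> at time
  \<open>n\<close>.\<close>

lemma act_pow_telescope:
  assumes M: "finite_borel M" and f: "bounded_borel f"
  shows "f x = (\<Sum>k<n. (act M ^^ k) (\<lambda>x. f x - act M f x) x) + (act M ^^ n) f x"
proof (induction n)
  case (Suc n)
  have "(act M ^^ n) (\<lambda>x. f x - act M f x) = (\<lambda>x. (act M ^^ n) f x - (act M ^^ n) (act M f) x)"
    by (induction n) (simp_all add: act_diff bounded_borel_act_pow bounded_borel_act assms)
  then show ?case using Suc by (simp add: funpow_swap1)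
qed simp

text \<open>At each scale the part not yet smoothed loses a factor \<open>r\<close>, which beats the factor
  \<open>Q\<close> that smoothing at the next finer scale costs.\<close>

lemma smoothing_recursion:
  fixes M :: "'a::euclidean_space measure"
  assumes M: "finite_borel M" "emeasure M UNIV \<le> 1"
    and V: "\<And>n. positive_op (v n) (V n)" and W: "\<And>n. positive_op (ennreal r) (W n)"
    and VW: "\<And>n h x. bounded_borel h \<Longrightarrow> ennreal \<bar>(act M ^^ (N * 2 ^ n)) h x\<bar>
       \<le> V n (\<lambda>x. ennreal \<bar>K n h x\<bar>) x + W n (\<lambda>x. ennreal \<bar>h x\<bar>) x"
    and K: "\<And>n m h. bounded_borel h \<Longrightarrow> K n ((act M ^^ m) h) = (act M ^^ m) (K n h)"
       "\<And>n h. bounded_borel h \<Longrightarrow> bounded_borel (K n h)"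
    and T: "\<And>n. positive_op (c n) (T n)" "\<And>n. smoothing_op (D n) (T n)"
    and vc: "\<And>n. v n * c n \<le> ennreal (C * a n)" "\<And>n. v n * D n \<le> ennreal (C * b n)"
    and ab: "\<And>n. 0 \<le> a n" "\<And>n. 0 \<le> b n" "\<And>n. a n \<le> Q * a (Suc n)" "\<And>n. b n \<le> Q * b (Suc n)"
    and r: "0 \<le> r" "r * Q \<le> 1 / 2" and C: "0 \<le> C" and Q: "1 \<le> Q"
  shows "\<exists>\<Theta>. (\<forall>n. positive_op (ennreal (2 * C * Q * a n)) (\<Theta> n)
      \<and> smoothing_op (ennreal (2 * C * Q * b n)) (\<Theta> n)
      \<and> (\<forall>h g B x. bounded_borel h \<longrightarrow> g \<in> borel_measurable borel \<longrightarrow> 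
           (\<forall>n x. ennreal \<bar>K n h x\<bar> \<le> T n g x) \<longrightarrow> (\<forall>x. \<bar>h x\<bar> \<le> B) \<longrightarrow>
           ennreal \<bar>(act M ^^ (N * 2 ^ n)) h x\<bar> \<le> \<Theta> n g x + ennreal (r ^ n * B)))"
proof (rule choice, rule allI)
  fix n
  show "\<exists>\<Theta>. positive_op (ennreal (2 * C * Q * a n)) \<Theta>
      \<and> smoothing_op (ennreal (2 * C * Q * b n)) \<Theta>
      \<and> (\<forall>h g B x. bounded_borel h \<longrightarrow> g \<in> borel_measurable borel \<longrightarrow> 
           (\<forall>n x. ennreal \<bar>K n h x\<bar> \<le> T n g x) \<longrightarrow> (\<forall>x. \<bar>h x\<bar> \<le> B) \<longrightarrow>
           ennreal \<bar>(act M ^^ (N * 2 ^ n)) h x\<bar> \<le> \<Theta> g x + ennreal (r ^ n * B))"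
  proof (induction n)
    case 0
    \<comment> \<open>At the finest scale nothing is smoothed: the operator is zero and the whole
      bound sits in \<open>r ^ 0 * B\<close>.\<close>
    have "positive_op (ennreal (2 * C * Q * a 0)) (\<lambda>g x. 0 :: ennreal)"
         "smoothing_op (ennreal (2 * C * Q * b 0)) (\<lambda>g x. 0 :: ennreal)"
      using positive_op_mono[OF positive_op_zero] smoothing_op_mono[OF smoothing_op_zero] by auto
    moreover have "ennreal \<bar>(act M ^^ N) h x\<bar> \<le> ennreal B"
      if "bounded_borel h" "\<forall>x. \<bar>h x\<bar> \<le> B" for h B x
      using act_pow_bound[OF M that(1)] that(2) by (auto intro: ennreal_leI)
    ultimately show ?case by (intro exI[of _ "\<lambda>g x. 0"]) auto
  next
    case (Suc n)
    then obtain \<Theta> where \<Theta>: "positive_op (ennreal (2 * C * Q * a n)) \<Theta>"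
      "smoothing_op (ennreal (2 * C * Q * b n)) \<Theta>"
      and le: "\<forall>h g B x. bounded_borel h \<longrightarrow> g \<in> borel_measurable borel \<longrightarrow> 
           (\<forall>n x. ennreal \<bar>K n h x\<bar> \<le> T n g x) \<longrightarrow> (\<forall>x. \<bar>h x\<bar> \<le> B) \<longrightarrow>
           ennreal \<bar>(act M ^^ (N * 2 ^ n)) h x\<bar> \<le> \<Theta> g x + ennreal (r ^ n * B)"
      by (elim exE conjE)
    let ?P = "act M ^^ (N * 2 ^ n)" and ?nP = "nact M ^^ (N * 2 ^ n)"
    have nP: "positive_op 1 ?nP"
      using positive_op_pow[OF nact_positive_op_mono[OF M], of "N * 2 ^ n"] by simp
    \<comment> \<open>The steps for scale \<open>Suc n\<close> are two runs of
      \<open>N * 2 ^ n\<close>. One run is split by \<open>V n\<close> and \<open>W n\<close>. On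
      the good part the other run only acts as a contraction; on the bad part it is estimated by the
      operator \<open>\<Theta>\<close> of scale \<open>n\<close>.\<close>
    define \<Theta>' where "\<Theta>' = (\<lambda>g x. V n (?nP (T n g)) x + W n (\<Theta> g) x)"
    \<comment> \<open>The constant \<open>2 * C * Q\<close> reproduces itself:
      \<open>r * Q \<le> 1 / 2\<close> makes the inherited term at most another
      \<open>C * t n\<close>, and passing from \<open>t n\<close> to \<open>t (Suc n)\<close> costs
      the factor \<open>Q\<close>.\<close>
    have num: "C * t n + r * (2 * C * Q * t n) \<le> 2 * C * Q * t (Suc n)"
      if "0 \<le> t n" "0 \<le> t (Suc n)" "t n \<le> Q * t (Suc n)" for t :: "nat \<Rightarrow> real"
    proof -
      have "C * t n \<le> C * (Q * t (Suc n))" using that C by (intro mult_left_mono) auto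
      moreover have "r * (2 * C * Q * t n) = 2 * (r * Q) * (C * t n)" by simp
      moreover have "2 * (r * Q) * (C * t n) \<le> 1 * (C * t n)"
        using r that C by (intro mult_right_mono) auto
      ultimately show ?thesis by linarith
    qed
    have nPT: "positive_op (1 * c n) (\<lambda>g. ?nP (T n g))" "smoothing_op (1 * D n) (\<lambda>g. ?nP (T n g))"
      by (rule positive_op_comp[OF nP T(1)]) (rule smoothing_op_comp_left[OF nP T])
    have "positive_op (v n * (1 * c n) + ennreal r * ennreal (2 * C * Q * a n)) \<Theta>'"
      unfolding \<Theta>'_def
      by (intro positive_op_add positive_op_comp[OF V nPT(1)] positive_op_comp[OF W \<Theta>(1)])
    moreover have "v n * (1 * c n) + ennreal r * ennreal (2 * C * Q * a n)
        \<le> ennreal (C * a n) + ennreal (r * (2 * C * Q * a n))"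
      using vc(1)[of n] r by (intro add_mono) (auto simp: ennreal_mult')
    moreover have "\<dots> = ennreal (C * a n + r * (2 * C * Q * a n))"
      using ab(1)[of n] C r Q by (intro ennreal_plus[symmetric]) auto
    moreover have "\<dots> \<le> ennreal (2 * C * Q * a (Suc n))"
      using num[of a] ab by (intro ennreal_leI) auto
    ultimately have 1: "positive_op (ennreal (2 * C * Q * a (Suc n))) \<Theta>'"
      by (elim positive_op_mono) (simp only: order_trans)
    have "smoothing_op (v n * (1 * D n) + ennreal r * ennreal (2 * C * Q * b n)) \<Theta>'"
      unfolding \<Theta>'_def
      by (intro smoothing_op_add smoothing_op_comp_left[OF V nPT] smoothing_op_comp_left[OF W \<Theta>])
    moreover have "v n * (1 * D n) + ennreal r * ennreal (2 * C * Q * b n)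
        \<le> ennreal (C * b n) + ennreal (r * (2 * C * Q * b n))"
      using vc(2)[of n] r by (intro add_mono) (auto simp: ennreal_mult')
    moreover have "\<dots> = ennreal (C * b n + r * (2 * C * Q * b n))"
      using ab(2)[of n] C r Q by (intro ennreal_plus[symmetric]) auto
    moreover have "\<dots> \<le> ennreal (2 * C * Q * b (Suc n))"
      using num[of b] ab by (intro ennreal_leI) auto
    ultimately have 2: "smoothing_op (ennreal (2 * C * Q * b (Suc n))) \<Theta>'"
      by (elim smoothing_op_mono) (simp only: order_trans)
    have "ennreal \<bar>(act M ^^ (N * 2 ^ Suc n)) h x\<bar> \<le> \<Theta>' g x + ennreal (r ^ Suc n * B)"
      if h: "bounded_borel h" and g: "g \<in> borel_measurable borel"
        and KT: "\<And>n x. ennreal \<bar>K n h x\<bar> \<le> T n g x" and B: "\<And>x. \<bar>h x\<bar> \<le> B" for h g B x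
    proof -
      have B0: "0 \<le> B" using B[of x] by linarith
      have Ph: "bounded_borel (?P h)" by (rule bounded_borel_act_pow[OF M(1) h])
      have "N * 2 ^ Suc n = N * 2 ^ n + N * 2 ^ n" by simp
      then have "(act M ^^ (N * 2 ^ Suc n)) h = ?P (?P h)"
        by (simp only: funpow_add comp_def)
      then have "ennreal \<bar>(act M ^^ (N * 2 ^ Suc n)) h x\<bar>
          \<le> V n (\<lambda>x. ennreal \<bar>K n (?P h) x\<bar>) x + W n (\<lambda>x. ennreal \<bar>?P h x\<bar>) x"
        using VW[OF Ph] by simp
      also have "\<dots> \<le> V n (?nP (T n g)) x + W n (\<lambda>x. \<Theta> g x + ennreal (r ^ n * B)) x"
      proof (intro add_mono positive_opD(5)[OF V] positive_opD(5)[OF W])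
        fix x
        have "ennreal \<bar>K n (?P h) x\<bar> \<le> ?nP (\<lambda>x. ennreal \<bar>K n h x\<bar>) x"
          using act_pow_le_nact_pow[OF M(1) K(2)[OF h]] K(1)[OF h] by simp
        also have "\<dots> \<le> ?nP (T n g) x"
          by (rule positive_opD(5)[OF nP KT])
        finally show "ennreal \<bar>K n (?P h) x\<bar> \<le> ?nP (T n g) x" .
        show "ennreal \<bar>?P h x\<bar> \<le> \<Theta> g x + ennreal (r ^ n * B)"
          by (rule le[rule_format, OF h g KT B])
      qed
      also have "W n (\<lambda>x. \<Theta> g x + ennreal (r ^ n * B)) x
          = W n (\<Theta> g) x + W n (\<lambda>x. ennreal (r ^ n * B)) x"
        by (intro positive_opD(4)[OF W] positive_opD(1)[OF \<Theta>(1)] g) auto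
      also have "V n (?nP (T n g)) x + (W n (\<Theta> g) x + W n (\<lambda>x. ennreal (r ^ n * B)) x)
          \<le> V n (?nP (T n g)) x + (W n (\<Theta> g) x + ennreal r * ennreal (r ^ n * B))"
        by (intro add_left_mono positive_opD(3)[OF W]) auto
      also have "\<dots> = \<Theta>' g x + ennreal (r ^ Suc n * B)"
        using r B0 by (simp add: \<Theta>'_def ennreal_mult'[symmetric] mult.assoc add.assoc)
      finally show ?thesis .
    qed
    then show ?case by (intro exI[of _ \<Theta>'] conjI 1 2) simp
  qed
qed

lemma geometric_partial_sum_le:
  fixes x :: real assumes "0 \<le> x" "x \<le> 1 / 2" shows "(\<Sum>n<m. x ^ n) \<le> 2"
proof -
  have "(\<Sum>n<m. x ^ n) \<le> (\<Sum>n<m. (1 / 2) ^ n)"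
    using assms by (intro sum_mono power_mono) auto
  also have "\<dots> = 2 * (1 - (1 / 2) ^ m)" by (simp add: sum_gp_strict)
  also have "\<dots> \<le> 2" by simp
  finally show ?thesis .
qed

text \<open>The times from \<open>N * 2 ^ n\<close> to \<open>N * 2 ^ (n + 1)\<close> form one
  block; each is \<open>N * 2 ^ n\<close> smoothing steps followed by \<open>j\<close> contractions.
  A block contributes the remainder \<open>N * 2 ^ n * r ^ n * B\<close>, a geometric series since
  \<open>2 * r \<le> 1 / 2\<close>. The initial \<open>N\<close> times add \<open>N * B\<close> and
  the series at most \<open>2 * N * B\<close>.\<close>

lemma dyadic_sum_bound:
  fixes M :: "'a::euclidean_space measure"
  assumes M: "finite_borel M" "emeasure M UNIV \<le> 1" and w: "bounded_borel w"
    and B: "\<And>x. \<bar>w x\<bar> \<le> B" and r: "0 \<le> r" "r \<le> 1 / 4"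
    and \<Theta>: "\<And>n. positive_op (\<theta> n) (\<Theta> n)" and g: "g \<in> borel_measurable borel"
    and le: "\<And>n x. ennreal \<bar>(act M ^^ (N * 2 ^ n)) w x\<bar> \<le> \<Theta> n g x + ennreal (r ^ n * B)"
  shows "(\<Sum>k<N * 2 ^ m. ennreal \<bar>(act M ^^ k) w x\<bar>)
     \<le> (\<Sum>n<m. \<Sum>j<N * 2 ^ n. (nact M ^^ j) (\<Theta> n g) x) + ennreal (3 * real N * B)"
proof -
  have B0: "0 \<le> B" using B[of x] by linarith
  have main: "(\<Sum>k<N * 2 ^ m. ennreal \<bar>(act M ^^ k) w x\<bar>)
     \<le> (\<Sum>n<m. \<Sum>j<N * 2 ^ n. (nact M ^^ j) (\<Theta> n g) x)
       + (ennreal (N * B) + (\<Sum>n<m. ennreal (N * B * (2 * r) ^ n)))"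
  proof (induction m)
    case 0
    have "(\<Sum>k<N. ennreal \<bar>(act M ^^ k) w x\<bar>) \<le> (\<Sum>k<N. ennreal B)"
      by (intro sum_mono ennreal_leI act_pow_bound[OF M w B])
    also have "\<dots> = ennreal (N * B)"
      using B0 by (simp add: ennreal_mult' ennreal_of_nat_eq_real_of_nat)
    finally show ?case by simp
  next
    case (Suc m)
    have S: "{..<N * 2 ^ Suc m} = {..<N * 2 ^ m} \<union> {N * 2 ^ m..<N * 2 ^ m + N * 2 ^ m}" by auto
    have split: "(\<Sum>k<N * 2 ^ Suc m. ennreal \<bar>(act M ^^ k) w x\<bar>)
        = (\<Sum>k<N * 2 ^ m. ennreal \<bar>(act M ^^ k) w x\<bar>)
          + (\<Sum>k\<in>{N * 2 ^ m..<N * 2 ^ m + N * 2 ^ m}. ennreal \<bar>(act M ^^ k) w x\<bar>)"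
      unfolding S by (rule sum.union_disjoint) auto
    have "(\<Sum>k\<in>{N * 2 ^ m..<N * 2 ^ m + N * 2 ^ m}. ennreal \<bar>(act M ^^ k) w x\<bar>)
        = (\<Sum>j<N * 2 ^ m. ennreal \<bar>(act M ^^ (j + N * 2 ^ m)) w x\<bar>)"
      using sum.shift_bounds_nat_ivl[of "\<lambda>k. ennreal \<bar>(act M ^^ k) w x\<bar>" 0 "N * 2 ^ m" "N * 2 ^ m"]
      by (simp add: atLeast0LessThan)
    also have "\<dots> \<le> (\<Sum>j<N * 2 ^ m. (nact M ^^ j) (\<Theta> m g) x + ennreal (r ^ m * B))"
    proof (rule sum_mono)
      fix j
      let ?w = "(act M ^^ (N * 2 ^ m)) w"
      have Mj: "positive_op 1 (nact M ^^ j)"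
        using positive_op_pow[OF nact_positive_op_mono[OF M], of j] by simp
      have "ennreal \<bar>(act M ^^ (j + N * 2 ^ m)) w x\<bar> \<le> (nact M ^^ j) (\<lambda>x. ennreal \<bar>?w x\<bar>) x"
        using act_pow_le_nact_pow[OF M(1) bounded_borel_act_pow[OF M(1) w]]
        by (simp add: funpow_add)
      also have "\<dots> \<le> (nact M ^^ j) (\<lambda>x. \<Theta> m g x + ennreal (r ^ m * B)) x"
        by (rule positive_opD(5)[OF Mj le])
      also have "\<dots> = (nact M ^^ j) (\<Theta> m g) x + (nact M ^^ j) (\<lambda>x. ennreal (r ^ m * B)) x"
        by (intro positive_opD(4)[OF Mj] positive_opD(1)[OF \<Theta>] g) auto
      also have "\<dots> \<le> (nact M ^^ j) (\<Theta> m g) x + 1 * ennreal (r ^ m * B)"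
        by (intro add_left_mono positive_opD(3)[OF Mj]) auto
      finally show "ennreal \<bar>(act M ^^ (j + N * 2 ^ m)) w x\<bar>
          \<le> (nact M ^^ j) (\<Theta> m g) x + ennreal (r ^ m * B)" by simp
    qed
    also have "\<dots> = (\<Sum>j<N * 2 ^ m. (nact M ^^ j) (\<Theta> m g) x) + ennreal (N * B * (2 * r) ^ m)"
    proof -
      have "(\<Sum>j<N * 2 ^ m. ennreal (r ^ m * B)) = ennreal (real (N * 2 ^ m) * (r ^ m * B))"
        using B0 r by (simp add: ennreal_mult'[symmetric] ennreal_of_nat_eq_real_of_nat del: of_nat_mult)
      also have "real (N * 2 ^ m) * (r ^ m * B) = N * B * (2 * r) ^ m"
        by (simp add: power_mult_distrib)
      finally show ?thesis by (simp add: sum.distrib)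
    qed
    finally have "(\<Sum>k<N * 2 ^ Suc m. ennreal \<bar>(act M ^^ k) w x\<bar>)
        \<le> ((\<Sum>n<m. \<Sum>j<N * 2 ^ n. (nact M ^^ j) (\<Theta> n g) x)
           + (ennreal (N * B) + (\<Sum>n<m. ennreal (N * B * (2 * r) ^ n))))
          + ((\<Sum>j<N * 2 ^ m. (nact M ^^ j) (\<Theta> m g) x) + ennreal (N * B * (2 * r) ^ m))"
      unfolding split by (rule add_mono[OF Suc])
    then show ?case by (simp add: add_ac)
  qed
  have "ennreal (N * B) + (\<Sum>n<m. ennreal (N * B * (2 * r) ^ n))
      = ennreal (N * B + (\<Sum>n<m. N * B * (2 * r) ^ n))"
    using B0 r by (simp add: sum_nonneg sum_ennreal)
  also have "\<dots> \<le> ennreal (3 * real N * B)"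
  proof (rule ennreal_leI)
    have "(\<Sum>n<m. N * B * (2 * r) ^ n) = N * B * (\<Sum>n<m. (2 * r) ^ n)"
      by (simp add: sum_distrib_left)
    also have "\<dots> \<le> N * B * 2"
      using geometric_partial_sum_le[of "2 * r" m] r B0 by (intro mult_left_mono) auto
    finally show "N * B + (\<Sum>n<m. N * B * (2 * r) ^ n) \<le> 3 * real N * B" by linarith
  qed
  finally show ?thesis by (rule order_trans[OF main add_left_mono])
qed

section \<open>Interpolation\<close>

lemma geometric_sum_low:
  fixes e q \<epsilon> \<tau> :: real
  assumes "0 < e" "1 < q" "0 < \<epsilon>" "0 < \<tau>"
  shows "(\<Sum>n<m. if \<epsilon> * q ^ n \<le> \<tau> then (\<epsilon> * q ^ n) powr e else 0) \<le> \<tau> powr e / (1 - q powr - e)"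
proof -
  define s where "s n = \<epsilon> * q ^ n" for n
  define E where "E = 1 - q powr - e"
  have s: "0 < s n" "s (Suc n) = q * s n" for n using assms by (auto simp: s_def)
  have "q powr - e < q powr 0" using assms by (intro powr_less_mono) auto
  then have E: "0 < E" using assms by (simp add: E_def)
  \<comment> \<open>For positive \<open>m\<close> the quotient \<open>s m / q\<close> is the last
    scale summed. A geometric sum is controlled by its largest term, which is this one or is capped
    by \<open>\<tau>\<close>.\<close>
  have "(\<Sum>n<m. if s n \<le> \<tau> then s n powr e else 0) \<le> (min \<tau> (s m / q)) powr e / E"
  proof (induction m)
    case 0
    then show ?case using E by simp
  next
    case (Suc m)
    have d: "s (Suc m) / q = s m" using assms s by simp
    show ?case
    proof (cases "s m \<le> \<tau>")
      case True
      have "s m / q \<le> s m" using assms s(1)[of m] by (simp add: divide_le_eq)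
      then have m: "min \<tau> (s m / q) = s m / q" "min \<tau> (s m) = s m" using True by auto
      have "(s m / q) powr e = s m powr e * (1 - E)"
        using assms s(1)[of m] by (simp add: powr_divide E_def powr_minus_divide)
      then have "(s m / q) powr e / E + s m powr e = s m powr e / E"
        using E by (simp add: field_simps)
      then show ?thesis using Suc True unfolding d m by simp
    next
      case False
      have "s m / q \<le> s m" using assms s(1)[of m] by (simp add: divide_le_eq)
      then have "(min \<tau> (s m / q)) powr e / E \<le> (min \<tau> (s m)) powr e / E"
        using E assms s(1)[of m] by (intro divide_right_mono powr_mono2) auto
      then show ?thesis using Suc False unfolding d by simp
    qed
  qed
  also have "\<dots> \<le> \<tau> powr e / E"
    using E assms s(1)[of m] by (intro divide_right_mono powr_mono2) auto
  finally show ?thesis unfolding s_def E_def .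
qed

lemma geometric_sum_high:
  fixes k q \<epsilon> \<tau> :: real
  assumes "0 < k" "1 < q" "0 < \<epsilon>" "0 < \<tau>"
  shows "(\<Sum>n<m. if \<epsilon> * q ^ n \<le> \<tau> then 0 else (\<epsilon> * q ^ n) powr - k) \<le> \<tau> powr - k / (1 - q powr - k)"
proof -
  define s where "s n = \<epsilon> * q ^ n" for n
  define E where "E = 1 - q powr - k"
  have s: "0 < s n" "s (Suc n) = q * s n" for n using assms by (auto simp: s_def)
  have "q powr - k < q powr 0" using assms by (intro powr_less_mono) auto
  then have E: "0 < E" using assms by (simp add: E_def)
  \<comment> \<open>Each term beyond \<open>\<tau>\<close> is an exact difference of two values of
    \<open>s powr - k / E\<close>, so the sum telescopes; \<open>max\<close> holds the subtracted
    value at \<open>\<tau>\<close> as long as \<open>s m\<close> has not passed it.\<close>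
  have "(\<Sum>n<m. if s n \<le> \<tau> then 0 else s n powr - k) \<le> (\<tau> powr - k - (max \<tau> (s m)) powr - k) / E"
  proof (induction m)
    case 0
    have "(max \<tau> (s 0)) powr - k \<le> \<tau> powr - k"
      using assms by (intro powr_mono2') auto
    then show ?case using E by simp
  next
    case (Suc m)
    have le: "s m \<le> s (Suc m)" using assms s(1)[of m] s(2)[of m] by simp
    show ?case
    proof (cases "s m \<le> \<tau>")
      case True
      have "(max \<tau> (s (Suc m))) powr - k \<le> (max \<tau> (s m)) powr - k"
        using assms le by (intro powr_mono2') auto
      then have "(\<tau> powr - k - (max \<tau> (s m)) powr - k) / E
          \<le> (\<tau> powr - k - (max \<tau> (s (Suc m))) powr - k) / E"
        using E by (intro divide_right_mono) auto
      then show ?thesis using Suc True by simp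
    next
      case False
      then have m: "max \<tau> (s m) = s m" "max \<tau> (s (Suc m)) = s (Suc m)" using le by auto
      have "s (Suc m) powr - k = (1 - E) * s m powr - k"
        using assms s(1)[of m] by (simp add: s(2) powr_mult E_def)
      then have "(\<tau> powr - k - s m powr - k) / E + s m powr - k
          = (\<tau> powr - k - s (Suc m) powr - k) / E"
        using E by (simp add: field_simps)
      then show ?thesis using Suc False unfolding m by simp
    qed
  qed
  also have "\<dots> \<le> \<tau> powr - k / E"
    using E by (intro divide_right_mono) auto
  finally show ?thesis unfolding s_def E_def .
qed

lemma nn_integral_powr_from_0:
  fixes a c :: real assumes "-1 < a" "0 \<le> c"
  shows "(\<integral>\<^sup>+h. ennreal (h powr a) * indicator {0<..<c} h \<partial>lborel) = ennreal (c powr (a + 1) / (a + 1))"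
proof -
  have "(\<integral>\<^sup>+h. ennreal (h powr a) * indicator {0<..<c} h \<partial>lborel)
      = (\<integral>\<^sup>+h. ennreal (indicator {0..c} h * h powr a) \<partial>lborel)"
  proof (intro nn_integral_cong_AE)
    show "AE h in lborel. ennreal (h powr a) * indicator {0<..<c} h = ennreal (indicator {0..c} h * h powr a)"
      using AE_lborel_singleton[of 0] AE_lborel_singleton[of c]
      by eventually_elim (auto simp: indicator_def)
  qed
  also have "\<dots> = ennreal (c powr (a + 1) / (a + 1))"
    using nn_integral_has_integral_lebesgue[OF _ has_integral_powr_from_0[OF assms], simplified]
    by simp
  finally show ?thesis .
qed

text \<open>Layer cake, as in Doob's maximal inequality.\<close>

lemma weak_type_imp_strong_type:
  fixes \<phi> g :: "'a::euclidean_space \<Rightarrow> real"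
  assumes [measurable]: "\<phi> \<in> borel_measurable borel" "g \<in> borel_measurable borel"
    and nn: "\<And>x. 0 \<le> \<phi> x" "\<And>x. 0 \<le> g x" and p: "1 < p"
    and weak: "\<And>h. 0 < h \<Longrightarrow> emeasure lborel {x. h < \<phi> x}
        \<le> ennreal (1 / h) * (\<integral>\<^sup>+x. ennreal (g x) * indicator {x. h < g x} x \<partial>lborel)"
  shows "(\<integral>\<^sup>+x. ennreal (\<phi> x powr p) \<partial>lborel)
     \<le> ennreal (p / (p - 1)) * (\<integral>\<^sup>+x. ennreal (g x powr p) \<partial>lborel)"
proof -
  have "(\<integral>\<^sup>+x. ennreal (\<phi> x powr p) \<partial>lborel)
     = (\<integral>\<^sup>+x. ennreal p * (\<integral>\<^sup>+h. ennreal (h powr (p - 1)) * indicator {0<..<\<phi> x} h \<partial>lborel) \<partial>lborel)"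
    using p nn by (subst nn_integral_powr_from_0) (auto simp: ennreal_mult'[symmetric])
  also have "\<dots> = ennreal p * (\<integral>\<^sup>+x. (\<integral>\<^sup>+h. ennreal (h powr (p - 1)) * indicator {0<..<\<phi> x} h \<partial>lborel) \<partial>lborel)"
    by (intro nn_integral_cmult) (simp add: indicator_def)
  also have "(\<integral>\<^sup>+x. (\<integral>\<^sup>+h. ennreal (h powr (p - 1)) * indicator {0<..<\<phi> x} h \<partial>lborel) \<partial>lborel)
     = (\<integral>\<^sup>+h. (\<integral>\<^sup>+x. ennreal (h powr (p - 1)) * indicator {0<..<\<phi> x} h \<partial>lborel) \<partial>lborel)"
    by (rule lborel_pair.Fubini'[symmetric]) (simp add: indicator_def)
  also have "\<dots> \<le> (\<integral>\<^sup>+h. (\<integral>\<^sup>+x. ennreal (g x) * (ennreal (h powr (p - 2)) * indicator {0<..<g x} h) \<partial>lborel) \<partial>lborel)"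
  proof (rule nn_integral_mono)
    fix h :: real
    show "(\<integral>\<^sup>+x. ennreal (h powr (p - 1)) * indicator {0<..<\<phi> x} h \<partial>lborel)
       \<le> (\<integral>\<^sup>+x. ennreal (g x) * (ennreal (h powr (p - 2)) * indicator {0<..<g x} h) \<partial>lborel)"
    proof (cases "0 < h")
      case False
      then show ?thesis by simp
    next
      case True
      have "(\<integral>\<^sup>+x. ennreal (h powr (p - 1)) * indicator {0<..<\<phi> x} h \<partial>lborel)
          = (\<integral>\<^sup>+x. ennreal (h powr (p - 1)) * indicator {x. h < \<phi> x} x \<partial>lborel)"
        using True by (intro nn_integral_cong) (auto simp: indicator_def)
      also have "\<dots> = ennreal (h powr (p - 1)) * emeasure lborel {x. h < \<phi> x}"
        by (subst nn_integral_cmult_indicator) auto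
      also have "\<dots> \<le> ennreal (h powr (p - 1)) * (ennreal (1 / h)
          * (\<integral>\<^sup>+x. ennreal (g x) * indicator {x. h < g x} x \<partial>lborel))"
        by (intro mult_left_mono weak True) auto
      also have "\<dots> = ennreal (h powr (p - 2)) * (\<integral>\<^sup>+x. ennreal (g x) * indicator {x. h < g x} x \<partial>lborel)"
      proof -
        have "h powr (p - 2) * h = h powr (p - 1)"
          using True powr_add[of h "p - 2" 1] by simp
        then have "h powr (p - 1) * (1 / h) = h powr (p - 2)"
          using True by (simp add: field_simps)
        then have "ennreal (h powr (p - 1)) * ennreal (1 / h) = ennreal (h powr (p - 2))"
          using True by (subst ennreal_mult'[symmetric]) auto
        then show ?thesis by (simp add: mult.assoc[symmetric])
      qed
      also have "\<dots> = (\<integral>\<^sup>+x. ennreal (h powr (p - 2)) * (ennreal (g x) * indicator {x. h < g x} x) \<partial>lborel)"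
        by (intro nn_integral_cmult[symmetric]) auto
      also have "\<dots> = (\<integral>\<^sup>+x. ennreal (g x) * (ennreal (h powr (p - 2)) * indicator {0<..<g x} h) \<partial>lborel)"
        using True by (intro nn_integral_cong) (auto simp: indicator_def mult.commute)
      finally show ?thesis .
    qed
  qed
  also have "\<dots> = (\<integral>\<^sup>+x. (\<integral>\<^sup>+h. ennreal (g x) * (ennreal (h powr (p - 2)) * indicator {0<..<g x} h) \<partial>lborel) \<partial>lborel)"
    by (rule lborel_pair.Fubini') (simp add: indicator_def)
  also have "\<dots> = (\<integral>\<^sup>+x. ennreal (1 / (p - 1)) * ennreal (g x powr p) \<partial>lborel)"
  proof (rule nn_integral_cong)
    fix x
    have "(\<integral>\<^sup>+h. ennreal (g x) * (ennreal (h powr (p - 2)) * indicator {0<..<g x} h) \<partial>lborel)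
       = ennreal (g x) * ennreal (g x powr (p - 2 + 1) / (p - 2 + 1))"
      using p nn by (subst nn_integral_cmult) (auto simp: nn_integral_powr_from_0)
    also have "\<dots> = ennreal (g x * (g x powr (p - 1) / (p - 1)))"
      using nn by (subst ennreal_mult'[symmetric]) auto
    also have "g x * (g x powr (p - 1) / (p - 1)) = 1 / (p - 1) * g x powr p"
      using powr_mult_base[OF nn(2)[of x], of "p - 1"] by simp
    also have "ennreal \<dots> = ennreal (1 / (p - 1)) * ennreal (g x powr p)"
      using p by (subst ennreal_mult') auto
    finally show "(\<integral>\<^sup>+h. ennreal (g x) * (ennreal (h powr (p - 2)) * indicator {0<..<g x} h) \<partial>lborel)
       = ennreal (1 / (p - 1)) * ennreal (g x powr p)" .
  qed
  also have "\<dots> = ennreal (1 / (p - 1)) * (\<integral>\<^sup>+x. ennreal (g x powr p) \<partial>lborel)"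
    by (intro nn_integral_cmult) auto
  finally have "(\<integral>\<^sup>+x. ennreal (\<phi> x powr p) \<partial>lborel)
     \<le> ennreal p * (ennreal (1 / (p - 1)) * (\<integral>\<^sup>+x. ennreal (g x powr p) \<partial>lborel))"
    by (simp add: mult_left_mono)
  also have "\<dots> = ennreal (p / (p - 1)) * (\<integral>\<^sup>+x. ennreal (g x powr p) \<partial>lborel)"
    using p by (simp add: mult.assoc[symmetric] ennreal_mult'[symmetric])
  finally show ?thesis .
qed

text \<open>Both endpoint bounds combine into an \<open>L\<^sup>p \<rightarrow> L\<^sup>\<infinity>\<close> bound by splitting \<open>g\<close> at the height \<open>b\<close>.\<close>

lemma smoothing_op_powr:
  fixes g :: "'a::euclidean_space \<Rightarrow> real"
  assumes T: "positive_op (ennreal c) T" "smoothing_op (ennreal D) T"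
    and [measurable]: "g \<in> borel_measurable borel" and nn: "\<And>x. 0 \<le> g x"
    and p: "1 < p" and int: "(\<integral>\<^sup>+x. ennreal (g x powr p) \<partial>lborel) \<le> 1"
    and b: "0 < b" "0 \<le> c" "0 \<le> D"
  shows "T (\<lambda>x. ennreal (g x)) x \<le> ennreal (c * b + D * b powr (1 - p))"
proof -
  let ?h = "\<lambda>x. ennreal (b powr (1 - p)) * ennreal (g x powr p)"
  have "g x \<le> b + b powr (1 - p) * g x powr p" for x
  proof (cases "g x \<le> b")
    case True
    then show ?thesis by (simp add: add_increasing2)
  next
    case False
    have "g x powr (1 - p) \<le> b powr (1 - p)"
      using False b p by (intro powr_mono2') auto
    then have "g x powr (1 - p) * g x powr p \<le> b powr (1 - p) * g x powr p"
      by (rule mult_right_mono) simp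
    moreover have "g x powr (1 - p) * g x powr p = g x"
      using False b by (simp add: powr_add[symmetric])
    ultimately show ?thesis using b by linarith
  qed
  then have "ennreal (g x) \<le> ennreal (b + b powr (1 - p) * g x powr p)" for x
    by (rule ennreal_leI)
  also have "ennreal (b + b powr (1 - p) * g x powr p) = ennreal b + ?h x" for x
    using b by (simp add: ennreal_mult')
  finally have "T (\<lambda>x. ennreal (g x)) x \<le> T (\<lambda>x. ennreal b + ?h x) x"
    by (rule positive_opD(5)[OF T(1)])
  also have "\<dots> = T (\<lambda>x. ennreal b) x + T ?h x"
    by (rule positive_opD(4)[OF T(1)]) auto
  also have "\<dots> \<le> ennreal c * ennreal b + ennreal D * (\<integral>\<^sup>+x. ?h x \<partial>lborel)"
    by (intro add_mono positive_opD(3)[OF T(1)] smoothing_opD[OF T(2)]) auto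
  also have "(\<integral>\<^sup>+x. ?h x \<partial>lborel) = ennreal (b powr (1 - p)) * (\<integral>\<^sup>+x. ennreal (g x powr p) \<partial>lborel)"
    by (intro nn_integral_cmult) auto
  also have "ennreal c * ennreal b + ennreal D * (ennreal (b powr (1 - p)) * (\<integral>\<^sup>+x. ennreal (g x powr p) \<partial>lborel))
      \<le> ennreal c * ennreal b + ennreal D * (ennreal (b powr (1 - p)) * 1)"
    by (intro add_left_mono mult_left_mono int) auto
  also have "\<dots> = ennreal (c * b + D * b powr (1 - p))"
    using b by (simp add: ennreal_mult')
  finally show ?thesis .
qed

text \<open>Instead of interpolating between weak type bounds, the proof checks the hypothesis of
  \<open>weak_type_imp_strong_type\<close> for a power of \<open>f\<close> and \<open>g\<close>
  itself. At each height \<open>h\<close> both the function \<open>g\<close> and the range of scales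
  are cut. Everything except the large part of \<open>g\<close> at the small scales is then
  uniformly small, and Markov's inequality applies to that remaining part. The two summands of
  \<open>K\<close> come from the large and from the small scales. The approximation may depend on
  \<open>\<eta>\<close>, because it is used for one height at a time.\<close>

lemma strong_type_of_dyadic_decomposition:
  fixes f g :: "'a::euclidean_space \<Rightarrow> real" and p e D q C :: real
  assumes [measurable]: "f \<in> borel_measurable borel" "g \<in> borel_measurable borel"
    and nn: "\<And>x. 0 \<le> g x" and p: "1 < p" and e: "0 < e" "p * e < D" and q: "1 < q" and C: "0 < C"
    and int: "(\<integral>\<^sup>+x. ennreal (g x powr p) \<partial>lborel) \<le> 1"
    and approx: "\<And>\<eta>. 0 < \<eta> \<Longrightarrow> \<exists>\<epsilon> m T. 0 < \<epsilon> \<and>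
       (\<forall>n::nat. positive_op (ennreal (C * (\<epsilon> * q ^ n) powr e)) (T n)
          \<and> smoothing_op (ennreal (C * (\<epsilon> * q ^ n) powr (e - D))) (T n)) \<and>
       (\<forall>x. ennreal \<bar>f x\<bar> \<le> (\<Sum>n<m. T n (\<lambda>x. ennreal (g x)) x) + ennreal \<eta>)"
  defines "K \<equiv> 2 * C / (1 - q powr - (D / p - e)) + C / (1 - q powr - e)"
  shows "(\<integral>\<^sup>+x. ennreal (\<bar>f x\<bar> powr (p * D / (D - p * e))) \<partial>lborel)
      \<le> ennreal ((4 * K) powr (p * D / (D - p * e)) * (p / (p - 1)))"
proof -
  define \<kappa> where "\<kappa> = D / p - e"
  define ps where "ps = p * D / (D - p * e)"
  have \<kappa>: "0 < \<kappa>" using e p by (simp add: \<kappa>_def field_simps)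
  have D: "0 < D" using e p by (smt (verit) mult_pos_pos)
  have ps: "0 < ps" using D e p by (simp add: ps_def)
  have "q powr - \<kappa> < q powr 0" "q powr - e < q powr 0"
    by (rule powr_less_mono; use q \<kappa> e in simp)+
  then have E: "0 < 1 - q powr - \<kappa>" "0 < 1 - q powr - e" using q by auto
  have K2: "2 * C / (1 - q powr - \<kappa>) \<le> K" "C / (1 - q powr - e) \<le> K" and K: "0 < K"
    using E C by (auto simp: K_def \<kappa>_def add_pos_pos)
  have pps: "p / ps = \<kappa> * p / D"
    using D e p by (simp add: ps_def \<kappa>_def field_simps)
  \<comment> \<open>The exponent is chosen so that \<open>h < \<phi> x\<close> means
    \<open>4 * s < \<bar>f x\<bar>\<close> for the threshold \<open>s\<close> below.\<close>
  define \<phi> where "\<phi> x = (\<bar>f x\<bar> / (4 * K)) powr (ps / p)" for x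
  have [measurable]: "\<phi> \<in> borel_measurable borel" unfolding \<phi>_def by measurable
  have weak: "emeasure lborel {x. h < \<phi> x}
        \<le> ennreal (1 / h) * (\<integral>\<^sup>+x. ennreal (g x) * indicator {x. h < g x} x \<partial>lborel)"
    if h: "0 < h" for h
  proof -
    \<comment> \<open>This scale balances the two errors: \<open>\<tau> powr e * h\<close> from
      values of \<open>g\<close> up to \<open>h\<close> at scales up to \<open>\<tau>\<close>, and
      \<open>\<tau> powr - \<kappa>\<close> from the larger scales. They agree since
      \<open>e + \<kappa> = D / p\<close>. Their common value times \<open>K\<close> is
      \<open>s\<close>.\<close>
    define \<tau> where "\<tau> = h powr - (p / D)"
    define s where "s = K * h powr (p / ps)"
    have \<tau>: "0 < \<tau>" using h by (simp add: \<tau>_def)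
    have s: "0 < s" using h K by (simp add: s_def)
    have s1: "K * \<tau> powr - \<kappa> = s"
      using h by (simp add: s_def \<tau>_def powr_powr pps field_simps)
    have s2: "K * \<tau> powr e * h = s"
    proof -
      have "\<tau> powr e * h = h powr (- (p / D) * e + 1)"
        using h powr_add[of h "- (p / D) * e" 1] by (simp add: \<tau>_def powr_powr)
      also have "- (p / D) * e + 1 = p / ps"
        unfolding pps using D p by (simp add: \<kappa>_def field_simps)
      finally show ?thesis by (simp add: s_def mult.assoc)
    qed
    obtain \<epsilon> m T where \<epsilon>: "0 < \<epsilon>"
      and T: "\<And>n::nat. positive_op (ennreal (C * (\<epsilon> * q ^ n) powr e)) (T n)"
          "\<And>n. smoothing_op (ennreal (C * (\<epsilon> * q ^ n) powr (e - D))) (T n)"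
      and le: "\<And>x. ennreal \<bar>f x\<bar> \<le> (\<Sum>n<m. T n (\<lambda>x. ennreal (g x)) x) + ennreal s"
      using approx[OF s] by blast
    define g1 where "g1 x = ennreal (g x) * indicator {x. g x \<le> h} x" for x
    define g2 where "g2 x = ennreal (g x) * indicator {x. h < g x} x" for x
    have [measurable]: "g1 \<in> borel_measurable borel" "g2 \<in> borel_measurable borel"
      unfolding g1_def g2_def by measurable
    have g12: "(\<lambda>x. ennreal (g x)) = (\<lambda>x. g1 x + g2 x)"
      by (auto simp: g1_def g2_def indicator_def fun_eq_iff)
    define L where "L g x = (\<Sum>n\<in>{n. n < m \<and> \<epsilon> * q ^ n \<le> \<tau>}. T n g x)" for g x
    have fin: "finite {n. n < m \<and> P n}" for P by simp
    have csum: "(\<Sum>n\<in>{n. n < m \<and> \<epsilon> * q ^ n \<le> \<tau>}. ennreal (C * (\<epsilon> * q ^ n) powr e))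
        \<le> ennreal (K * \<tau> powr e)"
    proof -
      have "(\<Sum>n\<in>{n. n < m \<and> \<epsilon> * q ^ n \<le> \<tau>}. C * (\<epsilon> * q ^ n) powr e)
          = C * (\<Sum>n<m. if \<epsilon> * q ^ n \<le> \<tau> then (\<epsilon> * q ^ n) powr e else 0)"
        by (simp add: sum.inter_filter[symmetric] sum_distrib_left lessThan_def)
      also have "\<dots> \<le> C * (\<tau> powr e / (1 - q powr - e))"
        using C by (intro mult_left_mono geometric_sum_low e q \<epsilon> \<tau>) auto
      also have "\<dots> = C / (1 - q powr - e) * \<tau> powr e" by simp
      also have "\<dots> \<le> K * \<tau> powr e" using K2 by (intro mult_right_mono) auto
      finally show ?thesis
        using C by (subst sum_ennreal) (auto intro!: ennreal_leI)
    qed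
    have L: "positive_op (ennreal (K * \<tau> powr e)) L"
      unfolding L_def by (rule positive_op_mono[OF positive_op_sum csum]) (auto intro: T)
    have high: "(\<Sum>n\<in>{n. n < m \<and> \<not> \<epsilon> * q ^ n \<le> \<tau>}. T n (\<lambda>x. ennreal (g x)) x) \<le> ennreal s" for x
    proof -
      have "T n (\<lambda>x. ennreal (g x)) x \<le> ennreal (2 * C * (\<epsilon> * q ^ n) powr - \<kappa>)" for n
      proof -
        have sn: "0 < \<epsilon> * q ^ n" using \<epsilon> q by simp
        \<comment> \<open>The height at which the two terms of \<open>smoothing_op_powr\<close>
          coincide at this scale: its power with exponent \<open>p\<close> is the scale to the power
          \<open>- D\<close>.\<close>
        let ?b = "(\<epsilon> * q ^ n) powr - (D / p)"
        have "T n (\<lambda>x. ennreal (g x)) x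
          \<le> ennreal (C * (\<epsilon> * q ^ n) powr e * ?b + C * (\<epsilon> * q ^ n) powr (e - D) * ?b powr (1 - p))"
          using sn C q \<epsilon> by (intro smoothing_op_powr[OF T _ nn p int]) auto
        also have "C * (\<epsilon> * q ^ n) powr e * ?b = C * (\<epsilon> * q ^ n) powr - \<kappa>"
          by (simp add: \<kappa>_def powr_add[symmetric] mult.assoc)
        also have "C * (\<epsilon> * q ^ n) powr (e - D) * ?b powr (1 - p) = C * (\<epsilon> * q ^ n) powr - \<kappa>"
        proof -
          have "(\<epsilon> * q ^ n) powr (e - D) * ?b powr (1 - p)
              = (\<epsilon> * q ^ n) powr (e - D + - (D / p) * (1 - p))"
            by (simp only: powr_powr powr_add)
          also have "e - D + - (D / p) * (1 - p) = - \<kappa>"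
            using p by (simp add: \<kappa>_def field_simps)
          finally show ?thesis by simp
        qed
        also have "C * (\<epsilon> * q ^ n) powr - \<kappa> + C * (\<epsilon> * q ^ n) powr - \<kappa> = 2 * C * (\<epsilon> * q ^ n) powr - \<kappa>"
          by simp
        finally show ?thesis .
      qed
      then have "(\<Sum>n\<in>{n. n < m \<and> \<not> \<epsilon> * q ^ n \<le> \<tau>}. T n (\<lambda>x. ennreal (g x)) x)
          \<le> (\<Sum>n\<in>{n. n < m \<and> \<not> \<epsilon> * q ^ n \<le> \<tau>}. ennreal (2 * C * (\<epsilon> * q ^ n) powr - \<kappa>))"
        by (intro sum_mono)
      also have "\<dots> = ennreal (\<Sum>n\<in>{n. n < m \<and> \<not> \<epsilon> * q ^ n \<le> \<tau>}. 2 * C * (\<epsilon> * q ^ n) powr - \<kappa>)"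
        using C by (subst sum_ennreal) auto
      also have "\<dots> \<le> ennreal s"
      proof (rule ennreal_leI)
        have "(\<Sum>n\<in>{n. n < m \<and> \<not> \<epsilon> * q ^ n \<le> \<tau>}. 2 * C * (\<epsilon> * q ^ n) powr - \<kappa>)
            = (\<Sum>n<m. if \<not> \<epsilon> * q ^ n \<le> \<tau> then 2 * C * (\<epsilon> * q ^ n) powr - \<kappa> else 0)"
          using sum.inter_filter[of "{..<m}" "\<lambda>n. 2 * C * (\<epsilon> * q ^ n) powr - \<kappa>" "\<lambda>n. \<not> \<epsilon> * q ^ n \<le> \<tau>"]
          by (simp only: finite_lessThan lessThan_iff)
        also have "\<dots> = 2 * C * (\<Sum>n<m. if \<epsilon> * q ^ n \<le> \<tau> then 0 else (\<epsilon> * q ^ n) powr - \<kappa>)"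
          by (subst sum_distrib_left) (auto intro!: sum.cong)
        also have "\<dots> \<le> 2 * C * (\<tau> powr - \<kappa> / (1 - q powr - \<kappa>))"
          using C by (intro mult_left_mono geometric_sum_high \<kappa> q \<epsilon> \<tau>) auto
        also have "\<dots> = 2 * C / (1 - q powr - \<kappa>) * \<tau> powr - \<kappa>" by simp
        also have "\<dots> \<le> K * \<tau> powr - \<kappa>" using K2 by (intro mult_right_mono) auto
        finally show "(\<Sum>n\<in>{n. n < m \<and> \<not> \<epsilon> * q ^ n \<le> \<tau>}. 2 * C * (\<epsilon> * q ^ n) powr - \<kappa>) \<le> s"
          by (simp add: s1)
      qed
      finally show ?thesis .
    qed
    \<comment> \<open>The three portions of size \<open>s\<close> are the small values of
      \<open>g\<close> at small scales, the large scales, and the approximation error, for which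
      \<open>\<eta> = s\<close> was chosen. A fourth portion must then come from \<open>L g2\<close>
      wherever \<open>\<bar>f x\<bar>\<close> exceeds \<open>4 * s\<close>.\<close>
    have bound: "ennreal \<bar>f x\<bar> \<le> L g2 x + ennreal (3 * s)" for x
    proof -
      have S: "{..<m} = {n. n < m \<and> \<epsilon> * q ^ n \<le> \<tau>} \<union> {n. n < m \<and> \<not> \<epsilon> * q ^ n \<le> \<tau>}" by auto
      have "(\<Sum>n<m. T n (\<lambda>x. ennreal (g x)) x)
          = L (\<lambda>x. ennreal (g x)) x + (\<Sum>n\<in>{n. n < m \<and> \<not> \<epsilon> * q ^ n \<le> \<tau>}. T n (\<lambda>x. ennreal (g x)) x)"
        unfolding S L_def by (rule sum.union_disjoint) auto
      also have "L (\<lambda>x. ennreal (g x)) x = L g1 x + L g2 x"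
        unfolding g12 by (rule positive_opD(4)[OF L]) auto
      finally have "(\<Sum>n<m. T n (\<lambda>x. ennreal (g x)) x) = L g1 x + L g2 x
          + (\<Sum>n\<in>{n. n < m \<and> \<not> \<epsilon> * q ^ n \<le> \<tau>}. T n (\<lambda>x. ennreal (g x)) x)" .
      then have "ennreal \<bar>f x\<bar> \<le> L g1 x + L g2 x
          + (\<Sum>n\<in>{n. n < m \<and> \<not> \<epsilon> * q ^ n \<le> \<tau>}. T n (\<lambda>x. ennreal (g x)) x) + ennreal s"
        using le[of x] by (simp only:)
      also have "\<dots> \<le> ennreal (K * \<tau> powr e) * ennreal h + L g2 x + ennreal s + ennreal s"
        by (intro add_mono high positive_opD(3)[OF L] order_refl)
          (auto simp: g1_def indicator_def intro: ennreal_leI)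
      also have "ennreal (K * \<tau> powr e) * ennreal h = ennreal s"
        using h K s2 by (subst ennreal_mult'[symmetric]) auto
      also have "ennreal s + L g2 x + ennreal s + ennreal s = L g2 x + (ennreal s + ennreal s + ennreal s)"
        by (simp add: add_ac)
      also have "ennreal s + ennreal s + ennreal s = ennreal (3 * s)"
        using s by (simp add: ennreal_plus[symmetric] del: ennreal_plus)
      finally show ?thesis .
    qed
    have [measurable]: "L g2 \<in> borel_measurable borel"
      by (rule positive_opD(1)[OF L]) simp
    have "{x. h < \<phi> x} \<subseteq> {x\<in>UNIV. 1 \<le> ennreal (1 / s) * L g2 x}"
    proof (intro subsetI CollectI conjI UNIV_I)
      fix x assume "x \<in> {x. h < \<phi> x}"
      then have "h < (\<bar>f x\<bar> / (4 * K)) powr (ps / p)" by (simp add: \<phi>_def)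
      then have "h powr (p / ps) < ((\<bar>f x\<bar> / (4 * K)) powr (ps / p)) powr (p / ps)"
        using h p ps by (intro powr_less_mono2) auto
      also have "\<dots> = \<bar>f x\<bar> / (4 * K)"
        using p ps K by (simp add: powr_powr)
      finally have f: "4 * s < \<bar>f x\<bar>"
        using K by (simp add: s_def field_simps)
      have "ennreal s \<le> L g2 x"
      proof (rule ccontr)
        assume "\<not> ennreal s \<le> L g2 x"
        then have "L g2 x + ennreal (3 * s) \<le> ennreal s + ennreal (3 * s)"
          by (intro add_right_mono) auto
        also have "\<dots> = ennreal (4 * s)"
          using s by (simp add: ennreal_plus[symmetric] del: ennreal_plus)
        finally have "ennreal \<bar>f x\<bar> \<le> ennreal (4 * s)"
          using bound[of x] by (rule order_trans[rotated])
        then show False using f s by (simp add: ennreal_le_iff)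
      qed
      then have "ennreal (1 / s) * ennreal s \<le> ennreal (1 / s) * L g2 x"
        by (rule mult_left_mono) simp
      moreover have "ennreal (1 / s) * ennreal s = 1"
        using s by (subst ennreal_mult'[symmetric]) auto
      ultimately show "1 \<le> ennreal (1 / s) * L g2 x" by simp
    qed
    then have "emeasure lborel {x. h < \<phi> x} \<le> emeasure lborel {x\<in>UNIV. 1 \<le> ennreal (1 / s) * L g2 x}"
      by (intro emeasure_mono) (auto)
    also have "\<dots> \<le> ennreal (1 / s) * (\<integral>\<^sup>+x. L g2 x * indicator UNIV x \<partial>lborel)"
      by (rule nn_integral_Markov_inequality) auto
    also have "(\<integral>\<^sup>+x. L g2 x * indicator UNIV x \<partial>lborel) \<le> ennreal (K * \<tau> powr e) * (\<integral>\<^sup>+x. g2 x \<partial>lborel)"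
      using positive_opD(2)[OF L, of g2] by simp
    also have "ennreal (1 / s) * (ennreal (K * \<tau> powr e) * (\<integral>\<^sup>+x. g2 x \<partial>lborel))
        = ennreal (1 / s * (K * \<tau> powr e)) * (\<integral>\<^sup>+x. g2 x \<partial>lborel)"
      using s by (subst ennreal_mult') (auto simp: mult.assoc)
    also have "1 / s * (K * \<tau> powr e) = 1 / h"
      using s2 s h by (simp add: field_simps)
    finally show ?thesis by (simp add: g2_def mult_left_mono)
  qed
  have "\<bar>f x\<bar> powr ps = (4 * K) powr ps * \<phi> x powr p" for x
  proof -
    have "\<phi> x powr p = (\<bar>f x\<bar> / (4 * K)) powr ps"
      using p by (simp add: \<phi>_def powr_powr)
    also have "\<dots> = \<bar>f x\<bar> powr ps / (4 * K) powr ps"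
      using K by (subst powr_divide) auto
    finally show ?thesis using K by simp
  qed
  then have "(\<integral>\<^sup>+x. ennreal (\<bar>f x\<bar> powr ps) \<partial>lborel)
      = (\<integral>\<^sup>+x. ennreal ((4 * K) powr ps) * ennreal (\<phi> x powr p) \<partial>lborel)"
    by (simp add: ennreal_mult')
  also have "\<dots> = ennreal ((4 * K) powr ps) * (\<integral>\<^sup>+x. ennreal (\<phi> x powr p) \<partial>lborel)"
    by (intro nn_integral_cmult) auto
  also have "\<dots> \<le> ennreal ((4 * K) powr ps) * (ennreal (p / (p - 1)) * (\<integral>\<^sup>+x. ennreal (g x powr p) \<partial>lborel))"
    by (intro mult_left_mono weak_type_imp_strong_type weak nn p) (auto simp: \<phi>_def)
  also have "\<dots> \<le> ennreal ((4 * K) powr ps) * (ennreal (p / (p - 1)) * 1)"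
    by (intro mult_left_mono int) auto
  also have "\<dots> = ennreal ((4 * K) powr ps * (p / (p - 1)))"
    using p by (subst ennreal_mult') auto
  finally show ?thesis by (simp add: ps_def)
qed

section \<open>Sums of jumps along a frame\<close>

lemma act_of_convolution:
  assumes M: "finite_borel M" and N: "finite_borel N" and P: "finite_borel P" and h: "bounded_borel h"
    and eq: "\<And>g. g \<in> borel_measurable borel \<Longrightarrow>
      (\<integral>\<^sup>+u. g u \<partial>P) = (\<integral>\<^sup>+u. (\<integral>\<^sup>+v. g (u + v) \<partial>N) \<partial>M)"
  shows "act P h = act M (act N h)"
proof
  fix x
  interpret M: finite_measure M using M by (simp add: finite_borel_def)
  interpret N: finite_measure N using N by (simp add: finite_borel_def)
  interpret MN: pair_sigma_finite M N ..
  interpret Q: finite_measure "M \<Otimes>\<^sub>M N"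
    by (rule finite_measure_pair_measure) unfold_locales
  have [measurable_cong]: "sets M = sets borel" "sets N = sets borel" "sets P = sets borel"
    using assms by (simp_all add: finite_borel_def)
  obtain B where B: "\<And>x. \<bar>h x\<bar> \<le> B" and [measurable]: "h \<in> borel_measurable borel"
    using h by (auto simp: bounded_borel_def)
  have "P = distr (M \<Otimes>\<^sub>M N) borel (\<lambda>(u, v). u + v)"
  proof (rule measure_eqI)
    fix A assume "A \<in> sets P"
    then have [measurable]: "A \<in> sets borel" using P by (simp add: finite_borel_def)
    have "emeasure P A = (\<integral>\<^sup>+u. (\<integral>\<^sup>+v. indicator A (u + v) \<partial>N) \<partial>M)"
      using eq[of "indicator A"] by simp
    also have "\<dots> = (\<integral>\<^sup>+z. indicator A (fst z + snd z) \<partial>(M \<Otimes>\<^sub>M N))"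
      by (subst N.nn_integral_fst[symmetric]) auto
    also have "\<dots> = (\<integral>\<^sup>+z. indicator A z \<partial>distr (M \<Otimes>\<^sub>M N) borel (\<lambda>(u, v). u + v))"
      by (subst nn_integral_distr) (auto simp: case_prod_beta)
    finally show "emeasure P A = emeasure (distr (M \<Otimes>\<^sub>M N) borel (\<lambda>(u, v). u + v)) A"
      by simp
  qed (simp add: assms(3)[unfolded finite_borel_def])
  then have "act P h x = (\<integral>z. h (x + (fst z + snd z)) \<partial>(M \<Otimes>\<^sub>M N))"
    unfolding act_def by (simp add: integral_distr case_prod_beta)
  also have "\<dots> = (\<integral>u. (\<integral>v. h (x + (u + v)) \<partial>N) \<partial>M)"
    using B by (subst MN.integral_fst'[symmetric]) (auto intro!: Q.integrable_const_bound[of _ B])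
  finally show "act P h x = act M (act N h) x" by (simp add: act_def add.assoc)
qed

text \<open>The unnormalised law of a sum of independent jumps \<open>r i *\<^sub>R y i\<close> with
  directions from \<open>\<Sigma> i\<close> and lengths of density \<open>\<omega>\<close>.
  Directions and lengths are kept in separate product measures so that the directions can be frozen
  while all lengths are integrated.\<close>

definition frame_law ::
    "('i \<Rightarrow> 'a::euclidean_space measure) \<Rightarrow> (real \<Rightarrow> ennreal) \<Rightarrow> 'i set \<Rightarrow> 'a measure" where
  "frame_law \<Sigma> \<omega> I =
     distr (density (PiM I \<Sigma> \<Otimes>\<^sub>M PiM I (\<lambda>_. lborel)) (\<lambda>(y, r). \<Prod>i\<in>I. \<omega> (r i))) borel
       (\<lambda>(y, r). \<Sum>i\<in>I. r i *\<^sub>R y i)"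

lemma sigma_finite_PiM_lborel:
  "finite I \<Longrightarrow> sigma_finite_measure (PiM I (\<lambda>_. lborel :: real measure))"
  using product_sigma_finite.sigma_finite[of "\<lambda>_. lborel :: real measure" I]
  by (simp add: product_sigma_finite_def sigma_finite_lborel)

context
  fixes \<Sigma> :: "'i \<Rightarrow> 'a::euclidean_space measure" and \<omega> :: "real \<Rightarrow> ennreal"
  assumes fin: "\<And>i. finite_borel (\<Sigma> i)" and om [measurable]: "\<omega> \<in> borel_measurable borel"
begin

lemma sets_frame [measurable_cong]: "sets (\<Sigma> i) = sets borel"
  using fin[of i] by (simp add: finite_borel_def)

lemma finite_measure_frame: "finite_measure (\<Sigma> i)"
  using fin[of i] by (simp add: finite_borel_def)

lemma product_sigma_finite_frame: "product_sigma_finite \<Sigma>"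
  using finite_measure_frame
  by (simp add: product_sigma_finite_def finite_measure_def)

lemma nn_integral_frame_law:
  assumes I: "finite I" and [measurable]: "g \<in> borel_measurable borel"
  shows "(\<integral>\<^sup>+u. g u \<partial>frame_law \<Sigma> \<omega> I)
     = (\<integral>\<^sup>+y. (\<integral>\<^sup>+r. (\<Prod>i\<in>I. \<omega> (r i)) * g (\<Sum>i\<in>I. r i *\<^sub>R y i) \<partial>PiM I (\<lambda>_. lborel)) \<partial>PiM I \<Sigma>)"
proof -
  interpret L: sigma_finite_measure "PiM I (\<lambda>_. lborel :: real measure)"
    by (rule sigma_finite_PiM_lborel[OF I])
  have "(\<integral>\<^sup>+u. g u \<partial>frame_law \<Sigma> \<omega> I)
     = (\<integral>\<^sup>+z. (\<Prod>i\<in>I. \<omega> (snd z i)) * g (\<Sum>i\<in>I. snd z i *\<^sub>R fst z i)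
          \<partial>(PiM I \<Sigma> \<Otimes>\<^sub>M PiM I (\<lambda>_. lborel)))"
    unfolding frame_law_def case_prod_beta
    by (subst nn_integral_distr, measurable, subst nn_integral_density, measurable)
  also have "\<dots> = (\<integral>\<^sup>+y. (\<integral>\<^sup>+r. (\<Prod>i\<in>I. \<omega> (r i)) * g (\<Sum>i\<in>I. r i *\<^sub>R y i) \<partial>PiM I (\<lambda>_. lborel)) \<partial>PiM I \<Sigma>)"
  proof -
    have "(\<lambda>z. (\<Prod>i\<in>I. \<omega> (snd z i)) * g (\<Sum>i\<in>I. snd z i *\<^sub>R fst z i))
        \<in> borel_measurable (PiM I \<Sigma> \<Otimes>\<^sub>M PiM I (\<lambda>_. lborel))"
      by measurable
    from L.nn_integral_fst[OF this] show ?thesis by simp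
  qed
  finally show ?thesis .
qed

lemma finite_borel_frame_law:
  assumes I: "finite I" and om_fin: "(\<integral>\<^sup>+t. \<omega> t \<partial>lborel) < \<infinity>"
  shows "finite_borel (frame_law \<Sigma> \<omega> I)"
    and "emeasure (frame_law \<Sigma> \<omega> I) UNIV = (\<Prod>i\<in>I. emeasure (\<Sigma> i) UNIV) * (\<integral>\<^sup>+t. \<omega> t \<partial>lborel) ^ card I"
proof -
  interpret S: product_sigma_finite \<Sigma> by (rule product_sigma_finite_frame)
  interpret R: product_sigma_finite "\<lambda>_. lborel :: real measure"
    by (simp add: product_sigma_finite_def sigma_finite_lborel)
  have sp: "space (\<Sigma> i) = UNIV" for i
    using sets_eq_imp_space_eq[OF sets_frame[of i]] by simp
  have "emeasure (frame_law \<Sigma> \<omega> I) UNIV = (\<integral>\<^sup>+u. 1 \<partial>frame_law \<Sigma> \<omega> I)"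
    by (simp add: frame_law_def)
  also have "\<dots> = (\<integral>\<^sup>+y. (\<integral>\<^sup>+r. (\<Prod>i\<in>I. \<omega> (r i)) \<partial>PiM I (\<lambda>_. lborel)) \<partial>PiM I \<Sigma>)"
    using I by (subst nn_integral_frame_law) auto
  also have "(\<integral>\<^sup>+r. (\<Prod>i\<in>I. \<omega> (r i)) \<partial>PiM I (\<lambda>_. lborel)) = (\<integral>\<^sup>+t. \<omega> t \<partial>lborel) ^ card I"
    using I by (subst R.product_nn_integral_prod) auto
  also have "(\<integral>\<^sup>+y. (\<integral>\<^sup>+t. \<omega> t \<partial>lborel) ^ card I \<partial>PiM I \<Sigma>)
      = (\<integral>\<^sup>+t. \<omega> t \<partial>lborel) ^ card I * emeasure (PiM I \<Sigma>) (PiE I (\<lambda>i. UNIV))"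
    by (simp add: space_PiM sp)
  also have "emeasure (PiM I \<Sigma>) (PiE I (\<lambda>i. UNIV)) = (\<Prod>i\<in>I. emeasure (\<Sigma> i) UNIV)"
    using I sp by (subst S.emeasure_PiM) (auto simp: sets_frame)
  finally show eq: "emeasure (frame_law \<Sigma> \<omega> I) UNIV = (\<Prod>i\<in>I. emeasure (\<Sigma> i) UNIV) * (\<integral>\<^sup>+t. \<omega> t \<partial>lborel) ^ card I"
    by (simp add: mult.commute)
  have "(\<Prod>i\<in>I. emeasure (\<Sigma> i) UNIV) \<noteq> \<infinity>"
    using finite_measure.emeasure_finite[OF finite_measure_frame] by (simp add: ennreal_prod_eq_top)
  then have "emeasure (frame_law \<Sigma> \<omega> I) UNIV \<noteq> \<infinity>"
    using om_fin unfolding eq by (auto simp: ennreal_mult_eq_top_iff power_eq_top_ennreal)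
  then show "finite_borel (frame_law \<Sigma> \<omega> I)"
    unfolding finite_borel_def by (auto simp: frame_law_def intro!: finite_measureI)
qed

text \<open>Adding an index is convolving with one more jump law. The new direction and the new
  length come out of two different product measures, so the direction has to be moved past the
  lengths of the old jumps by Fubini before the two combine to \<open>X\<close>.\<close>

lemma nn_integral_frame_law_insert:
  assumes I: "finite I" "i \<notin> I" and [measurable]: "g \<in> borel_measurable borel"
    and X: "\<And>g. g \<in> borel_measurable borel \<Longrightarrow>
       (\<integral>\<^sup>+u. g u \<partial>X) = (\<integral>\<^sup>+y. (\<integral>\<^sup>+t. \<omega> t * g (t *\<^sub>R y) \<partial>lborel) \<partial>\<Sigma> i)"
  shows "(\<integral>\<^sup>+u. g u \<partial>frame_law \<Sigma> \<omega> (insert i I))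
     = (\<integral>\<^sup>+u. (\<integral>\<^sup>+v. g (u + v) \<partial>X) \<partial>frame_law \<Sigma> \<omega> I)"
proof -
  interpret S: product_sigma_finite \<Sigma> by (rule product_sigma_finite_frame)
  interpret R: product_sigma_finite "\<lambda>_. lborel :: real measure"
    by (simp add: product_sigma_finite_def sigma_finite_lborel)
  interpret L: sigma_finite_measure "PiM I (\<lambda>_. lborel :: real measure)"
    by (rule sigma_finite_PiM_lborel[OF I(1)])
  interpret Si: finite_measure "\<Sigma> i" by (rule finite_measure_frame)
  interpret SL: pair_sigma_finite "\<Sigma> i" "PiM I (\<lambda>_. lborel :: real measure)" ..
  let ?u = "\<lambda>y r. \<Sum>j\<in>I. r j *\<^sub>R y j" and ?p = "\<lambda>r. \<Prod>j\<in>I. \<omega> (r j)"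
  let ?L = "PiM I (\<lambda>_. lborel :: real measure)"
  have upd: "(\<Sum>j\<in>insert i I. (r(i := t)) j *\<^sub>R (y(i := z)) j) = ?u y r + t *\<^sub>R z"
    "(\<Prod>j\<in>insert i I. \<omega> ((r(i := t)) j)) = ?p r * \<omega> t" for r t y z
  proof -
    have "(\<Sum>j\<in>I. (r(i := t)) j *\<^sub>R (y(i := z)) j) = ?u y r" "(\<Prod>j\<in>I. \<omega> ((r(i := t)) j)) = ?p r"
      using I by (auto intro!: sum.cong prod.cong)
    then show "(\<Sum>j\<in>insert i I. (r(i := t)) j *\<^sub>R (y(i := z)) j) = ?u y r + t *\<^sub>R z"
      "(\<Prod>j\<in>insert i I. \<omega> ((r(i := t)) j)) = ?p r * \<omega> t"
      using I by (simp_all add: add.commute mult.commute)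
  qed
  have "(\<integral>\<^sup>+u. g u \<partial>frame_law \<Sigma> \<omega> (insert i I))
     = (\<integral>\<^sup>+y. (\<integral>\<^sup>+r. (\<Prod>j\<in>insert i I. \<omega> (r j)) * g (\<Sum>j\<in>insert i I. r j *\<^sub>R y j)
          \<partial>PiM (insert i I) (\<lambda>_. lborel)) \<partial>PiM (insert i I) \<Sigma>)"
    using I by (subst nn_integral_frame_law) auto
  also have "\<dots> = (\<integral>\<^sup>+y. (\<integral>\<^sup>+z. (\<integral>\<^sup>+r. (\<Prod>j\<in>insert i I. \<omega> (r j)) * g (\<Sum>j\<in>insert i I. r j *\<^sub>R (y(i := z)) j)
          \<partial>PiM (insert i I) (\<lambda>_. lborel)) \<partial>\<Sigma> i) \<partial>PiM I \<Sigma>)"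
  proof (rule S.product_nn_integral_insert[OF I])
    interpret L': sigma_finite_measure "PiM (insert i I) (\<lambda>_. lborel :: real measure)"
      by (rule sigma_finite_PiM_lborel) (simp add: I)
    show "(\<lambda>y. \<integral>\<^sup>+r. (\<Prod>j\<in>insert i I. \<omega> (r j)) * g (\<Sum>j\<in>insert i I. r j *\<^sub>R y j)
          \<partial>PiM (insert i I) (\<lambda>_. lborel)) \<in> borel_measurable (PiM (insert i I) \<Sigma>)"
      by measurable
  qed
  also have "\<dots> = (\<integral>\<^sup>+y. (\<integral>\<^sup>+z. (\<integral>\<^sup>+r. (\<integral>\<^sup>+t. ?p r * \<omega> t * g (?u y r + t *\<^sub>R z) \<partial>lborel) \<partial>?L) \<partial>\<Sigma> i) \<partial>PiM I \<Sigma>)"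
  proof (intro nn_integral_cong)
    fix y z assume y: "y \<in> space (PiM I \<Sigma>)" and z: "z \<in> space (\<Sigma> i)"
    show "(\<integral>\<^sup>+r. (\<Prod>j\<in>insert i I. \<omega> (r j)) * g (\<Sum>j\<in>insert i I. r j *\<^sub>R (y(i := z)) j)
          \<partial>PiM (insert i I) (\<lambda>_. lborel))
        = (\<integral>\<^sup>+r. (\<integral>\<^sup>+t. ?p r * \<omega> t * g (?u y r + t *\<^sub>R z) \<partial>lborel) \<partial>?L)"
      unfolding upd[symmetric] by (rule R.product_nn_integral_insert[OF I]) measurable
  qed
  also have "\<dots> = (\<integral>\<^sup>+y. (\<integral>\<^sup>+r. (\<integral>\<^sup>+z. (\<integral>\<^sup>+t. ?p r * \<omega> t * g (?u y r + t *\<^sub>R z) \<partial>lborel) \<partial>\<Sigma> i) \<partial>?L) \<partial>PiM I \<Sigma>)"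
  proof (rule nn_integral_cong)
    fix y assume y: "y \<in> space (PiM I \<Sigma>)"
    show "(\<integral>\<^sup>+z. (\<integral>\<^sup>+r. (\<integral>\<^sup>+t. ?p r * \<omega> t * g (?u y r + t *\<^sub>R z) \<partial>lborel) \<partial>?L) \<partial>\<Sigma> i)
        = (\<integral>\<^sup>+r. (\<integral>\<^sup>+z. (\<integral>\<^sup>+t. ?p r * \<omega> t * g (?u y r + t *\<^sub>R z) \<partial>lborel) \<partial>\<Sigma> i) \<partial>?L)"
      by (rule SL.Fubini'[symmetric]) measurable
  qed
  also have "\<dots> = (\<integral>\<^sup>+y. (\<integral>\<^sup>+r. ?p r * (\<integral>\<^sup>+v. g (?u y r + v) \<partial>X) \<partial>?L) \<partial>PiM I \<Sigma>)"
    by (intro nn_integral_cong) (simp add: X mult.assoc nn_integral_cmult)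
  also have "\<dots> = (\<integral>\<^sup>+u. (\<integral>\<^sup>+v. g (u + v) \<partial>X) \<partial>frame_law \<Sigma> \<omega> I)"
  proof (subst nn_integral_frame_law[OF I(1)])
    show "(\<lambda>u. \<integral>\<^sup>+v. g (u + v) \<partial>X) \<in> borel_measurable borel"
      by (simp add: X)
  qed simp
  finally show ?thesis .
qed

lemma foldr_act_eq_frame_law:
  assumes om_fin: "(\<integral>\<^sup>+t. \<omega> t \<partial>lborel) < \<infinity>"
    and Xf: "\<And>i. finite_borel (X i)"
    and X: "\<And>i g. g \<in> borel_measurable borel \<Longrightarrow>
       (\<integral>\<^sup>+u. g u \<partial>X i) = (\<integral>\<^sup>+y. (\<integral>\<^sup>+t. \<omega> t * g (t *\<^sub>R y) \<partial>lborel) \<partial>\<Sigma> i)"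
    and d: "distinct is" and h: "bounded_borel h"
  shows "foldr (\<lambda>i. act (X i)) is h = act (frame_law \<Sigma> \<omega> (set is)) h"
  using d
proof (induction "is")
  case Nil
  \<comment> \<open>The empty sum is zero, so this is the point mass at the origin and convolution
    with it is the identity.\<close>
  define M0 where "M0 = distr (count_space {()}) borel (\<lambda>_. 0 :: 'a)"
  have "emeasure (frame_law \<Sigma> \<omega> {}) A = emeasure M0 A" if "A \<in> sets borel" for A
  proof -
    have "A \<in> sets (frame_law \<Sigma> \<omega> {})" using that by (simp add: frame_law_def)
    then have "emeasure (frame_law \<Sigma> \<omega> {}) A = (\<integral>\<^sup>+u. indicator A u \<partial>frame_law \<Sigma> \<omega> {})"
      by simp
    also have "\<dots> = indicator A 0"
      using that by (subst nn_integral_frame_law) (auto simp: PiM_empty nn_integral_count_space_finite)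
    also have "\<dots> = emeasure M0 A"
      using that by (auto simp: M0_def emeasure_distr indicator_def)
    finally show ?thesis .
  qed
  then have "frame_law \<Sigma> \<omega> {} = M0"
    by (intro measure_eqI) (simp_all add: frame_law_def M0_def)
  then have "act (frame_law \<Sigma> \<omega> {}) h = h"
    unfolding act_def M0_def using h
    by (auto simp: bounded_borel_def integral_distr lebesgue_integral_count_space_finite fun_eq_iff)
  then show ?case by simp
next
  case (Cons i "is")
  let ?J = "frame_law \<Sigma> \<omega> (set is)"
  have "act (frame_law \<Sigma> \<omega> (insert i (set is))) h = act ?J (act (X i) h)"
    using Cons.prems om_fin by (intro act_of_convolution finite_borel_frame_law nn_integral_frame_law_insert X Xf h) auto
  also have "\<dots> = act (X i) (act ?J h)"
    using om_fin by (intro act_comm finite_borel_frame_law Xf h) auto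
  finally show ?case using Cons by simp
qed

end

section \<open>Frames and linear changes of variables\<close>

lemma measurable_lborel_pair:
  "f \<in> borel_measurable (borel \<Otimes>\<^sub>M borel) \<Longrightarrow> f \<in> borel_measurable (lborel \<Otimes>\<^sub>M lborel)"
  by (subst measurable_cong_sets[OF sets_pair_measure_cong[OF sets_lborel sets_lborel] refl])

text \<open>Quantitative linear independence: \<open>c\<close> is a lower bound for the smallest
  singular value of the matrix whose columns are the vectors \<open>y b\<close>.\<close>

definition frame :: "real \<Rightarrow> ('a::euclidean_space \<Rightarrow> 'a) \<Rightarrow> bool" where
  "frame c y \<longleftrightarrow> (\<forall>v. c * norm v \<le> norm (\<Sum>b\<in>Basis. (v \<bullet> b) *\<^sub>R y b))"

lemma linear_frame: "linear (\<lambda>v::'a::euclidean_space. \<Sum>b\<in>Basis. (v \<bullet> b) *\<^sub>R (y b :: 'a))"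
  by (intro linear_compose_sum) (auto intro!: linearI simp: inner_add_left scaleR_add_left)

lemma frame_inverse:
  fixes y :: "'a::euclidean_space \<Rightarrow> 'a"
  assumes c: "0 < c" and y: "frame c y"
  obtains R where "linear R" "\<And>v. norm (R v) \<le> norm v / c"
    "\<And>u. (\<Sum>b\<in>Basis. (R u \<bullet> b) *\<^sub>R y b) = u" "\<And>v. R (\<Sum>b\<in>Basis. (v \<bullet> b) *\<^sub>R y b) = v"
proof -
  let ?L = "\<lambda>v. \<Sum>b\<in>Basis. (v \<bullet> b) *\<^sub>R y b"
  have L: "linear ?L" by (rule linear_frame)
  have "inj ?L"
  proof (subst linear_injective_0[OF L], intro allI impI)
    fix v assume "?L v = 0"
    then have "c * norm v \<le> 0" using y by (metis frame_def norm_zero)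
    then show "v = 0" using c by (simp add: mult_le_0_iff)
  qed
  then obtain R where R: "linear R" "\<And>x. R (?L x) = x" "\<And>x. ?L (R x) = x"
    using linear_injective_isomorphism[OF L] by blast
  have "norm (R v) \<le> norm v / c" for v
    using y[unfolded frame_def, rule_format, of "R v"] R(3)[of v] c by (simp add: field_simps)
  with R that show ?thesis by blast
qed

text \<open>Both sides of the proof integrate \<open>g y\<close> over the pairs \<open>(v, y)\<close> with \<open>\<parallel>y - L v\<parallel> \<le> 1\<close>.\<close>

lemma nn_integral_linear_le:
  fixes L L' :: "'a::euclidean_space \<Rightarrow> 'a"
  assumes L: "linear L" and c: "0 < c" "\<And>v. c * norm v \<le> norm (L v)" and L': "\<And>v. L (L' v) = v"
    and [measurable]: "g \<in> borel_measurable borel"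
  shows "(\<integral>\<^sup>+v. g (L v) \<partial>lborel) \<le> ennreal ((1 / c) ^ DIM('a)) * (\<integral>\<^sup>+v. g v \<partial>lborel)"
proof -
  define C where "C = cball (0::'a) 1"
  have [measurable]: "C \<in> sets borel" by (simp add: C_def)
  have [measurable]: "L \<in> borel_measurable borel"
    using linear_continuous_on[OF L[unfolded linear_conv_bounded_linear]]
    by (rule borel_measurable_continuous_onI)
  have em: "emeasure lborel (cball a r) = ennreal (measure lborel (cball a r))" for a :: 'a and r
    using emeasure_lborel_cball_finite[of a r] by (intro emeasure_eq_ennreal_measure) auto
  have "ennreal (measure lborel C) * (\<integral>\<^sup>+v. g (L v) \<partial>lborel)
      = (\<integral>\<^sup>+z. indicator C z * (\<integral>\<^sup>+v. g (L v) \<partial>lborel) \<partial>lborel)"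
    by (subst nn_integral_multc) (auto simp: em C_def intro!: borel_measurable_indicator)
  also have "\<dots> = (\<integral>\<^sup>+z. (\<integral>\<^sup>+v. indicator C z * g (z + L v) \<partial>lborel) \<partial>lborel)"
  proof (rule nn_integral_cong)
    fix z
    have "(\<integral>\<^sup>+v. g (z + L v) \<partial>lborel) = (\<integral>\<^sup>+v. g (L (v + L' z)) \<partial>lborel)"
      by (simp add: linear_add[OF L] L' add.commute)
    also have "\<dots> = (\<integral>\<^sup>+v. g (L v) \<partial>lborel)"
      by (rule nn_integral_lborel_translate) simp
    finally show "indicator C z * (\<integral>\<^sup>+v. g (L v) \<partial>lborel) = (\<integral>\<^sup>+v. indicator C z * g (z + L v) \<partial>lborel)"
      by (simp add: nn_integral_cmult)
  qed
  also have "\<dots> = (\<integral>\<^sup>+v. (\<integral>\<^sup>+z. indicator C z * g (z + L v) \<partial>lborel) \<partial>lborel)"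
    by (rule lborel_pair.Fubini'[OF measurable_lborel_pair]) measurable
  also have "\<dots> = (\<integral>\<^sup>+v. (\<integral>\<^sup>+z. indicator C (z - L v) * g z \<partial>lborel) \<partial>lborel)"
  proof (rule nn_integral_cong)
    fix v
    show "(\<integral>\<^sup>+z. indicator C z * g (z + L v) \<partial>lborel) = (\<integral>\<^sup>+z. indicator C (z - L v) * g z \<partial>lborel)"
      using nn_integral_lborel_translate[of "\<lambda>z. indicator C (z - L v) * g z" "L v"] by simp
  qed
  also have "\<dots> = (\<integral>\<^sup>+z. (\<integral>\<^sup>+v. indicator C (z - L v) * g z \<partial>lborel) \<partial>lborel)"
    by (rule lborel_pair.Fubini'[OF measurable_lborel_pair]) measurable
  also have "\<dots> \<le> (\<integral>\<^sup>+z. ennreal ((1 / c) ^ DIM('a) * measure lborel C) * g z \<partial>lborel)"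
  proof (rule nn_integral_mono)
    fix z
    have "(\<integral>\<^sup>+v. indicator C (z - L v) * g z \<partial>lborel) = (\<integral>\<^sup>+v. indicator C (z - L v) \<partial>lborel) * g z"
      by (rule nn_integral_multc) simp
    \<comment> \<open>For fixed \<open>z\<close> the admissible \<open>v\<close> lie in a ball of
      radius \<open>1 / c\<close> about \<open>L' z\<close>. The ratio of its volume to that of the
      unit ball is the constant claimed, so no determinant is computed.\<close>
    also have "(\<integral>\<^sup>+v. indicator C (z - L v) \<partial>lborel) \<le> (\<integral>\<^sup>+v. indicator (cball (L' z) (1 / c)) v \<partial>lborel)"
    proof (intro nn_integral_mono)
      fix v
      show "indicator C (z - L v) \<le> (indicator (cball (L' z) (1 / c)) v :: ennreal)"
      proof (cases "z - L v \<in> C")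
        case True
        have "z - L v = L (L' z - v)" by (simp add: linear_diff[OF L] L')
        then have "c * norm (L' z - v) \<le> 1" using c(2)[of "L' z - v"] True by (simp add: C_def)
        then show ?thesis using True c(1) by (simp add: dist_norm field_simps)
      qed simp
    qed
    also have "\<dots> = ennreal (measure lborel (cball (L' z) (1 / c)))"
      by (simp add: em)
    also have "measure lborel (cball (L' z) (1 / c)) = (1 / c) ^ DIM('a) * measure lborel C"
      using c content_ball_conv_unit_ball[of "1 / c" "L' z"] by (simp add: C_def content_cball_conv_ball)
    finally show "(\<integral>\<^sup>+v. indicator C (z - L v) * g z \<partial>lborel)
        \<le> ennreal ((1 / c) ^ DIM('a) * measure lborel C) * g z"
      by (simp add: mult_right_mono)
  qed
  also have "\<dots> = ennreal ((1 / c) ^ DIM('a) * measure lborel C) * (\<integral>\<^sup>+z. g z \<partial>lborel)"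
    by (intro nn_integral_cmult) simp
  also have "\<dots> = ennreal (measure lborel C) * (ennreal ((1 / c) ^ DIM('a)) * (\<integral>\<^sup>+z. g z \<partial>lborel))"
    using c by (subst ennreal_mult') (auto simp: mult_ac)
  finally show ?thesis
    using content_cball_pos[of 1 "0::'a"]
    by (subst (asm) ennreal_mult_le_mult_iff) (auto simp: C_def)
qed

text \<open>Lebesgue measure is the image of the product measure under the coordinate sum
  (\<open>lborel_eq\<close>), so the lengths \<open>r\<close> are the coordinates of
  \<open>v\<close>.\<close>

lemma nn_integral_frame_le:
  fixes y :: "'a::euclidean_space \<Rightarrow> 'a"
  assumes c: "0 < c" and y: "frame c y" and [measurable]: "g \<in> borel_measurable borel"
  shows "(\<integral>\<^sup>+r. g (\<Sum>b\<in>Basis. r b *\<^sub>R y b) \<partial>PiM Basis (\<lambda>_. lborel))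
     \<le> ennreal ((1 / c) ^ DIM('a)) * (\<integral>\<^sup>+v. g v \<partial>lborel)"
proof -
  let ?L = "\<lambda>v. \<Sum>b\<in>Basis. (v \<bullet> b) *\<^sub>R y b"
  obtain R where "linear R" "\<And>v. norm (R v) \<le> norm v / c" and R: "\<And>u. ?L (R u) = u"
      and "\<And>v. R (?L v) = v"
    by (rule frame_inverse[OF c y]) (rule that)
  have "(\<integral>\<^sup>+r. g (\<Sum>b\<in>Basis. r b *\<^sub>R y b) \<partial>PiM Basis (\<lambda>_. lborel))
      = (\<integral>\<^sup>+r. g (?L (\<Sum>b\<in>Basis. r b *\<^sub>R b)) \<partial>PiM Basis (\<lambda>_. lborel))"
    by (simp add: inner_sum_left_Basis)
  also have "\<dots> = (\<integral>\<^sup>+v. g (?L v) \<partial>lborel)"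
  proof -
    have "(\<lambda>r. \<Sum>b\<in>Basis. r b *\<^sub>R (b::'a)) \<in> borel_measurable (PiM Basis (\<lambda>_. lborel))"
    proof (intro borel_measurable_sum borel_measurable_scaleR borel_measurable_const)
      fix b :: 'a assume "b \<in> Basis"
      then show "(\<lambda>r. r b) \<in> borel_measurable (PiM Basis (\<lambda>_. lborel :: real measure))"
        using measurable_component_singleton[of b Basis "\<lambda>_. lborel :: real measure"] by simp
    qed
    then show ?thesis by (subst (2) lborel_eq, subst nn_integral_distr) simp_all
  qed
  also have "\<dots> \<le> ennreal ((1 / c) ^ DIM('a)) * (\<integral>\<^sup>+v. g v \<partial>lborel)"
    using y by (intro nn_integral_linear_le[OF linear_frame c _ R]) (auto simp: frame_def)
  finally show ?thesis .
qed

lemma AE_PiM_finite_measure: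
  fixes \<Sigma> :: "'i \<Rightarrow> 'a::euclidean_space measure"
  assumes fin: "\<And>i. finite_borel (\<Sigma> i)" and I: "finite I"
    and C: "\<And>i. i \<in> I \<Longrightarrow> C i \<in> sets borel" "\<And>i. i \<in> I \<Longrightarrow> emeasure (\<Sigma> i) (- C i) = 0"
  shows "AE y in PiM I \<Sigma>. \<forall>i\<in>I. y i \<in> C i"
proof -
  interpret S: product_sigma_finite \<Sigma> by (rule product_sigma_finite_frame[OF fin borel_measurable_const])
  have st: "sets (\<Sigma> i) = sets borel" for i using fin[of i] by (simp add: finite_borel_def)
  then have sp: "space (\<Sigma> i) = UNIV" for i using sets_eq_imp_space_eq[of "\<Sigma> i" borel] by simp
  have "AE y in PiM I \<Sigma>. y i \<in> C i" if i: "i \<in> I" for i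
  proof (rule AE_I)
    let ?N = "PiE I (\<lambda>j. if j = i then - C i else UNIV)"
    show "{y \<in> space (PiM I \<Sigma>). y i \<notin> C i} \<subseteq> ?N"
      by (auto simp: space_PiM PiE_def extensional_def)
    have m: "(if j = i then - C i else UNIV) \<in> sets (\<Sigma> j)" for j
      using C(1)[OF i] by (auto simp: st)
    then show "?N \<in> sets (PiM I \<Sigma>)" using I by (intro sets_PiM_I_finite) auto
    have "emeasure (PiM I \<Sigma>) ?N = (\<Prod>j\<in>I. emeasure (\<Sigma> j) (if j = i then - C i else UNIV))"
      using I m by (intro S.emeasure_PiM) auto
    also have "\<dots> = 0" using I i C(2)[OF i] by (intro prod_zero) auto
    finally show "emeasure (PiM I \<Sigma>) ?N = 0" .
  qed
  then show ?thesis using I by (auto intro: AE_finite_allI)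
qed

text \<open>With the directions frozen, the sum of the jumps is a linear image of \<open>d\<close>
  independent lengths of density at most 1, so its density is at most \<open>(1 / c) ^ d\<close>.
  Averaging over the directions keeps the bound, however singular their laws are.\<close>

lemma smoothing_op_frame_law:
  fixes \<Sigma> :: "'a \<Rightarrow> 'a::euclidean_space measure"
  assumes fin: "\<And>i. finite_borel (\<Sigma> i)" and [measurable]: "\<omega> \<in> borel_measurable borel"
    and om: "\<And>t. \<omega> t \<le> 1"
    and C: "\<And>b. b \<in> Basis \<Longrightarrow> C b \<in> sets borel" "\<And>b. b \<in> Basis \<Longrightarrow> emeasure (\<Sigma> b) (- C b) = 0"
    and c: "0 < c" and fr: "\<And>y. (\<And>b. b \<in> Basis \<Longrightarrow> y b \<in> C b) \<Longrightarrow> frame c y"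
  shows "smoothing_op ((\<Prod>b\<in>Basis. emeasure (\<Sigma> b) UNIV) * ennreal ((1 / c) ^ DIM('a)))
     (nact (frame_law \<Sigma> \<omega> Basis))"
  unfolding smoothing_op_def
proof (intro ballI allI)
  fix g :: "'a \<Rightarrow> ennreal" and x assume [measurable]: "g \<in> borel_measurable borel"
  interpret S: product_sigma_finite \<Sigma> by (rule product_sigma_finite_frame[OF fin borel_measurable_const])
  have st: "sets (\<Sigma> i) = sets borel" for i using fin[of i] by (simp add: finite_borel_def)
  then have sp: "space (\<Sigma> i) = UNIV" for i using sets_eq_imp_space_eq[of "\<Sigma> i" borel] by simp
  let ?D = "ennreal ((1 / c) ^ DIM('a)) * (\<integral>\<^sup>+v. g v \<partial>lborel)"
  have "nact (frame_law \<Sigma> \<omega> Basis) g x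
      = (\<integral>\<^sup>+y. (\<integral>\<^sup>+r. (\<Prod>b\<in>Basis. \<omega> (r b)) * g (x + (\<Sum>b\<in>Basis. r b *\<^sub>R y b)) \<partial>PiM Basis (\<lambda>_. lborel)) \<partial>PiM Basis \<Sigma>)"
    unfolding nact_def by (rule nn_integral_frame_law[OF fin]) measurable
  also have "\<dots> \<le> (\<integral>\<^sup>+y. ?D \<partial>PiM Basis \<Sigma>)"
  proof (rule nn_integral_mono_AE)
    have "AE y in PiM Basis \<Sigma>. \<forall>b\<in>Basis. y b \<in> C b"
      by (rule AE_PiM_finite_measure[OF fin finite_Basis C])
    then show "AE y in PiM Basis \<Sigma>. (\<integral>\<^sup>+r. (\<Prod>b\<in>Basis. \<omega> (r b)) * g (x + (\<Sum>b\<in>Basis. r b *\<^sub>R y b)) \<partial>PiM Basis (\<lambda>_. lborel)) \<le> ?D"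
    proof eventually_elim
      case (elim y)
      have "(\<integral>\<^sup>+r. (\<Prod>b\<in>Basis. \<omega> (r b)) * g (x + (\<Sum>b\<in>Basis. r b *\<^sub>R y b)) \<partial>PiM Basis (\<lambda>_. lborel))
          \<le> (\<integral>\<^sup>+r. 1 * g (x + (\<Sum>b\<in>Basis. r b *\<^sub>R y b)) \<partial>PiM Basis (\<lambda>_. lborel))"
        using om by (intro nn_integral_mono mult_right_mono prod_le_1) auto
      also have "\<dots> \<le> ennreal ((1 / c) ^ DIM('a)) * (\<integral>\<^sup>+v. g (x + v) \<partial>lborel)"
        using nn_integral_frame_le[OF c fr, of y "\<lambda>v. g (x + v)"] elim by simp
      also have "(\<integral>\<^sup>+v. g (x + v) \<partial>lborel) = (\<integral>\<^sup>+v. g v \<partial>lborel)"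
        using nn_integral_lborel_translate[of g x] by (simp add: add.commute)
      finally show ?case .
    qed
  qed
  also have "\<dots> = ?D * emeasure (PiM Basis \<Sigma>) (PiE Basis (\<lambda>i. UNIV))"
    by (simp add: space_PiM sp)
  also have "emeasure (PiM Basis \<Sigma>) (PiE Basis (\<lambda>i. UNIV)) = (\<Prod>i\<in>Basis. emeasure (\<Sigma> i) UNIV)"
    using sp by (subst S.emeasure_PiM) (auto simp: st)
  finally show "nact (frame_law \<Sigma> \<omega> Basis) g x
      \<le> (\<Prod>b\<in>Basis. emeasure (\<Sigma> b) UNIV) * ennreal ((1 / c) ^ DIM('a)) * (\<integral>\<^sup>+v. g v \<partial>lborel)"
    by (simp add: mult_ac)
qed

text \<open>The smooth cutoff that replaces the density \<open>t powr (- 1 - \<alpha>) \<ge> 1 / 8\<close> on \<open>{1..2}\<close>.\<close>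

definition chi :: "real \<Rightarrow> real" where
  "chi t = (if 1 \<le> t \<and> t \<le> 2 then ((t - 1) * (2 - t))\<^sup>2 else 0)"

lemma chi_measurable [measurable]: "chi \<in> borel_measurable borel"
  unfolding chi_def by measurable

lemma chi_bounds: "0 \<le> chi t" "chi t \<le> 1 / 8"
proof -
  show "0 \<le> chi t" by (simp add: chi_def)
  have "((t - 1) * (2 - t))\<^sup>2 \<le> (1 / 4)\<^sup>2" if "1 \<le> t" "t \<le> 2"
  proof (rule power_mono)
    have "0 \<le> (t - 3 / 2)\<^sup>2" by simp
    then show "(t - 1) * (2 - t) \<le> 1 / 4" by (simp add: power2_eq_square algebra_simps)
  qed (use that in auto)
  then show "chi t \<le> 1 / 8" by (auto simp: chi_def power2_eq_square)
qed

section \<open>Integration by parts in the lengths of the jumps\<close>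

lemma ennreal_integral_le: "ennreal \<bar>\<integral>x. f x \<partial>M\<bar> \<le> (\<integral>\<^sup>+x. ennreal \<bar>f x\<bar> \<partial>M)" for f :: "'a \<Rightarrow> real"
proof (cases "integrable M f")
  case True
  then show ?thesis using integral_norm_bound_ennreal[OF True] by simp
next
  case False
  then show ?thesis by (simp add: not_integrable_integral_eq)
qed

text \<open>The cutoff is a polynomial on \<open>{s..2 * s}\<close> that vanishes at both ends, so
  there are no boundary terms. Rescaling by \<open>s\<close> brings the factor \<open>1 / s\<close>;
  the rescaled cutoff has derivative at most 2.\<close>

lemma chi_by_parts:
  fixes \<phi> \<psi> :: "real \<Rightarrow> real"
  assumes s: "0 < s" and d: "\<And>t. DERIV \<phi> t :> \<psi> t" and cont: "\<And>t. isCont \<psi> t"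
  shows "ennreal \<bar>\<integral>t. chi (t / s) * \<psi> t \<partial>lborel\<bar>
    \<le> ennreal (2 / s) * (\<integral>\<^sup>+t. indicator {s..2 * s} t * ennreal \<bar>\<phi> t\<bar> \<partial>lborel)"
proof -
  define F where "F t = ((t / s - 1) * (2 - t / s))\<^sup>2" for t
  define f where "f t = 2 * ((t / s - 1) * (2 - t / s)) * (3 - 2 * (t / s)) / s" for t
  have Ff: "DERIV F t :> f t" for t
  proof -
    have "DERIV (\<lambda>u::real. ((u - 1) * (2 - u))\<^sup>2) u :> 2 * ((u - 1) * (2 - u)) * (3 - 2 * u)" for u
      by (rule derivative_eq_intros refl | simp)+
    then have "DERIV (\<lambda>t. ((t / s - 1) * (2 - t / s))\<^sup>2) t
        :> 2 * ((t / s - 1) * (2 - t / s)) * (3 - 2 * (t / s)) * (1 / s)"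
      by (rule DERIV_chain2[where g = "\<lambda>t. t / s"]) (rule DERIV_cdivide[OF DERIV_ident])
    then show ?thesis by (simp add: F_def[abs_def] f_def)
  qed
  have [measurable]: "\<phi> \<in> borel_measurable borel"
    using d by (intro borel_measurable_continuous_onI) (meson DERIV_isCont continuous_at_imp_continuous_on)
  have "(\<integral>t. chi (t / s) * \<psi> t \<partial>lborel) = (\<integral>t. (F t * \<psi> t) * indicator {s..2 * s} t \<partial>lborel)"
  proof (intro Bochner_Integration.integral_cong refl)
    fix t
    have "chi (t / s) = F t * indicator {s..2 * s} t"
      using s by (auto simp: chi_def F_def indicator_def le_divide_eq divide_le_eq)
    then show "chi (t / s) * \<psi> t = (F t * \<psi> t) * indicator {s..2 * s} t" by simp
  qed
  also have "\<dots> = F (2 * s) * \<phi> (2 * s) - F s * \<phi> s - (\<integral>t. (f t * \<phi> t) * indicator {s..2 * s} t \<partial>lborel)"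
    using s by (intro integral_by_parts Ff d cont) (auto simp: f_def intro!: continuous_intros)
  also have "\<dots> = - (\<integral>t. (f t * \<phi> t) * indicator {s..2 * s} t \<partial>lborel)"
    using s by (simp add: F_def)
  finally have "ennreal \<bar>\<integral>t. chi (t / s) * \<psi> t \<partial>lborel\<bar>
      \<le> (\<integral>\<^sup>+t. ennreal \<bar>(f t * \<phi> t) * indicator {s..2 * s} t\<bar> \<partial>lborel)"
    using ennreal_integral_le[of lborel "\<lambda>t. (f t * \<phi> t) * indicator {s..2 * s} t"] by simp
  also have "\<dots> \<le> (\<integral>\<^sup>+t. ennreal (2 / s) * (indicator {s..2 * s} t * ennreal \<bar>\<phi> t\<bar>) \<partial>lborel)"
  proof (rule nn_integral_mono)
    fix t
    show "ennreal \<bar>(f t * \<phi> t) * indicator {s..2 * s} t\<bar> \<le> ennreal (2 / s) * (indicator {s..2 * s} t * ennreal \<bar>\<phi> t\<bar>)"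
    proof (cases "t \<in> {s..2 * s}")
      case True
      define u where "u = t / s"
      have u: "1 \<le> u" "u \<le> 2" using True s by (auto simp: u_def field_simps)
      have "\<bar>(u - 1) * (2 - u)\<bar> \<le> 1 * 1" unfolding abs_mult
        using u by (intro mult_mono) auto
      moreover have "\<bar>3 - 2 * u\<bar> \<le> 1" using u by auto
      ultimately have "\<bar>(u - 1) * (2 - u)\<bar> * \<bar>3 - 2 * u\<bar> \<le> 1 * 1 * 1"
        by (intro mult_mono) auto
      then have "2 * \<bar>(u - 1) * (2 - u)\<bar> * \<bar>3 - 2 * u\<bar> / s \<le> 2 / s"
        using s by (intro divide_right_mono) auto
      moreover have "\<bar>f t\<bar> = 2 * \<bar>(u - 1) * (2 - u)\<bar> * \<bar>3 - 2 * u\<bar> / s"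
        using s by (simp add: f_def u_def abs_mult)
      ultimately have "\<bar>f t\<bar> * \<bar>\<phi> t\<bar> \<le> 2 / s * \<bar>\<phi> t\<bar>"
        by (intro mult_right_mono) auto
      then have "ennreal (\<bar>f t\<bar> * \<bar>\<phi> t\<bar>) \<le> ennreal (2 / s * \<bar>\<phi> t\<bar>)" by (rule ennreal_leI)
      also have "\<dots> = ennreal (2 / s) * ennreal \<bar>\<phi> t\<bar>" using s by (intro ennreal_mult') auto
      finally show ?thesis using True by (simp add: abs_mult)
    qed simp
  qed
  also have "\<dots> = ennreal (2 / s) * (\<integral>\<^sup>+t. indicator {s..2 * s} t * ennreal \<bar>\<phi> t\<bar> \<partial>lborel)"
    by (intro nn_integral_cmult) simp
  finally show ?thesis .
qed

lemma measurable_frame_sum [measurable]: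
  fixes y :: "'i \<Rightarrow> 'a::euclidean_space"
  shows "(\<lambda>r. \<Sum>b\<in>I. r b *\<^sub>R y b) \<in> borel_measurable (PiM I (\<lambda>_. lborel))"
proof (intro borel_measurable_sum borel_measurable_scaleR borel_measurable_const)
  fix b assume "b \<in> I"
  then show "(\<lambda>r. r b) \<in> borel_measurable (PiM I (\<lambda>_. lborel :: real measure))"
    using measurable_component_singleton[of b I "\<lambda>_. lborel :: real measure"] by simp
qed

lemma measurable_frame_prod [measurable]:
  fixes \<omega> :: "real \<Rightarrow> 'b::{second_countable_topology, real_normed_field}"
  assumes [measurable]: "\<omega> \<in> borel_measurable borel"
  shows "(\<lambda>r. \<Prod>b\<in>I. \<omega> (r b)) \<in> borel_measurable (PiM I (\<lambda>_. lborel))"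
proof (intro borel_measurable_prod)
  fix b assume "b \<in> I"
  then have [measurable]: "(\<lambda>r. r b) \<in> borel_measurable (PiM I (\<lambda>_. lborel :: real measure))"
    using measurable_component_singleton[of b I "\<lambda>_. lborel :: real measure"] by simp
  show "(\<lambda>r. \<omega> (r b)) \<in> borel_measurable (PiM I (\<lambda>_. lborel))" by measurable
qed

lemma measurable_frame_prod_ennreal [measurable]:
  fixes \<omega> :: "real \<Rightarrow> ennreal"
  assumes [measurable]: "\<omega> \<in> borel_measurable borel"
  shows "(\<lambda>r. \<Prod>b\<in>I. \<omega> (r b)) \<in> borel_measurable (PiM I (\<lambda>_. lborel))"
proof (intro borel_measurable_prod_ennreal)
  fix b assume "b \<in> I"
  then have [measurable]: "(\<lambda>r. r b) \<in> borel_measurable (PiM I (\<lambda>_. lborel :: real measure))"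
    using measurable_component_singleton[of b I "\<lambda>_. lborel :: real measure"] by simp
  show "(\<lambda>r. \<omega> (r b)) \<in> borel_measurable (PiM I (\<lambda>_. lborel))" by measurable
qed

lemma chi_le_indicator: "0 < s \<Longrightarrow> chi (t / s) \<le> indicator {s..2 * s} t"
proof (cases "t \<in> {s..2 * s}")
  case True
  then show ?thesis using chi_bounds(2)[of "t / s"] by (simp add: indicator_def)
qed (auto simp: chi_def le_divide_eq divide_le_eq)

lemma integrable_chi_prod:
  fixes h :: "('i \<Rightarrow> real) \<Rightarrow> real"
  assumes I: "finite I" and s: "0 < s" and [measurable]: "h \<in> borel_measurable (PiM I (\<lambda>_. lborel))"
    and B: "\<And>r. \<bar>h r\<bar> \<le> B"
  shows "integrable (PiM I (\<lambda>_. lborel)) (\<lambda>r. (\<Prod>b\<in>I. chi (r b / s)) * h r)"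
proof (rule integrableI_bounded)
  interpret R: product_sigma_finite "\<lambda>_. lborel :: real measure"
    by (simp add: product_sigma_finite_def sigma_finite_lborel)
  have [measurable]: "(\<lambda>r. \<Prod>b\<in>I. chi (r b / s)) \<in> borel_measurable (PiM I (\<lambda>_. lborel))"
    by (rule measurable_frame_prod) measurable
  show "(\<lambda>r. (\<Prod>b\<in>I. chi (r b / s)) * h r) \<in> borel_measurable (PiM I (\<lambda>_. lborel))"
    by measurable
  have "(\<integral>\<^sup>+r. ennreal (norm ((\<Prod>b\<in>I. chi (r b / s)) * h r)) \<partial>PiM I (\<lambda>_. lborel))
      \<le> (\<integral>\<^sup>+r. ennreal B * (\<Prod>b\<in>I. indicator {s..2 * s} (r b)) \<partial>PiM I (\<lambda>_. lborel))"
  proof (rule nn_integral_mono)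
    fix r :: "'i \<Rightarrow> real"
    have chi: "chi (t / s) \<le> indicator {s..2 * s} t" for t
      by (rule chi_le_indicator[OF s])
    have "norm ((\<Prod>b\<in>I. chi (r b / s)) * h r) \<le> (\<Prod>b\<in>I. indicator {s..2 * s} (r b)) * B"
      unfolding norm_mult by (intro mult_mono)
        (auto simp: abs_prod chi_bounds B chi intro!: prod_mono prod_nonneg)
    then have "ennreal (norm ((\<Prod>b\<in>I. chi (r b / s)) * h r)) \<le> ennreal (B * (\<Prod>b\<in>I. indicator {s..2 * s} (r b)))"
      by (intro ennreal_leI) (simp add: mult.commute)
    also have "\<dots> = ennreal B * (\<Prod>b\<in>I. indicator {s..2 * s} (r b))"
      by (subst ennreal_mult'') (auto simp: prod_ennreal[symmetric] ennreal_indicator intro!: prod_nonneg)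
    finally show "ennreal (norm ((\<Prod>b\<in>I. chi (r b / s)) * h r)) \<le> ennreal B * (\<Prod>b\<in>I. indicator {s..2 * s} (r b))" .
  qed
  also have "\<dots> = ennreal B * (\<integral>\<^sup>+r. (\<Prod>b\<in>I. indicator {s..2 * s} (r b)) \<partial>PiM I (\<lambda>_. lborel))"
    by (intro nn_integral_cmult measurable_frame_prod_ennreal) simp
  also have "(\<integral>\<^sup>+r. (\<Prod>b\<in>I. indicator {s..2 * s} (r b)) \<partial>PiM I (\<lambda>_. lborel))
      = (\<Prod>b\<in>I. (\<integral>\<^sup>+t. indicator {s..2 * s} t \<partial>(lborel :: real measure)))"
    using I by (intro R.product_nn_integral_prod) auto
  also have "ennreal B * \<dots> < \<infinity>"
    using s by (simp add: less_top[symmetric] ennreal_mult_eq_top_iff power_eq_top_ennreal)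
  finally show "(\<integral>\<^sup>+r. ennreal (norm ((\<Prod>b\<in>I. chi (r b / s)) * h r)) \<partial>PiM I (\<lambda>_. lborel)) < \<infinity>" .
qed

text \<open>\<open>G z v\<close> is the derivative of \<open>F\<close> in direction \<open>v\<close>, and \<open>w\<close> is the divergence of \<open>F\<close>: the map \<open>R\<close> gives
  the coordinates with respect to the frame \<open>y\<close>, and the trace of \<open>G z\<close> is computed in that frame.\<close>

definition divergence_pair ::
    "('a::euclidean_space \<Rightarrow> 'a) \<Rightarrow> ('a \<Rightarrow> 'a \<Rightarrow> 'a) \<Rightarrow> ('a \<Rightarrow> real) \<Rightarrow> bool" where
  "divergence_pair F G w \<longleftrightarrow>
     (\<forall>z v t. ((\<lambda>t. F (z + t *\<^sub>R v)) has_vector_derivative G (z + t *\<^sub>R v) v) (at t)) \<and>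
     (\<forall>v. continuous_on UNIV (\<lambda>z. G z v) \<and> (\<exists>B. \<forall>z. norm (G z v) \<le> B)) \<and>
     (\<forall>(y::'a \<Rightarrow> 'a) (R::'a \<Rightarrow> 'a) z. linear R \<longrightarrow> (\<forall>u. (\<Sum>b\<in>Basis. (R u \<bullet> b) *\<^sub>R y b) = u) \<longrightarrow>
        w z = (\<Sum>b\<in>Basis. R (G z (y b)) \<bullet> b))"

lemma prod_fun_upd:
  fixes f :: "'b \<Rightarrow> 'z::comm_monoid_mult"
  assumes "finite B" "b \<in> B"
  shows "(\<Prod>j\<in>B. f ((r(b := t)) j)) = (\<Prod>j\<in>B - {b}. f (r j)) * f t"
proof -
  have "(\<Prod>j\<in>B. f ((r(b := t)) j)) = f t * (\<Prod>j\<in>B - {b}. f ((r(b := t)) j))"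
    using assms by (subst prod.remove[OF assms]) simp
  also have "(\<Prod>j\<in>B - {b}. f ((r(b := t)) j)) = (\<Prod>j\<in>B - {b}. f (r j))"
    by (intro prod.cong) auto
  finally show ?thesis by (simp add: mult.commute)
qed

text \<open>In the variable \<open>r b\<close> the integrand is the cutoff times a derivative of a
  component of \<open>F\<close> along the line in direction \<open>y b\<close>, so Fubini reduces
  the claim to \<open>chi_by_parts\<close>. Reading off the component with \<open>R\<close> costs
  the factor \<open>1 / c\<close>.\<close>

lemma divergence_by_parts_component:
  fixes y :: "'a::euclidean_space \<Rightarrow> 'a"
  assumes c: "0 < c" and s: "0 < s" and F: "divergence_pair F G w"
    and [measurable]: "F \<in> borel_measurable borel"
    and R: "linear R" "\<And>v. norm (R v) \<le> norm v / c" and b: "b \<in> Basis"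
  shows "integrable (PiM Basis (\<lambda>_. lborel))
      (\<lambda>r. (\<Prod>j\<in>Basis. chi (r j / s)) * (R (G (x + (\<Sum>j\<in>Basis. r j *\<^sub>R y j)) (y b)) \<bullet> b))"
    and "ennreal \<bar>\<integral>r. (\<Prod>j\<in>Basis. chi (r j / s)) * (R (G (x + (\<Sum>j\<in>Basis. r j *\<^sub>R y j)) (y b)) \<bullet> b)
         \<partial>PiM Basis (\<lambda>_. lborel)\<bar>
    \<le> ennreal (2 / (s * c)) * (\<integral>\<^sup>+r. (\<Prod>j\<in>Basis. indicator {s..2 * s} (r j))
         * ennreal (norm (F (x + (\<Sum>j\<in>Basis. r j *\<^sub>R y j)))) \<partial>PiM Basis (\<lambda>_. lborel))"
proof -
  interpret P: product_sigma_finite "\<lambda>_. lborel :: real measure"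
    by (simp add: product_sigma_finite_def sigma_finite_lborel)
  let ?I = "Basis - {b}"
  have I: "finite ?I" "b \<notin> ?I" "insert b ?I = Basis" using b by auto
  have bl: "bounded_linear (\<lambda>v. R v \<bullet> b)"
    using R(1) by (intro bounded_linear_compose[OF bounded_linear_inner_left] linear_conv_bounded_linear[THEN iffD1])
  have Rb: "\<bar>R v \<bullet> b\<bar> \<le> norm v / c" for v
    using Basis_le_norm[OF b, of "R v"] R(2)[of v] by linarith
  obtain B where B: "\<And>z. norm (G z (y b)) \<le> B" and Gc: "continuous_on UNIV (\<lambda>z. G z (y b))"
    using F unfolding divergence_pair_def by blast
  define \<psi> where "\<psi> z = R (G z (y b)) \<bullet> b" for z
  define \<phi> where "\<phi> z = R (F z) \<bullet> b" for z
  have \<psi>c: "continuous_on UNIV \<psi>"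
    unfolding \<psi>_def by (rule continuous_on_compose2[OF linear_continuous_on[OF bl] Gc]) auto
  then have [measurable]: "\<psi> \<in> borel_measurable borel" by (rule borel_measurable_continuous_onI)
  have \<psi>B: "\<bar>\<psi> z\<bar> \<le> B / c" for z
    using Rb[of "G z (y b)"] divide_right_mono[OF B[of z], of c] c unfolding \<psi>_def by linarith
  have \<phi>B: "\<bar>\<phi> z\<bar> \<le> norm (F z) / c" for z
    unfolding \<phi>_def by (rule Rb)
  have d: "DERIV (\<lambda>t. \<phi> (z + t *\<^sub>R y b)) t :> \<psi> (z + t *\<^sub>R y b)" for z t
    unfolding \<phi>_def \<psi>_def has_real_derivative_iff_has_vector_derivative
    using F by (intro bounded_linear.has_vector_derivative[OF bl]) (simp add: divergence_pair_def)
  have cont: "isCont (\<lambda>t. \<psi> (z + t *\<^sub>R y b)) t" for z t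
  proof -
    have "continuous_on UNIV (\<lambda>t. \<psi> (z + t *\<^sub>R y b))"
      by (rule continuous_on_compose2[OF \<psi>c]) (auto intro!: continuous_intros)
    then show ?thesis by (simp add: continuous_on_eq_continuous_at)
  qed
  let ?u = "\<lambda>r. \<Sum>j\<in>Basis. r j *\<^sub>R y j" and ?v = "\<lambda>r. \<Sum>j\<in>?I. r j *\<^sub>R y j"
  have [measurable]: "?u \<in> borel_measurable (PiM Basis (\<lambda>_. lborel))"
    by (rule measurable_frame_sum)
  have "integrable (PiM Basis (\<lambda>_. lborel)) (\<lambda>r. (\<Prod>j\<in>Basis. chi (r j / s)) * \<psi> (x + ?u r))"
    using \<psi>B by (intro integrable_chi_prod s) auto
  then show int: "integrable (PiM Basis (\<lambda>_. lborel))
      (\<lambda>r. (\<Prod>j\<in>Basis. chi (r j / s)) * (R (G (x + ?u r) (y b)) \<bullet> b))"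
    by (simp add: \<psi>_def)
  have u: "?u (r(b := t)) = ?v r + t *\<^sub>R y b" for r t
  proof -
    have "?u (r(b := t)) = (\<Sum>j\<in>insert b ?I. (r(b := t)) j *\<^sub>R y j)" using I by simp
    also have "\<dots> = t *\<^sub>R y b + (\<Sum>j\<in>?I. (r(b := t)) j *\<^sub>R y j)"
      by (subst sum.insert[OF I(1,2)]) simp
    also have "(\<Sum>j\<in>?I. (r(b := t)) j *\<^sub>R y j) = ?v r" by (intro sum.cong) auto
    finally show ?thesis by (simp add: add.commute)
  qed
  let ?ind = "indicator {s..2 * s} :: real \<Rightarrow> ennreal"
  have "(\<integral>r. (\<Prod>j\<in>Basis. chi (r j / s)) * (R (G (x + ?u r) (y b)) \<bullet> b) \<partial>PiM (insert b ?I) (\<lambda>_. lborel))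
      = (\<integral>r. (\<integral>t. (\<Prod>j\<in>Basis. chi ((r(b := t)) j / s)) * (R (G (x + ?u (r(b := t))) (y b)) \<bullet> b) \<partial>lborel)
           \<partial>PiM ?I (\<lambda>_. lborel))"
    using int I(3) by (intro P.product_integral_insert I(1,2)) simp
  also have "\<dots> = (\<integral>r. (\<integral>t. (\<Prod>j\<in>?I. chi (r j / s)) * chi (t / s) * \<psi> ((x + ?v r) + t *\<^sub>R y b) \<partial>lborel)
           \<partial>PiM ?I (\<lambda>_. lborel))"
    unfolding prod_fun_upd[OF finite_Basis b, of "\<lambda>t. chi (t / s)"] u \<psi>_def by (simp add: add.assoc)
  finally have "ennreal \<bar>\<integral>r. (\<Prod>j\<in>Basis. chi (r j / s)) * (R (G (x + ?u r) (y b)) \<bullet> b) \<partial>PiM Basis (\<lambda>_. lborel)\<bar>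
      = ennreal \<bar>\<integral>r. (\<integral>t. (\<Prod>j\<in>?I. chi (r j / s)) * chi (t / s) * \<psi> ((x + ?v r) + t *\<^sub>R y b) \<partial>lborel)
           \<partial>PiM ?I (\<lambda>_. lborel)\<bar>"
    using I(3) by simp
  also have "\<dots> \<le> (\<integral>\<^sup>+r. ennreal \<bar>\<integral>t. (\<Prod>j\<in>?I. chi (r j / s)) * chi (t / s) * \<psi> ((x + ?v r) + t *\<^sub>R y b) \<partial>lborel\<bar>
           \<partial>PiM ?I (\<lambda>_. lborel))"
    by (rule ennreal_integral_le)
  also have "\<dots> \<le> (\<integral>\<^sup>+r. (\<integral>\<^sup>+t. ennreal (2 / (s * c)) * ((\<Prod>j\<in>Basis. ?ind ((r(b := t)) j))
         * ennreal (norm (F (x + ?u (r(b := t)))))) \<partial>lborel) \<partial>PiM ?I (\<lambda>_. lborel))"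
  proof (rule nn_integral_mono)
    fix r :: "'a \<Rightarrow> real"
    let ?z = "x + ?v r" and ?p = "\<Prod>j\<in>?I. chi (r j / s)"
    have chi: "ennreal (chi (t / s)) \<le> ?ind t" for t
      using ennreal_leI[OF chi_le_indicator[OF s, of t]] by (simp add: ennreal_indicator)
    have p: "0 \<le> ?p" by (intro prod_nonneg) (auto simp: chi_bounds)
    \<comment> \<open>Only the cutoff in \<open>r b\<close> is differentiated. The others are
      enlarged to indicators so that the majorant is the same for every \<open>b\<close>.\<close>
    have p': "ennreal ?p \<le> (\<Prod>j\<in>?I. ?ind (r j))"
    proof -
      have "?p \<le> (\<Prod>j\<in>?I. indicator {s..2 * s} (r j))"
        by (intro prod_mono) (simp add: chi_bounds chi_le_indicator s)
      then have "ennreal ?p \<le> ennreal (\<Prod>j\<in>?I. indicator {s..2 * s} (r j))" by (rule ennreal_leI)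
      also have "\<dots> = (\<Prod>j\<in>?I. ?ind (r j))"
        by (simp add: prod_ennreal[symmetric] ennreal_indicator)
      finally show ?thesis .
    qed
    have [measurable]: "(\<lambda>t. F (?z + t *\<^sub>R y b)) \<in> borel_measurable borel" by measurable
    have "ennreal \<bar>\<integral>t. ?p * chi (t / s) * \<psi> (?z + t *\<^sub>R y b) \<partial>lborel\<bar>
        = ennreal ?p * ennreal \<bar>\<integral>t. chi (t / s) * \<psi> (?z + t *\<^sub>R y b) \<partial>lborel\<bar>"
      using p by (simp add: mult.assoc abs_mult ennreal_mult')
    also have "\<dots> \<le> (\<Prod>j\<in>?I. ?ind (r j)) * (ennreal (2 / s) * (\<integral>\<^sup>+t. ?ind t * ennreal \<bar>\<phi> (?z + t *\<^sub>R y b)\<bar> \<partial>lborel))"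
      by (intro mult_mono p' chi_by_parts s d cont) auto
    also have "\<dots> \<le> (\<Prod>j\<in>?I. ?ind (r j)) * (ennreal (2 / s) * (\<integral>\<^sup>+t. ennreal (1 / c) * (?ind t * ennreal (norm (F (?z + t *\<^sub>R y b)))) \<partial>lborel))"
    proof (intro mult_left_mono nn_integral_mono)
      fix t
      have "ennreal \<bar>\<phi> (?z + t *\<^sub>R y b)\<bar> \<le> ennreal (1 / c * norm (F (?z + t *\<^sub>R y b)))"
        using \<phi>B by (intro ennreal_leI) simp
      also have "\<dots> = ennreal (1 / c) * ennreal (norm (F (?z + t *\<^sub>R y b)))"
        using c by (intro ennreal_mult') auto
      finally show "?ind t * ennreal \<bar>\<phi> (?z + t *\<^sub>R y b)\<bar> \<le> ennreal (1 / c) * (?ind t * ennreal (norm (F (?z + t *\<^sub>R y b))))"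
        by (cases "t \<in> {s..2 * s}") simp_all
    qed auto
    also have "\<dots> = ennreal (2 / (s * c)) * ((\<Prod>j\<in>?I. ?ind (r j)) * (\<integral>\<^sup>+t. ?ind t * ennreal (norm (F (?z + t *\<^sub>R y b))) \<partial>lborel))"
    proof -
      have e: "ennreal (2 / s) * ennreal (1 / c) = ennreal (2 / (s * c))"
        using c s by (subst ennreal_mult'[symmetric]) auto
      have "(\<integral>\<^sup>+t. ennreal (1 / c) * (?ind t * ennreal (norm (F (?z + t *\<^sub>R y b)))) \<partial>lborel)
          = ennreal (1 / c) * (\<integral>\<^sup>+t. ?ind t * ennreal (norm (F (?z + t *\<^sub>R y b))) \<partial>lborel)"
        by (intro nn_integral_cmult) simp
      then show ?thesis unfolding e[symmetric] by (simp only: mult_ac)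
    qed
    also have "\<dots> = (\<integral>\<^sup>+t. ennreal (2 / (s * c)) * ((\<Prod>j\<in>Basis. ?ind ((r(b := t)) j))
         * ennreal (norm (F (x + ?u (r(b := t)))))) \<partial>lborel)"
    proof -
      have "(\<integral>\<^sup>+t. ennreal (2 / (s * c)) * ((\<Prod>j\<in>Basis. ?ind ((r(b := t)) j))
         * ennreal (norm (F (x + ?u (r(b := t)))))) \<partial>lborel)
        = (\<integral>\<^sup>+t. ennreal (2 / (s * c)) * ((\<Prod>j\<in>?I. ?ind (r j)) * (?ind t * ennreal (norm (F (?z + t *\<^sub>R y b))))) \<partial>lborel)"
        unfolding prod_fun_upd[OF finite_Basis b, of ?ind] u by (simp add: add.assoc mult.assoc)
      also have "\<dots> = ennreal (2 / (s * c)) * ((\<Prod>j\<in>?I. ?ind (r j)) * (\<integral>\<^sup>+t. ?ind t * ennreal (norm (F (?z + t *\<^sub>R y b))) \<partial>lborel))"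
        by (subst nn_integral_cmult, simp, subst nn_integral_cmult, simp, simp)
      finally show ?thesis by simp
    qed
    finally show "ennreal \<bar>\<integral>t. ?p * chi (t / s) * \<psi> (?z + t *\<^sub>R y b) \<partial>lborel\<bar>
        \<le> (\<integral>\<^sup>+t. ennreal (2 / (s * c)) * ((\<Prod>j\<in>Basis. ?ind ((r(b := t)) j))
         * ennreal (norm (F (x + ?u (r(b := t)))))) \<partial>lborel)" .
  qed
  also have "\<dots> = (\<integral>\<^sup>+r. ennreal (2 / (s * c)) * ((\<Prod>j\<in>Basis. ?ind (r j)) * ennreal (norm (F (x + ?u r)))) \<partial>PiM (insert b ?I) (\<lambda>_. lborel))"
  proof (rule P.product_nn_integral_insert[OF I(1,2), symmetric])
    have [measurable]: "(\<lambda>r. \<Prod>j\<in>Basis. ?ind (r j)) \<in> borel_measurable (PiM Basis (\<lambda>_. lborel))"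
      by (rule measurable_frame_prod_ennreal) simp
    show "(\<lambda>r. ennreal (2 / (s * c)) * ((\<Prod>j\<in>Basis. ?ind (r j)) * ennreal (norm (F (x + ?u r)))))
        \<in> borel_measurable (PiM (insert b ?I) (\<lambda>_. lborel))"
      unfolding I(3) by measurable
  qed
  also have "\<dots> = ennreal (2 / (s * c)) * (\<integral>\<^sup>+r. (\<Prod>j\<in>Basis. ?ind (r j)) * ennreal (norm (F (x + ?u r))) \<partial>PiM Basis (\<lambda>_. lborel))"
  proof -
    have [measurable]: "(\<lambda>r. \<Prod>j\<in>Basis. ?ind (r j)) \<in> borel_measurable (PiM Basis (\<lambda>_. lborel))"
      by (rule measurable_frame_prod_ennreal) simp
    show ?thesis unfolding I(3) by (intro nn_integral_cmult) measurable
  qed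
  finally show "ennreal \<bar>\<integral>r. (\<Prod>j\<in>Basis. chi (r j / s)) * (R (G (x + ?u r) (y b)) \<bullet> b)
         \<partial>PiM Basis (\<lambda>_. lborel)\<bar>
    \<le> ennreal (2 / (s * c)) * (\<integral>\<^sup>+r. (\<Prod>j\<in>Basis. ?ind (r j)) * ennreal (norm (F (x + ?u r))) \<partial>PiM Basis (\<lambda>_. lborel))" .
qed

text \<open>The divergence is a trace and may be computed in the frame \<open>y\<close>: it is a sum
  of \<open>d\<close> derivatives, each along the direction of one jump. This is the reason for
  \<open>d\<close> jumps in independent directions.\<close>

lemma divergence_by_parts:
  fixes y :: "'a::euclidean_space \<Rightarrow> 'a"
  assumes c: "0 < c" and y: "frame c y" and s: "0 < s" and F: "divergence_pair F G w"
    and Fm: "F \<in> borel_measurable borel"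
  shows "ennreal \<bar>\<integral>r. (\<Prod>j\<in>Basis. chi (r j / s)) * w (x + (\<Sum>j\<in>Basis. r j *\<^sub>R y j)) \<partial>PiM Basis (\<lambda>_. lborel)\<bar>
    \<le> ennreal (2 * DIM('a) / (s * c)) * (\<integral>\<^sup>+r. (\<Prod>j\<in>Basis. indicator {s..2 * s} (r j))
         * ennreal (norm (F (x + (\<Sum>j\<in>Basis. r j *\<^sub>R y j)))) \<partial>PiM Basis (\<lambda>_. lborel))"
proof -
  let ?u = "\<lambda>r. \<Sum>j\<in>Basis. r j *\<^sub>R y j"
  let ?J = "\<integral>\<^sup>+r. (\<Prod>j\<in>Basis. indicator {s..2 * s} (r j)) * ennreal (norm (F (x + ?u r))) \<partial>PiM Basis (\<lambda>_. lborel)"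
  obtain R where R: "linear R" "\<And>v. norm (R v) \<le> norm v / c"
      and R': "\<And>u. (\<Sum>b\<in>Basis. (R u \<bullet> b) *\<^sub>R y b) = u"
      and "\<And>v. R (\<Sum>b\<in>Basis. (v \<bullet> b) *\<^sub>R y b) = v"
    by (rule frame_inverse[OF c y]) (rule that)
  let ?f = "\<lambda>b r. (\<Prod>j\<in>Basis. chi (r j / s)) * (R (G (x + ?u r) (y b)) \<bullet> b)"
  have "w z = (\<Sum>b\<in>Basis. R (G z (y b)) \<bullet> b)" for z
    using F R(1) R' by (simp add: divergence_pair_def)
  then have "(\<integral>r. (\<Prod>j\<in>Basis. chi (r j / s)) * w (x + ?u r) \<partial>PiM Basis (\<lambda>_. lborel))
      = (\<integral>r. (\<Sum>b\<in>Basis. ?f b r) \<partial>PiM Basis (\<lambda>_. lborel))"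
    by (simp add: sum_distrib_left)
  also have "\<dots> = (\<Sum>b\<in>Basis. \<integral>r. ?f b r \<partial>PiM Basis (\<lambda>_. lborel))"
    by (intro Bochner_Integration.integral_sum divergence_by_parts_component(1)[OF c s F Fm R])
  finally have "ennreal \<bar>\<integral>r. (\<Prod>j\<in>Basis. chi (r j / s)) * w (x + ?u r) \<partial>PiM Basis (\<lambda>_. lborel)\<bar>
      \<le> ennreal (\<Sum>b\<in>Basis. \<bar>\<integral>r. ?f b r \<partial>PiM Basis (\<lambda>_. lborel)\<bar>)"
    by (simp add: ennreal_leI sum_abs)
  also have "\<dots> = (\<Sum>b\<in>Basis. ennreal \<bar>\<integral>r. ?f b r \<partial>PiM Basis (\<lambda>_. lborel)\<bar>)"
    by (rule sum_ennreal[symmetric]) simp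
  also have "\<dots> \<le> (\<Sum>b\<in>(Basis::'a set). ennreal (2 / (s * c)) * ?J)"
    by (intro sum_mono divergence_by_parts_component(2)[OF c s F Fm R])
  also have "\<dots> = ennreal (2 * DIM('a) / (s * c)) * ?J"
  proof -
    have "of_nat (DIM('a)) * ennreal (2 / (s * c)) = ennreal (real (DIM('a)) * (2 / (s * c)))"
      using c s by (subst ennreal_mult') (auto simp: ennreal_of_nat_eq_real_of_nat)
    then show ?thesis by (simp add: mult.assoc[symmetric] mult.commute)
  qed
  finally show ?thesis .
qed

declare measurable_frame_sum [measurable del] measurable_frame_prod [measurable del]
  measurable_frame_prod_ennreal [measurable del]

lemma measurable_frame_pair:
  fixes \<Sigma> :: "'i \<Rightarrow> 'a::euclidean_space measure" and \<omega> :: "real \<Rightarrow> real" and \<omega>' :: "real \<Rightarrow> ennreal"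
  assumes "\<And>i. sets (\<Sigma> i) = sets borel"
  shows "(\<lambda>(y, r). \<Sum>i\<in>I. r i *\<^sub>R y i) \<in> borel_measurable (PiM I \<Sigma> \<Otimes>\<^sub>M PiM I (\<lambda>_. lborel))"
    and "\<omega> \<in> borel_measurable borel \<Longrightarrow>
      (\<lambda>(y, r). \<Prod>i\<in>I. \<omega> (r i)) \<in> borel_measurable (PiM I \<Sigma> \<Otimes>\<^sub>M PiM I (\<lambda>_. lborel))"
    and "\<omega>' \<in> borel_measurable borel \<Longrightarrow>
      (\<lambda>(y, r). \<Prod>i\<in>I. \<omega>' (r i)) \<in> borel_measurable (PiM I \<Sigma> \<Otimes>\<^sub>M PiM I (\<lambda>_. lborel))"
proof -
  let ?N = "PiM I \<Sigma> \<Otimes>\<^sub>M PiM I (\<lambda>_. lborel :: real measure)"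
  have y: "(\<lambda>z. fst z i) \<in> borel_measurable ?N" if "i \<in> I" for i
  proof -
    have "(\<lambda>z. fst z i) \<in> measurable ?N (\<Sigma> i)"
      by (rule measurable_compose[OF measurable_fst measurable_component_singleton[OF that]])
    then show ?thesis using measurable_cong_sets[OF refl assms(1)] by blast
  qed
  have r: "(\<lambda>z. snd z i) \<in> borel_measurable ?N" if "i \<in> I" for i
  proof -
    have "(\<lambda>z. snd z i) \<in> measurable ?N lborel"
      by (rule measurable_compose[OF measurable_snd measurable_component_singleton[OF that]])
    then show ?thesis by simp
  qed
  show "(\<lambda>(y, r). \<Sum>i\<in>I. r i *\<^sub>R y i) \<in> borel_measurable ?N"
    unfolding case_prod_beta' by (intro borel_measurable_sum borel_measurable_scaleR y r)
  show "(\<lambda>(y, r). \<Prod>i\<in>I. \<omega> (r i)) \<in> borel_measurable ?N" if "\<omega> \<in> borel_measurable borel"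
    unfolding case_prod_beta' using that by (intro borel_measurable_prod measurable_compose[OF r]) auto
  show "(\<lambda>(y, r). \<Prod>i\<in>I. \<omega>' (r i)) \<in> borel_measurable ?N" if "\<omega>' \<in> borel_measurable borel"
    unfolding case_prod_beta' using that by (intro borel_measurable_prod_ennreal measurable_compose[OF r]) auto
qed

text \<open>Almost every choice of directions lies in the sets \<open>C b\<close> and is a frame
  with the same \<open>c\<close>, so the bound for frozen directions can be integrated.\<close>

lemma act_frame_law_divergence:
  fixes \<Sigma> :: "'a \<Rightarrow> 'a::euclidean_space measure"
  assumes fin: "\<And>i. finite_borel (\<Sigma> i)"
    and C: "\<And>b. b \<in> Basis \<Longrightarrow> C b \<in> sets borel" "\<And>b. b \<in> Basis \<Longrightarrow> emeasure (\<Sigma> b) (- C b) = 0"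
    and c: "0 < c" and fr: "\<And>y. (\<And>b. b \<in> Basis \<Longrightarrow> y b \<in> C b) \<Longrightarrow> frame c y"
    and s: "0 < s" and F: "divergence_pair F G w" and Fm [measurable]: "F \<in> borel_measurable borel"
    and w: "bounded_borel w"
    and J: "finite_borel (frame_law \<Sigma> (\<lambda>t. ennreal (chi (t / s))) Basis)"
  shows "ennreal \<bar>act (frame_law \<Sigma> (\<lambda>t. ennreal (chi (t / s))) Basis) w x\<bar>
    \<le> ennreal (2 * DIM('a) / (s * c))
       * nact (frame_law \<Sigma> (indicator {s..2 * s}) Basis) (\<lambda>x. ennreal (norm (F x))) x"
proof -
  let ?\<omega> = "\<lambda>t. ennreal (chi (t / s))" and ?L = "PiM Basis (\<lambda>_. lborel :: real measure) :: ('a \<Rightarrow> real) measure"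
  let ?J = "frame_law \<Sigma> ?\<omega> Basis"
  interpret S: product_sigma_finite \<Sigma> by (rule product_sigma_finite_frame[OF fin borel_measurable_const])
  interpret PS: sigma_finite_measure "PiM Basis \<Sigma>" by (rule S.sigma_finite) simp
  interpret L: sigma_finite_measure ?L by (rule sigma_finite_PiM_lborel) simp
  interpret SL: pair_sigma_finite "PiM Basis \<Sigma>" ?L ..
  have [measurable_cong]: "sets (\<Sigma> i) = sets borel" for i using fin[of i] by (simp add: finite_borel_def)
  have wm [measurable]: "w \<in> borel_measurable borel" by (rule bounded_borel_measurable[OF w])
  let ?N = "PiM Basis \<Sigma> \<Otimes>\<^sub>M ?L"
  let ?u = "\<lambda>(y, r). \<Sum>i\<in>Basis. r i *\<^sub>R (y i :: 'a)"
  have um [measurable]: "?u \<in> borel_measurable ?N"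
    using fin by (intro measurable_frame_pair(1)) (simp add: finite_borel_def)
  have pm [measurable]: "(\<lambda>(y, r). \<Prod>b\<in>Basis. chi (r b / s)) \<in> borel_measurable ?N"
    using fin by (intro measurable_frame_pair(2)) (simp_all add: finite_borel_def)
  have J_eq: "?J = distr (density ?N (\<lambda>z. ennreal (case z of (y, r) \<Rightarrow> \<Prod>b\<in>Basis. chi (r b / s)))) borel ?u"
    unfolding frame_law_def by (simp add: case_prod_beta' prod_ennreal chi_bounds)
  have int: "integrable ?J (\<lambda>u. w (x + u))"
    by (rule bounded_borel_integrable[OF J bounded_borel_translate[OF w]])
  let ?f = "\<lambda>z. (case z of (y, r) \<Rightarrow> \<Prod>b\<in>Basis. chi (r b / s)) *\<^sub>R w (x + ?u z)"
  have nn: "AE z in ?N. 0 \<le> (case z of (y, r) \<Rightarrow> \<Prod>b\<in>Basis. chi (r b / s))"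
    by (auto intro!: prod_nonneg simp: chi_bounds)
  let ?p = "\<lambda>z. case z of (y, r) \<Rightarrow> \<Prod>b\<in>Basis. chi (r b / s)"
  have wx: "(\<lambda>u. w (x + u)) \<in> borel_measurable borel" by measurable
  have wu: "(\<lambda>z. w (x + ?u z)) \<in> borel_measurable ?N"
    by (rule measurable_compose[OF um wx])
  have um': "?u \<in> measurable (density ?N (\<lambda>z. ennreal (?p z))) borel"
    using um by simp
  have int': "integrable ?N ?f"
    using int unfolding J_eq integrable_distr_eq[OF um' wx] integrable_density[OF wu pm nn] .
  have "act ?J w x = (\<integral>z. ?f z \<partial>?N)"
    unfolding act_def J_eq integral_distr[OF um' wx] integral_density[OF wu pm nn] ..
  also have "\<dots> = (\<integral>y. (\<integral>r. (\<Prod>b\<in>Basis. chi (r b / s)) * w (x + (\<Sum>b\<in>Basis. r b *\<^sub>R y b)) \<partial>?L) \<partial>PiM Basis \<Sigma>)"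
    using SL.integral_fst'[OF int'] by simp
  finally have "ennreal \<bar>act ?J w x\<bar>
      \<le> (\<integral>\<^sup>+y. ennreal \<bar>\<integral>r. (\<Prod>b\<in>Basis. chi (r b / s)) * w (x + (\<Sum>b\<in>Basis. r b *\<^sub>R y b)) \<partial>?L\<bar> \<partial>PiM Basis \<Sigma>)"
    by (simp only: ennreal_integral_le)
  also have "\<dots> \<le> (\<integral>\<^sup>+y. ennreal (2 * DIM('a) / (s * c)) * (\<integral>\<^sup>+r. (\<Prod>b\<in>Basis. indicator {s..2 * s} (r b))
      * ennreal (norm (F (x + (\<Sum>b\<in>Basis. r b *\<^sub>R y b)))) \<partial>?L) \<partial>PiM Basis \<Sigma>)"
  proof (rule nn_integral_mono_AE)
    have "AE y in PiM Basis \<Sigma>. \<forall>b\<in>Basis. y b \<in> C b"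
      by (rule AE_PiM_finite_measure[OF fin finite_Basis C])
    then show "AE y in PiM Basis \<Sigma>.
        ennreal \<bar>\<integral>r. (\<Prod>b\<in>Basis. chi (r b / s)) * w (x + (\<Sum>b\<in>Basis. r b *\<^sub>R y b)) \<partial>?L\<bar>
        \<le> ennreal (2 * DIM('a) / (s * c)) * (\<integral>\<^sup>+r. (\<Prod>b\<in>Basis. indicator {s..2 * s} (r b))
          * ennreal (norm (F (x + (\<Sum>b\<in>Basis. r b *\<^sub>R y b)))) \<partial>?L)"
      by eventually_elim (rule divergence_by_parts[OF c fr s F Fm], simp)
  qed
  also have "\<dots> = ennreal (2 * DIM('a) / (s * c)) * (\<integral>\<^sup>+y. (\<integral>\<^sup>+r. (\<Prod>b\<in>Basis. indicator {s..2 * s} (r b))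
      * ennreal (norm (F (x + (\<Sum>b\<in>Basis. r b *\<^sub>R y b)))) \<partial>?L) \<partial>PiM Basis \<Sigma>)"
  proof (rule nn_integral_cmult)
    have "(\<lambda>(y, r). \<Prod>b\<in>Basis. indicator {s..2 * s} (r b) :: ennreal) \<in> borel_measurable ?N"
      using fin by (intro measurable_frame_pair(3)) (simp_all add: finite_borel_def)
    moreover have "(\<lambda>u. ennreal (norm (F (x + u)))) \<in> borel_measurable borel" by measurable
    ultimately have "(\<lambda>z. (case z of (y, r) \<Rightarrow> \<Prod>b\<in>Basis. indicator {s..2 * s} (r b))
        * ennreal (norm (F (x + ?u z)))) \<in> borel_measurable ?N"
      by (intro borel_measurable_times_ennreal measurable_compose[OF um])
    from L.borel_measurable_nn_integral_fst[OF this]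
    show "(\<lambda>y. \<integral>\<^sup>+r. (\<Prod>b\<in>Basis. indicator {s..2 * s} (r b))
      * ennreal (norm (F (x + (\<Sum>b\<in>Basis. r b *\<^sub>R y b)))) \<partial>?L) \<in> borel_measurable (PiM Basis \<Sigma>)"
      by simp
  qed
  also have "(\<integral>\<^sup>+y. (\<integral>\<^sup>+r. (\<Prod>b\<in>Basis. indicator {s..2 * s} (r b))
      * ennreal (norm (F (x + (\<Sum>b\<in>Basis. r b *\<^sub>R y b)))) \<partial>?L) \<partial>PiM Basis \<Sigma>)
      = nact (frame_law \<Sigma> (indicator {s..2 * s}) Basis) (\<lambda>x. ennreal (norm (F x))) x"
    unfolding nact_def by (rule nn_integral_frame_law[OF fin, symmetric]) auto
  finally show ?thesis .
qed

section \<open>Polar measures\<close>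

text \<open>The weight may depend on the direction as well as on the radius; this covers
  restrictions to a cap.\<close>

definition polar_law :: "'a::euclidean_space measure \<Rightarrow> ('a \<Rightarrow> real \<Rightarrow> ennreal) \<Rightarrow> 'a measure" where
  "polar_law S w = distr (density (S \<Otimes>\<^sub>M lborel) (\<lambda>(y, r). w y r)) borel (\<lambda>(y, r). r *\<^sub>R y)"

lemma nn_integral_polar_law:
  assumes S: "finite_borel S" and w: "(\<lambda>(y, r). w y r) \<in> borel_measurable (borel \<Otimes>\<^sub>M borel)"
    and g [measurable]: "g \<in> borel_measurable borel"
  shows "(\<integral>\<^sup>+u. g u \<partial>polar_law S w) = (\<integral>\<^sup>+y. (\<integral>\<^sup>+r. w y r * g (r *\<^sub>R y) \<partial>lborel) \<partial>S)"
proof -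
  interpret finite_measure S using S by (simp add: finite_borel_def)
  have SL: "sets (S \<Otimes>\<^sub>M (lborel :: real measure)) = sets (borel \<Otimes>\<^sub>M borel)"
    using S by (intro sets_pair_measure_cong) (auto simp: finite_borel_def)
  have mc: "f \<in> measurable (S \<Otimes>\<^sub>M (lborel :: real measure)) N \<longleftrightarrow> f \<in> measurable (borel \<Otimes>\<^sub>M borel) N" for f and N :: "'z measure"
    by (simp only: measurable_cong_sets[OF SL refl])
  have 1: "(\<lambda>(y, r). r *\<^sub>R y) \<in> borel_measurable (S \<Otimes>\<^sub>M lborel)"
    unfolding mc by measurable
  have w': "(\<lambda>(y, r). w y r) \<in> borel_measurable (S \<Otimes>\<^sub>M lborel)"
    unfolding mc by (rule w)
  have g': "(\<lambda>z. g (case z of (y, r) \<Rightarrow> r *\<^sub>R y)) \<in> borel_measurable (S \<Otimes>\<^sub>M lborel)"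
    unfolding mc by measurable
  have "(\<integral>\<^sup>+u. g u \<partial>polar_law S w)
      = (\<integral>\<^sup>+z. (case z of (y, r) \<Rightarrow> w y r) * g (case z of (y, r) \<Rightarrow> r *\<^sub>R y) \<partial>(S \<Otimes>\<^sub>M lborel))"
    unfolding polar_law_def using 1 w' g'
    by (subst nn_integral_distr) (auto simp: nn_integral_density)
  also have "\<dots> = (\<integral>\<^sup>+y. (\<integral>\<^sup>+r. w y r * g (r *\<^sub>R y) \<partial>lborel) \<partial>S)"
    using lborel.nn_integral_fst[OF borel_measurable_times_ennreal[OF w' g']] by simp
  finally show ?thesis .
qed

lemma finite_borel_polar_law:
  assumes S: "finite_borel S" and w: "(\<lambda>(y, r). w y r) \<in> borel_measurable (borel \<Otimes>\<^sub>M borel)"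
    and fin: "(\<integral>\<^sup>+y. (\<integral>\<^sup>+r. w y r \<partial>lborel) \<partial>S) < \<infinity>"
  shows "finite_borel (polar_law S w)"
    "emeasure (polar_law S w) UNIV = (\<integral>\<^sup>+y. (\<integral>\<^sup>+r. w y r \<partial>lborel) \<partial>S)"
proof -
  have "emeasure (polar_law S w) UNIV = (\<integral>\<^sup>+u. 1 \<partial>polar_law S w)"
    by (simp add: polar_law_def)
  also have "\<dots> = (\<integral>\<^sup>+y. (\<integral>\<^sup>+r. w y r \<partial>lborel) \<partial>S)"
    using nn_integral_polar_law[OF S w, of "\<lambda>_. 1"] by simp
  finally show eq: "emeasure (polar_law S w) UNIV = (\<integral>\<^sup>+y. (\<integral>\<^sup>+r. w y r \<partial>lborel) \<partial>S)" .
  show "finite_borel (polar_law S w)"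
    using fin eq unfolding finite_borel_def by (auto simp: polar_law_def intro!: finite_measureI)
qed

lemma splits_polar_law:
  assumes S: "finite_borel S" and w: "(\<lambda>(y, r). w y r) \<in> borel_measurable (borel \<Otimes>\<^sub>M borel)"
    and v: "(\<lambda>(y, r). v y r) \<in> borel_measurable (borel \<Otimes>\<^sub>M borel)"
    and le: "\<And>y r. v y r \<le> w y r"
    and fin: "(\<integral>\<^sup>+y. (\<integral>\<^sup>+r. w y r \<partial>lborel) \<partial>S) < \<infinity>"
  shows "splits (polar_law S w) (polar_law S v) (polar_law S (\<lambda>y r. w y r - v y r))"
proof -
  let ?d = "\<lambda>y r. w y r - v y r"
  have d: "(\<lambda>(y, r). ?d y r) \<in> borel_measurable (borel \<Otimes>\<^sub>M borel)"
    using borel_measurable_minus_ennreal[OF w v] by (simp add: case_prod_beta')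
  have mono: "(\<integral>\<^sup>+y. (\<integral>\<^sup>+r. f y r \<partial>lborel) \<partial>S) < \<infinity>" if "\<And>y r. f y r \<le> w y r" for f
    using that fin by (intro order.strict_trans1[OF nn_integral_mono fin] nn_integral_mono) auto
  have fb: "finite_borel (polar_law S w)" "finite_borel (polar_law S v)" "finite_borel (polar_law S ?d)"
    using S w v d le by (auto intro!: finite_borel_polar_law mono diff_le_self_ennreal)
  have sl: "f \<in> borel_measurable (borel \<Otimes>\<^sub>M borel) \<Longrightarrow> f \<in> borel_measurable (S \<Otimes>\<^sub>M lborel)" for f :: "'a \<times> real \<Rightarrow> ennreal"
    using S by (subst measurable_cong_sets[OF sets_pair_measure_cong[OF _ sets_lborel] refl]) (auto simp: finite_borel_def)
  have "(\<integral>\<^sup>+u. g u \<partial>polar_law S w) = (\<integral>\<^sup>+u. g u \<partial>polar_law S v) + (\<integral>\<^sup>+u. g u \<partial>polar_law S ?d)"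
    if g [measurable]: "g \<in> borel_measurable borel" for g
  proof -
    have gm: "(\<lambda>(y::'a, r). g (r *\<^sub>R y)) \<in> borel_measurable (borel \<Otimes>\<^sub>M borel)" by measurable
    have vg: "(\<lambda>(y, r). v y r * g (r *\<^sub>R y)) \<in> borel_measurable (S \<Otimes>\<^sub>M lborel)"
      using borel_measurable_times_ennreal[OF v gm] by (intro sl) (simp add: case_prod_beta')
    have dg: "(\<lambda>(y, r). ?d y r * g (r *\<^sub>R y)) \<in> borel_measurable (S \<Otimes>\<^sub>M lborel)"
      using borel_measurable_times_ennreal[OF d gm] by (intro sl) (simp add: case_prod_beta')
    note [measurable] = vg dg
    have "w y r * g (r *\<^sub>R y) = v y r * g (r *\<^sub>R y) + ?d y r * g (r *\<^sub>R y)" for y r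
      using le[of y r] by (simp add: distrib_right[symmetric] add_diff_inverse_ennreal)
    then have "(\<integral>\<^sup>+u. g u \<partial>polar_law S w)
        = (\<integral>\<^sup>+y. (\<integral>\<^sup>+r. v y r * g (r *\<^sub>R y) + ?d y r * g (r *\<^sub>R y) \<partial>lborel) \<partial>S)"
      by (simp add: nn_integral_polar_law[OF S w g])
    also have "\<dots> = (\<integral>\<^sup>+y. (\<integral>\<^sup>+r. v y r * g (r *\<^sub>R y) \<partial>lborel) + (\<integral>\<^sup>+r. ?d y r * g (r *\<^sub>R y) \<partial>lborel) \<partial>S)"
    proof (rule nn_integral_cong)
      fix y assume "y \<in> space S"
      then show "(\<integral>\<^sup>+r. v y r * g (r *\<^sub>R y) + ?d y r * g (r *\<^sub>R y) \<partial>lborel)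
          = (\<integral>\<^sup>+r. v y r * g (r *\<^sub>R y) \<partial>lborel) + (\<integral>\<^sup>+r. ?d y r * g (r *\<^sub>R y) \<partial>lborel)"
        using measurable_Pair2[OF vg] measurable_Pair2[OF dg] by (intro nn_integral_add) auto
    qed
    also have "\<dots> = (\<integral>\<^sup>+y. (\<integral>\<^sup>+r. v y r * g (r *\<^sub>R y) \<partial>lborel) \<partial>S) + (\<integral>\<^sup>+y. (\<integral>\<^sup>+r. ?d y r * g (r *\<^sub>R y) \<partial>lborel) \<partial>S)"
      using lborel.borel_measurable_nn_integral_fst[OF vg] lborel.borel_measurable_nn_integral_fst[OF dg]
      by (intro nn_integral_add) auto
    also have "\<dots> = (\<integral>\<^sup>+u. g u \<partial>polar_law S v) + (\<integral>\<^sup>+u. g u \<partial>polar_law S ?d)"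
      by (simp add: nn_integral_polar_law[OF S v g] nn_integral_polar_law[OF S d g])
    finally show ?thesis .
  qed
  with fb show ?thesis by (auto simp: splits_def)
qed

section \<open>Radial integrals of powers and of the cutoff\<close>

lemma nn_integral_powr_tail:
  fixes \<alpha> \<epsilon> :: real assumes "0 < \<alpha>" "0 < \<epsilon>"
  shows "(\<integral>\<^sup>+r. ennreal (r powr (- 1 - \<alpha>)) * indicator {\<epsilon><..} r \<partial>lborel) = ennreal (\<epsilon> powr - \<alpha> / \<alpha>)"
proof -
  have "(\<integral>\<^sup>+r. ennreal (r powr (- 1 - \<alpha>)) * indicator {\<epsilon><..} r \<partial>lborel)
      = (\<integral>\<^sup>+r. ennreal (r powr (- 1 - \<alpha>)) * indicator {\<epsilon>..} r \<partial>lborel)"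
  proof (rule nn_integral_cong_AE)
    show "AE r in lborel. ennreal (r powr (- 1 - \<alpha>)) * indicator {\<epsilon><..} r
        = ennreal (r powr (- 1 - \<alpha>)) * indicator {\<epsilon>..} r"
      using AE_lborel_singleton[of \<epsilon>] by eventually_elim (auto simp: indicator_def)
  qed
  also have "\<dots> = ennreal (0 - (- (\<epsilon> powr - \<alpha> / \<alpha>)))"
  proof (rule nn_integral_FTC_atLeast)
    show "(\<lambda>r. r powr (- 1 - \<alpha>)) \<in> borel_measurable borel" by measurable
    show "DERIV (\<lambda>r. - (r powr - \<alpha> / \<alpha>)) x :> x powr (- 1 - \<alpha>)" if "\<epsilon> \<le> x" for x
    proof -
      have x: "0 < x" using that assms by simp
      have "DERIV (\<lambda>r. r powr - \<alpha>) x :> - \<alpha> * x powr (- \<alpha> - 1)"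
        using x by (rule has_real_derivative_powr)
      then have "DERIV (\<lambda>r. r powr - \<alpha> / \<alpha>) x :> (- \<alpha> * x powr (- \<alpha> - 1)) / \<alpha>"
        by (rule DERIV_cdivide)
      then have "DERIV (\<lambda>r. - (r powr - \<alpha> / \<alpha>)) x :> - ((- \<alpha> * x powr (- \<alpha> - 1)) / \<alpha>)"
        by (rule DERIV_minus)
      moreover have "- ((- \<alpha> * x powr (- \<alpha> - 1)) / \<alpha>) = x powr (- 1 - \<alpha>)"
        using assms by (simp add: minus_diff_commute[symmetric] algebra_simps)
      ultimately show ?thesis by simp
    qed
    show "0 \<le> x powr (- 1 - \<alpha>)" for x by simp
    have "((\<lambda>r. r powr - \<alpha>) \<longlongrightarrow> 0) at_top"
      using assms by (intro tendsto_neg_powr filterlim_ident) auto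
    then have "((\<lambda>r. - (r powr - \<alpha> / \<alpha>)) \<longlongrightarrow> - (0 / \<alpha>)) at_top"
      using assms by (intro tendsto_intros) auto
    then show "((\<lambda>r. - (r powr - \<alpha> / \<alpha>)) \<longlongrightarrow> 0) at_top" by simp
  qed
  finally show ?thesis by simp
qed

lemma nn_integral_chi:
  assumes s: "0 < s"
  shows "(\<integral>\<^sup>+r. ennreal (chi (r / s)) \<partial>lborel) \<le> ennreal s"
    and "ennreal (9 / 512 * s) \<le> (\<integral>\<^sup>+r. ennreal (chi (r / s)) \<partial>lborel)"
proof -
  have "(\<integral>\<^sup>+r. ennreal (chi (r / s)) \<partial>lborel) \<le> (\<integral>\<^sup>+r. indicator {s..2 * s} r \<partial>lborel)"
    using ennreal_leI[OF chi_le_indicator[OF s]] by (intro nn_integral_mono) (simp add: ennreal_indicator)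
  also have "\<dots> = ennreal s" using s by simp
  finally show "(\<integral>\<^sup>+r. ennreal (chi (r / s)) \<partial>lborel) \<le> ennreal s" .
  \<comment> \<open>On the middle half of the interval, of length \<open>s / 2\<close>, the product
    \<open>(u - 1) * (2 - u)\<close> is at least \<open>3 / 16\<close>, so the cutoff is at least
    \<open>9 / 256\<close>.\<close>
  have "ennreal (9 / 512 * s) = (\<integral>\<^sup>+r. ennreal (9 / 256) * indicator {5 / 4 * s..7 / 4 * s} r \<partial>lborel)"
    using s by (simp add: nn_integral_cmult_indicator ennreal_mult'[symmetric])
  also have "\<dots> \<le> (\<integral>\<^sup>+r. ennreal (chi (r / s)) \<partial>lborel)"
  proof (rule nn_integral_mono)
    fix r
    show "ennreal (9 / 256) * indicator {5 / 4 * s..7 / 4 * s} r \<le> ennreal (chi (r / s))"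
    proof (cases "r \<in> {5 / 4 * s..7 / 4 * s}")
      case True
      define u where "u = r / s"
      have u: "5 / 4 \<le> u" "u \<le> 7 / 4" using True s by (auto simp: u_def le_divide_eq divide_le_eq)
      have "0 \<le> (u - 5 / 4) * (7 / 4 - u)" using u by (intro mult_nonneg_nonneg) auto
      then have "3 / 16 \<le> (u - 1) * (2 - u)" by (simp add: algebra_simps)
      then have "(3 / 16)\<^sup>2 \<le> ((u - 1) * (2 - u))\<^sup>2" by (rule power_mono) simp
      then have "9 / 256 \<le> chi u" using u by (simp add: chi_def power2_eq_square)
      then show ?thesis using True by (simp add: u_def ennreal_leI)
    qed simp
  qed
  finally show "ennreal (9 / 512 * s) \<le> (\<integral>\<^sup>+r. ennreal (chi (r / s)) \<partial>lborel)" .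
qed

text \<open>The \<open>C b\<close> are the caps of directions. \<open>S\<close> and not \<open>\<sigma>\<close> is used because \<open>S\<close> has the whole space as
  carrier.\<close>

locale polar_frame =
  fixes S :: "'a::euclidean_space measure" and \<alpha> c :: real and C :: "'a \<Rightarrow> 'a set"
  assumes S: "finite_borel S" and \<alpha>: "1 < \<alpha>" "\<alpha> < 2"
    and C: "\<And>b. C b \<in> sets borel" "\<And>b. b \<in> Basis \<Longrightarrow> 0 < emeasure S (C b)"
    and c: "0 < c" and fr: "\<And>y. (\<And>b. b \<in> Basis \<Longrightarrow> y b \<in> C b) \<Longrightarrow> frame c y"
begin

section \<open>Jump law, caps of directions and their masses\<close>

definition mass :: real where "mass = measure S UNIV"

definition rate :: "real \<Rightarrow> real" where "rate \<epsilon> = mass * \<epsilon> powr - \<alpha> / \<alpha>"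

definition jump_weight :: "real \<Rightarrow> 'a \<Rightarrow> real \<Rightarrow> ennreal" where
  "jump_weight \<epsilon> y r = ennreal (1 / rate \<epsilon>) * (ennreal (r powr (- 1 - \<alpha>)) * indicator {\<epsilon><..} r)"

text \<open>The true radial density is replaced by the constant
  \<open>s powr (- 1 - \<alpha>)\<close> times a fixed profile of \<open>r / s\<close>, since the
  profile is what will be differentiated.\<close>

definition cap_weight :: "real \<Rightarrow> real \<Rightarrow> 'a \<Rightarrow> 'a \<Rightarrow> real \<Rightarrow> ennreal" where
  "cap_weight \<epsilon> s b y r =
     indicator (C b) y * ennreal (s powr (- 1 - \<alpha>) / rate \<epsilon>) * ennreal (chi (r / s))"

definition jump_law :: "real \<Rightarrow> 'a measure" where
  "jump_law \<epsilon> = polar_law S (jump_weight \<epsilon>)"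

definition cap_law :: "real \<Rightarrow> real \<Rightarrow> 'a \<Rightarrow> 'a measure" where
  "cap_law \<epsilon> s b = polar_law S (cap_weight \<epsilon> s b)"

text \<open>No jump weight is lost in the truncated subtraction: \<open>cap_weight \<epsilon> s b\<close> is at most \<open>jump_weight \<epsilon>\<close>
  when \<open>\<epsilon> \<le> s\<close>.\<close>

definition rest_law :: "real \<Rightarrow> real \<Rightarrow> 'a \<Rightarrow> 'a measure" where
  "rest_law \<epsilon> s b = polar_law S (\<lambda>y r. jump_weight \<epsilon> y r - cap_weight \<epsilon> s b y r)"

text \<open>The constant factor of \<open>cap_weight\<close> is absorbed here, leaving
  \<open>chi (t / s)\<close> as the sole length weight. This is the product form that
  \<open>frame_law\<close> expects.\<close>

definition directions :: "real \<Rightarrow> real \<Rightarrow> 'a \<Rightarrow> 'a measure" where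
  "directions \<epsilon> s b = density S (\<lambda>y. indicator (C b) y * ennreal (s powr (- 1 - \<alpha>) / rate \<epsilon>))"

lemma sets_S [measurable_cong]: "sets S = sets borel"
  using S by (simp add: finite_borel_def)

lemma measurable_S: "f \<in> borel_measurable borel \<Longrightarrow> f \<in> borel_measurable S"
  using measurable_cong_sets[OF sets_S refl] by blast

lemma space_S: "space S = UNIV"
  using sets_eq_imp_space_eq[OF sets_S] by simp

lemma emeasure_S: "emeasure S A = ennreal (measure S A)"
  using S by (simp add: finite_borel_def finite_measure.emeasure_eq_measure)

lemma measure_S_le: "measure S A \<le> mass"
proof (cases "A \<in> sets S")
  case True
  then show ?thesis
    using finite_measure.finite_measure_mono[of S A UNIV] S sets_S space_S
    by (auto simp: mass_def finite_borel_def)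
qed (simp add: measure_notin_sets mass_def)

lemma cap_pos: "b \<in> Basis \<Longrightarrow> 0 < measure S (C b)"
  using C(2)[of b] by (simp add: emeasure_S)

lemma mass_pos: "0 < mass"
proof -
  obtain b :: 'a where "b \<in> Basis" using nonempty_Basis by blast
  then show ?thesis using cap_pos[of b] measure_S_le[of "C b"] by linarith
qed

lemma rate_pos: "0 < \<epsilon> \<Longrightarrow> 0 < rate \<epsilon>"
  using mass_pos \<alpha> by (simp add: rate_def)

lemma jump_weight_measurable: "(\<lambda>(y, r). jump_weight \<epsilon> y r) \<in> borel_measurable (borel \<Otimes>\<^sub>M borel)"
  unfolding jump_weight_def by measurable

lemma cap_weight_measurable: "(\<lambda>(y, r). cap_weight \<epsilon> s b y r) \<in> borel_measurable (borel \<Otimes>\<^sub>M borel)"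
proof -
  note [measurable] = C(1)[of b]
  show ?thesis unfolding cap_weight_def by measurable
qed

lemma jump_mass:
  assumes "0 < \<epsilon>"
  shows "(\<integral>\<^sup>+y. (\<integral>\<^sup>+r. jump_weight \<epsilon> y r \<partial>lborel) \<partial>S) = 1"
proof -
  have "1 / rate \<epsilon> * (\<epsilon> powr - \<alpha> / \<alpha>) = 1 / mass"
    using assms \<alpha> by (simp add: rate_def)
  then have e: "ennreal (1 / rate \<epsilon>) * ennreal (\<epsilon> powr - \<alpha> / \<alpha>) = ennreal (1 / mass)"
    using rate_pos[OF assms] by (subst ennreal_mult'[symmetric]) auto
  have "(\<integral>\<^sup>+r. jump_weight \<epsilon> y r \<partial>lborel) = ennreal (1 / mass)" for y
    unfolding jump_weight_def e[symmetric] using assms \<alpha>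
    by (subst nn_integral_cmult) (auto simp: nn_integral_powr_tail)
  then have "(\<integral>\<^sup>+y. (\<integral>\<^sup>+r. jump_weight \<epsilon> y r \<partial>lborel) \<partial>S) = ennreal (1 / mass) * emeasure S UNIV"
    by (simp add: space_S)
  also have "\<dots> = ennreal (1 / mass) * ennreal mass"
    unfolding emeasure_S mass_def ..
  also have "\<dots> = 1"
    using mass_pos by (simp add: ennreal_mult'[symmetric])
  finally show ?thesis .
qed

lemma finite_borel_jump_law: "0 < \<epsilon> \<Longrightarrow> finite_borel (jump_law \<epsilon>)"
  and emeasure_jump_law: "0 < \<epsilon> \<Longrightarrow> emeasure (jump_law \<epsilon>) UNIV = 1"
  using finite_borel_polar_law[OF S jump_weight_measurable, of \<epsilon>] jump_mass[of \<epsilon>]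
  by (auto simp: jump_law_def)

lemma cap_weight_le:
  assumes "0 < \<epsilon>" "\<epsilon> \<le> s"
  shows "cap_weight \<epsilon> s b y r \<le> jump_weight \<epsilon> y r"
\<comment> \<open>The left inequality is strict because the jump weight vanishes at
  \<open>r = \<epsilon>\<close>, and \<open>s = \<epsilon>\<close> is allowed; at
  \<open>r = s\<close> the cutoff vanishes as well.\<close>
proof (cases "s < r \<and> r \<le> 2 * s")
  case True
  have s: "0 < s" and r: "0 < r" using assms True by auto
  have "2 powr (- 1 - \<alpha>) \<le> (r / s) powr (- 1 - \<alpha>)"
    using True s \<alpha> by (intro powr_mono2') (auto simp: divide_le_eq)
  moreover have "2 powr - 3 \<le> (2::real) powr (- 1 - \<alpha>)"
    using \<alpha> by (intro powr_mono) auto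
  moreover have "(2::real) powr - 3 = 1 / 8"
    using powr_realpow[of 2 3] by (simp add: powr_minus_divide)
  ultimately have "chi (r / s) \<le> (r / s) powr (- 1 - \<alpha>)"
    using chi_bounds(2)[of "r / s"] by linarith
  then have "s powr (- 1 - \<alpha>) * chi (r / s) \<le> s powr (- 1 - \<alpha>) * (r / s) powr (- 1 - \<alpha>)"
    by (rule mult_left_mono) simp
  also have "\<dots> = r powr (- 1 - \<alpha>)"
    using s r by (simp add: powr_mult[symmetric])
  finally have "s powr (- 1 - \<alpha>) * chi (r / s) / rate \<epsilon> \<le> r powr (- 1 - \<alpha>) / rate \<epsilon>"
    using rate_pos[OF assms(1)] by (intro divide_right_mono) auto
  then have "ennreal (s powr (- 1 - \<alpha>) / rate \<epsilon> * chi (r / s)) \<le> ennreal (1 / rate \<epsilon> * r powr (- 1 - \<alpha>))"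
    by (intro ennreal_leI) simp
  then have "ennreal (s powr (- 1 - \<alpha>) / rate \<epsilon>) * ennreal (chi (r / s)) \<le> ennreal (1 / rate \<epsilon>) * ennreal (r powr (- 1 - \<alpha>))"
    using rate_pos[OF assms(1)] by (simp only: ennreal_mult'[symmetric] ennreal_mult''[symmetric] chi_bounds powr_ge_zero)
  then show ?thesis
    using True assms by (auto simp: cap_weight_def jump_weight_def indicator_def)
next
  case False
  have s: "0 < s" using assms by auto
  have "r / s \<le> 1 \<or> 2 < r / s" using False s by (auto simp: divide_le_eq less_divide_eq)
  then have "chi (r / s) = 0" by (auto simp: chi_def)
  then show ?thesis by (simp add: cap_weight_def)
qed

lemma splits_jump_law:
  assumes "0 < \<epsilon>" "\<epsilon> \<le> s"
  shows "splits (jump_law \<epsilon>) (cap_law \<epsilon> s b) (rest_law \<epsilon> s b)"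
  unfolding jump_law_def cap_law_def rest_law_def
  by (intro splits_polar_law S jump_weight_measurable cap_weight_measurable cap_weight_le assms)
    (simp add: jump_mass assms)

lemma finite_borel_directions:
  assumes "0 < \<epsilon>" shows "finite_borel (directions \<epsilon> s b)"
    and "emeasure (directions \<epsilon> s b) UNIV = ennreal (measure S (C b) * (s powr (- 1 - \<alpha>) / rate \<epsilon>))"
    and "emeasure (directions \<epsilon> s b) (- C b) = 0"
proof -
  note [measurable] = C(1)[of b]
  have m: "(\<lambda>y. indicator (C b) y * ennreal (s powr (- 1 - \<alpha>) / rate \<epsilon>)) \<in> borel_measurable S"
    by (rule measurable_S) measurable
  have "emeasure (directions \<epsilon> s b) UNIV = (\<integral>\<^sup>+y. indicator (C b) y * ennreal (s powr (- 1 - \<alpha>) / rate \<epsilon>) \<partial>S)"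
    unfolding directions_def by (subst emeasure_density[OF m]) (auto simp: sets_S)
  also have "\<dots> = emeasure S (C b) * ennreal (s powr (- 1 - \<alpha>) / rate \<epsilon>)"
    by (subst nn_integral_multc) (auto simp: sets_S intro!: measurable_S borel_measurable_indicator)
  also have "\<dots> = ennreal (measure S (C b) * (s powr (- 1 - \<alpha>) / rate \<epsilon>))"
    unfolding emeasure_S by (intro ennreal_mult'[symmetric]) simp
  finally show eq: "emeasure (directions \<epsilon> s b) UNIV = ennreal (measure S (C b) * (s powr (- 1 - \<alpha>) / rate \<epsilon>))" .
  show "finite_borel (directions \<epsilon> s b)"
    unfolding finite_borel_def using eq
    by (auto simp: directions_def sets_S space_S intro!: finite_measureI)
  have "emeasure (directions \<epsilon> s b) (- C b)
      = (\<integral>\<^sup>+y. indicator (C b) y * ennreal (s powr (- 1 - \<alpha>) / rate \<epsilon>) * indicator (- C b) y \<partial>S)"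
    unfolding directions_def by (subst emeasure_density[OF m]) (auto simp: sets_S)
  also have "\<dots> = (\<integral>\<^sup>+y. 0 \<partial>S)" by (intro nn_integral_cong) (auto simp: indicator_def)
  finally show "emeasure (directions \<epsilon> s b) (- C b) = 0" by simp
qed

lemma nn_integral_cap_law:
  assumes "0 < \<epsilon>" and [measurable]: "g \<in> borel_measurable borel"
  shows "(\<integral>\<^sup>+u. g u \<partial>cap_law \<epsilon> s b)
    = (\<integral>\<^sup>+y. (\<integral>\<^sup>+t. ennreal (chi (t / s)) * g (t *\<^sub>R y) \<partial>lborel) \<partial>directions \<epsilon> s b)"
proof -
  note [measurable] = C(1)[of b]
  have m: "(\<lambda>y. indicator (C b) y * ennreal (s powr (- 1 - \<alpha>) / rate \<epsilon>)) \<in> borel_measurable S"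
    by (rule measurable_S) measurable
  have m2: "(\<lambda>y. \<integral>\<^sup>+t. ennreal (chi (t / s)) * g (t *\<^sub>R y) \<partial>lborel) \<in> borel_measurable S"
  proof (rule measurable_S)
    have "(\<lambda>(y, t). ennreal (chi (t / s)) * g (t *\<^sub>R y)) \<in> borel_measurable (borel \<Otimes>\<^sub>M borel)"
      by measurable
    then have "(\<lambda>(y, t). ennreal (chi (t / s)) * g (t *\<^sub>R y)) \<in> borel_measurable (borel \<Otimes>\<^sub>M lborel)"
      by (subst measurable_cong_sets[OF sets_pair_measure_cong[OF refl sets_lborel] refl])
    from lborel.borel_measurable_nn_integral_fst[OF this]
    show "(\<lambda>y. \<integral>\<^sup>+t. ennreal (chi (t / s)) * g (t *\<^sub>R y) \<partial>lborel) \<in> borel_measurable borel" by simp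
  qed
  show ?thesis
    unfolding cap_law_def directions_def nn_integral_polar_law[OF S cap_weight_measurable assms(2)]
      nn_integral_density[OF m m2]
    by (intro nn_integral_cong) (simp add: cap_weight_def nn_integral_cmult[symmetric] mult.assoc)
qed

text \<open>The scale \<open>s\<close> at which \<open>2 ^ n\<close> jumps of size at least \<open>\<epsilon>\<close> typically land.\<close>

definition at_scale :: "real \<Rightarrow> nat \<Rightarrow> real \<Rightarrow> bool" where
  "at_scale \<epsilon> n s \<longleftrightarrow> 0 < \<epsilon> \<and> \<epsilon> \<le> s \<and> s powr \<alpha> = \<epsilon> powr \<alpha> * 2 ^ n"

text \<open>A step is longer than \<open>s\<close> with probability
  \<open>(\<epsilon> / s) powr \<alpha>\<close>, which is \<open>1 / 2 ^ n\<close> at this scale.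
  The right-hand side is therefore the density of the step length at \<open>s\<close>, and
  \<open>\<epsilon>\<close> has dropped out.\<close>

lemma at_scale_rate:
  assumes "at_scale \<epsilon> n s"
  shows "mass * (s powr (- 1 - \<alpha>) / rate \<epsilon>) = \<alpha> / 2 ^ n / s"
proof -
  have s: "0 < s" "0 < \<epsilon>" using assms by (auto simp: at_scale_def)
  have "s powr (- 1 - \<alpha>) = 1 / (s * s powr \<alpha>)"
    using s by (simp add: powr_diff powr_minus_divide)
  also have "\<dots> = 1 / (s * (\<epsilon> powr \<alpha> * 2 ^ n))" using assms by (simp add: at_scale_def)
  finally show ?thesis
    using s \<alpha> mass_pos by (simp add: rate_def powr_minus_divide field_simps)
qed

definition cap_min :: real where "cap_min = Min ((\<lambda>b. measure S (C b)) ` Basis)"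

lemma cap_min: "0 < cap_min" "b \<in> Basis \<Longrightarrow> cap_min \<le> measure S (C b)"
  using cap_pos by (auto simp: cap_min_def)

text \<open>\<open>hit / 2 ^ n\<close> is a lower bound for the mass that one step puts into any of
  the caps at scale \<open>n\<close>; the last factor is the lower bound in
  \<open>nn_integral_chi\<close>.\<close>

definition hit :: real where "hit = \<alpha> * cap_min / mass * (9 / 512)"

lemma hit_pos: "0 < hit"
  using \<alpha> cap_min(1) mass_pos by (simp add: hit_def)

lemma cap_law_mass:
  assumes a: "at_scale \<epsilon> n s" and b: "b \<in> Basis"
  shows "emeasure (cap_law \<epsilon> s b) UNIV \<le> ennreal (\<alpha> / 2 ^ n)"
    and "ennreal (hit / 2 ^ n) \<le> emeasure (cap_law \<epsilon> s b) UNIV"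
proof -
  have s: "0 < s" "0 < \<epsilon>" using a by (auto simp: at_scale_def)
  let ?k = "s powr (- 1 - \<alpha>) / rate \<epsilon>" and ?I = "\<integral>\<^sup>+t. ennreal (chi (t / s)) \<partial>lborel"
  have k: "0 \<le> ?k" using rate_pos[OF s(2)] by simp
  have "emeasure (cap_law \<epsilon> s b) UNIV = (\<integral>\<^sup>+u. 1 \<partial>cap_law \<epsilon> s b)"
    by (simp add: cap_law_def polar_law_def)
  also have "\<dots> = ?I * emeasure (directions \<epsilon> s b) UNIV"
    by (subst nn_integral_cap_law[OF s(2)]) (auto simp: directions_def space_S)
  finally have eq: "emeasure (cap_law \<epsilon> s b) UNIV = ?I * ennreal (measure S (C b) * ?k)"
    using finite_borel_directions(2)[OF s(2)] by simp
  have "measure S (C b) * ?k \<le> \<alpha> / 2 ^ n / s"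
    unfolding at_scale_rate[OF a, symmetric] by (intro mult_right_mono measure_S_le k)
  then have "emeasure (cap_law \<epsilon> s b) UNIV \<le> ennreal s * ennreal (\<alpha> / 2 ^ n / s)"
    unfolding eq by (intro mult_mono nn_integral_chi s ennreal_leI) auto
  also have "\<dots> = ennreal (\<alpha> / 2 ^ n)"
    using s \<alpha> by (subst ennreal_mult'[symmetric]) auto
  finally show "emeasure (cap_law \<epsilon> s b) UNIV \<le> ennreal (\<alpha> / 2 ^ n)" .
  have "hit / 2 ^ n = (9 / 512 * s) * (cap_min / mass * (mass * ?k))"
    unfolding at_scale_rate[OF a] using s by (simp add: hit_def mult_ac)
  also have "\<dots> = (9 / 512 * s) * (cap_min * ?k)" using mass_pos by simp
  finally have h: "hit / 2 ^ n = (9 / 512 * s) * (cap_min * ?k)" .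
  have "ennreal (hit / 2 ^ n) = ennreal (9 / 512 * s) * ennreal (cap_min * ?k)"
    unfolding h using s by (intro ennreal_mult') auto
  also have "\<dots> \<le> ?I * ennreal (measure S (C b) * ?k)"
    using cap_min(2)[OF b] k by (intro mult_mono nn_integral_chi s ennreal_leI mult_right_mono) auto
  finally show "ennreal (hit / 2 ^ n) \<le> emeasure (cap_law \<epsilon> s b) UNIV" by (simp add: eq)
qed

text \<open>A step is left to \<open>rest_law\<close> with probability at most
  \<open>1 - hit / 2 ^ n\<close>, and \<open>1 - x\<close> is at most \<open>exp (- x)\<close>. Over
  \<open>N * 2 ^ n\<close> steps the power of 2 cancels, so the probability of missing a cap is
  small uniformly in the scale.\<close>

lemma rest_law_mass:
  assumes a: "at_scale \<epsilon> n s" and b: "b \<in> Basis"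
  shows "emeasure (rest_law \<epsilon> s b) UNIV \<le> 1"
    and "emeasure (rest_law \<epsilon> s b) UNIV ^ (N * 2 ^ n) \<le> ennreal (exp (- hit * N))"
proof -
  have s: "0 < \<epsilon>" "\<epsilon> \<le> s" using a by (auto simp: at_scale_def)
  have sp: "splits (jump_law \<epsilon>) (cap_law \<epsilon> s b) (rest_law \<epsilon> s b)" by (rule splits_jump_law[OF s])
  have "emeasure (jump_law \<epsilon>) UNIV = emeasure (cap_law \<epsilon> s b) UNIV + emeasure (rest_law \<epsilon> s b) UNIV"
    using sp unfolding splits_def
    by (elim conjE ballE[of _ _ "\<lambda>_. 1"]) (auto simp: jump_law_def cap_law_def rest_law_def polar_law_def)
  then have sum: "1 = emeasure (cap_law \<epsilon> s b) UNIV + emeasure (rest_law \<epsilon> s b) UNIV"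
    using emeasure_jump_law[OF s(1)] by simp
  have "emeasure (rest_law \<epsilon> s b) UNIV \<le> emeasure (cap_law \<epsilon> s b) UNIV + emeasure (rest_law \<epsilon> s b) UNIV"
    by simp
  then show le1: "emeasure (rest_law \<epsilon> s b) UNIV \<le> 1" by (simp only: sum[symmetric])
  obtain u where u: "0 \<le> u" "emeasure (cap_law \<epsilon> s b) UNIV = ennreal u"
    using sum by (cases "emeasure (cap_law \<epsilon> s b) UNIV") auto
  obtain v where v: "0 \<le> v" "emeasure (rest_law \<epsilon> s b) UNIV = ennreal v"
    using le1 by (cases "emeasure (rest_law \<epsilon> s b) UNIV") (auto simp: top_unique)
  have "u + v = 1" using sum u v by (simp add: ennreal_plus[symmetric] del: ennreal_plus)
  moreover have "hit / 2 ^ n \<le> u"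
    using cap_law_mass(2)[OF a b] u by (simp add: ennreal_le_iff)
  ultimately have "v \<le> 1 + (- hit / 2 ^ n)" by simp
  also have "\<dots> \<le> exp (- hit / 2 ^ n)" by (rule exp_ge_add_one_self)
  finally have "v ^ (N * 2 ^ n) \<le> exp (- hit / 2 ^ n) ^ (N * 2 ^ n)"
    using v by (intro power_mono)
  also have "\<dots> = exp (of_nat (N * 2 ^ n) * (- hit / 2 ^ n))" by (rule exp_of_nat_mult[symmetric])
  also have "of_nat (N * 2 ^ n) * (- hit / 2 ^ n) = - hit * N" by simp
  finally show "emeasure (rest_law \<epsilon> s b) UNIV ^ (N * 2 ^ n) \<le> ennreal (exp (- hit * N))"
    using v by (simp add: ennreal_power ennreal_leI)
qed

text \<open>Each of the \<open>d\<close> jumps has mass at most \<open>\<alpha> / 2 ^ n\<close>, and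
  their lengths spread the product over a volume of order \<open>(s * c) ^ d\<close>. The small
  factor \<open>(1 / 2 ^ n) ^ d\<close> will cancel against the number of places of the jumps in
  \<open>scale_split\<close>. The assumptions on \<open>\<omega>\<close> fit both the cutoff and the
  indicator that replaces it.\<close>

lemma frame_law_bounds:
  assumes a: "at_scale \<epsilon> n s" and \<omega>: "\<omega> \<in> borel_measurable borel" "\<And>t. \<omega> t \<le> 1"
    "(\<integral>\<^sup>+t. \<omega> t \<partial>lborel) \<le> ennreal s"
  shows "finite_borel (frame_law (directions \<epsilon> s) \<omega> Basis)"
    and "positive_op (ennreal ((\<alpha> / 2 ^ n) ^ DIM('a))) (nact (frame_law (directions \<epsilon> s) \<omega> Basis))"
    and "smoothing_op (ennreal ((\<alpha> / 2 ^ n / (s * c)) ^ DIM('a))) (nact (frame_law (directions \<epsilon> s) \<omega> Basis))"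
proof -
  have s: "0 < s" "0 < \<epsilon>" using a by (auto simp: at_scale_def)
  have fin: "\<And>b. finite_borel (directions \<epsilon> s b)" by (rule finite_borel_directions[OF s(2)])
  have \<omega>f: "(\<integral>\<^sup>+t. \<omega> t \<partial>lborel) < \<infinity>" using \<omega>(3) by (rule order.strict_trans1) simp
  show fb: "finite_borel (frame_law (directions \<epsilon> s) \<omega> Basis)"
    by (rule finite_borel_frame_law[OF fin \<omega>(1) finite_Basis \<omega>f])
  have k: "0 \<le> s powr (- 1 - \<alpha>) / rate \<epsilon>" using rate_pos[OF s(2)] by simp
  have "emeasure (directions \<epsilon> s b) UNIV \<le> ennreal (\<alpha> / 2 ^ n / s)" for b
    unfolding finite_borel_directions(2)[OF s(2)] at_scale_rate[OF a, symmetric]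
    by (intro ennreal_leI mult_right_mono measure_S_le k)
  then have "(\<Prod>b\<in>Basis. emeasure (directions \<epsilon> s b) UNIV) \<le> (\<Prod>b\<in>(Basis::'a set). ennreal (\<alpha> / 2 ^ n / s))"
    by (intro prod_mono_ennreal) auto
  also have "\<dots> = ennreal ((\<alpha> / 2 ^ n / s) ^ DIM('a))"
    using s \<alpha> by (simp add: ennreal_power)
  finally have pr: "(\<Prod>b\<in>Basis. emeasure (directions \<epsilon> s b) UNIV) \<le> ennreal ((\<alpha> / 2 ^ n / s) ^ DIM('a))" .
  have pos: "0 \<le> \<alpha> / 2 ^ n / s" using s \<alpha> by simp
  have "emeasure (frame_law (directions \<epsilon> s) \<omega> Basis) UNIV
      \<le> ennreal ((\<alpha> / 2 ^ n / s) ^ DIM('a)) * ennreal s ^ DIM('a)"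
    unfolding finite_borel_frame_law(2)[OF fin \<omega>(1) finite_Basis \<omega>f]
    by (intro mult_mono pr power_mono \<omega>(3)) auto
  also have "\<dots> = ennreal ((\<alpha> / 2 ^ n / s) ^ DIM('a) * s ^ DIM('a))"
    using s pos by (simp add: ennreal_power ennreal_mult')
  also have "(\<alpha> / 2 ^ n / s) ^ DIM('a) * s ^ DIM('a) = (\<alpha> / 2 ^ n) ^ DIM('a)"
    using s by (simp add: power_mult_distrib[symmetric])
  finally show "positive_op (ennreal ((\<alpha> / 2 ^ n) ^ DIM('a))) (nact (frame_law (directions \<epsilon> s) \<omega> Basis))"
    by (rule nact_positive_op_mono[OF fb])
  have "(\<Prod>b\<in>Basis. emeasure (directions \<epsilon> s b) UNIV) * ennreal ((1 / c) ^ DIM('a))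
      \<le> ennreal ((\<alpha> / 2 ^ n / s) ^ DIM('a)) * ennreal ((1 / c) ^ DIM('a))"
    by (intro mult_right_mono pr) auto
  also have "\<dots> = ennreal ((\<alpha> / 2 ^ n / (s * c)) ^ DIM('a))"
  proof -
    have "\<alpha> / 2 ^ n / s * (1 / c) = \<alpha> / 2 ^ n / (s * c)" by simp
    then have "(\<alpha> / 2 ^ n / s) ^ DIM('a) * (1 / c) ^ DIM('a) = (\<alpha> / 2 ^ n / (s * c)) ^ DIM('a)"
      by (simp only: power_mult_distrib[symmetric])
    then show ?thesis using pos by (simp only: ennreal_mult'[symmetric] zero_le_power)
  qed
  finally show "smoothing_op (ennreal ((\<alpha> / 2 ^ n / (s * c)) ^ DIM('a))) (nact (frame_law (directions \<epsilon> s) \<omega> Basis))"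
    by (elim smoothing_op_mono[rotated]) (rule smoothing_op_frame_law[where C = C, OF fin \<omega>(1,2)],
      auto intro: C(1) finite_borel_directions(3)[OF s(2)] c fr)
qed

end

text \<open>Used to choose the number \<open>N\<close> of runs per cap: the power counts the places
  of the jumps already found, the exponential is the probability of missing the next cap. The
  expression is a power of \<open>n * x ^ n\<close> with \<open>x = exp (- h / d)\<close>, which
  tends to zero.\<close>

lemma exp_beats_power:
  fixes h b r :: real
  assumes h: "0 < h" and d: "0 < d" and r: "0 < r" and b: "0 < b"
  shows "\<exists>N::nat. 1 \<le> N \<and> d * (max 1 (N * b) ^ d * exp (- h * N)) \<le> r"
proof -
  define x where "x = exp (- h / d)"
  have x: "norm x < 1" using h d by (simp add: x_def)
  have "(\<lambda>n. of_nat n * x ^ n) \<longlonglongrightarrow> 0" by (rule powser_times_n_limit_0[OF x])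
  then have "(\<lambda>n. d * ((1 + b) ^ d * (of_nat n * x ^ n) ^ d)) \<longlonglongrightarrow> d * ((1 + b) ^ d * 0 ^ d)"
    by (intro tendsto_intros)
  moreover have "d * ((1 + b) ^ d * 0 ^ d) = 0" using d by simp
  ultimately have "(\<lambda>n. d * ((1 + b) ^ d * (of_nat n * x ^ n) ^ d)) \<longlonglongrightarrow> 0" by (simp only:)
  then have "\<forall>\<^sub>F n in sequentially. d * ((1 + b) ^ d * (of_nat n * x ^ n) ^ d) < r"
    using r by (rule order_tendstoD(2))
  then have "\<forall>\<^sub>F n in sequentially. d * ((1 + b) ^ d * (of_nat n * x ^ n) ^ d) < r \<and> 1 \<le> n"
    using eventually_ge_at_top[of "1::nat"] by (rule eventually_conj)
  then obtain N where N: "d * ((1 + b) ^ d * (of_nat N * x ^ N) ^ d) < r" "1 \<le> N"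
    using eventually_sequentially by (metis (no_types, lifting) order_refl)
  have "(x ^ N) ^ d = exp (- h * N)"
    using d by (simp add: x_def exp_of_nat_mult[symmetric] power_mult[symmetric] mult.commute)
  then have e: "(1 + b) ^ d * (of_nat N * x ^ N) ^ d = ((1 + b) * N) ^ d * exp (- h * N)"
    by (simp add: power_mult_distrib)
  have "1 * 1 \<le> (1 + b) * real N" using b N(2) by (intro mult_mono) auto
  moreover have "real N * b \<le> (1 + b) * real N" using b by (simp add: algebra_simps)
  ultimately have "max 1 (N * b) ^ d \<le> ((1 + b) * N) ^ d"
    by (intro power_mono) auto
  then have "d * (max 1 (N * b) ^ d * exp (- h * N)) \<le> d * (((1 + b) * N) ^ d * exp (- h * N))"
    by (intro mult_left_mono mult_right_mono) auto
  then show ?thesis using N e by (intro exI[of _ N]) auto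
qed

context polar_frame
begin

text \<open>The law of one jump in every cap at scale \<open>s\<close>, and its majorant after the integration by parts.\<close>

definition kernel :: "real \<Rightarrow> real \<Rightarrow> 'a measure" where
  "kernel \<epsilon> s = frame_law (directions \<epsilon> s) (\<lambda>t. ennreal (chi (t / s))) Basis"

definition wide_kernel :: "real \<Rightarrow> real \<Rightarrow> 'a measure" where
  "wide_kernel \<epsilon> s = frame_law (directions \<epsilon> s) (indicator {s..2 * s}) Basis"

lemma chi_weight:
  assumes "at_scale \<epsilon> n s"
  shows "(\<lambda>t. ennreal (chi (t / s))) \<in> borel_measurable borel" "ennreal (chi (t / s)) \<le> 1"
    "(\<integral>\<^sup>+t. ennreal (chi (t / s)) \<partial>lborel) \<le> ennreal s"
proof -
  have s: "0 < s" using assms by (auto simp: at_scale_def)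
  show "(\<lambda>t. ennreal (chi (t / s))) \<in> borel_measurable borel" by measurable
  show "ennreal (chi (t / s)) \<le> 1"
    using chi_bounds(2)[of "t / s"] by (simp add: ennreal_le_1)
  show "(\<integral>\<^sup>+t. ennreal (chi (t / s)) \<partial>lborel) \<le> ennreal s" by (rule nn_integral_chi(1)[OF s])
qed

lemma wide_weight:
  assumes "at_scale \<epsilon> n s"
  shows "(indicator {s..2 * s} :: real \<Rightarrow> ennreal) \<in> borel_measurable borel"
    "indicator {s..2 * s} t \<le> (1 :: ennreal)"
    "(\<integral>\<^sup>+t. indicator {s..2 * s} t \<partial>lborel) \<le> ennreal s"
proof -
  have s: "0 < s" using assms by (auto simp: at_scale_def)
  show "(indicator {s..2 * s} :: real \<Rightarrow> ennreal) \<in> borel_measurable borel"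
    by (rule borel_measurable_indicator) simp
  show "indicator {s..2 * s} t \<le> (1 :: ennreal)" by (simp add: indicator_def)
  show "(\<integral>\<^sup>+t. indicator {s..2 * s} t \<partial>lborel) \<le> ennreal s" using s by simp
qed

text \<open>Each of the \<open>d\<close> caps receives a block of \<open>N * 2 ^ n\<close> steps.
  The number of places times the mass of a cap is at most \<open>N * \<alpha>\<close>, so the bound
  for the bad part depends on \<open>N\<close> but not on the scale.\<close>

lemma scale_split:
  assumes a: "at_scale \<epsilon> n s"
  shows "\<exists>V W. positive_op (of_nat (N * 2 ^ n) ^ DIM('a)) V
     \<and> positive_op (ennreal (DIM('a) * (max 1 (N * \<alpha>) ^ DIM('a) * exp (- hit * N)))) W
     \<and> (\<forall>h x. bounded_borel h \<longrightarrow> ennreal \<bar>(act (jump_law \<epsilon>) ^^ (N * DIM('a) * 2 ^ n)) h x\<bar>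
       \<le> V (\<lambda>x. ennreal \<bar>act (kernel \<epsilon> s) h x\<bar>) x + W (\<lambda>x. ennreal \<bar>h x\<bar>) x)"
proof -
  have s: "0 < \<epsilon>" "\<epsilon> \<le> s" using a by (auto simp: at_scale_def)
  obtain bs :: "'a list" where bs: "set bs = Basis" "distinct bs"
    using finite_distinct_list[OF finite_Basis] by blast
  then have len: "length bs = DIM('a)" using distinct_card[OF bs(2)] by simp
  have sp: "splits (jump_law \<epsilon>) (cap_law \<epsilon> s b) (rest_law \<epsilon> s b)" for b by (rule splits_jump_law[OF s])
  then have fb: "finite_borel (cap_law \<epsilon> s b)" for b by (simp add: splits_def)
  have B: "of_nat (N * 2 ^ n) * ennreal (\<alpha> / 2 ^ n) \<le> ennreal (max 1 (N * \<alpha>))" "1 \<le> ennreal (max 1 (N * \<alpha>))"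
  proof -
    have "of_nat (N * 2 ^ n) * ennreal (\<alpha> / 2 ^ n) = ennreal (real (N * 2 ^ n) * (\<alpha> / 2 ^ n))"
      using \<alpha> by (subst ennreal_mult') (auto simp: ennreal_of_nat_eq_real_of_nat)
    also have "real (N * 2 ^ n) * (\<alpha> / 2 ^ n) = N * \<alpha>" by simp
    finally show "of_nat (N * 2 ^ n) * ennreal (\<alpha> / 2 ^ n) \<le> ennreal (max 1 (N * \<alpha>))"
      by (simp add: ennreal_leI)
    show "1 \<le> ennreal (max 1 (N * \<alpha>))" by (simp add: ennreal_ge_1)
  qed
  have "\<exists>V W. positive_op (of_nat (N * 2 ^ n) ^ length bs) V \<and>
      positive_op (of_nat (length bs) * (ennreal (max 1 (N * \<alpha>)) ^ length bs * ennreal (exp (- hit * N)))) W \<and>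
      (\<forall>h x. bounded_borel h \<longrightarrow> ennreal \<bar>(act (jump_law \<epsilon>) ^^ (N * 2 ^ n * length bs)) h x\<bar>
       \<le> V (\<lambda>x. ennreal \<bar>foldr (\<lambda>b. act (cap_law \<epsilon> s b)) bs h x\<bar>) x + W (\<lambda>x. ennreal \<bar>h x\<bar>) x)"
    by (rule act_pow_splits_list[where X = "cap_law \<epsilon> s" and Y = "rest_law \<epsilon> s" and m = "N * 2 ^ n",
        OF sp finite_borel_jump_law[OF s(1)] eq_refl[OF emeasure_jump_law[OF s(1)]]
        cap_law_mass(1)[OF a, folded bs(1)] rest_law_mass(1)[OF a, folded bs(1)]
        rest_law_mass(2)[OF a, folded bs(1)] B])
  then obtain V W where V: "positive_op (of_nat (N * 2 ^ n) ^ length bs) V"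
    and W: "positive_op (of_nat (length bs) * (ennreal (max 1 (N * \<alpha>)) ^ length bs * ennreal (exp (- hit * N)))) W"
    and VW: "\<forall>h x. bounded_borel h \<longrightarrow> ennreal \<bar>(act (jump_law \<epsilon>) ^^ (N * 2 ^ n * length bs)) h x\<bar>
       \<le> V (\<lambda>x. ennreal \<bar>foldr (\<lambda>b. act (cap_law \<epsilon> s b)) bs h x\<bar>) x + W (\<lambda>x. ennreal \<bar>h x\<bar>) x"
    by (elim exE conjE)
  have K: "foldr (\<lambda>b. act (cap_law \<epsilon> s b)) bs h = act (kernel \<epsilon> s) h" if "bounded_borel h" for h
    unfolding kernel_def bs(1)[symmetric]
    by (rule foldr_act_eq_frame_law[OF finite_borel_directions(1)[OF s(1)] chi_weight(1)[OF a] _ fb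
          nn_integral_cap_law[OF s(1)] bs(2) that])
      (use chi_weight(3)[OF a] in \<open>auto intro: order.strict_trans1\<close>)
  have "of_nat (length bs) * (ennreal (max 1 (N * \<alpha>)) ^ length bs * ennreal (exp (- hit * N)))
      = ennreal (DIM('a) * (max 1 (N * \<alpha>) ^ DIM('a) * exp (- hit * N)))"
    unfolding len by (simp add: ennreal_mult' ennreal_power ennreal_of_nat_eq_real_of_nat)
  with W have W': "positive_op (ennreal (DIM('a) * (max 1 (N * \<alpha>) ^ DIM('a) * exp (- hit * N)))) W"
    by simp
  show ?thesis
    by (rule exI[of _ V], rule exI[of _ W]) (use V W' VW K in \<open>simp add: len mult_ac\<close>)
qed

text \<open>Doubling the number of steps multiplies the reached distance by this ratio.\<close>

definition q :: real where "q = 2 powr (1 / \<alpha>)"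

lemma q_gt_1: "1 < q"
  using \<alpha> by (simp add: q_def)

lemma at_scale_geometric:
  assumes "0 < \<epsilon>" shows "at_scale \<epsilon> n (\<epsilon> * q ^ n)"
proof -
  have q0: "0 < q" using q_gt_1 by simp
  have "(q ^ n) powr \<alpha> = (q powr \<alpha>) ^ n"
    using q0 by (simp add: powr_realpow[symmetric] powr_powr mult.commute)
  also have "q powr \<alpha> = 2" using \<alpha> by (simp add: q_def powr_powr)
  finally show ?thesis
    using assms q0 one_le_power[of q n] q_gt_1 by (simp add: at_scale_def powr_mult)
qed

lemma finite_borel_kernel: "at_scale \<epsilon> n s \<Longrightarrow> finite_borel (kernel \<epsilon> s)"
  unfolding kernel_def by (rule frame_law_bounds(1)[OF _ chi_weight]) auto

lemma kernel_divergence: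
  assumes a: "at_scale \<epsilon> n s" and F: "divergence_pair F G w" "F \<in> borel_measurable borel" and w: "bounded_borel w"
  shows "ennreal \<bar>act (kernel \<epsilon> s) w x\<bar>
    \<le> ennreal (2 * DIM('a) / (s * c)) * nact (wide_kernel \<epsilon> s) (\<lambda>x. ennreal (norm (F x))) x"
proof -
  have s: "0 < s" "0 < \<epsilon>" using a by (auto simp: at_scale_def)
  show ?thesis
    unfolding kernel_def wide_kernel_def
    by (rule act_frame_law_divergence[where C = C, OF finite_borel_directions(1)[OF s(2)] C(1)
          finite_borel_directions(3)[OF s(2)] c _ s(1) F w])
      (auto intro: fr finite_borel_kernel[OF a, unfolded kernel_def])
qed

text \<open>\<open>K\<close> and \<open>r\<close> are fixed before \<open>\<epsilon>\<close>, and
  the operators before \<open>f\<close>; this uniformity is what makes the final constant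
  independent of \<open>f\<close>. The errors have separate origins. The term with \<open>B\<close>
  comes from the earliest steps, where no smoothing has happened, and from the bad events at every
  scale. The term with \<open>E\<close> is the consistency error of the generator summed over all
  steps. The term with \<open>I\<close> is \<open>f\<close> itself after the last step, bounded by
  its integral over the volume reached, and the last term is the bad event there.\<close>

lemma decomposition_at_scale:
  "\<exists>K r. 0 < K \<and> 0 \<le> r \<and> r \<le> 1 / 4 \<and> (\<forall>\<epsilon>>0. \<exists>T.
     (\<forall>n. positive_op (ennreal (K * (\<epsilon> * q ^ n) powr (\<alpha> - 1))) (T n)
        \<and> smoothing_op (ennreal (K * (\<epsilon> * q ^ n) powr (\<alpha> - 1 - DIM('a)))) (T n)) \<and>
     (\<forall>f w F G E B Bf I M x. bounded_borel f \<longrightarrow> bounded_borel w \<longrightarrow> F \<in> borel_measurable borel \<longrightarrow>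
        divergence_pair F G w \<longrightarrow> (\<forall>x. \<bar>f x\<bar> \<le> Bf) \<longrightarrow> (\<forall>x. \<bar>w x\<bar> \<le> B) \<longrightarrow>
        (\<integral>\<^sup>+x. ennreal \<bar>f x\<bar> \<partial>lborel) \<le> ennreal I \<longrightarrow> 0 \<le> I \<longrightarrow>
        (\<forall>x. \<bar>rate \<epsilon> * \<alpha> * (act (jump_law \<epsilon>) f x - f x) - w x\<bar> \<le> E) \<longrightarrow>
        ennreal \<bar>f x\<bar> \<le> (\<Sum>n<M. T n (\<lambda>x. ennreal (norm (F x))) x)
          + ennreal (K * \<epsilon> powr \<alpha> * (B + 2 ^ M * E) + K * I / (\<epsilon> * q ^ M) ^ DIM('a) + r ^ M * Bf)))"
proof -
  let ?d = "DIM('a)"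
  have q0: "0 < q" using q_gt_1 by simp
  \<comment> \<open>The largest loss in passing to the next scale: \<open>1 / s ^ (d + 1)\<close> is
    the fastest decaying of the bounds to which the recursion is applied.\<close>
  define Q where "Q = q ^ (?d + 1)"
  have Q: "1 \<le> Q" using q_gt_1 by (simp add: Q_def one_le_power del: power_Suc)
  \<comment> \<open>Small enough for \<open>r * Q \<le> 1 / 2\<close> in the recursion and for
    \<open>r \<le> 1 / 4\<close> in the dyadic sum. \<open>N\<close> is then chosen so large that
    the bad part has norm at most \<open>r\<close>.\<close>
  define r where "r = 1 / (4 * Q)"
  have r: "0 \<le> r" "0 < r" "r * Q \<le> 1 / 2" "r \<le> 1 / 4" using Q by (auto simp: r_def field_simps)
  obtain N :: nat where N: "1 \<le> N" and Nr: "?d * (max 1 (N * \<alpha>) ^ ?d * exp (- hit * N)) \<le> r"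
    using exp_beats_power[OF hit_pos DIM_positive r(2), of \<alpha>] \<alpha> by auto
  \<comment> \<open>The added ones make \<open>C0\<close> dominate all four combinations listed in
    \<open>Ca\<close>: with or without the factor of the integration by parts, and with or without
    the density factor.\<close>
  define C0 where "C0 = (N * \<alpha>) ^ ?d * (2 * ?d / c + 1) * (1 + (1 / c) ^ ?d)"
  have Na: "0 < real N * \<alpha>" using N \<alpha> by simp
  have C0: "0 < C0"
  proof -
    have "0 < 2 * ?d / c + 1" "0 < 1 + (1 / c) ^ ?d" using c by (auto intro: add_nonneg_pos add_pos_nonneg)
    then show ?thesis unfolding C0_def using zero_less_power[OF Na] by (intro mult_pos_pos)
  qed
  define L where "L = N * ?d"
  \<comment> \<open>The summands serve in turn the error with \<open>B\<close>, the last remnant of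
    \<open>f\<close>, and the norms of the operators \<open>T\<close>.\<close>
  define K where "K = 3 * L / mass + 2 * C0 * Q + 2 * C0 * Q * L / mass"
  have K: "0 < K" "3 * L / mass \<le> K" "2 * C0 * Q \<le> K" "2 * C0 * Q * L / mass \<le> K"
    using C0 Q mass_pos by (auto simp: K_def add_nonneg_pos add_pos_nonneg)
  show ?thesis
  proof (rule exI[of _ K], rule exI[of _ r], intro conjI K(1) r(1) r(4) allI impI)
    fix \<epsilon> :: real assume \<epsilon>: "0 < \<epsilon>"
    define s where "s n = \<epsilon> * q ^ n" for n
    have s: "0 < s n" "s (Suc n) = q * s n" for n using \<epsilon> q0 by (auto simp: s_def)
    have a: "at_scale \<epsilon> n (s n)" for n unfolding s_def by (rule at_scale_geometric[OF \<epsilon>])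
    let ?M = "jump_law \<epsilon>"
    have M: "finite_borel ?M" "emeasure ?M UNIV \<le> 1"
      using finite_borel_jump_law[OF \<epsilon>] emeasure_jump_law[OF \<epsilon>] by auto
    have "\<forall>n. \<exists>VW. positive_op (of_nat (N * 2 ^ n) ^ ?d) (fst VW) \<and> positive_op (ennreal r) (snd VW)
     \<and> (\<forall>h x. bounded_borel h \<longrightarrow> ennreal \<bar>(act ?M ^^ (L * 2 ^ n)) h x\<bar>
       \<le> fst VW (\<lambda>x. ennreal \<bar>act (kernel \<epsilon> (s n)) h x\<bar>) x + snd VW (\<lambda>x. ennreal \<bar>h x\<bar>) x)"
    proof
      fix n
      obtain V W where V: "positive_op (of_nat (N * 2 ^ n) ^ ?d) V"
        and W: "positive_op (ennreal (?d * (max 1 (N * \<alpha>) ^ ?d * exp (- hit * N)))) W"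
        and VW: "\<forall>h x. bounded_borel h \<longrightarrow> ennreal \<bar>(act ?M ^^ (N * ?d * 2 ^ n)) h x\<bar>
            \<le> V (\<lambda>x. ennreal \<bar>act (kernel \<epsilon> (s n)) h x\<bar>) x + W (\<lambda>x. ennreal \<bar>h x\<bar>) x"
        using scale_split[OF a[of n], of N] by (elim exE conjE)
      have "positive_op (ennreal r) W" by (rule positive_op_mono[OF W ennreal_leI[OF Nr]])
      with V VW show "\<exists>VW. positive_op (of_nat (N * 2 ^ n) ^ ?d) (fst VW) \<and> positive_op (ennreal r) (snd VW)
        \<and> (\<forall>h x. bounded_borel h \<longrightarrow> ennreal \<bar>(act ?M ^^ (L * 2 ^ n)) h x\<bar>
          \<le> fst VW (\<lambda>x. ennreal \<bar>act (kernel \<epsilon> (s n)) h x\<bar>) x + snd VW (\<lambda>x. ennreal \<bar>h x\<bar>) x)"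
        by (intro exI[of _ "(V, W)"]) (simp add: L_def)
    qed
    from choice[OF this] obtain VW where VW: "\<forall>n. positive_op (of_nat (N * 2 ^ n) ^ ?d) (fst (VW n)) \<and> positive_op (ennreal r) (snd (VW n))
     \<and> (\<forall>h x. bounded_borel h \<longrightarrow> ennreal \<bar>(act ?M ^^ (L * 2 ^ n)) h x\<bar>
       \<le> fst (VW n) (\<lambda>x. ennreal \<bar>act (kernel \<epsilon> (s n)) h x\<bar>) x + snd (VW n) (\<lambda>x. ennreal \<bar>h x\<bar>) x)"
      by (elim exE)
    note Vp = VW[rule_format, THEN conjunct1] and Wp = VW[rule_format, THEN conjunct2, THEN conjunct1]
      and VWle = VW[rule_format, THEN conjunct2, THEN conjunct2, rule_format]
    have Kf: "finite_borel (kernel \<epsilon> (s n))" for n by (rule finite_borel_kernel[OF a])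
    have Kc: "act (kernel \<epsilon> (s n)) ((act ?M ^^ m) h) = (act ?M ^^ m) (act (kernel \<epsilon> (s n)) h)"
      if "bounded_borel h" for n m h by (rule act_pow_comm[OF M(1) Kf that])
    have Kb: "bounded_borel (act (kernel \<epsilon> (s n)) h)" if "bounded_borel h" for n h
      by (rule bounded_borel_act[OF Kf that])
    have v: "of_nat (N * 2 ^ n) ^ ?d * ennreal t = ennreal ((real N * 2 ^ n) ^ ?d * t)" if "0 \<le> t" for n and t :: real
      using that by (simp add: ennreal_mult' ennreal_power[symmetric] ennreal_of_nat_eq_real_of_nat[symmetric] numeral_power_eq_of_nat_cancel_iff)
    have v': "of_nat (N * 2 ^ n) ^ ?d * (ennreal t * ennreal u) = ennreal ((real N * 2 ^ n) ^ ?d * (t * u))"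
      if "0 \<le> t" "0 \<le> u" for n and t u :: real
      using v[of "t * u" n] that by (simp add: ennreal_mult')
    have e1: "(real N * 2 ^ n) ^ ?d * (\<alpha> / 2 ^ n) ^ ?d = (N * \<alpha>) ^ ?d" for n
      by (simp add: power_mult_distrib[symmetric])
    have e2: "(\<alpha> / 2 ^ n / (s n * c)) ^ ?d = (\<alpha> / 2 ^ n) ^ ?d * ((1 / c) ^ ?d * (1 / s n ^ ?d))" for n
      by (simp add: power_mult_distrib power_divide)
    define P where "P = (N * \<alpha>) ^ ?d"
    have P: "0 \<le> P" using Na by (simp add: P_def)
    have cd: "0 \<le> (1 / c) ^ ?d" using c by simp
    have dc: "0 \<le> 2 * ?d / c" using c by simp
    have Ca: "P * (2 * ?d / c) \<le> C0" "P * (2 * ?d / c) * (1 / c) ^ ?d \<le> C0" "P \<le> C0" "P * (1 / c) ^ ?d \<le> C0"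
    proof -
      have "P * u \<le> P * (u + 1) * (1 + v)" "P * u * v \<le> P * (u + 1) * (1 + v)"
           "P \<le> P * (u + 1) * (1 + v)" "P * v \<le> P * (u + 1) * (1 + v)" if "0 \<le> u" "0 \<le> v" for u v
        using P that by (auto simp: algebra_simps intro!: add_nonneg_nonneg mult_nonneg_nonneg)
      from this[OF dc cd] show "P * (2 * ?d / c) \<le> C0" "P * (2 * ?d / c) * (1 / c) ^ ?d \<le> C0"
          "P \<le> C0" "P * (1 / c) ^ ?d \<le> C0"
        unfolding C0_def P_def[symmetric] by simp_all
    qed
    \<comment> \<open>The majorant of \<open>kernel_divergence\<close>. The first recursion uses it
      for \<open>w\<close>, and its factor \<open>1 / s\<close> is the gain from the integration by
      parts.\<close>
    define T1 where "T1 n g x = ennreal (2 * ?d / (s n * c)) * nact (wide_kernel \<epsilon> (s n)) g x" for n g x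
    note fl = frame_law_bounds[OF a wide_weight[OF a]]
    have T1p: "positive_op (ennreal (2 * ?d / (s n * c)) * ennreal ((\<alpha> / 2 ^ n) ^ ?d)) (T1 n)" for n
      unfolding T1_def wide_kernel_def by (rule positive_op_cmult[OF fl(2)])
    have T1s: "smoothing_op (ennreal (2 * ?d / (s n * c)) * ennreal ((\<alpha> / 2 ^ n / (s n * c)) ^ ?d)) (T1 n)" for n
      unfolding T1_def wide_kernel_def by (rule smoothing_op_cmult[OF fl(3)])
    have pos: "0 \<le> 2 * ?d / (s n * c)" "0 \<le> (\<alpha> / 2 ^ n) ^ ?d" "0 \<le> (\<alpha> / 2 ^ n / (s n * c)) ^ ?d" for n
      using s(1)[of n] c \<alpha> by auto
    have v1: "of_nat (N * 2 ^ n) ^ ?d * (ennreal (2 * ?d / (s n * c)) * ennreal ((\<alpha> / 2 ^ n) ^ ?d)) \<le> ennreal (C0 * (1 / s n))" for n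
    proof -
      have "(real N * 2 ^ n) ^ ?d * (2 * ?d / (s n * c) * (\<alpha> / 2 ^ n) ^ ?d)
          = ((real N * 2 ^ n) ^ ?d * (\<alpha> / 2 ^ n) ^ ?d) * (2 * ?d / c) * (1 / s n)"
        by (simp add: mult_ac)
      also have "\<dots> \<le> C0 * (1 / s n)"
        unfolding e1 P_def[symmetric] using s(1)[of n] by (intro mult_right_mono Ca) auto
      finally show ?thesis
        using v'[OF pos(1)[of n], of _ n] pos[of n] by (simp only: ennreal_leI)
    qed
    have v2: "of_nat (N * 2 ^ n) ^ ?d * (ennreal (2 * ?d / (s n * c)) * ennreal ((\<alpha> / 2 ^ n / (s n * c)) ^ ?d))
        \<le> ennreal (C0 * (1 / s n ^ (?d + 1)))" for n
    proof -
      have "(real N * 2 ^ n) ^ ?d * (2 * ?d / (s n * c) * (\<alpha> / 2 ^ n / (s n * c)) ^ ?d)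
          = ((real N * 2 ^ n) ^ ?d * (\<alpha> / 2 ^ n) ^ ?d) * (2 * ?d / c) * (1 / c) ^ ?d * (1 / s n ^ (?d + 1))"
        unfolding e2 by (simp add: mult_ac)
      also have "\<dots> \<le> C0 * (1 / s n ^ (?d + 1))"
        unfolding e1 P_def[symmetric] using s(1)[of n] by (intro mult_right_mono Ca) auto
      finally show ?thesis
        using v'[OF pos(1)[of n], of _ n] pos[of n] by (simp only: ennreal_leI)
    qed
    have qQ: "q \<le> Q" "q ^ ?d \<le> Q" "q ^ (?d + 1) \<le> Q"
      using q_gt_1 power_increasing[of 1 "?d + 1" q] power_increasing[of ?d "?d + 1" q] by (auto simp: Q_def)
    have step: "1 / s n ^ k \<le> Q * (1 / s (Suc n) ^ k)" if "q ^ k \<le> Q" for n k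
    proof -
      have "1 / s n ^ k = q ^ k * (1 / s (Suc n) ^ k)"
        using q0 by (simp add: s(2) power_mult_distrib)
      also have "\<dots> \<le> Q * (1 / s (Suc n) ^ k)" using that s(1)[of "Suc n"] by (intro mult_right_mono) auto
      finally show ?thesis .
    qed
    have s0: "0 \<le> s n" "0 \<le> s n ^ k" for n k using s(1)[of n] by (auto intro: less_imp_le)
    have "\<exists>\<Theta>. \<forall>n. positive_op (ennreal (2 * C0 * Q * (1 / s n))) (\<Theta> n)
      \<and> smoothing_op (ennreal (2 * C0 * Q * (1 / s n ^ (?d + 1)))) (\<Theta> n)
      \<and> (\<forall>h g B x. bounded_borel h \<longrightarrow> g \<in> borel_measurable borel \<longrightarrow> 
           (\<forall>n x. ennreal \<bar>act (kernel \<epsilon> (s n)) h x\<bar> \<le> T1 n g x) \<longrightarrow> (\<forall>x. \<bar>h x\<bar> \<le> B) \<longrightarrow>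
           ennreal \<bar>(act ?M ^^ (L * 2 ^ n)) h x\<bar> \<le> \<Theta> n g x + ennreal (r ^ n * B))"
      using step[of 1] step[of "?d + 1"] qQ s0 C0
      by (intro smoothing_recursion[OF M Vp Wp VWle Kc Kb T1p T1s v1 v2 _ _ _ _ r(1) r(3) _ Q])
        (auto simp del: power_Suc)
    then obtain \<Theta> where \<Theta>: "\<forall>n. positive_op (ennreal (2 * C0 * Q * (1 / s n))) (\<Theta> n)
      \<and> smoothing_op (ennreal (2 * C0 * Q * (1 / s n ^ (?d + 1)))) (\<Theta> n)
      \<and> (\<forall>h g B x. bounded_borel h \<longrightarrow> g \<in> borel_measurable borel \<longrightarrow> 
           (\<forall>n x. ennreal \<bar>act (kernel \<epsilon> (s n)) h x\<bar> \<le> T1 n g x) \<longrightarrow> (\<forall>x. \<bar>h x\<bar> \<le> B) \<longrightarrow>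
           ennreal \<bar>(act ?M ^^ (L * 2 ^ n)) h x\<bar> \<le> \<Theta> n g x + ennreal (r ^ n * B))"
      by (elim exE)
    note \<Theta>p = \<Theta>[rule_format, THEN conjunct1] and \<Theta>s = \<Theta>[rule_format, THEN conjunct2, THEN conjunct1]
      and \<Theta>le = \<Theta>[rule_format, THEN conjunct2, THEN conjunct2, rule_format]

    \<comment> \<open>A second recursion, without a derivative to move, is prepared for the term
      \<open>f\<close> left over in the telescoping sum; it yields decay like
      \<open>1 / s ^ d\<close>.\<close>
    define T0 where "T0 n = nact (kernel \<epsilon> (s n))" for n
    note kl = frame_law_bounds[OF a chi_weight[OF a]]
    have T0p: "positive_op (ennreal ((\<alpha> / 2 ^ n) ^ ?d)) (T0 n)" for n
      unfolding T0_def kernel_def by (rule kl(2))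
    have T0s: "smoothing_op (ennreal ((\<alpha> / 2 ^ n / (s n * c)) ^ ?d)) (T0 n)" for n
      unfolding T0_def kernel_def by (rule kl(3))
    have v3: "of_nat (N * 2 ^ n) ^ ?d * ennreal ((\<alpha> / 2 ^ n) ^ ?d) \<le> ennreal (C0 * 1)" for n
      using pos[of n] Ca(3) by (subst v) (auto simp: e1 P_def intro: ennreal_leI)
    have v4: "of_nat (N * 2 ^ n) ^ ?d * ennreal ((\<alpha> / 2 ^ n / (s n * c)) ^ ?d) \<le> ennreal (C0 * (1 / s n ^ ?d))" for n
    proof -
      have "(real N * 2 ^ n) ^ ?d * (\<alpha> / 2 ^ n / (s n * c)) ^ ?d
          = ((real N * 2 ^ n) ^ ?d * (\<alpha> / 2 ^ n) ^ ?d) * (1 / c) ^ ?d * (1 / s n ^ ?d)"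
        unfolding e2 by (simp add: mult_ac)
      also have "\<dots> \<le> C0 * (1 / s n ^ ?d)"
        unfolding e1 P_def[symmetric] using s(1)[of n] by (intro mult_right_mono Ca) auto
      finally show ?thesis
        using pos[of n] by (subst v) (auto intro: ennreal_leI)
    qed
    have "\<exists>\<Theta>. \<forall>n. positive_op (ennreal (2 * C0 * Q * 1)) (\<Theta> n)
      \<and> smoothing_op (ennreal (2 * C0 * Q * (1 / s n ^ ?d))) (\<Theta> n)
      \<and> (\<forall>h g B x. bounded_borel h \<longrightarrow> g \<in> borel_measurable borel \<longrightarrow> 
           (\<forall>n x. ennreal \<bar>act (kernel \<epsilon> (s n)) h x\<bar> \<le> T0 n g x) \<longrightarrow> (\<forall>x. \<bar>h x\<bar> \<le> B) \<longrightarrow>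
           ennreal \<bar>(act ?M ^^ (L * 2 ^ n)) h x\<bar> \<le> \<Theta> n g x + ennreal (r ^ n * B))"
      using step[of ?d] qQ s0 C0 Q
      by (intro smoothing_recursion[OF M Vp Wp VWle Kc Kb T0p T0s v3 v4 _ _ _ _ r(1) r(3) _ Q]) auto
    then obtain \<Theta>0 where \<Theta>0: "\<forall>n. positive_op (ennreal (2 * C0 * Q * 1)) (\<Theta>0 n)
      \<and> smoothing_op (ennreal (2 * C0 * Q * (1 / s n ^ ?d))) (\<Theta>0 n)
      \<and> (\<forall>h g B x. bounded_borel h \<longrightarrow> g \<in> borel_measurable borel \<longrightarrow> 
           (\<forall>n x. ennreal \<bar>act (kernel \<epsilon> (s n)) h x\<bar> \<le> T0 n g x) \<longrightarrow> (\<forall>x. \<bar>h x\<bar> \<le> B) \<longrightarrow>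
           ennreal \<bar>(act ?M ^^ (L * 2 ^ n)) h x\<bar> \<le> \<Theta>0 n g x + ennreal (r ^ n * B))"
      by (elim exE)
    note \<Theta>0s = \<Theta>0[rule_format, THEN conjunct2, THEN conjunct1]
      and \<Theta>0le = \<Theta>0[rule_format, THEN conjunct2, THEN conjunct2, rule_format]

    \<comment> \<open>Up to the error \<open>e\<close> below, \<open>w\<close> is
      \<open>\<rho> * (act ?M f - f)\<close>. The reciprocal is the time that one step of the walk
      represents.\<close>
    define \<rho> where "\<rho> = rate \<epsilon> * \<alpha>"
    have \<rho>: "0 < \<rho>" "1 / \<rho> = \<epsilon> powr \<alpha> / mass"
      using rate_pos[OF \<epsilon>] \<alpha> \<epsilon> mass_pos by (auto simp: \<rho>_def rate_def powr_minus_divide)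
    define T where "T n g x = (\<Sum>j<L * 2 ^ n. ennreal (1 / \<rho>) * (nact ?M ^^ j) (\<Theta> n g) x)" for n g x
    have Mj: "positive_op 1 (nact ?M ^^ j)" for j
      using positive_op_pow[OF nact_positive_op_mono[OF M], of j] by simp
    have sum_const: "(\<Sum>j<L * 2 ^ n. ennreal (1 / \<rho>) * (1 * ennreal t)) = ennreal (L * 2 ^ n / \<rho> * t)"
      if "0 \<le> t" for n t
    proof -
      have "ennreal (1 / \<rho>) * (1 * ennreal t) = ennreal (1 / \<rho> * t)"
        using \<rho>(1) by (subst ennreal_mult') auto
      then have "(\<Sum>j<L * 2 ^ n. ennreal (1 / \<rho>) * (1 * ennreal t)) = of_nat (L * 2 ^ n) * ennreal (1 / \<rho> * t)"
        by (simp only: sum_constant card_lessThan)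
      also have "\<dots> = ennreal (real (L * 2 ^ n) * (1 / \<rho> * t))"
        using that \<rho>(1) by (simp only: ennreal_of_nat_eq_real_of_nat ennreal_mult'[symmetric] of_nat_0_le_iff)
      finally show ?thesis by simp
    qed
    \<comment> \<open>Number of steps times time per step:
      \<open>\<epsilon> powr \<alpha> * 2 ^ n\<close> is \<open>s n powr \<alpha>\<close>, and the
      cutoff no longer appears.\<close>
    have LK: "L * 2 ^ n / \<rho> * (2 * C0 * Q * t) \<le> K * (s n powr \<alpha> * t)" if "0 \<le> t" for n t
    proof -
      have "L * 2 ^ n / \<rho> * (2 * C0 * Q * t) = 2 * C0 * Q * L * 2 ^ n * t * (1 / \<rho>)" by simp
      also have "\<dots> = 2 * C0 * Q * L / mass * ((\<epsilon> powr \<alpha> * 2 ^ n) * t)" unfolding \<rho>(2) by simp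
      also have "\<epsilon> powr \<alpha> * 2 ^ n = s n powr \<alpha>" using a[of n] by (simp add: at_scale_def)
      also have "2 * C0 * Q * L / mass * (s n powr \<alpha> * t) \<le> K * (s n powr \<alpha> * t)"
        using that by (intro mult_right_mono K) auto
      finally show ?thesis .
    qed
    have Tp: "positive_op (ennreal (K * s n powr (\<alpha> - 1))) (T n)" for n
    proof -
      have t: "0 \<le> 2 * C0 * Q * (1 / s n)" using C0 Q s(1)[of n] by simp
      have "positive_op (\<Sum>j<L * 2 ^ n. ennreal (1 / \<rho>) * (1 * ennreal (2 * C0 * Q * (1 / s n)))) (T n)"
        unfolding T_def by (intro positive_op_sum positive_op_cmult positive_op_comp[OF Mj \<Theta>p]) auto
      then have "positive_op (ennreal (L * 2 ^ n / \<rho> * (2 * C0 * Q * (1 / s n)))) (T n)"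
        unfolding sum_const[OF t] .
      moreover have "L * 2 ^ n / \<rho> * (2 * C0 * Q * (1 / s n)) \<le> K * s n powr (\<alpha> - 1)"
        using LK[of "1 / s n" n] s(1)[of n] by (simp add: powr_diff)
      ultimately show ?thesis by (elim positive_op_mono) (rule ennreal_leI)
    qed
    have Ts: "smoothing_op (ennreal (K * s n powr (\<alpha> - 1 - ?d))) (T n)" for n
    proof -
      have t: "0 \<le> 2 * C0 * Q * (1 / s n ^ (?d + 1))" using C0 Q s(1)[of n] by simp
      have "smoothing_op (\<Sum>j<L * 2 ^ n. ennreal (1 / \<rho>) * (1 * ennreal (2 * C0 * Q * (1 / s n ^ (?d + 1))))) (T n)"
        unfolding T_def by (intro smoothing_op_sum smoothing_op_cmult smoothing_op_comp_left[OF Mj \<Theta>p \<Theta>s]) auto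
      then have "smoothing_op (ennreal (L * 2 ^ n / \<rho> * (2 * C0 * Q * (1 / s n ^ (?d + 1))))) (T n)"
        unfolding sum_const[OF t] .
      moreover have "L * 2 ^ n / \<rho> * (2 * C0 * Q * (1 / s n ^ (?d + 1))) \<le> K * s n powr (\<alpha> - 1 - ?d)"
      proof -
        have "s n powr (\<alpha> - 1 - ?d) = s n powr \<alpha> * (1 / s n ^ (?d + 1))"
          using s(1)[of n] by (simp add: powr_diff powr_realpow)
        then show ?thesis using LK[of "1 / s n ^ (?d + 1)" n] s(1)[of n] by simp
      qed
      ultimately show ?thesis by (elim smoothing_op_mono) (rule ennreal_leI)
    qed
    show "\<exists>T. (\<forall>n. positive_op (ennreal (K * (\<epsilon> * q ^ n) powr (\<alpha> - 1))) (T n)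
        \<and> smoothing_op (ennreal (K * (\<epsilon> * q ^ n) powr (\<alpha> - 1 - ?d))) (T n)) \<and>
     (\<forall>f w F G E B Bf I M x. bounded_borel f \<longrightarrow> bounded_borel w \<longrightarrow> F \<in> borel_measurable borel \<longrightarrow>
        divergence_pair F G w \<longrightarrow> (\<forall>x. \<bar>f x\<bar> \<le> Bf) \<longrightarrow> (\<forall>x. \<bar>w x\<bar> \<le> B) \<longrightarrow>
        (\<integral>\<^sup>+x. ennreal \<bar>f x\<bar> \<partial>lborel) \<le> ennreal I \<longrightarrow> 0 \<le> I \<longrightarrow>
        (\<forall>x. \<bar>rate \<epsilon> * \<alpha> * (act ?M f x - f x) - w x\<bar> \<le> E) \<longrightarrow>
        ennreal \<bar>f x\<bar> \<le> (\<Sum>n<M. T n (\<lambda>x. ennreal (norm (F x))) x)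
          + ennreal (K * \<epsilon> powr \<alpha> * (B + 2 ^ M * E) + K * I / (\<epsilon> * q ^ M) ^ ?d + r ^ M * Bf))"
    proof (rule exI[of _ T], intro conjI allI impI)
      fix n
      show "positive_op (ennreal (K * (\<epsilon> * q ^ n) powr (\<alpha> - 1))) (T n)" using Tp by (simp add: s_def)
      show "smoothing_op (ennreal (K * (\<epsilon> * q ^ n) powr (\<alpha> - 1 - ?d))) (T n)" using Ts by (simp add: s_def)
    next
      fix f w F G E B Bf I m x
      assume f: "bounded_borel f" and w: "bounded_borel w" and Fm: "F \<in> borel_measurable borel"
        and F: "divergence_pair F G w" and Bf: "\<forall>x. \<bar>f x\<bar> \<le> Bf" and B: "\<forall>x. \<bar>w x\<bar> \<le> B"
        and I: "(\<integral>\<^sup>+x. ennreal \<bar>f x\<bar> \<partial>lborel) \<le> ennreal I" "0 \<le> I"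
        and E: "\<forall>x. \<bar>rate \<epsilon> * \<alpha> * (act ?M f x - f x) - w x\<bar> \<le> E"
      let ?g = "\<lambda>x. ennreal (norm (F x))"
      have g: "?g \<in> borel_measurable borel" using Fm by measurable
      have B0: "0 \<le> B" "0 \<le> E" "0 \<le> Bf"
        using B[rule_format, of x] E[rule_format, of x] Bf[rule_format, of x] by linarith+
      \<comment> \<open>The consistency error of the truncated generator. Powers of a probability
        measure do not increase its supremum, so every step of the walk adds at most
        \<open>E / \<rho>\<close>.\<close>
      define e where "e x = \<rho> * (act ?M f x - f x) - w x" for x
      have eb: "bounded_borel e"
        unfolding e_def[abs_def]
        by (intro bounded_borel_diff bounded_borel_cmult bounded_borel_act M f w)
      have eE: "\<bar>e x\<bar> \<le> E" for x using E by (simp add: e_def \<rho>_def)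
      have diff: "(\<lambda>x. f x - act ?M f x) = (\<lambda>x. - (1 / \<rho>) * (w x + e x))"
        using \<rho> by (auto simp: e_def field_simps)
      have pw: "ennreal \<bar>(act ?M ^^ k) (\<lambda>x. f x - act ?M f x) x\<bar>
          \<le> ennreal (1 / \<rho>) * (ennreal \<bar>(act ?M ^^ k) w x\<bar> + ennreal E)" for k
      proof -
        have "(act ?M ^^ k) (\<lambda>x. f x - act ?M f x) x = - (1 / \<rho>) * ((act ?M ^^ k) w x + (act ?M ^^ k) e x)"
          unfolding diff act_pow_cmult act_pow_add[OF M(1) w eb] ..
        then have "\<bar>(act ?M ^^ k) (\<lambda>x. f x - act ?M f x) x\<bar> = 1 / \<rho> * \<bar>(act ?M ^^ k) w x + (act ?M ^^ k) e x\<bar>"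
          using \<rho>(1) by (simp only: abs_mult abs_minus_cancel) simp
        also have "\<dots> \<le> 1 / \<rho> * (\<bar>(act ?M ^^ k) w x\<bar> + E)"
          using \<rho>(1) act_pow_bound[OF M eb eE, of k x]
          by (intro mult_left_mono order_trans[OF abs_triangle_ineq]) auto
        finally have "ennreal \<bar>(act ?M ^^ k) (\<lambda>x. f x - act ?M f x) x\<bar>
            \<le> ennreal (1 / \<rho> * (\<bar>(act ?M ^^ k) w x\<bar> + E))" by (rule ennreal_leI)
        also have "\<dots> = ennreal (1 / \<rho>) * (ennreal \<bar>(act ?M ^^ k) w x\<bar> + ennreal E)"
          using \<rho>(1) B0 by (subst ennreal_mult') (auto simp: ennreal_plus)
        finally show ?thesis .
      qed
      have w1: "ennreal \<bar>(act ?M ^^ (L * 2 ^ n)) w x\<bar> \<le> \<Theta> n ?g x + ennreal (r ^ n * B)" for n x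
      proof (rule \<Theta>le[OF w g _ B[rule_format]])
        show "ennreal \<bar>act (kernel \<epsilon> (s n)) w x\<bar> \<le> T1 n ?g x" for n x
          unfolding T1_def by (rule kernel_divergence[OF a F Fm w])
      qed
      let ?S = "\<Sum>n<m. \<Sum>j<L * 2 ^ n. (nact ?M ^^ j) (\<Theta> n ?g) x"
      have sumw: "(\<Sum>k<L * 2 ^ m. ennreal \<bar>(act ?M ^^ k) w x\<bar>) \<le> ?S + ennreal (3 * real L * B)"
        by (rule dyadic_sum_bound[OF M w B[rule_format] r(1) r(4) \<Theta>p g w1])
      have f0: "ennreal \<bar>(act ?M ^^ (L * 2 ^ m)) f x\<bar> \<le> ennreal (K * I / s m ^ ?d + r ^ m * Bf)"
      proof -
        have "ennreal \<bar>(act ?M ^^ (L * 2 ^ m)) f x\<bar> \<le> \<Theta>0 m (\<lambda>x. ennreal \<bar>f x\<bar>) x + ennreal (r ^ m * Bf)"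
          unfolding T0_def[symmetric]
          by (rule \<Theta>0le[OF f abs_measurable_ennreal[OF f] _ Bf[rule_format]])
            (simp add: T0_def act_le_nact[OF Kf f])
        also have "\<Theta>0 m (\<lambda>x. ennreal \<bar>f x\<bar>) x \<le> ennreal (2 * C0 * Q * (1 / s m ^ ?d)) * (\<integral>\<^sup>+x. ennreal \<bar>f x\<bar> \<partial>lborel)"
          by (rule smoothing_opD[OF \<Theta>0s abs_measurable_ennreal[OF f]])
        also have "\<dots> \<le> ennreal (2 * C0 * Q * (1 / s m ^ ?d)) * ennreal I"
          by (intro mult_left_mono I) auto
        also have "\<dots> = ennreal (2 * C0 * Q * (1 / s m ^ ?d) * I)"
          using C0 Q s(1)[of m] by (intro ennreal_mult'[symmetric]) auto
        also have "\<dots> \<le> ennreal (K * (1 / s m ^ ?d) * I)"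
          using s(1)[of m] I by (intro ennreal_leI mult_right_mono K) auto
        finally have "ennreal \<bar>(act ?M ^^ (L * 2 ^ m)) f x\<bar> \<le> ennreal (K * (1 / s m ^ ?d) * I) + ennreal (r ^ m * Bf)"
          by (simp add: add_right_mono)
        also have "\<dots> = ennreal (K * I / s m ^ ?d + r ^ m * Bf)"
          using K(1) I s(1)[of m] r(1) B0 by (subst ennreal_plus[symmetric]) auto
        finally show ?thesis .
      qed
      \<comment> \<open>Telescoping up to the end of the last block. The sum is handled by the first
        recursion and the remnant of \<open>f\<close> by the second.\<close>
      have "ennreal \<bar>f x\<bar> \<le> ennreal ((\<Sum>k<L * 2 ^ m. \<bar>(act ?M ^^ k) (\<lambda>x. f x - act ?M f x) x\<bar>)
          + \<bar>(act ?M ^^ (L * 2 ^ m)) f x\<bar>)"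
      proof (rule ennreal_leI)
        have "\<bar>f x\<bar> \<le> \<bar>\<Sum>k<L * 2 ^ m. (act ?M ^^ k) (\<lambda>x. f x - act ?M f x) x\<bar> + \<bar>(act ?M ^^ (L * 2 ^ m)) f x\<bar>"
          by (subst act_pow_telescope[OF M(1) f, of x "L * 2 ^ m"]) (rule abs_triangle_ineq)
        then show "\<bar>f x\<bar> \<le> (\<Sum>k<L * 2 ^ m. \<bar>(act ?M ^^ k) (\<lambda>x. f x - act ?M f x) x\<bar>) + \<bar>(act ?M ^^ (L * 2 ^ m)) f x\<bar>"
          using sum_abs[of "\<lambda>k. (act ?M ^^ k) (\<lambda>x. f x - act ?M f x) x" "{..<L * 2 ^ m}"] by linarith
      qed
      also have "\<dots> = (\<Sum>k<L * 2 ^ m. ennreal \<bar>(act ?M ^^ k) (\<lambda>x. f x - act ?M f x) x\<bar>)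
          + ennreal \<bar>(act ?M ^^ (L * 2 ^ m)) f x\<bar>"
        by (simp add: ennreal_plus sum_nonneg sum_ennreal)
      also have "\<dots> \<le> (\<Sum>k<L * 2 ^ m. ennreal (1 / \<rho>) * (ennreal \<bar>(act ?M ^^ k) w x\<bar> + ennreal E))
          + ennreal (K * I / s m ^ ?d + r ^ m * Bf)"
        by (intro add_mono sum_mono pw f0)
      also have "(\<Sum>k<L * 2 ^ m. ennreal (1 / \<rho>) * (ennreal \<bar>(act ?M ^^ k) w x\<bar> + ennreal E))
          = ennreal (1 / \<rho>) * ((\<Sum>k<L * 2 ^ m. ennreal \<bar>(act ?M ^^ k) w x\<bar>) + of_nat (L * 2 ^ m) * ennreal E)"
        by (simp add: sum_distrib_left[symmetric] sum.distrib)
      also have "\<dots> \<le> ennreal (1 / \<rho>) * ((?S + ennreal (3 * real L * B)) + of_nat (L * 2 ^ m) * ennreal E)"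
        by (intro mult_left_mono add_right_mono sumw) auto
      also have "\<dots> = (\<Sum>n<m. T n ?g x) + ennreal (1 / \<rho> * (3 * real L * B + L * 2 ^ m * E))"
      proof -
        have "of_nat (L * 2 ^ m) * ennreal E = ennreal (real (L * 2 ^ m) * E)"
          by (simp only: ennreal_of_nat_eq_real_of_nat ennreal_mult'[symmetric] of_nat_0_le_iff)
        then have "ennreal (3 * real L * B) + of_nat (L * 2 ^ m) * ennreal E = ennreal (3 * real L * B + L * 2 ^ m * E)"
          using B0 by (simp only:) (subst ennreal_plus[symmetric], auto)
        moreover have "ennreal (1 / \<rho>) * ?S = (\<Sum>n<m. T n ?g x)"
          by (simp add: T_def sum_distrib_left)
        moreover have "ennreal (1 / \<rho>) * ennreal (3 * real L * B + L * 2 ^ m * E)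
            = ennreal (1 / \<rho> * (3 * real L * B + L * 2 ^ m * E))"
          using \<rho>(1) by (intro ennreal_mult'[symmetric]) auto
        ultimately show ?thesis
          by (simp only: add.assoc distrib_left[of "ennreal (1 / \<rho>)"])
      qed
      also have "ennreal (1 / \<rho> * (3 * real L * B + L * 2 ^ m * E)) \<le> ennreal (K * \<epsilon> powr \<alpha> * (B + 2 ^ m * E))"
      proof (rule ennreal_leI)
        have "1 / \<rho> * (3 * real L * B + L * 2 ^ m * E) = \<epsilon> powr \<alpha> * (3 * L / mass * B + L / mass * (2 ^ m * E))"
          unfolding \<rho>(2) by (simp add: algebra_simps add_divide_distrib)
        also have "\<dots> \<le> \<epsilon> powr \<alpha> * (K * B + K * (2 ^ m * E))"
        proof (intro mult_left_mono add_mono mult_right_mono K)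
          have "L / mass \<le> 3 * L / mass" using mass_pos by (intro divide_right_mono) auto
          then show "L / mass \<le> K" using K(2) by linarith
        qed (use B0 in auto)
        finally show "1 / \<rho> * (3 * real L * B + L * 2 ^ m * E) \<le> K * \<epsilon> powr \<alpha> * (B + 2 ^ m * E)"
          by (simp add: algebra_simps)
      qed
      finally have "ennreal \<bar>f x\<bar> \<le> (\<Sum>n<m. T n ?g x) + ennreal (K * \<epsilon> powr \<alpha> * (B + 2 ^ m * E))
          + ennreal (K * I / s m ^ ?d + r ^ m * Bf)"
        by (simp add: add_mono)
      also have "\<dots> = (\<Sum>n<m. T n ?g x) + ennreal (K * \<epsilon> powr \<alpha> * (B + 2 ^ m * E) + K * I / s m ^ ?d + r ^ m * Bf)"
        using K(1) B0 I s(1)[of m] r(1) by (simp add: add.assoc ennreal_plus[symmetric] del: ennreal_plus)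
      finally show "ennreal \<bar>f x\<bar> \<le> (\<Sum>n<m. T n ?g x)
          + ennreal (K * \<epsilon> powr \<alpha> * (B + 2 ^ m * E) + K * I / (\<epsilon> * q ^ m) ^ ?d + r ^ m * Bf)"
        by (simp add: s_def)
    qed
  qed
qed

end

section \<open>The Sobolev bound from a resolvent identity\<close>

lemma divergence_pair_scale:
  assumes "divergence_pair F G w"
  shows "divergence_pair (\<lambda>x. k *\<^sub>R F x) (\<lambda>x v. k *\<^sub>R G x v) (\<lambda>x. k * w x)"
  unfolding divergence_pair_def
proof (intro conjI allI impI)
  fix z v t
  show "((\<lambda>t. k *\<^sub>R F (z + t *\<^sub>R v)) has_vector_derivative k *\<^sub>R G (z + t *\<^sub>R v) v) (at t)"
    using assms
    by (intro bounded_linear.has_vector_derivative[OF bounded_linear_scaleR_right]) (simp add: divergence_pair_def)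
next
  fix v
  show "continuous_on UNIV (\<lambda>z. k *\<^sub>R G z v)"
    using assms by (intro continuous_intros) (simp add: divergence_pair_def)
  obtain B where "\<forall>z. norm (G z v) \<le> B" using assms unfolding divergence_pair_def by blast
  then have "\<forall>z. norm (k *\<^sub>R G z v) \<le> \<bar>k\<bar> * B" by (simp add: mult_left_mono)
  then show "\<exists>B. \<forall>z. norm (k *\<^sub>R G z v) \<le> B" by blast
next
  fix y R :: "'a \<Rightarrow> 'a" and z
  assume R: "linear R" "\<forall>u. (\<Sum>b\<in>Basis. (R u \<bullet> b) *\<^sub>R y b) = u"
  then have "w z = (\<Sum>b\<in>Basis. R (G z (y b)) \<bullet> b)" using assms by (simp add: divergence_pair_def)
  then show "k * w z = (\<Sum>b\<in>Basis. R (k *\<^sub>R G z (y b)) \<bullet> b)"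
    by (simp add: linear_cmul[OF R(1)] sum_distrib_left)
qed

context polar_frame
begin

text \<open>The total mass of \<open>\<nu>\<close> on jumps longer than \<open>\<epsilon>\<close> is \<open>rate \<epsilon>\<close>, so the last clause says that \<open>w\<close> is \<open>\<alpha>\<close> times
  the generator applied to \<open>f\<close>, with a rate of convergence of the truncations.\<close>

definition resolvent_data ::
    "('a \<Rightarrow> real) \<Rightarrow> ('a \<Rightarrow> 'a) \<Rightarrow> ('a \<Rightarrow> 'a \<Rightarrow> 'a) \<Rightarrow> ('a \<Rightarrow> real) \<Rightarrow> bool" where
  "resolvent_data f F G w \<longleftrightarrow> bounded_borel f \<and> (\<integral>\<^sup>+x. ennreal \<bar>f x\<bar> \<partial>lborel) < \<infinity> \<and> bounded_borel w \<and>
     F \<in> borel_measurable borel \<and> divergence_pair F G w \<and>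
     (\<exists>E. \<forall>\<epsilon>>0. \<forall>x. \<bar>rate \<epsilon> * \<alpha> * (act (jump_law \<epsilon>) f x - f x) - w x\<bar> \<le> E * \<epsilon> powr (2 - \<alpha>))"

lemma resolvent_data_scale:
  assumes "resolvent_data f F G w"
  shows "resolvent_data (\<lambda>x. k * f x) (\<lambda>x. k *\<^sub>R F x) (\<lambda>x v. k *\<^sub>R G x v) (\<lambda>x. k * w x)"
proof -
  from assms have f: "bounded_borel f" "(\<integral>\<^sup>+x. ennreal \<bar>f x\<bar> \<partial>lborel) < \<infinity>" and w: "bounded_borel w"
    and [measurable]: "F \<in> borel_measurable borel" and F: "divergence_pair F G w" by (auto simp: resolvent_data_def)
  have [measurable]: "f \<in> borel_measurable borel" by (rule bounded_borel_measurable[OF f(1)])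
  obtain E where E: "\<And>\<epsilon> x. 0 < \<epsilon> \<Longrightarrow> \<bar>rate \<epsilon> * \<alpha> * (act (jump_law \<epsilon>) f x - f x) - w x\<bar> \<le> E * \<epsilon> powr (2 - \<alpha>)"
    using assms unfolding resolvent_data_def by blast
  have "(\<integral>\<^sup>+x. ennreal \<bar>k * f x\<bar> \<partial>lborel) = ennreal \<bar>k\<bar> * (\<integral>\<^sup>+x. ennreal \<bar>f x\<bar> \<partial>lborel)"
    by (simp add: abs_mult ennreal_mult' nn_integral_cmult)
  also have "\<dots> < \<infinity>" using f(2) by (simp add: ennreal_mult_less_top)
  finally have "(\<integral>\<^sup>+x. ennreal \<bar>k * f x\<bar> \<partial>lborel) < \<infinity>" .
  moreover have "\<bar>rate \<epsilon> * \<alpha> * (act (jump_law \<epsilon>) (\<lambda>x. k * f x) x - k * f x) - k * w x\<bar> \<le> \<bar>k\<bar> * E * \<epsilon> powr (2 - \<alpha>)"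
    if "0 < \<epsilon>" for \<epsilon> x
  proof -
    have "rate \<epsilon> * \<alpha> * (act (jump_law \<epsilon>) (\<lambda>x. k * f x) x - k * f x) - k * w x
        = k * (rate \<epsilon> * \<alpha> * (act (jump_law \<epsilon>) f x - f x) - w x)"
      by (simp add: act_cmult algebra_simps)
    then show ?thesis using mult_left_mono[OF E[OF that, of x], of "\<bar>k\<bar>"] by (simp add: abs_mult)
  qed
  ultimately show ?thesis
    unfolding resolvent_data_def
    by (intro conjI bounded_borel_cmult f w divergence_pair_scale F exI[of _ "\<bar>k\<bar> * E"]) auto
qed

text \<open>The data constants \<open>B\<close>, \<open>E\<close>, \<open>I\<close> and
  \<open>Bf\<close> depend on \<open>f\<close> but enter only through errors that vanish in the
  limit. The interpolation then sees nothing but the operators, whose bounds are uniform.\<close>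

lemma sobolev_normalized:
  fixes p :: real
  assumes p: "1 < p" "p * (\<alpha> - 1) < DIM('a)"
  shows "\<exists>C>0. \<forall>f F G w. resolvent_data f F G w \<longrightarrow> (\<integral>\<^sup>+x. ennreal (norm (F x) powr p) \<partial>lborel) \<le> 1 \<longrightarrow>
     (\<integral>\<^sup>+x. ennreal (\<bar>f x\<bar> powr (p * DIM('a) / (DIM('a) - p * (\<alpha> - 1)))) \<partial>lborel) \<le> ennreal C"
proof -
  let ?d = "real DIM('a)"
  define ps where "ps = p * ?d / (?d - p * (\<alpha> - 1))"
  obtain K r where K: "0 < K" and r: "0 \<le> r" "r \<le> 1 / 4" and dec: "\<forall>\<epsilon>>0. \<exists>T.
     (\<forall>n. positive_op (ennreal (K * (\<epsilon> * q ^ n) powr (\<alpha> - 1))) (T n)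
        \<and> smoothing_op (ennreal (K * (\<epsilon> * q ^ n) powr (\<alpha> - 1 - ?d))) (T n)) \<and>
     (\<forall>f w F G E B Bf I M x. bounded_borel f \<longrightarrow> bounded_borel w \<longrightarrow> F \<in> borel_measurable borel \<longrightarrow>
        divergence_pair F G w \<longrightarrow> (\<forall>x. \<bar>f x\<bar> \<le> Bf) \<longrightarrow> (\<forall>x. \<bar>w x\<bar> \<le> B) \<longrightarrow>
        (\<integral>\<^sup>+x. ennreal \<bar>f x\<bar> \<partial>lborel) \<le> ennreal I \<longrightarrow> 0 \<le> I \<longrightarrow>
        (\<forall>x. \<bar>rate \<epsilon> * \<alpha> * (act (jump_law \<epsilon>) f x - f x) - w x\<bar> \<le> E) \<longrightarrow>
        ennreal \<bar>f x\<bar> \<le> (\<Sum>n<M. T n (\<lambda>x. ennreal (norm (F x))) x)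
          + ennreal (K * \<epsilon> powr \<alpha> * (B + 2 ^ M * E) + K * I / (\<epsilon> * q ^ M) ^ DIM('a) + r ^ M * Bf))"
    using decomposition_at_scale by (elim exE conjE)
  define K' where "K' = 2 * K / (1 - q powr - (?d / p - (\<alpha> - 1))) + K / (1 - q powr - (\<alpha> - 1))"
  define C where "C = (4 * K') powr ps * (p / (p - 1))"
  have bound: "(\<integral>\<^sup>+x. ennreal (\<bar>f x\<bar> powr ps) \<partial>lborel) \<le> ennreal C"
    if data: "resolvent_data f F G w" and int: "(\<integral>\<^sup>+x. ennreal (norm (F x) powr p) \<partial>lborel) \<le> 1" for f F G w
  proof -
    from data have f: "bounded_borel f" "(\<integral>\<^sup>+x. ennreal \<bar>f x\<bar> \<partial>lborel) < \<infinity>" and w: "bounded_borel w"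
      and Fm [measurable]: "F \<in> borel_measurable borel" and F: "divergence_pair F G w" by (auto simp: resolvent_data_def)
    obtain E where E: "\<And>\<epsilon> x. 0 < \<epsilon> \<Longrightarrow> \<bar>rate \<epsilon> * \<alpha> * (act (jump_law \<epsilon>) f x - f x) - w x\<bar> \<le> E * \<epsilon> powr (2 - \<alpha>)"
      using data unfolding resolvent_data_def by blast
    obtain Bf where Bf: "\<forall>x. \<bar>f x\<bar> \<le> Bf" using f(1) by (auto simp: bounded_borel_def)
    obtain B where B: "\<forall>x. \<bar>w x\<bar> \<le> B" using w by (auto simp: bounded_borel_def)
    obtain I where I: "0 \<le> I" "(\<integral>\<^sup>+x. ennreal \<bar>f x\<bar> \<partial>lborel) = ennreal I"
      using f(2) by (cases "\<integral>\<^sup>+x. ennreal \<bar>f x\<bar> \<partial>lborel") auto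
    \<comment> \<open>With \<open>\<epsilon> = X ^ M\<close>, that is
      \<open>2 powr (- \<theta> * M)\<close>, two demands compete:
      \<open>2 ^ M * \<epsilon>\<^sup>2\<close> must tend to zero, which needs
      \<open>\<theta> > 1 / 2\<close>, and the largest scale \<open>\<epsilon> * q ^ M\<close> must
      tend to infinity, which needs \<open>\<theta> < 1 / \<alpha>\<close>. Since
      \<open>\<alpha> < 2\<close> there is room, and the midpoint is taken.\<close>
    define \<theta> where "\<theta> = (1 / 2 + 1 / \<alpha>) / 2"
    have "1 / 2 < 1 / \<alpha>" using \<alpha> by (simp add: field_simps)
    then have \<theta>: "1 / 2 < \<theta>" "\<theta> < 1 / \<alpha>" by (auto simp: \<theta>_def)
    define X where "X = (2::real) powr - \<theta>"
    have X0: "0 < X" by (simp add: X_def)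
    have "X powr \<alpha> = 2 powr (- \<theta> * \<alpha>)" by (simp add: X_def powr_powr)
    also have "\<dots> < 2 powr 0" using \<theta> \<alpha> by (intro powr_less_mono) (auto simp: zero_less_mult_iff)
    finally have x1: "X powr \<alpha> < 1" by simp
    have "2 * X ^ 2 = 2 powr (1 - 2 * \<theta>)"
    proof -
      have "X ^ 2 = 2 powr (- 2 * \<theta>)"
        by (simp add: X_def power2_eq_square powr_add[symmetric])
      then show ?thesis using powr_add[of 2 1 "- 2 * \<theta>"] by simp
    qed
    also have "\<dots> < 2 powr 0" using \<theta> by (intro powr_less_mono) auto
    finally have x2: "2 * X ^ 2 < 1" by simp
    have q0: "0 < q" using q_gt_1 by simp
    have "X * q = 2 powr (1 / \<alpha> - \<theta>)" by (simp add: X_def q_def powr_add[symmetric])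
    then have xq: "1 < X * q" using \<theta> by simp
    define Y where "Y = (1 / (X * q)) ^ DIM('a)"
    have Y: "0 \<le> Y" "Y < 1" using xq by (auto simp: Y_def power_less_one_iff)
    define err where "err M = K * B * (X powr \<alpha>) ^ M + K * E * (2 * X ^ 2) ^ M + K * I * Y ^ M + r ^ M * Bf" for M :: nat
    have "err \<longlonglongrightarrow> K * B * 0 + K * E * 0 + K * I * 0 + 0 * Bf"
      unfolding err_def using x1 x2 Y r X0
      by (intro tendsto_intros LIMSEQ_power_zero) auto
    then have err0: "err \<longlonglongrightarrow> 0" by simp
    show ?thesis
      unfolding C_def K'_def ps_def
    proof (rule strong_type_of_dyadic_decomposition[where g = "\<lambda>x. norm (F x)"])
      fix \<eta> :: real assume "0 < \<eta>"
      then have "\<forall>\<^sub>F M in sequentially. err M < \<eta>" by (rule order_tendstoD(2)[OF err0])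
      then obtain M where M: "err M < \<eta>" using eventually_happens'[OF sequentially_bot] by blast
      define \<epsilon> where "\<epsilon> = X ^ M"
      have \<epsilon>: "0 < \<epsilon>" using X0 by (simp add: \<epsilon>_def)
      obtain T where T: "\<forall>n. positive_op (ennreal (K * (\<epsilon> * q ^ n) powr (\<alpha> - 1))) (T n)
        \<and> smoothing_op (ennreal (K * (\<epsilon> * q ^ n) powr (\<alpha> - 1 - ?d))) (T n)"
        and le: "\<forall>f w F G E B Bf I M x. bounded_borel f \<longrightarrow> bounded_borel w \<longrightarrow> F \<in> borel_measurable borel \<longrightarrow>
        divergence_pair F G w \<longrightarrow> (\<forall>x. \<bar>f x\<bar> \<le> Bf) \<longrightarrow> (\<forall>x. \<bar>w x\<bar> \<le> B) \<longrightarrow>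
        (\<integral>\<^sup>+x. ennreal \<bar>f x\<bar> \<partial>lborel) \<le> ennreal I \<longrightarrow> 0 \<le> I \<longrightarrow>
        (\<forall>x. \<bar>rate \<epsilon> * \<alpha> * (act (jump_law \<epsilon>) f x - f x) - w x\<bar> \<le> E) \<longrightarrow>
        ennreal \<bar>f x\<bar> \<le> (\<Sum>n<M. T n (\<lambda>x. ennreal (norm (F x))) x)
          + ennreal (K * \<epsilon> powr \<alpha> * (B + 2 ^ M * E) + K * I / (\<epsilon> * q ^ M) ^ DIM('a) + r ^ M * Bf)"
        using dec[rule_format, OF \<epsilon>] by (elim exE conjE)
      have e1: "\<epsilon> powr \<alpha> = (X powr \<alpha>) ^ M"
        using X0 by (simp add: \<epsilon>_def powr_realpow[symmetric] powr_powr mult.commute)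
      have e2: "\<epsilon> powr \<alpha> * \<epsilon> powr (2 - \<alpha>) = (X ^ 2) ^ M"
        using \<epsilon> X0 by (simp add: powr_add[symmetric] \<epsilon>_def power_mult[symmetric] mult.commute)
      have e3: "1 / (\<epsilon> * q ^ M) ^ DIM('a) = Y ^ M"
        by (simp add: \<epsilon>_def Y_def power_mult_distrib[symmetric] power_mult[symmetric] power_one_over mult.commute)
      have "K * \<epsilon> powr \<alpha> * (B + 2 ^ M * (E * \<epsilon> powr (2 - \<alpha>)))
          = K * B * \<epsilon> powr \<alpha> + K * E * (2 ^ M * (\<epsilon> powr \<alpha> * \<epsilon> powr (2 - \<alpha>)))"
        by (simp add: algebra_simps)
      then have eq: "K * \<epsilon> powr \<alpha> * (B + 2 ^ M * (E * \<epsilon> powr (2 - \<alpha>))) + K * I / (\<epsilon> * q ^ M) ^ DIM('a) + r ^ M * Bf = err M"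
        unfolding err_def e2 e3[symmetric] e1[symmetric] by (simp add: power_mult_distrib)
      have "ennreal \<bar>f x\<bar> \<le> (\<Sum>n<M. T n (\<lambda>x. ennreal (norm (F x))) x) + ennreal \<eta>" for x
      proof -
        have "ennreal \<bar>f x\<bar> \<le> (\<Sum>n<M. T n (\<lambda>x. ennreal (norm (F x))) x) + ennreal (err M)"
          unfolding eq[symmetric]
          by (rule le[rule_format, OF f(1) w Fm F Bf[rule_format] B[rule_format] eq_refl[OF I(2)] I(1) E[OF \<epsilon>]])
        also have "\<dots> \<le> (\<Sum>n<M. T n (\<lambda>x. ennreal (norm (F x))) x) + ennreal \<eta>"
          using M by (intro add_left_mono ennreal_leI) auto
        finally show ?thesis .
      qed
      then show "\<exists>\<epsilon> m T. 0 < \<epsilon> \<and>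
       (\<forall>n::nat. positive_op (ennreal (K * (\<epsilon> * q ^ n) powr (\<alpha> - 1))) (T n)
          \<and> smoothing_op (ennreal (K * (\<epsilon> * q ^ n) powr (\<alpha> - 1 - ?d))) (T n)) \<and>
       (\<forall>x. ennreal \<bar>f x\<bar> \<le> (\<Sum>n<m. T n (\<lambda>x. ennreal (norm (F x))) x) + ennreal \<eta>)"
        using \<epsilon> T by (intro exI[of _ \<epsilon>] exI[of _ M] exI[of _ T]) simp
    qed (use f p \<alpha> q_gt_1 K int in \<open>auto simp: bounded_borel_measurable\<close>)
  qed
  show ?thesis
    unfolding ps_def[symmetric]
  \<comment> \<open>The maximum provides the positivity of the constant without examining the sign
    of \<open>C\<close>.\<close>
  proof (intro exI[of _ "max 1 C"] conjI allI impI)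
    fix f F G w
    assume "resolvent_data f F G w" "(\<integral>\<^sup>+x. ennreal (norm (F x) powr p) \<partial>lborel) \<le> 1"
    then have "(\<integral>\<^sup>+x. ennreal (\<bar>f x\<bar> powr ps) \<partial>lborel) \<le> ennreal C" by (rule bound)
    also have "\<dots> \<le> ennreal (max 1 C)" by (intro ennreal_leI) simp
    finally show "(\<integral>\<^sup>+x. ennreal (\<bar>f x\<bar> powr ps) \<partial>lborel) \<le> ennreal (max 1 C)" .
  qed simp
qed

end

section \<open>Fractional gradients of test functions\<close>

text \<open>The sequential dominated convergence theorem extends to \<open>at a\<close> because the
  source is first countable. The bound is asked only away from \<open>a\<close>, as difference
  quotients require.\<close>

lemma tendsto_integral_dominated:
  fixes q :: "'b::first_countable_topology \<Rightarrow> 'a \<Rightarrow> 'c::{banach, second_countable_topology}"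
  assumes m: "\<And>h. q h \<in> borel_measurable M" "l \<in> borel_measurable M" and \<phi>: "integrable M \<phi>"
    and lim: "\<And>u. ((\<lambda>h. q h u) \<longlongrightarrow> l u) (at a)"
    and bd: "\<And>h u. h \<noteq> a \<Longrightarrow> norm (q h u) \<le> \<phi> u"
  shows "((\<lambda>h. \<integral>u. q h u \<partial>M) \<longlongrightarrow> (\<integral>u. l u \<partial>M)) (at a)"
  unfolding tendsto_at_iff_sequentially comp_def
proof (intro allI impI)
  fix X :: "nat \<Rightarrow> 'b" assume X: "\<forall>i. X i \<in> UNIV - {a}" "X \<longlonglongrightarrow> a"
  show "(\<lambda>i. \<integral>u. q (X i) u \<partial>M) \<longlonglongrightarrow> (\<integral>u. l u \<partial>M)"
  proof (rule integral_dominated_convergence[OF m(2) m(1) \<phi>])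
    show "AE u in M. (\<lambda>i. q (X i) u) \<longlonglongrightarrow> l u"
      using lim X unfolding tendsto_at_iff_sequentially comp_def by (intro AE_I2) blast
    show "AE u in M. norm (q (X i) u) \<le> \<phi> u" for i using X(1) bd by (intro AE_I2) auto
  qed
qed

lemma has_vector_derivative_of_quotient:
  fixes g :: "real \<Rightarrow> 'a::real_normed_vector"
  assumes "((\<lambda>\<tau>. (g \<tau> - g t) /\<^sub>R (\<tau> - t)) \<longlongrightarrow> L) (at t)"
  shows "(g has_vector_derivative L) (at t)"
  unfolding has_vector_derivative_def has_derivative_iff_norm
proof (intro conjI bounded_linear_scaleR_left)
  have "((\<lambda>\<tau>. norm ((g \<tau> - g t) /\<^sub>R (\<tau> - t) - L)) \<longlongrightarrow> 0) (at t)"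
    using tendsto_norm_zero[OF LIM_zero[OF assms]] .
  moreover have "\<forall>\<^sub>F \<tau> in at t. norm ((g \<tau> - g t) /\<^sub>R (\<tau> - t) - L)
      = norm (g \<tau> - g t - (\<tau> - t) *\<^sub>R L) / norm (\<tau> - t)"
    unfolding eventually_at_filter
  proof (intro always_eventually allI impI)
    fix \<tau> assume "\<tau> \<noteq> t"
    then have "(g \<tau> - g t) /\<^sub>R (\<tau> - t) - L = (g \<tau> - g t - (\<tau> - t) *\<^sub>R L) /\<^sub>R (\<tau> - t)"
      by (simp add: scaleR_diff_right)
    then show "norm ((g \<tau> - g t) /\<^sub>R (\<tau> - t) - L) = norm (g \<tau> - g t - (\<tau> - t) *\<^sub>R L) / norm (\<tau> - t)"
      by (simp only: norm_scaleR) (simp add: divide_inverse mult.commute)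
  qed
  ultimately show "((\<lambda>\<tau>. norm (g \<tau> - g t - (\<tau> - t) *\<^sub>R L) / norm (\<tau> - t)) \<longlongrightarrow> 0) (at t)"
    by (rule Lim_transform_eventually)
qed

text \<open>Integrable functions of class \<open>C\<close> with one Lipschitz derivative, with a
  single constant for the function, its derivative and the Lipschitz bound. \<open>f' x v\<close> is
  the derivative at \<open>x\<close> in direction \<open>v\<close>.\<close>

definition test_function :: "('a::euclidean_space \<Rightarrow> real) \<Rightarrow> ('a \<Rightarrow> 'a \<Rightarrow> real) \<Rightarrow> real \<Rightarrow> bool" where
  "test_function f f' B \<longleftrightarrow> (\<forall>x. (f has_derivative f' x) (at x)) \<and> (\<forall>x v. \<bar>f' x v\<bar> \<le> B * norm v) \<and>
     (\<forall>x z v. \<bar>f' x v - f' z v\<bar> \<le> B * norm (x - z) * norm v) \<and> (\<forall>x. \<bar>f x\<bar> \<le> B) \<and>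
     (\<integral>\<^sup>+x. ennreal \<bar>f x\<bar> \<partial>lborel) < \<infinity>"

text \<open>The usual gauge of a Levy measure is \<open>min 1\<close> of the squared norm. Here
  increments are multiplied by \<open>u\<close>, so the growth at infinity is linear, and the gauge
  is integrable for a stable measure because \<open>1 < \<alpha>\<close> and
  \<open>\<alpha> < 2\<close>.\<close>

definition levy_gauge :: "'a::euclidean_space \<Rightarrow> real" where
  "levy_gauge u = min (norm u ^ 2) (norm u)"

lemma levy_gauge_measurable [measurable]: "levy_gauge \<in> borel_measurable borel"
  unfolding levy_gauge_def by measurable

context
  fixes f :: "'a::euclidean_space \<Rightarrow> real" and f' B
  assumes tf: "test_function f f' B"
begin

lemma tf_deriv: "(f has_derivative f' x) (at x)"
  and tf_bound': "\<bar>f' x v\<bar> \<le> B * norm v"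
  and tf_lip': "\<bar>f' x v - f' z v\<bar> \<le> B * norm (x - z) * norm v"
  and tf_bound: "\<bar>f x\<bar> \<le> B"
  using tf by (auto simp: test_function_def)

lemma tf_B: "0 \<le> B" using tf_bound[of 0] by linarith

lemma tf_linear: "linear (f' x)"
  using tf_deriv by (rule has_derivative_linear)

lemma tf_cont': "continuous_on UNIV (\<lambda>x. f' x v)"
proof (rule continuous_on_subset[OF lipschitz_on_continuous_on])
  show "(B * norm v)-lipschitz_on UNIV (\<lambda>x. f' x v)"
    using tf_lip'[of _ v] tf_B by (intro lipschitz_onI) (auto simp: dist_real_def dist_norm mult_ac)
qed simp

lemma tf_cont: "continuous_on UNIV f"
  using tf_deriv by (meson continuous_at_imp_continuous_on has_derivative_continuous)

lemma tf_measurable [measurable]: "f \<in> borel_measurable borel" "(\<lambda>x. f' x v) \<in> borel_measurable borel"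
  using tf_cont tf_cont' by (auto intro: borel_measurable_continuous_onI)

lemma tf_lip: "\<bar>f x - f z\<bar> \<le> B * norm (x - z)"
proof -
  have "norm (f x - f z) \<le> B * norm (x - z)"
  proof (rule differentiable_bound[of UNIV f f'])
    show "(f has_derivative f' x) (at x within UNIV)" for x using tf_deriv by simp
    show "onorm (f' x) \<le> B" for x using tf_bound' tf_B by (intro onorm_bound) auto
  qed auto
  then show ?thesis by simp
qed

lemma tf_taylor: "\<bar>f (x + u) - f x - f' x u\<bar> \<le> B * norm u ^ 2"
proof -
  let ?g = "\<lambda>z. f z - f' x z"
  have lb: "bounded_linear (f' x)" using tf_deriv by (rule has_derivative_bounded_linear)
  have "norm (?g (x + u) - ?g x) \<le> (B * norm u) * norm (x + u - x)"
  proof (rule differentiable_bound[of "cball x (norm u)" ?g "\<lambda>z v. f' z v - f' x v"])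
    fix z assume z: "z \<in> cball x (norm u)"
    show "(?g has_derivative (\<lambda>v. f' z v - f' x v)) (at z within cball x (norm u))"
      by (intro has_derivative_diff has_derivative_at_withinI[OF tf_deriv] bounded_linear_imp_has_derivative lb)
    show "onorm (\<lambda>v. f' z v - f' x v) \<le> B * norm u"
    proof (rule onorm_bound)
      show "norm (f' z v - f' x v) \<le> B * norm u * norm v" for v
        using tf_lip'[of z v x] mult_right_mono[OF mult_left_mono[OF _ tf_B], of "norm (z - x)" "norm u" "norm v"] z
        by (simp add: dist_norm norm_minus_commute)
    qed (use tf_B in auto)
  qed (auto simp: dist_norm)
  moreover have "?g (x + u) - ?g x = f (x + u) - f x - f' x u"
    using linear_add[OF tf_linear, of x x u] by simp
  ultimately show ?thesis by (simp add: power2_eq_square mult.assoc)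
qed

lemma tf_increment: "\<bar>f (z + u) - f z\<bar> * norm u \<le> 2 * B * levy_gauge u"
proof -
  have "\<bar>f (z + u) - f z\<bar> * norm u \<le> B * norm u * norm u"
    using tf_lip[of "z + u" z] by (intro mult_right_mono) auto
  moreover have "\<bar>f (z + u) - f z\<bar> * norm u \<le> 2 * B * norm u"
    using tf_bound[of z] tf_bound[of "z + u"] by (intro mult_right_mono) auto
  moreover have "B * norm u * norm u \<le> 2 * B * norm u ^ 2"
    using tf_B mult_right_mono[of B "2 * B" "norm u ^ 2"] by (simp add: power2_eq_square mult.assoc)
  ultimately show ?thesis using tf_B by (auto simp: levy_gauge_def min_def)
qed

lemma tf_increment': "\<bar>f' (z + u) v - f' z v\<bar> * norm u \<le> 2 * B * norm v * levy_gauge u"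
proof -
  have "\<bar>f' (z + u) v - f' z v\<bar> * norm u \<le> B * norm u * norm v * norm u"
    using tf_lip'[of "z + u" v z] by (intro mult_right_mono) auto
  moreover have "\<bar>f' (z + u) v - f' z v\<bar> * norm u \<le> 2 * B * norm v * norm u"
    using tf_bound'[of z v] tf_bound'[of "z + u" v] by (intro mult_right_mono) auto
  moreover have "B * norm u * norm v * norm u \<le> 2 * B * norm v * norm u ^ 2"
    using tf_B mult_right_mono[of B "2 * B" "norm v * norm u ^ 2"] by (simp add: power2_eq_square mult_ac)
  ultimately show ?thesis using tf_B by (auto simp: levy_gauge_def min_def)
qed

lemma tf_increment_self: "\<bar>f' (z + u) u - f' z u\<bar> \<le> 2 * B * levy_gauge u"
proof (cases "u = 0")
  case True
  then show ?thesis using linear_0[OF tf_linear] by (simp add: levy_gauge_def)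
next
  case False
  have "\<bar>f' (z + u) u - f' z u\<bar> * norm u \<le> (2 * B * levy_gauge u) * norm u"
    using tf_increment'[of z u u] by (simp add: mult_ac)
  then show ?thesis using False by simp
qed

context
  fixes \<nu> :: "'a measure"
  assumes \<nu> [measurable_cong]: "sets \<nu> = sets borel" and gauge: "integrable \<nu> levy_gauge"
begin

text \<open>The derivative of \<open>grad\<close> and its divergence are written with the
  differentiation already moved under the integral; \<open>grad_deriv\<close> and
  \<open>dvg_trace\<close> justify this.\<close>

definition grad where "grad z = (\<integral>u. (f (z + u) - f z) *\<^sub>R u \<partial>\<nu>)"
definition grad' where "grad' z v = (\<integral>u. (f' (z + u) v - f' z v) *\<^sub>R u \<partial>\<nu>)"
definition dvg where "dvg z = (\<integral>u. f' (z + u) u - f' z u \<partial>\<nu>)"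

text \<open>Here \<open>u\<close> is both part of the point and the direction. Expanding the
  direction in coordinates leaves derivatives in fixed directions, which are continuous in the
  point.\<close>

lemma f'_diag_measurable: "(\<lambda>u. f' (z + u) u) \<in> borel_measurable borel"
proof -
  have e: "f' (z + u) u = (\<Sum>b\<in>Basis. (u \<bullet> b) * f' (z + u) b)" for u
    using linear_sum[OF tf_linear, of _ "\<lambda>b. (u \<bullet> b) *\<^sub>R b" Basis] linear_cmul[OF tf_linear]
    by (simp add: euclidean_representation)
  have "(\<lambda>u. f' (z + u) b) \<in> borel_measurable borel" for b
    using measurable_compose[OF _ tf_measurable(2), of "\<lambda>u. z + u" borel b] by simp
  then show ?thesis unfolding e by measurable
qed

lemma measurable_nu: "g \<in> borel_measurable borel \<Longrightarrow> g \<in> borel_measurable \<nu>" for g :: "'a \<Rightarrow> 'b::topological_space"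
  using measurable_cong_sets[OF \<nu> refl] by blast

lemma int_gauge: "integrable \<nu> (\<lambda>u. k * levy_gauge u)"
  using gauge by simp

lemma grad_meas: "(\<lambda>u. (f (z + u) - f z) *\<^sub>R u) \<in> borel_measurable \<nu>"
  by (rule measurable_nu) measurable

lemma grad'_meas: "(\<lambda>u. (f' (z + u) v - f' z v) *\<^sub>R u) \<in> borel_measurable \<nu>"
proof (rule measurable_nu)
  have [measurable]: "(\<lambda>u. f' (z + u) v) \<in> borel_measurable borel"
    using measurable_compose[OF _ tf_measurable(2), of "\<lambda>u. z + u" borel v] by simp
  show "(\<lambda>u. (f' (z + u) v - f' z v) *\<^sub>R u) \<in> borel_measurable borel" by measurable
qed

lemma grad'_int: "integrable \<nu> (\<lambda>u. (f' (z + u) v - f' z v) *\<^sub>R u)"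
  by (rule Bochner_Integration.integrable_bound[OF int_gauge[of "2 * B * norm v"] grad'_meas])
    (use tf_increment' in \<open>auto intro!: AE_I2 intro: order_trans[OF _ abs_ge_self]\<close>)

lemma dvg_meas: "(\<lambda>u. f' (z + u) u - f' z u) \<in> borel_measurable \<nu>"
proof (rule measurable_nu)
  have "continuous_on UNIV (f' z)"
    using has_derivative_bounded_linear[OF tf_deriv] by (rule linear_continuous_on)
  then have [measurable]: "f' z \<in> borel_measurable borel" by (rule borel_measurable_continuous_onI)
  note [measurable] = f'_diag_measurable
  show "(\<lambda>u. f' (z + u) u - f' z u) \<in> borel_measurable borel" by measurable
qed

lemma dvg_int: "integrable \<nu> (\<lambda>u. f' (z + u) u - f' z u)"
  by (rule Bochner_Integration.integrable_bound[OF int_gauge[of "2 * B"] dvg_meas])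
    (use tf_increment_self in \<open>auto intro!: AE_I2 intro: order_trans[OF _ abs_ge_self]\<close>)

lemma tf_tendsto: "((\<lambda>z. f (z + u)) \<longlongrightarrow> f (a + u)) (at a)" "((\<lambda>z. f' (z + u) v) \<longlongrightarrow> f' (a + u) v) (at a)"
proof -
  have "continuous_on UNIV (\<lambda>z. f (z + u))" "continuous_on UNIV (\<lambda>z. f' (z + u) v)"
    by (rule continuous_on_compose2[OF tf_cont] continuous_on_compose2[OF tf_cont'], auto intro!: continuous_intros)+
  then show "((\<lambda>z. f (z + u)) \<longlongrightarrow> f (a + u)) (at a)" "((\<lambda>z. f' (z + u) v) \<longlongrightarrow> f' (a + u) v) (at a)"
    by (auto simp: continuous_on_eq_continuous_at isCont_def)
qed

lemma grad_cont: "continuous_on UNIV grad"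
  unfolding continuous_on_eq_continuous_at[OF open_UNIV] isCont_def grad_def
proof (intro ballI tendsto_integral_dominated[OF grad_meas grad_meas int_gauge[of "2 * B"]])
  fix a u
  show "((\<lambda>z. (f (z + u) - f z) *\<^sub>R u) \<longlongrightarrow> (f (a + u) - f a) *\<^sub>R u) (at a)"
    using tf_tendsto(1)[of 0 a] by (intro tendsto_intros tf_tendsto) simp
  show "norm ((f (z + u) - f z) *\<^sub>R u) \<le> 2 * B * levy_gauge u" for z
    using tf_increment by simp
qed

lemma grad'_cont: "continuous_on UNIV (\<lambda>z. grad' z v)"
  unfolding continuous_on_eq_continuous_at[OF open_UNIV] isCont_def grad'_def
proof (intro ballI tendsto_integral_dominated[OF grad'_meas grad'_meas int_gauge[of "2 * B * norm v"]])
  fix a u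
  show "((\<lambda>z. (f' (z + u) v - f' z v) *\<^sub>R u) \<longlongrightarrow> (f' (a + u) v - f' a v) *\<^sub>R u) (at a)"
    using tf_tendsto(2)[of 0 v a] by (intro tendsto_intros tf_tendsto) simp
  show "norm ((f' (z + u) v - f' z v) *\<^sub>R u) \<le> 2 * B * norm v * levy_gauge u" for z
    using tf_increment' by simp
qed

lemma dvg_cont: "continuous_on UNIV dvg"
  unfolding continuous_on_eq_continuous_at[OF open_UNIV] isCont_def dvg_def
proof (intro ballI tendsto_integral_dominated[OF dvg_meas dvg_meas int_gauge[of "2 * B"]])
  fix a u
  show "((\<lambda>z. f' (z + u) u - f' z u) \<longlongrightarrow> f' (a + u) u - f' a u) (at a)"
    using tf_tendsto(2)[of 0 u a] by (intro tendsto_intros tf_tendsto) simp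
  show "norm (f' (z + u) u - f' z u) \<le> 2 * B * levy_gauge u" for z
    using tf_increment_self by simp
qed

lemma dvg_bounded: "bounded_borel dvg"
proof -
  have "\<bar>dvg z\<bar> \<le> (\<integral>u. 2 * B * levy_gauge u \<partial>\<nu>)" for z
    unfolding dvg_def
    by (rule order_trans[OF integral_abs_bound integral_mono[OF integrable_abs[OF dvg_int] int_gauge]])
      (rule tf_increment_self)
  moreover have "dvg \<in> borel_measurable borel" by (rule borel_measurable_continuous_onI[OF dvg_cont])
  ultimately show ?thesis unfolding bounded_borel_def by blast
qed

lemma grad'_bounded: "norm (grad' z v) \<le> (\<integral>u. 2 * B * norm v * levy_gauge u \<partial>\<nu>)"
proof -
  have "norm (grad' z v) \<le> (\<integral>u. norm ((f' (z + u) v - f' z v) *\<^sub>R u) \<partial>\<nu>)"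
    unfolding grad'_def by (rule integral_norm_bound)
  also have "\<dots> \<le> (\<integral>u. 2 * B * norm v * levy_gauge u \<partial>\<nu>)"
    using tf_increment' by (intro integral_mono integrable_norm grad'_int int_gauge) auto
  finally show ?thesis .
qed

lemma line_deriv: "DERIV (\<lambda>t. f (z + t *\<^sub>R v)) t :> f' (z + t *\<^sub>R v) v"
proof -
  have "((\<lambda>t. f (z + t *\<^sub>R v)) has_derivative (\<lambda>h. f' (z + t *\<^sub>R v) (h *\<^sub>R v))) (at t)"
    by (rule has_derivative_compose[OF _ tf_deriv]) (auto intro!: derivative_eq_intros)
  then show ?thesis
    unfolding has_field_derivative_def
    by (rule has_derivative_eq_rhs) (simp add: fun_eq_iff linear_cmul[OF tf_linear])
qed

text \<open>Differentiation under the integral: the difference quotients of the increments,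
  multiplied by \<open>u\<close>, are dominated by the gauge uniformly in
  \<open>\<tau>\<close>.\<close>

lemma grad_deriv: "((\<lambda>t. grad (z + t *\<^sub>R v)) has_vector_derivative grad' (z + t *\<^sub>R v) v) (at t)"
proof -
  define D where "D u \<tau> = f (z + u + \<tau> *\<^sub>R v) - f (z + \<tau> *\<^sub>R v)" for u \<tau>
  define D' where "D' u \<tau> = f' (z + u + \<tau> *\<^sub>R v) v - f' (z + \<tau> *\<^sub>R v) v" for u \<tau>
  have DD: "DERIV (D u) \<tau> :> D' u \<tau>" for u \<tau>
    unfolding D_def[abs_def] D'_def by (intro DERIV_diff line_deriv)
  have D'b: "\<bar>D' u \<tau>\<bar> * norm u \<le> 2 * B * norm v * levy_gauge u" for u \<tau>
    using tf_increment'[of "z + \<tau> *\<^sub>R v" u v] by (simp add: D'_def add_ac)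
  let ?q = "\<lambda>\<tau> u. ((D u \<tau> - D u t) / (\<tau> - t)) *\<^sub>R u"
  have int: "integrable \<nu> (\<lambda>u. D u \<tau> *\<^sub>R u)" for \<tau>
    unfolding D_def
  proof (rule Bochner_Integration.integrable_bound[OF int_gauge[of "2 * B"]])
    show "(\<lambda>u. (f (z + u + \<tau> *\<^sub>R v) - f (z + \<tau> *\<^sub>R v)) *\<^sub>R u) \<in> borel_measurable \<nu>"
      using grad_meas[of "z + \<tau> *\<^sub>R v"] by (simp add: add_ac)
    show "AE u in \<nu>. norm ((f (z + u + \<tau> *\<^sub>R v) - f (z + \<tau> *\<^sub>R v)) *\<^sub>R u) \<le> norm (2 * B * levy_gauge u)"
    proof (rule AE_I2)
      fix u
      show "norm ((f (z + u + \<tau> *\<^sub>R v) - f (z + \<tau> *\<^sub>R v)) *\<^sub>R u) \<le> norm (2 * B * levy_gauge u)"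
        using tf_increment[of "z + \<tau> *\<^sub>R v" u] by (simp add: add_ac abs_le_iff)
    qed
  qed
  have "((\<lambda>\<tau>. \<integral>u. ?q \<tau> u \<partial>\<nu>) \<longlongrightarrow> (\<integral>u. D' u t *\<^sub>R u \<partial>\<nu>)) (at t)"
  proof (rule tendsto_integral_dominated[OF _ _ int_gauge[of "2 * B * norm v"]])
    show "?q \<tau> \<in> borel_measurable \<nu>" for \<tau>
      using borel_measurable_scaleR[OF borel_measurable_const borel_measurable_diff[OF
         borel_measurable_integrable[OF int[of \<tau>]] borel_measurable_integrable[OF int[of t]]], of "1 / (\<tau> - t)"]
      by (simp add: scaleR_diff_left[symmetric])
    show "(\<lambda>u. D' u t *\<^sub>R u) \<in> borel_measurable \<nu>"
      using grad'_meas[of "z + t *\<^sub>R v" v] by (simp add: D'_def add_ac)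
    show "((\<lambda>\<tau>. ?q \<tau> u) \<longlongrightarrow> D' u t *\<^sub>R u) (at t)" for u
      using DD[of u t] unfolding has_field_derivative_iff by (intro tendsto_intros)
    fix \<tau> u assume "\<tau> \<noteq> t"
    \<comment> \<open>The mean value inequality is applied after multiplication with
      \<open>norm u\<close>, because it is the product
      \<open>\<bar>D' u \<tau>\<bar> * norm u\<close> that the gauge bounds.\<close>
    have "norm (D u \<tau> * norm u - D u t * norm u) \<le> (2 * B * norm v * levy_gauge u) * norm (\<tau> - t)"
    proof (rule differentiable_bound[of UNIV "\<lambda>\<tau>. D u \<tau> * norm u" "\<lambda>\<tau> h. D' u \<tau> * norm u * h"])
      show "((\<lambda>\<tau>. D u \<tau> * norm u) has_derivative (\<lambda>h. D' u \<tau> * norm u * h)) (at \<tau> within UNIV)" for \<tau>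
        using DERIV_cmult_right[OF DD[of u \<tau>], of "norm u"] unfolding has_field_derivative_def
        by (rule has_derivative_eq_rhs) (simp add: fun_eq_iff mult_ac)
      show "onorm (\<lambda>h. D' u \<tau> * norm u * h) \<le> 2 * B * norm v * levy_gauge u" for \<tau>
      proof (rule onorm_bound)
        show "0 \<le> 2 * B * norm v * levy_gauge u" using tf_B by (simp add: levy_gauge_def)
        show "norm (D' u \<tau> * norm u * h) \<le> 2 * B * norm v * levy_gauge u * norm h" for h
          using mult_right_mono[OF D'b[of u \<tau>], of "\<bar>h\<bar>"] by (simp add: abs_mult)
      qed
    qed auto
    moreover have "norm (D u \<tau> * norm u - D u t * norm u) = \<bar>D u \<tau> - D u t\<bar> * norm u"
      by (simp add: left_diff_distrib[symmetric] abs_mult)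
    ultimately show "norm (?q \<tau> u) \<le> 2 * B * norm v * levy_gauge u"
      using \<open>\<tau> \<noteq> t\<close> by (simp add: divide_le_eq abs_divide)
  qed
  moreover have "(\<integral>u. ?q \<tau> u \<partial>\<nu>) = (grad (z + \<tau> *\<^sub>R v) - grad (z + t *\<^sub>R v)) /\<^sub>R (\<tau> - t)" for \<tau>
  proof -
    have g: "grad (z + \<tau> *\<^sub>R v) = (\<integral>u. D u \<tau> *\<^sub>R u \<partial>\<nu>)" for \<tau>
      by (simp add: grad_def D_def add_ac)
    have "(\<integral>u. ?q \<tau> u \<partial>\<nu>) = (\<integral>u. (1 / (\<tau> - t)) *\<^sub>R (D u \<tau> *\<^sub>R u - D u t *\<^sub>R u) \<partial>\<nu>)"
      by (simp add: scaleR_diff_left[symmetric])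
    also have "\<dots> = (1 / (\<tau> - t)) *\<^sub>R ((\<integral>u. D u \<tau> *\<^sub>R u \<partial>\<nu>) - (\<integral>u. D u t *\<^sub>R u \<partial>\<nu>))"
      by (simp add: Bochner_Integration.integral_diff[OF int int])
    finally show ?thesis by (simp add: g divide_inverse)
  qed
  moreover have "(\<integral>u. D' u t *\<^sub>R u \<partial>\<nu>) = grad' (z + t *\<^sub>R v) v"
    by (simp add: grad'_def D'_def add_ac)
  ultimately have "((\<lambda>\<tau>. (grad (z + \<tau> *\<^sub>R v) - grad (z + t *\<^sub>R v)) /\<^sub>R (\<tau> - t)) \<longlongrightarrow> grad' (z + t *\<^sub>R v) v) (at t)"
    by simp
  then show ?thesis by (rule has_vector_derivative_of_quotient)
qed

text \<open>Under the integral the numbers \<open>R u \<bullet> b\<close> are the coordinates of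
  \<open>u\<close> in the frame, and linearity of \<open>f' x\<close> recombines the derivatives
  along \<open>y b\<close> to the derivative along \<open>u\<close>.\<close>

lemma dvg_trace:
  fixes y R :: "'a \<Rightarrow> 'a"
  assumes R: "linear R" and yR: "\<And>u. (\<Sum>b\<in>Basis. (R u \<bullet> b) *\<^sub>R y b) = u"
  shows "dvg z = (\<Sum>b\<in>Basis. R (grad' z (y b)) \<bullet> b)"
proof -
  have bl: "bounded_linear (\<lambda>v. R v \<bullet> b)" for b
    using R by (intro bounded_linear_compose[OF bounded_linear_inner_left] linear_conv_bounded_linear[THEN iffD1])
  have i: "integrable \<nu> (\<lambda>u. R ((f' (z + u) v - f' z v) *\<^sub>R u) \<bullet> b)" for v b
    by (rule integrable_bounded_linear[OF bl grad'_int])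
  have "(\<Sum>b\<in>Basis. R (grad' z (y b)) \<bullet> b) = (\<Sum>b\<in>Basis. \<integral>u. R ((f' (z + u) (y b) - f' z (y b)) *\<^sub>R u) \<bullet> b \<partial>\<nu>)"
    unfolding grad'_def by (intro sum.cong refl integral_bounded_linear[OF bl grad'_int, symmetric])
  also have "\<dots> = (\<integral>u. (\<Sum>b\<in>Basis. R ((f' (z + u) (y b) - f' z (y b)) *\<^sub>R u) \<bullet> b) \<partial>\<nu>)"
    by (intro Bochner_Integration.integral_sum[symmetric] i)
  also have "\<dots> = dvg z"
    unfolding dvg_def
  proof (rule Bochner_Integration.integral_cong[OF refl])
    fix u
    have L: "(\<Sum>b\<in>Basis. (R u \<bullet> b) * f' x (y b)) = f' x u" for x
      using linear_sum[OF tf_linear[of x], of "\<lambda>b. (R u \<bullet> b) *\<^sub>R y b" Basis]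
      by (simp add: yR linear_cmul[OF tf_linear])
    have "(\<Sum>b\<in>Basis. R ((f' (z + u) (y b) - f' z (y b)) *\<^sub>R u) \<bullet> b)
        = (\<Sum>b\<in>Basis. (R u \<bullet> b) * f' (z + u) (y b)) - (\<Sum>b\<in>Basis. (R u \<bullet> b) * f' z (y b))"
      by (simp add: linear_cmul[OF R] left_diff_distrib right_diff_distrib sum_subtractf mult.commute)
    then show "(\<Sum>b\<in>Basis. R ((f' (z + u) (y b) - f' z (y b)) *\<^sub>R u) \<bullet> b) = f' (z + u) u - f' z u"
      by (simp only: L)
  qed
  finally show ?thesis ..
qed

lemma grad_divergence_pair: "divergence_pair grad grad' dvg"
  unfolding divergence_pair_def
  using grad_deriv grad'_cont grad'_bounded dvg_trace by blast

end

end

declare tf_measurable [measurable del]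

section \<open>The resolvent identity for test functions\<close>

lemma integral_polar_law:
  fixes w :: "'a::euclidean_space \<Rightarrow> real \<Rightarrow> real" and h :: "'a \<Rightarrow> real"
  assumes S: "finite_borel S" and w: "(\<lambda>(y, r). w y r) \<in> borel_measurable (borel \<Otimes>\<^sub>M borel)" "\<And>y r. 0 \<le> w y r"
    and h [measurable]: "h \<in> borel_measurable borel" and int: "integrable (polar_law S (\<lambda>y r. ennreal (w y r))) h"
  shows "integrable S (\<lambda>y. \<integral>r. w y r * h (r *\<^sub>R y) \<partial>lborel)"
    and "(\<integral>u. h u \<partial>polar_law S (\<lambda>y r. ennreal (w y r))) = (\<integral>y. (\<integral>r. w y r * h (r *\<^sub>R y) \<partial>lborel) \<partial>S)"
proof -
  interpret finite_measure S using S by (simp add: finite_borel_def)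
  interpret P: pair_sigma_finite S "lborel :: real measure" ..
  let ?N = "S \<Otimes>\<^sub>M (lborel :: real measure)"
  have SL: "sets ?N = sets (borel \<Otimes>\<^sub>M borel)"
    using S by (intro sets_pair_measure_cong) (auto simp: finite_borel_def)
  have mc: "f \<in> measurable ?N K \<longleftrightarrow> f \<in> measurable (borel \<Otimes>\<^sub>M borel) K" for f and K :: "'z measure"
    by (simp only: measurable_cong_sets[OF SL refl])
  let ?T = "\<lambda>(y, r). r *\<^sub>R (y::'a)" and ?w = "\<lambda>z. case z of (y, r) \<Rightarrow> w y r"
  have T: "?T \<in> borel_measurable ?N" unfolding mc by measurable
  have wm: "?w \<in> borel_measurable ?N" unfolding mc by (rule w(1))
  have hT: "(\<lambda>z. h (?T z)) \<in> borel_measurable ?N" by (rule measurable_compose[OF T h])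
  have T': "?T \<in> measurable (density ?N (\<lambda>z. ennreal (?w z))) borel" using T by simp
  have nn: "AE z in ?N. 0 \<le> ?w z" using w(2) by (auto simp: case_prod_beta')
  have eq: "polar_law S (\<lambda>y r. ennreal (w y r)) = distr (density ?N (\<lambda>z. ennreal (?w z))) borel ?T"
    unfolding polar_law_def by (simp add: case_prod_beta')
  have i: "integrable ?N (\<lambda>z. ?w z *\<^sub>R h (?T z))"
    using int unfolding eq integrable_distr_eq[OF T' h] integrable_density[OF hT wm nn] .
  show "integrable S (\<lambda>y. \<integral>r. w y r * h (r *\<^sub>R y) \<partial>lborel)"
    using P.integrable_fst'[OF i] by simp
  have "(\<integral>u. h u \<partial>polar_law S (\<lambda>y r. ennreal (w y r))) = (\<integral>z. ?w z *\<^sub>R h (?T z) \<partial>?N)"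
    unfolding eq integral_distr[OF T' h] integral_density[OF hT wm nn] ..
  also have "\<dots> = (\<integral>y. (\<integral>r. w y r * h (r *\<^sub>R y) \<partial>lborel) \<partial>S)"
    using P.integral_fst'[OF i] by simp
  finally show "(\<integral>u. h u \<partial>polar_law S (\<lambda>y r. ennreal (w y r))) = (\<integral>y. (\<integral>r. w y r * h (r *\<^sub>R y) \<partial>lborel) \<partial>S)" .
qed

lemma has_bochner_integral_powr_tail:
  fixes \<alpha> \<epsilon> :: real assumes "0 < \<alpha>" "0 < \<epsilon>"
  shows "has_bochner_integral lborel (\<lambda>r. r powr (- 1 - \<alpha>) * indicator {\<epsilon><..} r) (\<epsilon> powr - \<alpha> / \<alpha>)"
proof (rule has_bochner_integral_nn_integral)
  have "(\<integral>\<^sup>+r. ennreal (r powr (- 1 - \<alpha>) * indicator {\<epsilon><..} r) \<partial>lborel)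
      = (\<integral>\<^sup>+r. ennreal (r powr (- 1 - \<alpha>)) * indicator {\<epsilon><..} r \<partial>lborel)"
    by (intro nn_integral_cong) (auto simp: indicator_def)
  then show "(\<integral>\<^sup>+r. ennreal (r powr (- 1 - \<alpha>) * indicator {\<epsilon><..} r) \<partial>lborel) = ennreal (\<epsilon> powr - \<alpha> / \<alpha>)"
    using assms by (simp add: nn_integral_powr_tail)
qed (use assms in auto)

lemma has_bochner_integral_powr_head:
  fixes \<alpha> \<epsilon> :: real assumes "\<alpha> < 2" "0 < \<epsilon>"
  shows "has_bochner_integral lborel (\<lambda>r. r powr (1 - \<alpha>) * indicator {0<..<\<epsilon>} r) (\<epsilon> powr (2 - \<alpha>) / (2 - \<alpha>))"
proof (rule has_bochner_integral_nn_integral)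
  have "(\<integral>\<^sup>+r. ennreal (r powr (1 - \<alpha>) * indicator {0<..<\<epsilon>} r) \<partial>lborel)
      = (\<integral>\<^sup>+r. ennreal (r powr (1 - \<alpha>)) * indicator {0<..<\<epsilon>} r \<partial>lborel)"
    by (intro nn_integral_cong) (auto simp: indicator_def)
  then show "(\<integral>\<^sup>+r. ennreal (r powr (1 - \<alpha>) * indicator {0<..<\<epsilon>} r) \<partial>lborel) = ennreal (\<epsilon> powr (2 - \<alpha>) / (2 - \<alpha>))"
    using assms nn_integral_powr_from_0[of "1 - \<alpha>" \<epsilon>] by simp
qed (use assms in auto)

text \<open>Integrate the derivative of \<open>r powr - \<alpha> * \<psi> r\<close> over the radii
  beyond \<open>\<epsilon>\<close>. The boundary term at infinity vanishes by the linear bound since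
  \<open>\<alpha> > 1\<close>; the one at \<open>\<epsilon>\<close> is at most
  \<open>B * \<epsilon> powr (2 - \<alpha>)\<close> by the quadratic bound. The piece of the second
  integral below \<open>\<epsilon>\<close> is of the same order by the bound \<open>B * r\<close> on
  \<open>\<psi>'\<close>.\<close>

lemma radial_identity:
  fixes \<psi> \<psi>' :: "real \<Rightarrow> real"
  assumes \<alpha>: "1 < \<alpha>" "\<alpha> < 2" and \<epsilon>: "0 < \<epsilon>" and B: "0 \<le> B"
    and d: "\<And>r. DERIV \<psi> r :> \<psi>' r" and cont: "\<And>r. isCont \<psi>' r"
    and b1: "\<And>r. 0 < r \<Longrightarrow> \<bar>\<psi> r\<bar> \<le> 2 * B * r" and b2: "\<And>r. 0 < r \<Longrightarrow> \<bar>\<psi> r\<bar> \<le> B * r ^ 2"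
    and b3: "\<And>r. 0 < r \<Longrightarrow> \<bar>\<psi>' r\<bar> \<le> 2 * B" and b4: "\<And>r. 0 < r \<Longrightarrow> \<bar>\<psi>' r\<bar> \<le> B * r"
  shows "integrable lborel (\<lambda>r. r powr (- 1 - \<alpha>) * \<psi> r * indicator {\<epsilon><..} r)"
    and "\<bar>\<alpha> * (\<integral>r. r powr (- 1 - \<alpha>) * \<psi> r * indicator {\<epsilon><..} r \<partial>lborel)
        - (\<integral>r. r powr - \<alpha> * \<psi>' r * indicator {0<..} r \<partial>lborel)\<bar> \<le> (B + B / (2 - \<alpha>)) * \<epsilon> powr (2 - \<alpha>)"
proof -
  have [measurable]: "\<psi> \<in> borel_measurable borel" "\<psi>' \<in> borel_measurable borel"
    using DERIV_isCont[OF d] cont by (auto intro!: borel_measurable_continuous_onI simp: continuous_on_eq_continuous_at)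
  have tail: "integrable lborel (\<lambda>r. 2 * B * (r powr - \<alpha> * indicator {\<epsilon><..} r))"
    using has_bochner_integral_powr_tail[of "\<alpha> - 1" \<epsilon>] \<alpha> \<epsilon> by (auto simp: has_bochner_integral_iff)
  show i1: "integrable lborel (\<lambda>r. r powr (- 1 - \<alpha>) * \<psi> r * indicator {\<epsilon><..} r)"
  proof (rule Bochner_Integration.integrable_bound[OF tail])
    show "AE r in lborel. norm (r powr (- 1 - \<alpha>) * \<psi> r * indicator {\<epsilon><..} r) \<le> norm (2 * B * (r powr - \<alpha> * indicator {\<epsilon><..} r))"
    proof (rule AE_I2)
      fix r
      show "norm (r powr (- 1 - \<alpha>) * \<psi> r * indicator {\<epsilon><..} r) \<le> norm (2 * B * (r powr - \<alpha> * indicator {\<epsilon><..} r))"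
      proof (cases "\<epsilon> < r")
        case True
        then have r: "0 < r" using \<epsilon> by simp
        have "r powr (- 1 - \<alpha>) * \<bar>\<psi> r\<bar> \<le> r powr (- 1 - \<alpha>) * (2 * B * r)"
          by (intro mult_left_mono b1 r) simp
        also have "\<dots> = 2 * B * (r powr (- 1 - \<alpha>) * r)" by simp
        also have "r powr (- 1 - \<alpha>) * r = r powr - \<alpha>"
          using r powr_add[of r "- 1 - \<alpha>" 1] by simp
        finally show ?thesis using True B by (simp add: abs_mult)
      qed simp
    qed
  qed simp
  have i2: "integrable lborel (\<lambda>r. r powr - \<alpha> * \<psi>' r * indicator {\<epsilon><..} r)"
  proof (rule Bochner_Integration.integrable_bound[OF tail])
    show "AE r in lborel. norm (r powr - \<alpha> * \<psi>' r * indicator {\<epsilon><..} r) \<le> norm (2 * B * (r powr - \<alpha> * indicator {\<epsilon><..} r))"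
    proof (rule AE_I2)
      fix r
      show "norm (r powr - \<alpha> * \<psi>' r * indicator {\<epsilon><..} r) \<le> norm (2 * B * (r powr - \<alpha> * indicator {\<epsilon><..} r))"
        using mult_left_mono[OF b3[of r], of "r powr - \<alpha>"] \<epsilon> B
        by (cases "\<epsilon> < r") (auto simp: abs_mult mult_ac)
    qed
  qed simp
  have head: "has_bochner_integral lborel (\<lambda>r. B * (r powr (1 - \<alpha>) * indicator {0<..<\<epsilon>} r)) (B * (\<epsilon> powr (2 - \<alpha>) / (2 - \<alpha>)))"
    using has_bochner_integral_powr_head[OF \<alpha>(2) \<epsilon>] by (rule has_bochner_integral_mult_right)
  have hb: "\<bar>r powr - \<alpha> * \<psi>' r * indicator {0<..<\<epsilon>} r\<bar> \<le> B * (r powr (1 - \<alpha>) * indicator {0<..<\<epsilon>} r)" for r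
  proof (cases "r \<in> {0<..<\<epsilon>}")
    case True
    then have r: "0 < r" by simp
    have "r powr - \<alpha> * \<bar>\<psi>' r\<bar> \<le> r powr - \<alpha> * (B * r)" by (intro mult_left_mono b4 r) simp
    also have "\<dots> = B * r powr (1 - \<alpha>)" using r powr_add[of r "- \<alpha>" 1] by simp
    finally show ?thesis using True by (simp add: abs_mult)
  qed simp
  have i3: "integrable lborel (\<lambda>r. r powr - \<alpha> * \<psi>' r * indicator {0<..<\<epsilon>} r)"
  proof (rule Bochner_Integration.integrable_bound[OF integrable.intros[OF head]])
    show "AE r in lborel. norm (r powr - \<alpha> * \<psi>' r * indicator {0<..<\<epsilon>} r) \<le> norm (B * (r powr (1 - \<alpha>) * indicator {0<..<\<epsilon>} r))"
      using order_trans[OF hb abs_ge_self] by (intro AE_I2) (simp only: real_norm_def)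
  qed simp
  have I3: "\<bar>\<integral>r. r powr - \<alpha> * \<psi>' r * indicator {0<..<\<epsilon>} r \<partial>lborel\<bar> \<le> B * (\<epsilon> powr (2 - \<alpha>) / (2 - \<alpha>))"
  proof -
    have "\<bar>\<integral>r. r powr - \<alpha> * \<psi>' r * indicator {0<..<\<epsilon>} r \<partial>lborel\<bar>
        \<le> (\<integral>r. \<bar>r powr - \<alpha> * \<psi>' r * indicator {0<..<\<epsilon>} r\<bar> \<partial>lborel)" by (rule integral_abs_bound)
    also have "\<dots> \<le> (\<integral>r. B * (r powr (1 - \<alpha>) * indicator {0<..<\<epsilon>} r) \<partial>lborel)"
      by (rule integral_mono[OF integrable_abs[OF i3] integrable.intros[OF head] hb])
    also have "\<dots> = B * (\<epsilon> powr (2 - \<alpha>) / (2 - \<alpha>))" using head by (rule has_bochner_integral_integral_eq)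
    finally show ?thesis .
  qed
  have split: "(\<integral>r. r powr - \<alpha> * \<psi>' r * indicator {0<..} r \<partial>lborel)
      = (\<integral>r. r powr - \<alpha> * \<psi>' r * indicator {0<..<\<epsilon>} r \<partial>lborel) + (\<integral>r. r powr - \<alpha> * \<psi>' r * indicator {\<epsilon><..} r \<partial>lborel)"
  proof -
    have "(\<integral>r. r powr - \<alpha> * \<psi>' r * indicator {0<..} r \<partial>lborel)
        = (\<integral>r. r powr - \<alpha> * \<psi>' r * indicator {0<..<\<epsilon>} r + r powr - \<alpha> * \<psi>' r * indicator {\<epsilon><..} r \<partial>lborel)"
    proof (rule integral_cong_AE)
      show "AE r in lborel. r powr - \<alpha> * \<psi>' r * indicator {0<..} r
          = r powr - \<alpha> * \<psi>' r * indicator {0<..<\<epsilon>} r + r powr - \<alpha> * \<psi>' r * indicator {\<epsilon><..} r"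
        using AE_lborel_singleton[of \<epsilon>] by eventually_elim (use \<epsilon> in \<open>auto simp: indicator_def\<close>)
      show "(\<lambda>r. r powr - \<alpha> * \<psi>' r * indicator {0<..<\<epsilon>} r + r powr - \<alpha> * \<psi>' r * indicator {\<epsilon><..} r) \<in> borel_measurable lborel"
        by (intro borel_measurable_add borel_measurable_integrable[OF i2] borel_measurable_integrable[OF i3])
    qed simp
    then show ?thesis by (simp add: Bochner_Integration.integral_add[OF i3 i2])
  qed
  define H where "H r = r powr - \<alpha> * \<psi> r" for r
  define h where "h r = r powr - \<alpha> * \<psi>' r - \<alpha> * (r powr (- 1 - \<alpha>) * \<psi> r)" for r
  have Hd: "DERIV H r :> h r" if "0 < r" for r
    unfolding H_def[abs_def] h_def
  proof (rule DERIV_cong[OF DERIV_mult[OF has_real_derivative_powr[OF that] d]])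
    have "- \<alpha> - 1 = - 1 - \<alpha>" by simp
    then show "- \<alpha> * r powr (- \<alpha> - 1) * \<psi> r + \<psi>' r * r powr - \<alpha> = r powr - \<alpha> * \<psi>' r - \<alpha> * (r powr (- 1 - \<alpha>) * \<psi> r)"
      by (simp only:) (simp add: mult_ac)
  qed
  have hc: "isCont h r" if "0 < r" for r
    unfolding h_def[abs_def] using that cont DERIV_isCont[OF d] by (intro continuous_intros) auto
  have hi: "integrable lborel (\<lambda>r. r powr - \<alpha> * \<psi>' r * indicator {\<epsilon><..} r - \<alpha> * (r powr (- 1 - \<alpha>) * \<psi> r * indicator {\<epsilon><..} r))"
    by (intro Bochner_Integration.integrable_diff i2 integrable_mult_right i1)
  have hi': "(\<lambda>r. indicator {\<epsilon><..} r *\<^sub>R h r) = (\<lambda>r. r powr - \<alpha> * \<psi>' r * indicator {\<epsilon><..} r - \<alpha> * (r powr (- 1 - \<alpha>) * \<psi> r * indicator {\<epsilon><..} r))"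
    by (auto simp: h_def indicator_def fun_eq_iff)
  have ei: "einterval (ereal \<epsilon>) \<infinity> = {\<epsilon><..}" by (auto simp: einterval_def)
  have "(LBINT r=ereal \<epsilon>..\<infinity>. h r) = 0 - H \<epsilon>"
  proof (rule interval_integral_FTC_integrable)
    show "set_integrable lborel (einterval (ereal \<epsilon>) \<infinity>) h"
      unfolding ei set_integrable_def hi' by (rule hi)
    show "(H has_vector_derivative h r) (at r)" if "ereal \<epsilon> < ereal r" "ereal r < \<infinity>" for r
      using Hd[of r] that \<epsilon> by (simp add: has_real_derivative_iff_has_vector_derivative[symmetric])
    show "isCont h r" if "ereal \<epsilon> < ereal r" "ereal r < \<infinity>" for r
      using hc[of r] that \<epsilon> by simp
    have "isCont H \<epsilon>" using Hd[OF \<epsilon>] by (rule DERIV_isCont)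
    then have "(H \<longlongrightarrow> H \<epsilon>) (at_right \<epsilon>)" by (simp add: isCont_def filterlim_at_split)
    then show "((H \<circ> real_of_ereal) \<longlongrightarrow> H \<epsilon>) (at_right (ereal \<epsilon>))"
      by (simp add: ereal_tendsto_simps)
    have "((\<lambda>r. r powr - (\<alpha> - 1)) \<longlongrightarrow> 0) at_top"
      using \<alpha> by (intro tendsto_neg_powr filterlim_ident) auto
    then have "((\<lambda>r. 2 * B * r powr - (\<alpha> - 1)) \<longlongrightarrow> 2 * B * 0) at_top" by (intro tendsto_intros)
    then have "((\<lambda>r. 2 * B * r powr - (\<alpha> - 1)) \<longlongrightarrow> 0) at_top" by simp
    then have "(H \<longlongrightarrow> 0) at_top"
    proof (rule Lim_null_comparison[rotated])
      show "\<forall>\<^sub>F r in at_top. norm (H r) \<le> 2 * B * r powr - (\<alpha> - 1)"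
        using eventually_gt_at_top[of "0::real"]
      proof eventually_elim
        case (elim r)
        have "norm (H r) \<le> r powr - \<alpha> * (2 * B * r)"
          unfolding H_def using b1[OF elim] by (simp add: abs_mult mult_left_mono)
        also have "\<dots> = 2 * B * (r powr - \<alpha> * r)" by simp
        also have "r powr - \<alpha> * r = r powr - (\<alpha> - 1)" using elim powr_add[of r "- \<alpha>" 1] by simp
        finally show ?case .
      qed
    qed
    then show "((H \<circ> real_of_ereal) \<longlongrightarrow> 0) (at_left \<infinity>)" by (simp add: ereal_tendsto_simps)
  qed simp
  moreover have "(LBINT r=ereal \<epsilon>..\<infinity>. h r) = (\<integral>r. indicator {\<epsilon><..} r *\<^sub>R h r \<partial>lborel)"
    by (simp add: interval_lebesgue_integral_def set_lebesgue_integral_def ei)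
  moreover have "\<dots> = (\<integral>r. r powr - \<alpha> * \<psi>' r * indicator {\<epsilon><..} r \<partial>lborel)
      - \<alpha> * (\<integral>r. r powr (- 1 - \<alpha>) * \<psi> r * indicator {\<epsilon><..} r \<partial>lborel)"
    unfolding hi' by (subst Bochner_Integration.integral_diff[OF i2 integrable_mult_right[OF i1]]) simp
  ultimately have "\<alpha> * (\<integral>r. r powr (- 1 - \<alpha>) * \<psi> r * indicator {\<epsilon><..} r \<partial>lborel)
        - (\<integral>r. r powr - \<alpha> * \<psi>' r * indicator {0<..} r \<partial>lborel)
      = H \<epsilon> - (\<integral>r. r powr - \<alpha> * \<psi>' r * indicator {0<..<\<epsilon>} r \<partial>lborel)"
    unfolding split by linarith
  moreover have "\<bar>H \<epsilon>\<bar> \<le> B * \<epsilon> powr (2 - \<alpha>)"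
  proof -
    have "\<bar>H \<epsilon>\<bar> \<le> \<epsilon> powr - \<alpha> * (B * \<epsilon> ^ 2)"
      unfolding H_def using b2[OF \<epsilon>] by (simp add: abs_mult mult_left_mono)
    also have "\<dots> = B * (\<epsilon> powr - \<alpha> * \<epsilon> powr 2)" using \<epsilon> by simp
    also have "\<epsilon> powr - \<alpha> * \<epsilon> powr 2 = \<epsilon> powr (2 - \<alpha>)" by (simp add: powr_add[symmetric])
    finally show ?thesis .
  qed
  moreover have "(B + B / (2 - \<alpha>)) * \<epsilon> powr (2 - \<alpha>) = B * \<epsilon> powr (2 - \<alpha>) + B * (\<epsilon> powr (2 - \<alpha>) / (2 - \<alpha>))"
    by (simp add: distrib_right)
  ultimately show "\<bar>\<alpha> * (\<integral>r. r powr (- 1 - \<alpha>) * \<psi> r * indicator {\<epsilon><..} r \<partial>lborel)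
        - (\<integral>r. r powr - \<alpha> * \<psi>' r * indicator {0<..} r \<partial>lborel)\<bar> \<le> (B + B / (2 - \<alpha>)) * \<epsilon> powr (2 - \<alpha>)"
    using I3 by linarith
qed

locale polar_symmetric = polar_frame +
  assumes sphere: "AE y in S. norm y = 1" and symmetric: "distr S borel uminus = S"
begin

definition levy :: "'a measure" where
  "levy = polar_law S (\<lambda>y r. ennreal (r powr (- 1 - \<alpha>) * indicator {0<..} r))"

lemma levy_weight: "(\<lambda>(y::'a, r). r powr (- 1 - \<alpha>) * indicator {0<..} r) \<in> borel_measurable (borel \<Otimes>\<^sub>M borel)"
  by measurable

lemma sets_levy: "sets levy = sets borel"
  by (simp add: levy_def polar_law_def)

text \<open>On a ray the gauge is \<open>min (r\<^sup>2) r\<close>: integrability at zero is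
  \<open>\<alpha> < 2\<close>, at infinity \<open>\<alpha> > 1\<close>.\<close>

lemma integrable_gauge: "integrable levy levy_gauge"
proof (rule integrableI_bounded)
  show "levy_gauge \<in> borel_measurable levy"
    using measurable_cong_sets[OF sets_levy refl] levy_gauge_measurable by blast
  \<comment> \<open>The two ranges overlap on the radii between 1 and 2, so their sum covers every
    positive radius and no endpoint needs attention.\<close>
  let ?h = "\<lambda>r. ennreal (r powr (1 - \<alpha>)) * indicator {0<..<2} r + ennreal (r powr (- 1 - (\<alpha> - 1))) * indicator {1<..} r"
  let ?D = "ennreal (2 powr (1 - \<alpha> + 1) / (1 - \<alpha> + 1)) + ennreal (1 powr - (\<alpha> - 1) / (\<alpha> - 1))"
  have "(\<integral>\<^sup>+u. ennreal (norm (levy_gauge u)) \<partial>levy)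
      = (\<integral>\<^sup>+y. (\<integral>\<^sup>+r. ennreal (r powr (- 1 - \<alpha>) * indicator {0<..} r) * ennreal (norm (levy_gauge (r *\<^sub>R y))) \<partial>lborel) \<partial>S)"
    unfolding levy_def using levy_weight by (intro nn_integral_polar_law[OF S]) (auto simp: case_prod_beta')
  also have "\<dots> \<le> (\<integral>\<^sup>+y. ?D \<partial>S)"
  proof (rule nn_integral_mono_AE)
    show "AE y in S. (\<integral>\<^sup>+r. ennreal (r powr (- 1 - \<alpha>) * indicator {0<..} r) * ennreal (norm (levy_gauge (r *\<^sub>R y))) \<partial>lborel) \<le> ?D"
      using sphere
    proof eventually_elim
      case (elim y)
      have "(\<integral>\<^sup>+r. ennreal (r powr (- 1 - \<alpha>) * indicator {0<..} r) * ennreal (norm (levy_gauge (r *\<^sub>R y))) \<partial>lborel) \<le> (\<integral>\<^sup>+r. ?h r \<partial>lborel)"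
      proof (rule nn_integral_mono)
        fix r :: real
        show "ennreal (r powr (- 1 - \<alpha>) * indicator {0<..} r) * ennreal (norm (levy_gauge (r *\<^sub>R y))) \<le> ?h r"
        proof (cases "0 < r")
          case True
          have g: "levy_gauge (r *\<^sub>R y) = min (r ^ 2) r" using True elim by (simp add: levy_gauge_def)
          have p: "r powr (- 1 - \<alpha>) * r ^ 2 = r powr (1 - \<alpha>)" "r powr (- 1 - \<alpha>) * r = r powr (- 1 - (\<alpha> - 1))"
            using True powr_add[of r "- 1 - \<alpha>" 2] powr_add[of r "- 1 - \<alpha>" 1] by simp_all
          show ?thesis
          proof (cases "r < 2")
            case r2: True
            have "ennreal (r powr (- 1 - \<alpha>) * min (r ^ 2) r) \<le> ennreal (r powr (1 - \<alpha>))"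
              unfolding p(1)[symmetric] by (intro ennreal_leI mult_left_mono) auto
            then show ?thesis using True r2 g by (simp add: ennreal_mult'[symmetric] add_increasing2)
          next
            case False
            have "ennreal (r powr (- 1 - \<alpha>) * min (r ^ 2) r) \<le> ennreal (r powr (- 1 - (\<alpha> - 1)))"
              unfolding p(2)[symmetric] by (intro ennreal_leI mult_left_mono) auto
            then show ?thesis using True False g by (simp add: ennreal_mult'[symmetric])
          qed
        qed simp
      qed
      also have "\<dots> = ?D"
        using \<alpha> nn_integral_powr_from_0[of "1 - \<alpha>" 2] nn_integral_powr_tail[of "\<alpha> - 1" 1]
        by (subst nn_integral_add) auto
      finally show ?case .
    qed
  qed
  also have "\<dots> = ?D * ennreal mass" by (simp add: space_S emeasure_S mass_def)
  also have "\<dots> < \<infinity>" by (simp add: ennreal_mult_less_top)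
  finally show "(\<integral>\<^sup>+u. ennreal (norm (levy_gauge u)) \<partial>levy) < \<infinity>" .
qed

text \<open>On each ray the second-order remainder of \<open>f\<close> satisfies
  \<open>radial_identity\<close>. The truncated jump integral contains the full increment instead of
  the remainder, and the difference is a multiple of \<open>f' x y\<close>. This is odd in
  \<open>y\<close>, and the symmetry of \<open>S\<close> removes it.\<close>

lemma resolvent_identity:
  assumes tf: "test_function f f' B" and \<epsilon>: "0 < \<epsilon>"
  shows "\<bar>rate \<epsilon> * \<alpha> * (act (jump_law \<epsilon>) f x - f x) - dvg f' levy x\<bar>
     \<le> mass * (B + B / (2 - \<alpha>)) * \<epsilon> powr (2 - \<alpha>)"
proof -
  have B: "0 \<le> B" by (rule tf_B[OF tf])
  have [measurable]: "f \<in> borel_measurable borel" by (rule tf_measurable[OF tf])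
  have lin: "linear (f' z)" for z by (rule tf_linear[OF tf])
  let ?k = "\<lambda>r. r powr (- 1 - \<alpha>) * indicator {\<epsilon><..} r"
  define a where "a y = (\<integral>r. 1 / rate \<epsilon> * ?k r * (f (x + r *\<^sub>R y) - f x) \<partial>lborel)" for y
  define b where "b y = (\<integral>r. r powr (- 1 - \<alpha>) * indicator {0<..} r * (f' (x + r *\<^sub>R y) (r *\<^sub>R y) - f' x (r *\<^sub>R y)) \<partial>lborel)" for y
  have R: "0 < rate \<epsilon>" by (rule rate_pos[OF \<epsilon>])
  have fb: "finite_borel (jump_law \<epsilon>)" by (rule finite_borel_jump_law[OF \<epsilon>])
  have jw: "(\<lambda>(y::'a, r). 1 / rate \<epsilon> * ?k r) \<in> borel_measurable (borel \<Otimes>\<^sub>M borel)" by measurable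
  have je: "jump_law \<epsilon> = polar_law S (\<lambda>y r. ennreal (1 / rate \<epsilon> * ?k r))"
  proof -
    have "jump_weight \<epsilon> = (\<lambda>(y::'a) r. ennreal (1 / rate \<epsilon> * ?k r))"
    proof (intro ext)
      fix y :: 'a and r
      show "jump_weight \<epsilon> y r = ennreal (1 / rate \<epsilon> * ?k r)"
        using R by (cases "\<epsilon> < r") (simp_all add: jump_weight_def ennreal_mult'[symmetric])
    qed
    then show ?thesis unfolding jump_law_def by simp
  qed
  have hb: "bounded_borel (\<lambda>u. f (x + u) - f x)"
  proof -
    have "bounded_borel f" using tf_bound[OF tf] by (auto simp: bounded_borel_def)
    moreover have "bounded_borel (\<lambda>u::'a. f x)" by (auto simp: bounded_borel_def)
    ultimately show ?thesis by (rule bounded_borel_diff[OF bounded_borel_translate])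
  qed
  have hm: "(\<lambda>u. f (x + u) - f x) \<in> borel_measurable borel" by measurable
  note A = integral_polar_law[OF S jw _ hm bounded_borel_integrable[OF fb hb, unfolded je]]
  have Ai: "integrable S a" unfolding a_def using A(1) R by simp
  have "act (jump_law \<epsilon>) f x - f x = (\<integral>u. f (x + u) - f x \<partial>jump_law \<epsilon>)"
  proof -
    interpret J: finite_measure "jump_law \<epsilon>" using fb by (simp add: finite_borel_def)
    have "bounded_borel f" using tf_bound[OF tf] by (auto simp: bounded_borel_def)
    then have i: "integrable (jump_law \<epsilon>) (\<lambda>u. f (x + u))"
      by (intro bounded_borel_integrable[OF fb bounded_borel_translate])
    have "measure (jump_law \<epsilon>) UNIV = 1" using emeasure_jump_law[OF \<epsilon>] by (simp add: measure_def)
    moreover have "space (jump_law \<epsilon>) = UNIV" by (simp add: jump_law_def polar_law_def)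
    ultimately show ?thesis using i by (simp add: act_def)
  qed
  also have "\<dots> = (\<integral>y. a y \<partial>S)" unfolding a_def je using A(2) R by simp
  finally have ea: "rate \<epsilon> * \<alpha> * (act (jump_law \<epsilon>) f x - f x) = (\<integral>y. rate \<epsilon> * \<alpha> * a y \<partial>S)" by simp
  have dm: "(\<lambda>u. f' (x + u) u - f' x u) \<in> borel_measurable borel"
    using dvg_meas[OF tf sets_levy integrable_gauge] measurable_cong_sets[OF sets_levy refl] by blast
  note D = integral_polar_law[OF S levy_weight _ dm dvg_int[OF tf sets_levy integrable_gauge, unfolded levy_def]]
  have Di: "integrable S b" unfolding b_def using D(1) by simp
  have eb: "dvg f' levy x = (\<integral>y. b y \<partial>S)"
    unfolding dvg_def[OF tf sets_levy integrable_gauge] b_def using D(2) by (simp add: levy_def)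
  \<comment> \<open>The integral of \<open>r powr - \<alpha>\<close> beyond
    \<open>\<epsilon>\<close>. It blows up as \<open>\<epsilon>\<close> tends to zero, so the
    first-order term has to cancel exactly and cannot be absorbed in the error.\<close>
  define \<kappa> where "\<kappa> = \<epsilon> powr - (\<alpha> - 1) / (\<alpha> - 1)"
  have key: "\<bar>rate \<epsilon> * \<alpha> * a y - b y - \<alpha> * \<kappa> * f' x y\<bar> \<le> (B + B / (2 - \<alpha>)) * \<epsilon> powr (2 - \<alpha>)" if y: "norm y = 1" for y
  proof -
    define \<psi> where "\<psi> r = f (x + r *\<^sub>R y) - f x - r * f' x y" for r
    define \<psi>' where "\<psi>' r = f' (x + r *\<^sub>R y) y - f' x y" for r
    have d: "DERIV \<psi> r :> \<psi>' r" for r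
      unfolding \<psi>_def[abs_def] \<psi>'_def
      by (rule DERIV_cong[OF DERIV_diff[OF DERIV_diff[OF line_deriv[OF tf sets_levy integrable_gauge] DERIV_const] DERIV_cmult_right[OF DERIV_ident]]]) simp
    have c: "isCont \<psi>' r" for r
    proof -
      have "continuous_on UNIV (\<lambda>r. f' (x + r *\<^sub>R y) y)"
        by (rule continuous_on_compose2[OF tf_cont'[OF tf]]) (auto intro!: continuous_intros)
      then show ?thesis unfolding \<psi>'_def[abs_def]
        by (intro continuous_intros) (simp add: continuous_on_eq_continuous_at)
    qed
    have b1: "\<bar>\<psi> r\<bar> \<le> 2 * B * r" if "0 < r" for r
    proof -
      have "\<bar>f (x + r *\<^sub>R y) - f x\<bar> \<le> B * r" using tf_lip[OF tf, of "x + r *\<^sub>R y" x] y that by simp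
      moreover have "\<bar>r * f' x y\<bar> \<le> r * B"
        using tf_bound'[OF tf, of x y] y that by (simp add: abs_mult mult_left_mono)
      ultimately show ?thesis by (simp add: \<psi>_def abs_le_iff) (simp add: algebra_simps)
    qed
    have b2: "\<bar>\<psi> r\<bar> \<le> B * r ^ 2" if "0 < r" for r
      using tf_taylor[OF tf, of x "r *\<^sub>R y"] y that by (simp add: \<psi>_def linear_cmul[OF lin])
    have b3: "\<bar>\<psi>' r\<bar> \<le> 2 * B" for r
      using tf_bound'[OF tf, of x y] tf_bound'[OF tf, of "x + r *\<^sub>R y" y] y by (simp add: \<psi>'_def)
    have b4: "\<bar>\<psi>' r\<bar> \<le> B * r" if "0 < r" for r
      using tf_lip'[OF tf, of "x + r *\<^sub>R y" y x] y that by (simp add: \<psi>'_def)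
    note RI = radial_identity[OF \<alpha> \<epsilon> B d c b1 b2 b3 b4]
    have t: "has_bochner_integral lborel (\<lambda>r. r powr - \<alpha> * indicator {\<epsilon><..} r) \<kappa>"
      using has_bochner_integral_powr_tail[of "\<alpha> - 1" \<epsilon>] \<alpha> \<epsilon> by (simp add: \<kappa>_def)
    have "rate \<epsilon> * a y = (\<integral>r. ?k r * (f (x + r *\<^sub>R y) - f x) \<partial>lborel)"
      using R by (simp add: a_def mult.assoc)
    also have "\<dots> = (\<integral>r. r powr (- 1 - \<alpha>) * \<psi> r * indicator {\<epsilon><..} r + f' x y * (r powr - \<alpha> * indicator {\<epsilon><..} r) \<partial>lborel)"
    proof (rule Bochner_Integration.integral_cong[OF refl])
      fix r
      show "?k r * (f (x + r *\<^sub>R y) - f x) = r powr (- 1 - \<alpha>) * \<psi> r * indicator {\<epsilon><..} r + f' x y * (r powr - \<alpha> * indicator {\<epsilon><..} r)"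
      proof (cases "\<epsilon> < r")
        case True
        then have "r powr - \<alpha> = r powr (- 1 - \<alpha>) * r" using \<epsilon> powr_add[of r "- 1 - \<alpha>" 1] by simp
        then show ?thesis using True by (simp add: \<psi>_def algebra_simps)
      qed simp
    qed
    also have "\<dots> = (\<integral>r. r powr (- 1 - \<alpha>) * \<psi> r * indicator {\<epsilon><..} r \<partial>lborel) + f' x y * \<kappa>"
      using t by (subst Bochner_Integration.integral_add[OF RI(1)]) (auto simp: has_bochner_integral_iff)
    finally have ra: "rate \<epsilon> * a y = (\<integral>r. r powr (- 1 - \<alpha>) * \<psi> r * indicator {\<epsilon><..} r \<partial>lborel) + f' x y * \<kappa>" .
    have rb: "b y = (\<integral>r. r powr - \<alpha> * \<psi>' r * indicator {0<..} r \<partial>lborel)"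
      unfolding b_def
    proof (rule Bochner_Integration.integral_cong[OF refl])
      fix r
      show "r powr (- 1 - \<alpha>) * indicator {0<..} r * (f' (x + r *\<^sub>R y) (r *\<^sub>R y) - f' x (r *\<^sub>R y)) = r powr - \<alpha> * \<psi>' r * indicator {0<..} r"
      proof (cases "0 < r")
        case True
        then have "r powr - \<alpha> = r powr (- 1 - \<alpha>) * r" using powr_add[of r "- 1 - \<alpha>" 1] by simp
        then show ?thesis using True by (simp add: \<psi>'_def linear_cmul[OF lin] algebra_simps)
      qed simp
    qed
    have "rate \<epsilon> * \<alpha> * a y - b y - \<alpha> * \<kappa> * f' x y
        = \<alpha> * (\<integral>r. r powr (- 1 - \<alpha>) * \<psi> r * indicator {\<epsilon><..} r \<partial>lborel) - (\<integral>r. r powr - \<alpha> * \<psi>' r * indicator {0<..} r \<partial>lborel)"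
    proof -
      have "rate \<epsilon> * \<alpha> * a y = \<alpha> * (rate \<epsilon> * a y)" by simp
      then show ?thesis unfolding ra rb by (simp add: algebra_simps)
    qed
    then show ?thesis using RI(2) by simp
  qed
  interpret finite_measure S using S by (simp add: finite_borel_def)
  have lm: "f' x \<in> borel_measurable borel"
    using has_derivative_bounded_linear[OF tf_deriv[OF tf]]
    by (intro borel_measurable_continuous_onI linear_continuous_on)
  have li: "integrable S (f' x)"
  proof (rule integrable_const_bound)
    show "AE y in S. norm (f' x y) \<le> B"
      using sphere
    proof eventually_elim
      case (elim y)
      then show ?case using tf_bound'[OF tf, of x y] by simp
    qed
  qed (rule measurable_S[OF lm])
  \<comment> \<open>A linear function has integral zero against a measure that is invariant under
    reflection.\<close>
  have "(\<integral>y. f' x y \<partial>S) = (\<integral>y. f' x y \<partial>distr S borel uminus)" by (simp add: symmetric)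
  also have "\<dots> = (\<integral>y. f' x (- y) \<partial>S)"
    by (rule integral_distr[OF _ lm]) (rule measurable_S, simp)
  also have "\<dots> = - (\<integral>y. f' x y \<partial>S)" by (simp add: linear_neg[OF lin])
  finally have l0: "(\<integral>y. f' x y \<partial>S) = 0" by simp
  have "rate \<epsilon> * \<alpha> * (act (jump_law \<epsilon>) f x - f x) - dvg f' levy x
      = (\<integral>y. rate \<epsilon> * \<alpha> * a y - b y - \<alpha> * \<kappa> * f' x y \<partial>S)"
    unfolding ea eb using Ai Di li l0 by simp
  also have "\<bar>\<dots>\<bar> \<le> (\<integral>y. (B + B / (2 - \<alpha>)) * \<epsilon> powr (2 - \<alpha>) \<partial>S)"
  proof (rule order_trans[OF integral_abs_bound integral_mono_AE])
    show "AE y in S. \<bar>rate \<epsilon> * \<alpha> * a y - b y - \<alpha> * \<kappa> * f' x y\<bar> \<le> (B + B / (2 - \<alpha>)) * \<epsilon> powr (2 - \<alpha>)"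
      using sphere by eventually_elim (rule key)
  qed (use Ai Di li in auto)
  also have "\<dots> = mass * (B + B / (2 - \<alpha>)) * \<epsilon> powr (2 - \<alpha>)"
    by (simp add: mass_def space_S)
  finally show ?thesis .
qed

lemma resolvent_data_test_function:
  assumes tf: "test_function f f' B"
  shows "resolvent_data f (grad f levy) (grad' f' levy) (dvg f' levy)"
  unfolding resolvent_data_def
proof (intro conjI)
  note L = sets_levy integrable_gauge
  show "bounded_borel f" using tf_bound[OF tf] tf_measurable[OF tf] by (auto simp: bounded_borel_def)
  show "(\<integral>\<^sup>+x. ennreal \<bar>f x\<bar> \<partial>lborel) < \<infinity>" using tf by (simp add: test_function_def)
  show "bounded_borel (dvg f' levy)" by (rule dvg_bounded[OF tf L])
  show "grad f levy \<in> borel_measurable borel"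
    by (rule borel_measurable_continuous_onI[OF grad_cont[OF tf L]])
  show "divergence_pair (grad f levy) (grad' f' levy) (dvg f' levy)"
    by (rule grad_divergence_pair[OF tf L])
  show "\<exists>E. \<forall>\<epsilon>>0. \<forall>x. \<bar>rate \<epsilon> * \<alpha> * (act (jump_law \<epsilon>) f x - f x) - dvg f' levy x\<bar> \<le> E * \<epsilon> powr (2 - \<alpha>)"
    using resolvent_identity[OF tf] by blast
qed

end

section \<open>Frames from non-degeneracy\<close>

text \<open>The topological support of the measure.\<close>

definition law_support :: "'a::euclidean_space measure \<Rightarrow> 'a set" where
  "law_support S = {y. \<forall>r>0. 0 < emeasure S (ball y r)}"

text \<open>The complement is a union of open null sets. By Lindelof countably many of them suffice,
  so the union is null.\<close>

lemma AE_law_support: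
  fixes S :: "'a::euclidean_space measure"
  assumes S: "sets S = sets borel"
  shows "AE y in S. y \<in> law_support S"
proof -
  define \<F> where "\<F> = {U :: 'a set. open U \<and> emeasure S U = 0}"
  obtain \<G> where G: "\<G> \<subseteq> \<F>" "countable \<G>" "\<Union>\<G> = \<Union>\<F>"
    using Lindelof[of \<F>] by (auto simp: \<F>_def)
  have "(\<Union>U\<in>\<G>. U) \<in> null_sets S"
    using G(1,2) S by (intro null_sets_UN') (auto simp: \<F>_def null_sets_def)
  then have "\<Union>\<G> \<in> null_sets S" by simp
  moreover have "{y \<in> space S. y \<notin> law_support S} \<subseteq> \<Union>\<G>"
  proof
    fix y assume "y \<in> {y \<in> space S. y \<notin> law_support S}"
    then obtain r where "0 < r" "emeasure S (ball y r) = 0" by (auto simp: law_support_def not_gr_zero)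
    then have "ball y r \<in> \<F>" "y \<in> ball y r" by (auto simp: \<F>_def)
    then show "y \<in> \<Union>\<G>" unfolding G(3) by blast
  qed
  ultimately show ?thesis by (rule AE_I')
qed

text \<open>If the support lay in a proper subspace, some unit vector would be orthogonal to almost
  every direction.\<close>

lemma law_support_spans:
  fixes S :: "'a::euclidean_space measure"
  assumes S: "sets S = sets borel" and nd: "\<And>v. norm v = 1 \<Longrightarrow> \<not> (AE y in S. v \<bullet> y = 0)"
  shows "span (law_support S) = UNIV"
proof (rule ccontr)
  assume "span (law_support S) \<noteq> UNIV"
  then obtain a where a: "a \<noteq> 0" "\<forall>y\<in>span (law_support S). a \<bullet> y = 0"
    using span_not_UNIV_orthogonal by blast
  have "AE y in S. (a /\<^sub>R norm a) \<bullet> y = 0"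
    using AE_law_support[OF S] by eventually_elim (use a(2) in \<open>auto intro: span_base\<close>)
  then show False using nd[of "a /\<^sub>R norm a"] a(1) by simp
qed

lemma frame_perturb:
  fixes \<delta> :: real
  assumes y: "frame c y" and z: "\<And>b. b \<in> Basis \<Longrightarrow> norm (z b - y b) \<le> \<delta>" and \<delta>: "DIM('a) * \<delta> \<le> c / 2"
  shows "frame (c / 2) (z :: 'a::euclidean_space \<Rightarrow> 'a)"
  unfolding frame_def
proof
  fix v :: 'a
  have "norm (\<Sum>b\<in>Basis. (v \<bullet> b) *\<^sub>R (z b - y b)) \<le> (\<Sum>b\<in>(Basis::'a set). norm v * \<delta>)"
  proof (rule sum_norm_le)
    fix b :: 'a assume b: "b \<in> Basis"
    show "norm ((v \<bullet> b) *\<^sub>R (z b - y b)) \<le> norm v * \<delta>"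
      using Basis_le_norm[OF b, of v] z[OF b] by (auto intro!: mult_mono)
  qed
  also have "\<dots> \<le> c / 2 * norm v" using mult_left_mono[OF \<delta>, of "norm v"] by (simp add: mult_ac)
  finally have "norm (\<Sum>b\<in>Basis. (v \<bullet> b) *\<^sub>R (z b - y b)) \<le> c / 2 * norm v" .
  moreover have "c * norm v \<le> norm (\<Sum>b\<in>Basis. (v \<bullet> b) *\<^sub>R y b)" using y by (simp add: frame_def)
  moreover have "(\<Sum>b\<in>Basis. (v \<bullet> b) *\<^sub>R z b) = (\<Sum>b\<in>Basis. (v \<bullet> b) *\<^sub>R y b) + (\<Sum>b\<in>Basis. (v \<bullet> b) *\<^sub>R (z b - y b))"
    by (simp add: scaleR_diff_right sum_subtractf)
  moreover have "norm (\<Sum>b\<in>Basis. (v \<bullet> b) *\<^sub>R y b) - norm (\<Sum>b\<in>Basis. (v \<bullet> b) *\<^sub>R (z b - y b))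
      \<le> norm ((\<Sum>b\<in>Basis. (v \<bullet> b) *\<^sub>R y b) + (\<Sum>b\<in>Basis. (v \<bullet> b) *\<^sub>R (z b - y b)))"
    by (rule norm_diff_ineq)
  ultimately show "c / 2 * norm v \<le> norm (\<Sum>b\<in>Basis. (v \<bullet> b) *\<^sub>R z b)" by simp
qed

text \<open>A basis chosen inside \<open>P\<close> and indexed by \<open>Basis\<close> makes the
  coefficient map onto, hence injective, and an injective linear map in finite dimension is bounded
  below.\<close>

lemma frame_of_spanning_set:
  assumes "span (P :: 'a::euclidean_space set) = UNIV"
  obtains c y where "0 < c" "frame c (y :: 'a \<Rightarrow> 'a)" "\<And>b. b \<in> Basis \<Longrightarrow> y b \<in> P"
proof -
  obtain Q where Q: "Q \<subseteq> P" "independent Q" "P \<subseteq> span Q" "card Q = dim P" by (rule basis_exists)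
  have "span P \<subseteq> span Q" using Q(3) by (simp add: span_minimal)
  then have sQ: "span Q = UNIV" using assms by auto
  have fQ: "finite Q" using Q(2) by (rule independent_imp_finite)
  have "card Q = DIM('a)" using Q(4) assms by (metis dim_UNIV dim_span)
  then obtain y where y: "bij_betw y (Basis :: 'a set) Q"
    using finite_same_card_bij[OF finite_Basis fQ] by auto
  let ?L = "\<lambda>v::'a. \<Sum>b\<in>Basis. (v \<bullet> b) *\<^sub>R y b"
  have L: "linear ?L" by (rule linear_frame)
  have "Q \<subseteq> range ?L"
  proof
    fix q assume "q \<in> Q"
    then obtain e where e: "e \<in> Basis" "y e = q" using y by (auto simp: bij_betw_def)
    have "?L e = (\<Sum>b\<in>Basis. if b = e then y b else 0)"
      by (intro sum.cong) (auto simp: e(1) inner_Basis)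
    then have "?L e = q" using e by simp
    then show "q \<in> range ?L" by blast
  qed
  then have "span Q \<subseteq> range ?L" by (intro span_minimal linear_subspace_image[OF L]) auto
  then have "surj ?L" using sQ by auto
  then have "inj ?L" by (rule linear_surjective_imp_injective[OF L]) simp
  then obtain c where "0 < c" "\<And>x. c * norm x \<le> norm (?L x)" using linear_inj_bounded_below_pos[OF L] by metis
  then show ?thesis using that[of c y] y Q(1) by (auto simp: frame_def bij_betw_def)
qed

lemma positive_caps:
  fixes S :: "'a::euclidean_space measure"
  assumes S: "sets S = sets borel" and nd: "\<And>v. norm v = 1 \<Longrightarrow> \<not> (AE y in S. v \<bullet> y = 0)"
  obtains c C where "0 < c" "\<And>b. C b \<in> sets borel" "\<And>b. b \<in> Basis \<Longrightarrow> 0 < emeasure S (C b)"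
    "\<And>y :: 'a \<Rightarrow> 'a. (\<And>b. b \<in> Basis \<Longrightarrow> y b \<in> C b) \<Longrightarrow> frame c y"
proof -
  obtain c y where c: "0 < c" and y: "frame c (y :: 'a \<Rightarrow> 'a)" "\<And>b. b \<in> Basis \<Longrightarrow> y b \<in> law_support S"
    using frame_of_spanning_set[OF law_support_spans[OF S nd]] by blast
  \<comment> \<open>Moving each of the \<open>d\<close> vectors by at most this radius changes the
    frame map by at most \<open>c / 2\<close>, so half of the lower bound survives for every choice
    from the balls. The balls have positive mass because their centres lie in the support.\<close>
  define \<delta> where "\<delta> = c / (2 * DIM('a))"
  have d: "0 < \<delta>" "DIM('a) * \<delta> \<le> c / 2" using c by (auto simp: \<delta>_def)
  show ?thesis
  proof (rule that[of "c / 2" "\<lambda>b. ball (y b) \<delta>"])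
    show "frame (c / 2) z" if "\<And>b. b \<in> Basis \<Longrightarrow> z b \<in> ball (y b) \<delta>" for z :: "'a \<Rightarrow> 'a"
      by (rule frame_perturb[OF y(1) _ d(2)]) (use that in \<open>fastforce simp: dist_norm norm_minus_commute\<close>)
  qed (use c d y(2) in \<open>auto simp: law_support_def\<close>)
qed

section \<open>Smooth functions of compact support\<close>

lemma frechet_derivative_zero_outside:
  fixes g :: "'a::euclidean_space \<Rightarrow> real"
  assumes "closed K" "\<And>x. x \<notin> K \<Longrightarrow> g x = 0" "x \<notin> K"
  shows "frechet_derivative g (at x) v = 0"
proof -
  have "(g has_derivative (\<lambda>_. 0)) (at x)"
    by (rule has_derivative_transform_within_open[of "\<lambda>_. 0" _ _ UNIV "- K"]) (use assms in auto)
  then show ?thesis by (metis frechet_derivative_at)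
qed

lemma bounded_of_continuous_zero_outside:
  fixes g :: "'a::euclidean_space \<Rightarrow> real"
  assumes "compact K" "continuous_on UNIV g" "\<And>x. x \<notin> K \<Longrightarrow> g x = 0"
  obtains M where "0 \<le> M" "\<And>x. \<bar>g x\<bar> \<le> M"
proof -
  have "bounded (g ` K)"
    using assms by (intro compact_imp_bounded compact_continuous_image) (auto intro: continuous_on_subset)
  then obtain M where M: "\<And>x. x \<in> K \<Longrightarrow> \<bar>g x\<bar> \<le> M" by (auto simp: bounded_iff)
  have "\<bar>g x\<bar> \<le> max M 0" for x using M[of x] assms(3)[of x] by (cases "x \<in> K") auto
  then show ?thesis using that[of "max M 0"] by simp
qed

text \<open>The derivative in each basis direction is continuous and vanishes off a compact set,
  hence is bounded. The sum of these bounds controls the full derivative, and the mean value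
  inequality gives the Lipschitz bound.\<close>

lemma Ck_1_lipschitz:
  fixes g :: "real ^ 'n \<Rightarrow> real"
  assumes g: "Ck 1 g" and K: "compact K" "\<And>x. x \<notin> K \<Longrightarrow> g x = 0"
  obtains M where "0 \<le> M" "\<And>x v. \<bar>frechet_derivative g (at x) v\<bar> \<le> M * norm v" "\<And>x z. \<bar>g x - g z\<bar> \<le> M * norm (x - z)"
proof -
  let ?D = "\<lambda>x v. frechet_derivative g (at x) v"
  have dg: "g differentiable (at x)" and ct: "continuous_on UNIV (\<lambda>x. ?D x v)" for x v
    using g by (simp_all add: numeral_eq_Suc One_nat_def)
  have hd: "(g has_derivative ?D x) (at x)" for x using dg frechet_derivative_works by blast
  have lin: "linear (?D x)" for x by (rule linear_frechet_derivative[OF dg])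
  have "\<exists>M\<ge>0. \<forall>x. \<bar>?D x b\<bar> \<le> M" for b
    using bounded_of_continuous_zero_outside[OF K(1) ct frechet_derivative_zero_outside[OF compact_imp_closed[OF K(1)] K(2)]]
    by metis
  then obtain m where m: "\<And>b. 0 \<le> m b" "\<And>b x. \<bar>?D x b\<bar> \<le> m b" by metis
  define M where "M = (\<Sum>b\<in>Basis. m b)"
  have M: "0 \<le> M" unfolding M_def by (intro sum_nonneg m)
  have bd: "\<bar>?D x v\<bar> \<le> M * norm v" for x v
  proof -
    have "?D x v = ?D x (\<Sum>b\<in>Basis. (v \<bullet> b) *\<^sub>R b)" by (simp only: euclidean_representation)
    also have "\<dots> = (\<Sum>b\<in>Basis. (v \<bullet> b) * ?D x b)"
      by (simp add: linear_sum[OF lin] linear_cmul[OF lin])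
    also have "\<bar>\<dots>\<bar> \<le> (\<Sum>b\<in>Basis. norm v * m b)"
      unfolding real_norm_def[symmetric]
      by (rule sum_norm_le) (auto simp: abs_mult intro!: mult_mono m Basis_le_norm)
    also have "\<dots> = M * norm v" by (simp add: M_def sum_distrib_left mult.commute)
    finally show ?thesis .
  qed
  have "norm (g x - g z) \<le> M * norm (x - z)" for x z
  proof (rule differentiable_bound[of UNIV g ?D])
    show "(g has_derivative ?D x) (at x within UNIV)" for x using hd by simp
    show "onorm (?D x) \<le> M" for x using bd M by (intro onorm_bound) auto
  qed auto
  then show ?thesis using that[OF M bd] by simp
qed

lemma test_function_Cc_infinity:
  fixes f :: "real ^ 'n \<Rightarrow> real"
  assumes "f \<in> Cc_infinity"
  obtains B where "test_function f (\<lambda>x. frechet_derivative f (at x)) B"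
proof -
  let ?D = "\<lambda>x v. frechet_derivative f (at x) v"
  define K where "K = closure (support_on UNIV f)"
  have K: "compact K" using assms by (simp add: Cc_infinity_def K_def)
  have f0: "f x = 0" if "x \<notin> K" for x
    using that closure_subset[of "support_on UNIV f"] by (auto simp: K_def support_on_def)
  have Ck: "Ck k f" for k using assms by (simp add: Cc_infinity_def)
  have C0: "continuous_on UNIV f" using Ck[of 0] by simp
  \<comment> \<open>The Lipschitz bound for the derivative needs the second derivatives, that is
    \<open>Ck 2 f\<close>. It is obtained for each basis direction and then summed.\<close>
  have C1: "Ck 1 (\<lambda>x. ?D x v)" for v using Ck[of "Suc 1"] by (simp only: Ck.simps)
  have df: "f differentiable (at x)" for x using Ck[of 1] by simp
  have hd: "(f has_derivative ?D x) (at x)" for x using df frechet_derivative_works by blast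
  have lin: "linear (?D x)" for x by (rule linear_frechet_derivative[OF df])
  obtain M0 where M0: "0 \<le> M0" "\<And>x. \<bar>f x\<bar> \<le> M0" using bounded_of_continuous_zero_outside[OF K C0 f0] by metis
  obtain M1 where M1: "0 \<le> M1" "\<And>x v. \<bar>?D x v\<bar> \<le> M1 * norm v" using Ck_1_lipschitz[OF Ck[of 1] K f0] by metis
  have "\<exists>M\<ge>0. \<forall>x z. \<bar>?D x b - ?D z b\<bar> \<le> M * norm (x - z)" for b
    using Ck_1_lipschitz[OF C1[of b] K frechet_derivative_zero_outside[OF compact_imp_closed[OF K] f0]] by metis
  then obtain m where m: "\<And>b. 0 \<le> m b" "\<And>b x z. \<bar>?D x b - ?D z b\<bar> \<le> m b * norm (x - z)" by metis
  define M2 where "M2 = (\<Sum>b\<in>Basis. m b)"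
  have M2: "0 \<le> M2" unfolding M2_def by (intro sum_nonneg m)
  have b2: "\<bar>?D x v - ?D z v\<bar> \<le> M2 * norm (x - z) * norm v" for x z v
  proof -
    have e: "?D x v = (\<Sum>b\<in>Basis. (v \<bullet> b) * ?D x b)" for x
    proof -
      have "?D x v = ?D x (\<Sum>b\<in>Basis. (v \<bullet> b) *\<^sub>R b)" by (simp only: euclidean_representation)
      also have "\<dots> = (\<Sum>b\<in>Basis. (v \<bullet> b) * ?D x b)"
        by (simp add: linear_sum[OF lin] linear_cmul[OF lin])
      finally show ?thesis .
    qed
    have "?D x v - ?D z v = (\<Sum>b\<in>Basis. (v \<bullet> b) * (?D x b - ?D z b))"
      unfolding e[of x] e[of z] by (simp add: sum_subtractf right_diff_distrib)
    also have "\<bar>\<dots>\<bar> \<le> (\<Sum>b\<in>Basis. norm v * (m b * norm (x - z)))"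
      unfolding real_norm_def[symmetric]
      by (rule sum_norm_le) (auto simp: abs_mult intro!: mult_mono m Basis_le_norm)
    also have "\<dots> = M2 * norm (x - z) * norm v"
      by (simp add: M2_def sum_distrib_left sum_distrib_right mult_ac)
    finally show ?thesis .
  qed
  have "(\<integral>\<^sup>+x. ennreal \<bar>f x\<bar> \<partial>lborel) \<le> (\<integral>\<^sup>+x. ennreal M0 * indicator K x \<partial>lborel)"
    using M0 f0 by (intro nn_integral_mono) (auto simp: indicator_def intro!: ennreal_leI)
  also have "\<dots> = ennreal M0 * emeasure lborel K"
    using compact_imp_closed[OF K] by (intro nn_integral_cmult_indicator) auto
  also have "\<dots> < \<infinity>"
    using emeasure_bounded_finite[OF compact_imp_bounded[OF K]] by (auto intro!: ennreal_mult_less_top[THEN iffD2])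
  finally have fin: "(\<integral>\<^sup>+x. ennreal \<bar>f x\<bar> \<partial>lborel) < \<infinity>" .
  let ?B = "M0 + M1 + M2"
  have "test_function f ?D ?B"
    unfolding test_function_def
  proof (intro conjI allI hd fin)
    fix x z v :: "real ^ 'n"
    have "M1 * norm v \<le> ?B * norm v" using M0 M2 by (intro mult_right_mono) auto
    then show "\<bar>?D x v\<bar> \<le> ?B * norm v" using M1(2)[of x v] by linarith
    have "M2 * norm (x - z) * norm v \<le> ?B * norm (x - z) * norm v" using M0 M1 by (intro mult_right_mono) auto
    then show "\<bar>?D x v - ?D z v\<bar> \<le> ?B * norm (x - z) * norm v" using b2[of x v z] by linarith
    show "\<bar>f x\<bar> \<le> ?B" using M0(2)[of x] M1(1) M2 by linarith
  qed
  then show ?thesis by (rule that)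
qed

section \<open>The Sobolev inequality\<close>

text \<open>\<open>\<sigma>\<close> lives on the sphere as its whole space, while convolutions and
  product measures below are taken over the whole Euclidean space. The image under the inclusion
  carries all the properties over.\<close>

lemma spherical_component_ambient:
  fixes \<sigma> :: "(real ^ 'n) measure"
  assumes "spherical_component \<sigma>"
  defines "S \<equiv> distr \<sigma> borel (\<lambda>x. x)"
  shows measurable_spherical: "(\<lambda>x. x) \<in> measurable \<sigma> borel" and finite_borel_ambient: "finite_borel S"
    and AE_sphere_ambient: "AE y in S. norm y = 1" and symmetric_ambient: "distr S borel uminus = S"
proof -
  have s: "sets \<sigma> = sets (restrict_space borel (sphere 0 1))" and fin: "finite_measure \<sigma>"
    and sym: "\<And>B. B \<in> sets \<sigma> \<Longrightarrow> emeasure \<sigma> (uminus ` B) = emeasure \<sigma> B"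
    using assms(1) by (auto simp: spherical_component_def)
  have sp: "space \<sigma> = sphere 0 1" using sets_eq_imp_space_eq[OF s] by (simp add: space_restrict_space)
  have "(\<lambda>x. x) \<in> measurable (restrict_space borel (sphere 0 1)) (borel :: (real ^ 'n) measure)"
    by (intro measurable_restrict_space1) simp
  then show id: "(\<lambda>x. x) \<in> measurable \<sigma> borel"
    using measurable_cong_sets[OF s refl] by blast
  show fS: "finite_borel S"
    using finite_measure.finite_measure_distr[OF fin id] by (simp add: finite_borel_def S_def)
  have "AE x in \<sigma>. norm x = 1" by (rule AE_I2) (simp add: sp)
  then show "AE y in S. norm y = 1" unfolding S_def by (subst AE_distr_iff[OF id]) auto
  show "distr S borel uminus = S"
  proof (rule measure_eqI)
    fix A assume "A \<in> sets (distr S borel uminus)"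
    then have A: "A \<in> sets borel" by simp
    have um: "uminus \<in> measurable S borel" by (simp add: S_def)
    have A': "uminus -` A \<in> sets borel" using measurable_sets[OF _ A, of uminus borel] by simp
    have "emeasure (distr S borel uminus) A = emeasure S (uminus -` A)"
      by (subst emeasure_distr[OF um A]) (simp add: S_def)
    also have "\<dots> = emeasure \<sigma> (uminus -` A \<inter> sphere 0 1)"
      unfolding S_def by (subst emeasure_distr[OF id A']) (simp add: sp)
    also have "uminus -` A \<inter> sphere 0 1 = uminus ` (A \<inter> sphere 0 1)"
    proof (intro equalityI subsetI)
      fix x assume "x \<in> uminus -` A \<inter> sphere 0 1"
      then have "- x \<in> A \<inter> sphere 0 1" by simp
      then show "x \<in> uminus ` (A \<inter> sphere 0 1)" by (rule rev_image_eqI) simp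
    qed auto
    also have "emeasure \<sigma> \<dots> = emeasure \<sigma> (A \<inter> sphere 0 1)"
      using A by (intro sym) (auto simp: s sets_restrict_space)
    also have "\<dots> = emeasure S A"
      unfolding S_def by (subst emeasure_distr[OF id A]) (simp add: sp)
    finally show "emeasure (distr S borel uminus) A = emeasure S A" .
  qed (simp add: S_def)
qed

lemma symmetric_stable_levy_measure_polar_law:
  fixes \<sigma> \<nu> :: "(real ^ 'n) measure"
  assumes "symmetric_stable_levy_measure \<alpha> \<sigma> \<nu>"
  shows "\<nu> = polar_law (distr \<sigma> borel (\<lambda>x. x)) (\<lambda>y r. ennreal (r powr (- 1 - \<alpha>) * indicator {0<..} r))"
    (is "_ = polar_law ?S ?w")
proof (rule measure_eqI)
  have sph: "spherical_component \<sigma>" and s: "sets \<nu> = sets borel"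
    and e: "\<And>B. B \<in> sets borel \<Longrightarrow> emeasure \<nu> B =
        (\<integral>\<^sup>+y. (\<integral>\<^sup>+r\<in>{0<..}. indicator B (r *\<^sub>R y) * ennreal (1 / r powr (\<alpha> + 1)) \<partial>lborel) \<partial>\<sigma>)"
    using assms by (auto simp: symmetric_stable_levy_measure_def)
  show "sets \<nu> = sets (polar_law ?S ?w)" by (simp add: s polar_law_def)
  fix A assume "A \<in> sets \<nu>"
  then have A [measurable]: "A \<in> sets borel" by (simp add: s)
  have w: "(\<lambda>(y::real ^ 'n, r). ?w y r) \<in> borel_measurable (borel \<Otimes>\<^sub>M borel)" by measurable
  have m: "(\<lambda>y::real ^ 'n. \<integral>\<^sup>+r. ?w y r * indicator A (r *\<^sub>R y) \<partial>lborel) \<in> borel_measurable borel"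
  proof (rule lborel.borel_measurable_nn_integral)
    have "(\<lambda>(y::real ^ 'n, r). ?w y r * indicator A (r *\<^sub>R y)) \<in> borel_measurable (borel \<Otimes>\<^sub>M borel)" by measurable
    then show "(\<lambda>(y::real ^ 'n, r). ?w y r * indicator A (r *\<^sub>R y)) \<in> borel_measurable (borel \<Otimes>\<^sub>M lborel)"
      by (subst measurable_cong_sets[OF sets_pair_measure_cong[OF refl sets_lborel] refl])
  qed
  have "emeasure (polar_law ?S ?w) A = (\<integral>\<^sup>+u. indicator A u \<partial>polar_law ?S ?w)"
    using A by (simp add: polar_law_def)
  also have "\<dots> = (\<integral>\<^sup>+y. (\<integral>\<^sup>+r. ?w y r * indicator A (r *\<^sub>R y) \<partial>lborel) \<partial>?S)"
    by (rule nn_integral_polar_law[OF finite_borel_ambient[OF sph] w]) simp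
  also have "\<dots> = (\<integral>\<^sup>+y. (\<integral>\<^sup>+r. ?w y r * indicator A (r *\<^sub>R y) \<partial>lborel) \<partial>\<sigma>)"
    using m by (intro nn_integral_distr measurable_spherical[OF sph]) simp
  also have "\<dots> = emeasure \<nu> A"
    unfolding e[OF A]
  proof (intro nn_integral_cong)
    fix y :: "real ^ 'n" and r :: real
    have "r powr (- 1 - \<alpha>) = 1 / r powr (\<alpha> + 1)" using powr_minus_divide[of r "\<alpha> + 1"] by (simp add: algebra_simps)
    then show "?w y r * indicator A (r *\<^sub>R y) = indicator A (r *\<^sub>R y) * ennreal (1 / r powr (\<alpha> + 1)) * indicator {0<..} r"
      by (simp add: indicator_def)
  qed
  finally show "emeasure \<nu> A = emeasure (polar_law ?S ?w) A" by simp
qed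

text \<open>If almost every direction were orthogonal to \<open>v\<close>, the integral at
  \<open>v\<close> would be zero and the infimum could not be positive. The spectral measure is a
  multiple of \<open>\<sigma>\<close>, so null sets of \<open>\<sigma>\<close> remain null.\<close>

lemma nondegenerate_not_AE_orthogonal:
  fixes \<sigma> :: "(real ^ 'n) measure"
  assumes nd: "nondegenerate \<alpha> \<sigma>" and v: "norm v = 1"
  shows "\<not> (AE x in \<sigma>. v \<bullet> x = 0)"
proof
  let ?I = "\<lambda>y. \<integral>x. \<bar>y \<bullet> x\<bar> powr \<alpha> \<partial>(spectral_measure \<alpha> \<sigma>)"
  assume "AE x in \<sigma>. v \<bullet> x = 0"
  then obtain N where N: "{x \<in> space \<sigma>. v \<bullet> x \<noteq> 0} \<subseteq> N" "emeasure \<sigma> N = 0" "N \<in> sets \<sigma>" by (rule AE_E)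
  have "AE x in spectral_measure \<alpha> \<sigma>. v \<bullet> x = 0"
  proof (rule AE_I'[of N])
    show "N \<in> null_sets (spectral_measure \<alpha> \<sigma>)" using N by (auto simp: spectral_measure_def null_sets_def)
  qed (use N in \<open>simp add: spectral_measure_def space_scale_measure\<close>)
  then have "?I v = 0" by (intro integral_eq_zero_AE) (auto elim!: eventually_mono)
  \<comment> \<open>The infimum is taken in the reals, so that it lies below a value only once the
    values are known to be bounded below; zero is such a bound.\<close>
  moreover have "(INF y\<in>sphere 0 1. ?I y) \<le> ?I v"
    by (rule cINF_lower) (use v in \<open>auto intro!: bdd_belowI2[of _ 0] integral_nonneg_AE\<close>)
  ultimately show False using nd by (simp add: nondegenerate_def)
qed

text \<open>Division by \<open>t\<close> reduces to the normalised estimate. An arbitrary positive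
  upper bound \<open>t\<close> is used instead of the norm itself, which could be zero.\<close>

lemma (in polar_symmetric) sobolev_test_function:
  fixes p :: real
  assumes p: "1 < p" "p * (\<alpha> - 1) < DIM('a)"
  defines "ps \<equiv> p * DIM('a) / (DIM('a) - p * (\<alpha> - 1))"
  shows "\<exists>C>0. \<forall>f f' B t. test_function f f' B \<longrightarrow> 0 < t \<longrightarrow>
     (\<integral>\<^sup>+x. ennreal (norm (grad f levy x) powr p) \<partial>lborel) \<le> ennreal (t powr p) \<longrightarrow>
     (\<integral>\<^sup>+x. ennreal (norm (f x) powr ps) \<partial>lborel) \<le> ennreal (C * t powr ps)"
proof -
  obtain C where C: "0 < C" "\<And>f F G w. resolvent_data f F G w \<Longrightarrow> (\<integral>\<^sup>+x. ennreal (norm (F x) powr p) \<partial>lborel) \<le> 1 \<Longrightarrow>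
     (\<integral>\<^sup>+x. ennreal (\<bar>f x\<bar> powr ps) \<partial>lborel) \<le> ennreal C"
    using sobolev_normalized[OF p] unfolding ps_def by blast
  have "(\<integral>\<^sup>+x. ennreal (norm (f x) powr ps) \<partial>lborel) \<le> ennreal (C * t powr ps)"
    if tf: "test_function f f' B" and t: "0 < t"
      and F: "(\<integral>\<^sup>+x. ennreal (norm (grad f levy x) powr p) \<partial>lborel) \<le> ennreal (t powr p)" for f f' B t
  proof -
    note rd = resolvent_data_test_function[OF tf]
    have [measurable]: "f \<in> borel_measurable borel" "grad f levy \<in> borel_measurable borel"
      using rd by (auto simp: resolvent_data_def bounded_borel_def)
    have "(\<integral>\<^sup>+x. ennreal (norm ((1 / t) *\<^sub>R grad f levy x) powr p) \<partial>lborel)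
        = (\<integral>\<^sup>+x. ennreal ((1 / t) powr p) * ennreal (norm (grad f levy x) powr p) \<partial>lborel)"
      using t by (intro nn_integral_cong) (simp add: powr_mult ennreal_mult'[symmetric] powr_divide)
    also have "\<dots> = ennreal ((1 / t) powr p) * (\<integral>\<^sup>+x. ennreal (norm (grad f levy x) powr p) \<partial>lborel)"
      by (rule nn_integral_cmult) simp
    also have "\<dots> \<le> ennreal ((1 / t) powr p) * ennreal (t powr p)" by (intro mult_left_mono F) simp
    also have "\<dots> = 1" using t by (simp add: ennreal_mult'[symmetric] powr_mult[symmetric])
    finally have "(\<integral>\<^sup>+x. ennreal (\<bar>1 / t * f x\<bar> powr ps) \<partial>lborel) \<le> ennreal C"
      by (rule C(2)[OF resolvent_data_scale[OF rd]])
    then have "ennreal (t powr ps) * (\<integral>\<^sup>+x. ennreal (\<bar>1 / t * f x\<bar> powr ps) \<partial>lborel) \<le> ennreal (t powr ps) * ennreal C"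
      by (intro mult_left_mono) auto
    also have "\<dots> = ennreal (C * t powr ps)" using C(1) by (simp add: ennreal_mult'[symmetric] mult.commute)
    also have "ennreal (t powr ps) * (\<integral>\<^sup>+x. ennreal (\<bar>1 / t * f x\<bar> powr ps) \<partial>lborel)
        = (\<integral>\<^sup>+x. ennreal (t powr ps) * ennreal (\<bar>1 / t * f x\<bar> powr ps) \<partial>lborel)"
      by (rule nn_integral_cmult[symmetric]) simp
    also have "\<dots> = (\<integral>\<^sup>+x. ennreal (norm (f x) powr ps) \<partial>lborel)"
      using t by (intro nn_integral_cong) (simp add: ennreal_mult'[symmetric] powr_mult[symmetric] abs_mult)
    finally show ?thesis .
  qed
  then show ?thesis using C(1) by blast
qed

text \<open>The hypothesis is applied with every \<open>t\<close> above the norm of \<open>F\<close>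
  and then \<open>t\<close> decreases to it, so a vanishing norm needs no case of its own. If the
  norm of \<open>F\<close> is infinite, so is the right-hand side, the constant being
  positive.\<close>

lemma Lp_norm_le_of_homogeneous_bound:
  fixes F :: "real ^ 'n \<Rightarrow> 'b::real_normed_vector" and f :: "real ^ 'n \<Rightarrow> 'c::real_normed_vector"
  assumes p: "0 < p" "0 < q" and C: "0 < C"
    and bd: "\<And>t. 0 < t \<Longrightarrow> (\<integral>\<^sup>+x. ennreal (norm (F x) powr p) \<partial>lborel) \<le> ennreal (t powr p)
      \<Longrightarrow> (\<integral>\<^sup>+x. ennreal (norm (f x) powr q) \<partial>lborel) \<le> ennreal (C * t powr q)"
  shows "Lp_norm q f \<le> ennreal (C powr (1 / q)) * Lp_norm p F"
proof (cases "(\<integral>\<^sup>+x. ennreal (norm (F x) powr p) \<partial>lborel) = \<infinity>")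
  case True
  then show ?thesis using C by (simp add: Lp_norm_def ennreal_mult_eq_top_iff)
next
  case False
  then obtain a where a: "0 \<le> a" "(\<integral>\<^sup>+x. ennreal (norm (F x) powr p) \<partial>lborel) = ennreal a"
    by (cases "\<integral>\<^sup>+x. ennreal (norm (F x) powr p) \<partial>lborel") auto
  define s where "s = a powr (1 / p)"
  have s: "0 \<le> s" by (simp add: s_def)
  have J: "(\<integral>\<^sup>+x. ennreal (norm (f x) powr q) \<partial>lborel) \<le> ennreal (C * t powr q)" if t: "s < t" for t
  proof (rule bd)
    show "0 < t" using s t by simp
    have "a = s powr p" using p a(1) by (cases "a = 0") (simp_all add: s_def powr_powr)
    also have "\<dots> \<le> t powr p" using s t p by (intro powr_mono2) auto
    finally show "(\<integral>\<^sup>+x. ennreal (norm (F x) powr p) \<partial>lborel) \<le> ennreal (t powr p)"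
      unfolding a(2) by (rule ennreal_leI)
  qed
  have "(\<integral>\<^sup>+x. ennreal (norm (f x) powr q) \<partial>lborel) < \<infinity>"
    using J[of "s + 1"] by (auto intro: order.strict_trans1)
  then obtain j where j: "0 \<le> j" "(\<integral>\<^sup>+x. ennreal (norm (f x) powr q) \<partial>lborel) = ennreal j"
    by (cases "\<integral>\<^sup>+x. ennreal (norm (f x) powr q) \<partial>lborel") auto
  have "j powr (1 / q) / C powr (1 / q) \<le> s"
  proof (rule dense_ge)
    fix t assume t: "s < t"
    then have t0: "0 < t" using s by simp
    have "j \<le> C * t powr q" using J[OF t] C unfolding j(2) by (simp add: ennreal_le_iff)
    then have "j powr (1 / q) \<le> (C * t powr q) powr (1 / q)" using j(1) p by (intro powr_mono2) auto
    also have "\<dots> = C powr (1 / q) * t" using C t0 p by (simp add: powr_mult powr_powr)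
    finally show "j powr (1 / q) / C powr (1 / q) \<le> t" using C by (simp add: divide_le_eq mult.commute)
  qed
  then have "j powr (1 / q) \<le> C powr (1 / q) * s" using C by (simp add: divide_le_eq mult.commute)
  then show ?thesis using a j C s by (simp add: Lp_norm_def s_def ennreal_mult'[symmetric] ennreal_leI)
qed

theorem theorem1p1:
  fixes \<alpha> :: real and \<sigma> \<nu> :: "(real ^ 'd) measure"
  assumes "CARD('d) \<ge> 2"
    and "1 < \<alpha>" and "\<alpha> < 2"
    and "symmetric_stable_levy_measure \<alpha> \<sigma> \<nu>"
    and "nondegenerate \<alpha> \<sigma>"
  shows "\<forall>p. 1 < p \<and> p < real CARD('d) / (\<alpha> - 1) \<longrightarrow>
    (\<exists>C::real. C > 0 \<and> (\<forall>f::real ^ 'd \<Rightarrow> real. f \<in> Cc_infinity \<longrightarrow>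
       Lp_norm (p * real CARD('d) / (real CARD('d) - p * (\<alpha> - 1))) f
         \<le> ennreal C * Lp_norm p (fractional_gradient \<nu> f)))"
proof (intro allI impI, elim conjE)
  fix p :: real assume p: "1 < p" "p < real CARD('d) / (\<alpha> - 1)"
  define S where "S = distr \<sigma> borel (\<lambda>x. x)"
  have sph: "spherical_component \<sigma>" using assms(4) by (simp add: symmetric_stable_levy_measure_def)
  note id = measurable_spherical[OF sph]
  have fS: "finite_borel S" unfolding S_def by (rule finite_borel_ambient[OF sph])
  have nd: "\<not> (AE y in S. v \<bullet> y = 0)" if "norm v = 1" for v
    using nondegenerate_not_AE_orthogonal[OF assms(5) that] unfolding S_def by (subst AE_distr_iff[OF id]) auto
  obtain c C where cap: "0 < c" "\<And>b. C b \<in> sets borel" "\<And>b. b \<in> Basis \<Longrightarrow> 0 < emeasure S (C b)"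
    "\<And>y :: real ^ 'd \<Rightarrow> real ^ 'd. (\<And>b. b \<in> Basis \<Longrightarrow> y b \<in> C b) \<Longrightarrow> frame c y"
    using positive_caps[of S] fS nd unfolding finite_borel_def by metis
  interpret polar_symmetric S \<alpha> c C
  proof unfold_locales
    show "AE y in S. norm y = 1" "distr S borel uminus = S"
      unfolding S_def using AE_sphere_ambient[OF sph] symmetric_ambient[OF sph] by auto
  qed (use assms(2,3) fS cap in auto)
  have \<nu>: "\<nu> = levy"
    using symmetric_stable_levy_measure_polar_law[OF assms(4)] unfolding S_def[symmetric] levy_def .
  define ps where "ps = p * real CARD('d) / (real CARD('d) - p * (\<alpha> - 1))"
  have p': "p * (\<alpha> - 1) < DIM(real ^ 'd)" using p(2) assms(2) by (simp add: pos_less_divide_eq)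
  then have ps: "0 < ps" using p(1) by (simp add: ps_def)
  obtain K where K: "0 < K" "\<And>f f' B t. test_function f f' B \<Longrightarrow> 0 < t \<Longrightarrow>
     (\<integral>\<^sup>+x. ennreal (norm (grad f levy x) powr p) \<partial>lborel) \<le> ennreal (t powr p) \<Longrightarrow>
     (\<integral>\<^sup>+x. ennreal (norm (f x) powr ps) \<partial>lborel) \<le> ennreal (K * t powr ps)"
    using sobolev_test_function[OF p(1) p'] unfolding ps_def by (simp only: DIM_cart DIM_real mult_1_right) blast
  have "Lp_norm ps f \<le> ennreal (K powr (1 / ps)) * Lp_norm p (fractional_gradient \<nu> f)" if f: "f \<in> Cc_infinity" for f
  proof (rule Lp_norm_le_of_homogeneous_bound[OF _ ps K(1)])
    obtain B where B: "test_function f (\<lambda>x. frechet_derivative f (at x)) B"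
      by (rule test_function_Cc_infinity[OF f])
    fix t :: real
    assume t: "0 < t" "(\<integral>\<^sup>+x. ennreal (norm (fractional_gradient \<nu> f x) powr p) \<partial>lborel) \<le> ennreal (t powr p)"
    \<comment> \<open>Both are the same integral once \<open>\<nu>\<close> is known to be
      \<open>levy\<close>, so the estimate for test functions speaks of the operator in the
      theorem.\<close>
    have "fractional_gradient \<nu> f = grad f levy"
      by (intro ext) (simp add: \<nu> fractional_gradient_def grad_def[OF B sets_levy integrable_gauge])
    then show "(\<integral>\<^sup>+x. ennreal (norm (f x) powr ps) \<partial>lborel) \<le> ennreal (K * t powr ps)"
      using K(2)[OF B t(1)] t(2) by simp
  qed (use p in simp)
  moreover have "0 < K powr (1 / ps)" using K(1) by simp
  ultimately show "\<exists>C::real. C > 0 \<and> (\<forall>f::real ^ 'd \<Rightarrow> real. f \<in> Cc_infinity \<longrightarrow>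
       Lp_norm (p * real CARD('d) / (real CARD('d) - p * (\<alpha> - 1))) f \<le> ennreal C * Lp_norm p (fractional_gradient \<nu> f))"
    unfolding ps_def by blast
qed

end
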